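(* For every $c\in(1,\tfrac{147}{145})$ there are infinitely many Carmichael numbers all of whose prime factors belong to the set $$ \mathscr{P}^{(c)}=\{p\text{ prime}:p=\lfloor n^c\rfloor\text{ for some }n\in\mathbb{N}\}. $$
   Context: $\lfloor t\rfloor$ is the integer part of the real number $t$. A Carmichael number is a composite natural number $N$ such that $N\mid a^N-a$ for every $a\in\mathbb{Z}$. *)

theory Defs
  imports Complex_Main "HOL-Computational_Algebra.Primes"
begin

definition carmichael :: "nat \<Rightarrow> bool" where
  "carmichael N \<longleftrightarrow> N > 1 \<and> \<not> prime N \<and> (\<forall>a::int. int N dvd a ^ N - a)"

(* The floor is integer-valued, hence the coercion of p.
   Since 0 powr c = 0, the index n = 0 contributes no prime. *)
definition piatetski_shapiro_primes :: "real \<Rightarrow> nat set" where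
  "piatetski_shapiro_primes c = {p. prime p \<and> (\<exists>n::nat. int p = \<lfloor>real n powr c\<rfloor>)}"

end

theory Submission
  imports Defs "HOL-Number_Theory.Number_Theory" "HOL-Analysis.Analysis" "HOL-Real_Asymp.Real_Asymp"
    "HOL-Computational_Algebra.Squarefree"
begin

text \<open>
Put \<open>\<gamma> = 1 / c\<close>. A prime \<open>p\<close> has the form \<open>\<lfloor>n powr c\<rfloor>\<close> as soon as the fractional part of
\<open>- (p powr \<gamma>)\<close> is less than about \<open>p powr (\<gamma> - 1)\<close>. By Korselt's criterion it suffices to find a product of
such primes \<open>p = k d + 1\<close> that is \<open>1\<close> modulo \<open>k L\<close>, where \<open>k\<close> is fixed and all \<open>d\<close> divide \<open>L\<close>;
when the group of units modulo \<open>L\<close> has small exponent, a Davenport-type argument yields such products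
from few primes.

The modulus \<open>L\<close> is a product of a set \<open>Q\<close> of primes, and the \<open>d\<close> are products of \<open>u\<close> elements of \<open>Q\<close>.
No information on Siegel zeros is needed: averaged over all these \<open>d\<close>, nontrivial characters are controlled
by Vaughan's identity and a bilinear large sieve, for \<open>d\<close> up to \<open>x powr 0.123\<close>. The fractional part
condition is detected by a trigonometric minorant, and the exponential sums over primes in progressions are
estimated by Vaughan's identity and the van der Corput method. The argument runs twice. A first time, without the
fractional part condition, it turns all the primes up to a power of \<open>ln X\<close> into a set \<open>Q\<close> of at least
\<open>X powr 0.112\<close> primes up to \<open>X\<close> for which every \<open>q - 1\<close> divides one number \<open>l\<close> with \<open>ln l\<close> polylogarithmic.
A second time, with \<open>ln x = (ln X) ^ 30\<close>, it finds the Piatetski-Shapiro primes. It succeeds since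
the number \<open>x powr (0.112 * 0.123)\<close> of moduli exceeds the loss \<open>x powr (1 - \<gamma>)\<close>: \<open>0.112 * 0.123 > 2 / 147\<close>.
\<close>

section \<open>Bilinear large sieve from almost orthogonality\<close>

text \<open>The exponent \<open>0.123\<close> is just below \<open>1/8\<close>, the value at which
  three error terms meet. With Vaughan cutoff \<open>x^a\<close> and moduli up to
  \<open>x^b\<close>, type I sums need \<open>2a + 2b < 1\<close>, type II sums need
  \<open>3b < a\<close>, and the off-diagonal terms need \<open>2b < 1/4\<close>; all three force
  \<open>b < 1/8\<close>, with \<open>a\<close> near \<open>3/8\<close>. No zero-free region enters
  because a character acts only on those \<open>d\<close> that contain every prime of its conductor.
  This is a proportion of at most \<open>u / card Q\<close> of all \<open>d\<close>, so a
  \<open>Q\<close> larger than a suitable power of \<open>ln x\<close> already gives the logarithms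
  that a single exceptional character would cost. The set of all primes up to a power of
  \<open>ln x\<close> is large enough for that, but no useful bound is at hand for the exponent of
  its unit group, and the Davenport argument needs about \<open>l * ln L\<close> primes when that
  exponent divides \<open>l\<close>. This is why the averaging result is first spent on producing a
  better \<open>Q\<close>: there \<open>ln l\<close> is at most \<open>(ln X)^27\<close>, so
  \<open>l\<close> is negligible against powers of \<open>x\<close> once
  \<open>ln x = (ln X)^30\<close>. The exponent \<open>0.112\<close> is what remains of
  \<open>0.123 * 23/25\<close> after that first run.\<close>

lemma sum_norm_square_expand:
  fixes f :: "'i \<Rightarrow> 'n \<Rightarrow> complex" and c :: "'i \<Rightarrow> complex"
  shows "complex_of_real (\<Sum>n\<in>S. (norm (\<Sum>i\<in>K. c i * f i n))\<^sup>2)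
         = (\<Sum>i\<in>K. \<Sum>j\<in>K. c i * cnj (c j) * (\<Sum>n\<in>S. f i n * cnj (f j n)))"
proof -
  have "complex_of_real (\<Sum>n\<in>S. (norm (\<Sum>i\<in>K. c i * f i n))\<^sup>2)
      = (\<Sum>n\<in>S. (\<Sum>i\<in>K. c i * f i n) * cnj (\<Sum>j\<in>K. c j * f j n))"
    unfolding of_real_sum complex_norm_square by simp
  also have "\<dots> = (\<Sum>n\<in>S. \<Sum>i\<in>K. \<Sum>j\<in>K. c i * cnj (c j) * (f i n * cnj (f j n)))"
    by (simp add: sum_product mult_ac)
  also have "\<dots> = (\<Sum>i\<in>K. \<Sum>n\<in>S. \<Sum>j\<in>K. c i * cnj (c j) * (f i n * cnj (f j n)))"
    by (rule sum.swap)
  also have "\<dots> = (\<Sum>i\<in>K. \<Sum>j\<in>K. \<Sum>n\<in>S. c i * cnj (c j) * (f i n * cnj (f j n)))"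
    by (intro sum.cong refl sum.swap)
  finally show ?thesis by (simp add: sum_distrib_left)
qed

text \<open>Opening the square gives the Hermitian form of the Gram matrix of the
  \<open>f i\<close>. The diagonal is kept, each off-diagonal entry is replaced by \<open>P\<close>,
  and the off-diagonal sum is completed to all pairs, which makes it a square.\<close>

lemma almost_orthogonal_bound:
  fixes f :: "'i \<Rightarrow> 'n \<Rightarrow> complex" and c :: "'i \<Rightarrow> complex"
  assumes K: "finite K" and P: "P \<ge> 0"
    and off: "\<And>i j. i \<in> K \<Longrightarrow> j \<in> K \<Longrightarrow> i \<noteq> j \<Longrightarrow> norm (\<Sum>n\<in>S. f i n * cnj (f j n)) \<le> P"
  shows "(\<Sum>n\<in>S. (norm (\<Sum>i\<in>K. c i * f i n))\<^sup>2)
         \<le> (\<Sum>i\<in>K. (norm (c i))\<^sup>2 * (\<Sum>n\<in>S. (norm (f i n))\<^sup>2)) + P * (\<Sum>i\<in>K. norm (c i))\<^sup>2"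
proof -
  define G where "G = (\<lambda>i j. \<Sum>n\<in>S. f i n * cnj (f j n))"
  define A where "A = (\<lambda>i. \<Sum>n\<in>S. (norm (f i n))\<^sup>2)"
  have A0: "A i \<ge> 0" for i unfolding A_def by (intro sum_nonneg) auto
  have Gii: "norm (G i i) \<le> A i" for i
    unfolding G_def A_def by (rule order_trans[OF norm_sum]) (simp add: norm_mult power2_eq_square)
  have Gij: "norm (G i j) \<le> (if i = j then A i else 0) + P" if "i \<in> K" "j \<in> K" for i j
    using off[OF that] Gii[of i] P unfolding G_def by auto
  have "(\<Sum>n\<in>S. (norm (\<Sum>i\<in>K. c i * f i n))\<^sup>2)
        = norm (complex_of_real (\<Sum>n\<in>S. (norm (\<Sum>i\<in>K. c i * f i n))\<^sup>2))"
    by (simp only: norm_of_real) (simp add: sum_nonneg)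
  also have "\<dots> = norm (\<Sum>i\<in>K. \<Sum>j\<in>K. c i * cnj (c j) * G i j)"
    unfolding G_def sum_norm_square_expand ..
  also have "\<dots> \<le> (\<Sum>i\<in>K. \<Sum>j\<in>K. norm (c i) * norm (c j) * norm (G i j))"
    by (rule order_trans[OF norm_sum] sum_mono)+ (simp add: norm_mult)
  also have "\<dots> \<le> (\<Sum>i\<in>K. \<Sum>j\<in>K. norm (c i) * norm (c j) * ((if i = j then A i else 0) + P))"
    by (intro sum_mono mult_left_mono Gij) auto
  also have "\<dots> = (\<Sum>i\<in>K. \<Sum>j\<in>K. (if i = j then (norm (c i))\<^sup>2 * A i else 0))
                 + (\<Sum>i\<in>K. \<Sum>j\<in>K. P * (norm (c i) * norm (c j)))"
    unfolding sum.distrib[symmetric]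
    by (intro sum.cong refl) (auto simp: algebra_simps power2_eq_square)
  also have "(\<Sum>i\<in>K. \<Sum>j\<in>K. (if i = j then (norm (c i))\<^sup>2 * A i else 0)) = (\<Sum>i\<in>K. (norm (c i))\<^sup>2 * A i)"
    using K by (intro sum.cong refl) (simp add: sum.delta)
  also have "(\<Sum>i\<in>K. \<Sum>j\<in>K. P * (norm (c i) * norm (c j))) = P * (\<Sum>i\<in>K. norm (c i))\<^sup>2"
    by (simp only: power2_eq_square sum_product) (simp only: sum_distrib_left)
  finally show ?thesis unfolding A_def .
qed

text \<open>Duality: the sums \<open>A i\<close> are tested against their own conjugates.
  Cauchy-Schwarz over \<open>n\<close> gives \<open>X\<^sup>2 \<le> B * Y\<close>, where
  \<open>Y\<close> is the dual form with coefficients \<open>cnj (A i)\<close>; almost orthogonality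
  bounds \<open>Y\<close> by a multiple of \<open>X\<close>, and one factor \<open>X\<close>
  cancels.\<close>

lemma dual_large_sieve:
  fixes chi :: "'i \<Rightarrow> 'n \<Rightarrow> complex" and b :: "'n \<Rightarrow> complex"
  assumes K: "finite K" and S: "finite S" and P: "P \<ge> 0"
    and bd: "\<And>i n. i \<in> K \<Longrightarrow> n \<in> S \<Longrightarrow> norm (chi i n) \<le> 1"
    and off: "\<And>i j. i \<in> K \<Longrightarrow> j \<in> K \<Longrightarrow> i \<noteq> j \<Longrightarrow> norm (\<Sum>n\<in>S. chi i n * cnj (chi j n)) \<le> P"
  shows "(\<Sum>i\<in>K. (norm (\<Sum>n\<in>S. b n * chi i n))\<^sup>2)
          \<le> (real (card S) + real (card K) * P) * (\<Sum>n\<in>S. (norm (b n))\<^sup>2)"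
proof -
  define A where "A = (\<lambda>i. \<Sum>n\<in>S. b n * chi i n)"
  define X where "X = (\<Sum>i\<in>K. (norm (A i))\<^sup>2)"
  define B where "B = (\<Sum>n\<in>S. (norm (b n))\<^sup>2)"
  define Y where "Y = (\<Sum>n\<in>S. (norm (\<Sum>i\<in>K. cnj (A i) * chi i n))\<^sup>2)"
  have X0: "X \<ge> 0" and B0: "B \<ge> 0" and Y0: "Y \<ge> 0" unfolding X_def B_def Y_def by (auto intro: sum_nonneg)
  have "(\<Sum>n\<in>S. (norm (chi i n))\<^sup>2) \<le> real (card S)" if "i \<in> K" for i
  proof -
    have "(\<Sum>n\<in>S. (norm (chi i n))\<^sup>2) \<le> (\<Sum>n\<in>S. 1)"
      by (intro sum_mono) (use bd[OF that] in \<open>auto simp: power_le_one\<close>)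
    thus ?thesis by simp
  qed
  hence "(\<Sum>i\<in>K. (norm (cnj (A i)))\<^sup>2 * (\<Sum>n\<in>S. (norm (chi i n))\<^sup>2)) \<le> (\<Sum>i\<in>K. (norm (A i))\<^sup>2 * real (card S))"
    by (intro sum_mono mult_mono) (auto intro: sum_nonneg)
  also have "\<dots> = real (card S) * X" by (simp add: X_def sum_distrib_left mult.commute)
  finally have d1: "(\<Sum>i\<in>K. (norm (cnj (A i)))\<^sup>2 * (\<Sum>n\<in>S. (norm (chi i n))\<^sup>2)) \<le> real (card S) * X" .
  have "(\<Sum>i\<in>K. norm (cnj (A i)))\<^sup>2 \<le> (\<Sum>i\<in>K. (norm (A i))\<^sup>2) * real (card K)"
    using sum_squared_le_sum_of_squares[of "\<lambda>i. norm (A i)" K] by simp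
  hence d2: "P * (\<Sum>i\<in>K. norm (cnj (A i)))\<^sup>2 \<le> P * (X * real (card K))"
    using P unfolding X_def by (intro mult_left_mono) auto
  have Y: "Y \<le> (real (card S) + real (card K) * P) * X"
  proof -
    have "Y \<le> (\<Sum>i\<in>K. (norm (cnj (A i)))\<^sup>2 * (\<Sum>n\<in>S. (norm (chi i n))\<^sup>2)) + P * (\<Sum>i\<in>K. norm (cnj (A i)))\<^sup>2"
      unfolding Y_def by (rule almost_orthogonal_bound[OF K P off]) auto
    with d1 d2 show ?thesis by (simp add: algebra_simps)
  qed
  have "complex_of_real X = (\<Sum>i\<in>K. cnj (A i) * A i)"
    unfolding X_def of_real_sum complex_norm_square by (simp add: mult.commute)
  also have "\<dots> = (\<Sum>n\<in>S. b n * (\<Sum>i\<in>K. cnj (A i) * chi i n))"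
    by (subst (2) A_def) (simp add: sum_distrib_left sum.swap[of _ K] mult_ac)
  finally have "X = norm (\<Sum>n\<in>S. b n * (\<Sum>i\<in>K. cnj (A i) * chi i n))"
    using X0 by (metis abs_of_nonneg norm_of_real)
  also have "\<dots> \<le> (\<Sum>n\<in>S. norm (b n) * norm (\<Sum>i\<in>K. cnj (A i) * chi i n))"
    by (rule order_trans[OF norm_sum]) (simp add: norm_mult)
  finally have "X\<^sup>2 \<le> (\<Sum>n\<in>S. norm (b n) * norm (\<Sum>i\<in>K. cnj (A i) * chi i n))\<^sup>2"
    using X0 by (intro power_mono)
  also have "\<dots> \<le> B * Y" unfolding B_def Y_def by (rule Cauchy_Schwarz_ineq_sum)
  also have "\<dots> \<le> B * ((real (card S) + real (card K) * P) * X)" by (intro mult_left_mono Y B0)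
  finally have "X * X \<le> ((real (card S) + real (card K) * P) * B) * X" by (simp add: power2_eq_square algebra_simps)
  moreover have "0 \<le> (real (card S) + real (card K) * P) * B" using P B0 by auto
  ultimately have "X \<le> (real (card S) + real (card K) * P) * B"
    using X0 by (cases "X = 0") (auto simp: mult_le_cancel_right)
  thus ?thesis unfolding X_def A_def B_def .
qed

text \<open>Cauchy-Schwarz over \<open>m\<close> removes \<open>\<alpha>\<close>, and almost
  orthogonality is then applied to the functions \<open>f i m = chi i m * y i m\<close>, with the
  whole sum over \<open>n\<close> hidden in \<open>y\<close>. The relation \<open>R\<close> stands
  for the hyperbola condition that couples \<open>m\<close> and \<open>n\<close>; all that is asked
  of it is that two values of \<open>n\<close> leave an interval of \<open>m\<close>, on which
  incomplete character sums are bounded by \<open>P\<close>.\<close>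

lemma bilinear_large_sieve:
  fixes chi :: "'i \<Rightarrow> nat \<Rightarrow> complex" and \<alpha> \<beta> :: "nat \<Rightarrow> real"
  assumes K: "finite K" and P: "P \<ge> 0"
    and bd: "\<And>i n. i \<in> K \<Longrightarrow> norm (chi i n) \<le> 1"
    and mult: "\<And>i m n. i \<in> K \<Longrightarrow> chi i (m * n) = chi i m * chi i n"
    and off: "\<And>i j a b. i \<in> K \<Longrightarrow> j \<in> K \<Longrightarrow> i \<noteq> j \<Longrightarrow> norm (\<Sum>n\<in>{a<..b}. chi i n * cnj (chi j n)) \<le> P"
    and R: "\<And>n n'. \<exists>a b. {m\<in>{1..M}. R m n \<and> R m n'} = {a<..(b::nat)}"
  shows "(\<Sum>i\<in>K. norm (\<Sum>n\<in>{A<..B}. \<Sum>m\<in>{1..M}. of_bool (R m n) * of_real (\<alpha> m * \<beta> n) * chi i (m * n)))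
     \<le> sqrt (\<Sum>m\<in>{1..M}. (\<alpha> m)\<^sup>2) * sqrt (\<Sum>n\<in>{A<..B}. (\<beta> n)\<^sup>2)
        * sqrt (real M * (real (B - A) + real (card K) * P) + (real (card K))\<^sup>2 * P * real (B - A))"
proof -
  define k where "k = real (card K)"
  define b2 where "b2 = (\<Sum>n\<in>{A<..B}. (\<beta> n)\<^sup>2)"
  define y where "y = (\<lambda>i m. \<Sum>n\<in>{A<..B}. of_bool (R m n) * of_real (\<beta> n) * chi i n)"
  define S where "S = (\<lambda>i. \<Sum>n\<in>{A<..B}. \<Sum>m\<in>{1..M}. of_bool (R m n) * of_real (\<alpha> m * \<beta> n) * chi i (m * n))"
  \<comment> \<open>Unimodular factors (or zero) that turn the sum of norms into a linear form, so
    that the sum over \<open>i\<close> can be moved inside the sum over \<open>m\<close>.\<close>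
  define c where "c = (\<lambda>i. if S i = 0 then 0 else cnj (S i) / norm (S i))"
  define f where "f = (\<lambda>i m. chi i m * y i m)"
  have b20: "b2 \<ge> 0" unfolding b2_def by (intro sum_nonneg) auto
  have cn: "norm (c i) \<le> 1" for i by (auto simp: c_def norm_divide)
  have cS: "of_real (norm (S i)) = c i * S i" for i
    using complex_norm_square[of "S i"] by (auto simp: c_def power2_eq_square divide_simps mult.commute)
  have Sf: "S i = (\<Sum>m\<in>{1..M}. of_real (\<alpha> m) * f i m)" if "i \<in> K" for i
    unfolding S_def f_def y_def
    by (subst sum.swap) (simp add: sum_distrib_left mult[OF that] mult_ac)
  define T where "T = (\<Sum>i\<in>K. norm (S i))"
  have T0: "T \<ge> 0" unfolding T_def by (intro sum_nonneg) auto
  have "complex_of_real T = (\<Sum>i\<in>K. c i * S i)" unfolding T_def of_real_sum cS ..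
  also have "\<dots> = (\<Sum>i\<in>K. c i * (\<Sum>m\<in>{1..M}. of_real (\<alpha> m) * f i m))"
    by (intro sum.cong refl) (simp add: Sf)
  also have "\<dots> = (\<Sum>m\<in>{1..M}. of_real (\<alpha> m) * (\<Sum>i\<in>K. c i * f i m))"
    by (simp add: sum_distrib_left sum.swap[of _ K] mult_ac)
  finally have "T = norm (\<Sum>m\<in>{1..M}. of_real (\<alpha> m) * (\<Sum>i\<in>K. c i * f i m))"
    using T0 by (metis abs_of_nonneg norm_of_real)
  also have "\<dots> \<le> (\<Sum>m\<in>{1..M}. \<bar>\<alpha> m\<bar> * norm (\<Sum>i\<in>K. c i * f i m))"
    by (rule order_trans[OF norm_sum]) (simp add: norm_mult)
  finally have "T\<^sup>2 \<le> (\<Sum>m\<in>{1..M}. \<bar>\<alpha> m\<bar> * norm (\<Sum>i\<in>K. c i * f i m))\<^sup>2"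
    using T0 by (intro power_mono)
  also have "\<dots> \<le> (\<Sum>m\<in>{1..M}. \<bar>\<alpha> m\<bar>\<^sup>2) * (\<Sum>m\<in>{1..M}. (norm (\<Sum>i\<in>K. c i * f i m))\<^sup>2)"
    by (rule Cauchy_Schwarz_ineq_sum)
  also have "(\<Sum>m\<in>{1..M}. (norm (\<Sum>i\<in>K. c i * f i m))\<^sup>2) \<le> 
       (real M * (real (B - A) + k * P) + k\<^sup>2 * P * real (B - A)) * b2"
  proof -
    \<comment> \<open>Expanding both \<open>y\<close> leaves, for each pair \<open>n\<close>,
      \<open>n'\<close>, a sum over an interval of \<open>m\<close>. Multiplicativity has pulled the
      characters of \<open>n\<close> and \<open>n'\<close> out of it, so \<open>P\<close> applies
      uniformly in the pair.\<close>
    have off': "norm (\<Sum>m\<in>{1..M}. f i m * cnj (f j m)) \<le> P * (real (B - A) * b2)"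
      if ij: "i \<in> K" "j \<in> K" "i \<noteq> j" for i j
    proof -
      have "(\<Sum>m\<in>{1..M}. f i m * cnj (f j m)) = 
        (\<Sum>m\<in>{1..M}. \<Sum>n\<in>{A<..B}. \<Sum>n'\<in>{A<..B}. of_real (\<beta> n) * of_real (\<beta> n') * (chi i n * cnj (chi j n'))
            * (of_bool (R m n \<and> R m n') * (chi i m * cnj (chi j m))))"
      proof (intro sum.cong refl)
        fix m
        have [simp]: "cnj (of_bool b) = of_bool b" for b by (cases b) auto
        have "f i m * cnj (f j m) = (chi i m * cnj (chi j m)) * (y i m * cnj (y j m))"
          by (simp add: f_def mult_ac)
        also have "\<dots> = (\<Sum>n\<in>{A<..B}. \<Sum>n'\<in>{A<..B}. (chi i m * cnj (chi j m)) *
            ((of_bool (R m n) * of_real (\<beta> n) * chi i n) * cnj (of_bool (R m n') * of_real (\<beta> n') * chi j n')))"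
          by (simp only: y_def cnj_sum sum_product) (simp only: sum_distrib_left)
        also have "\<dots> = (\<Sum>n\<in>{A<..B}. \<Sum>n'\<in>{A<..B}. of_real (\<beta> n) * of_real (\<beta> n') * (chi i n * cnj (chi j n'))
            * (of_bool (R m n \<and> R m n') * (chi i m * cnj (chi j m))))"
          by (intro sum.cong refl) (simp add: of_bool_conj mult_ac)
        finally show "f i m * cnj (f j m) = \<dots>" .
      qed
      also have "\<dots> = (\<Sum>n\<in>{A<..B}. \<Sum>n'\<in>{A<..B}. \<Sum>m\<in>{1..M}. of_real (\<beta> n) * of_real (\<beta> n') * (chi i n * cnj (chi j n'))
            * (of_bool (R m n \<and> R m n') * (chi i m * cnj (chi j m))))"
        by (subst sum.swap) (intro sum.cong refl sum.swap)
      also have "\<dots> = (\<Sum>n\<in>{A<..B}. \<Sum>n'\<in>{A<..B}. of_real (\<beta> n) * of_real (\<beta> n') * (chi i n * cnj (chi j n'))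
            * (\<Sum>m\<in>{m\<in>{1..M}. R m n \<and> R m n'}. chi i m * cnj (chi j m)))"
        by (intro sum.cong refl) (simp add: sum_distrib_left[symmetric] sum.inter_filter[symmetric] of_bool_def if_distrib if_distribR cong: if_cong)
      also have "norm \<dots> \<le> (\<Sum>n\<in>{A<..B}. \<Sum>n'\<in>{A<..B}. \<bar>\<beta> n\<bar> * \<bar>\<beta> n'\<bar> * P)"
      proof (rule order_trans[OF norm_sum], rule sum_mono, rule order_trans[OF norm_sum], rule sum_mono)
        fix n n'
        obtain a b where ab: "{m\<in>{1..M}. R m n \<and> R m n'} = {a<..b}" using R by blast
        have 1: "norm (\<Sum>m\<in>{m\<in>{1..M}. R m n \<and> R m n'}. chi i m * cnj (chi j m)) \<le> P"
          unfolding ab by (rule off[OF ij])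
        have 2: "norm (chi i n) * norm (chi j n') \<le> 1 * 1"
          by (intro mult_mono bd ij) auto
        have "norm (chi i n) * norm (chi j n') * norm (\<Sum>m\<in>{m\<in>{1..M}. R m n \<and> R m n'}. chi i m * cnj (chi j m)) \<le> 1 * P"
          by (intro mult_mono 1) (use 2 in auto)
        hence "\<bar>\<beta> n\<bar> * \<bar>\<beta> n'\<bar> * (norm (chi i n) * norm (chi j n') * norm (\<Sum>m\<in>{m\<in>{1..M}. R m n \<and> R m n'}. chi i m * cnj (chi j m)))
             \<le> \<bar>\<beta> n\<bar> * \<bar>\<beta> n'\<bar> * (1 * P)" by (intro mult_left_mono) auto
        thus "norm (of_real (\<beta> n) * of_real (\<beta> n') * (chi i n * cnj (chi j n'))
            * (\<Sum>m\<in>{m\<in>{1..M}. R m n \<and> R m n'}. chi i m * cnj (chi j m))) \<le> \<bar>\<beta> n\<bar> * \<bar>\<beta> n'\<bar> * P"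
          by (simp add: norm_mult mult.assoc)
      qed
      also have "\<dots> = P * (\<Sum>n\<in>{A<..B}. \<bar>\<beta> n\<bar>)\<^sup>2"
        by (simp add: power2_eq_square sum_product sum_distrib_left mult_ac)
      also have "\<dots> \<le> P * (b2 * real (B - A))"
        using sum_squared_le_sum_of_squares[of "\<lambda>n. \<bar>\<beta> n\<bar>" "{A<..B}"] P
        by (intro mult_left_mono) (auto simp: b2_def)
      finally show ?thesis by (simp add: mult_ac)
    qed
    \<comment> \<open>For fixed \<open>m\<close> the sums \<open>y i m\<close> are again character
      sums over an interval, with coefficients truncated by \<open>R m\<close>; the dual sieve
      treats the diagonal part with no loss.\<close>
    have LSm: "(\<Sum>i\<in>K. (norm (y i m))\<^sup>2) \<le> (real (B - A) + k * P) * b2" for m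
    proof -
      have "(\<Sum>i\<in>K. (norm (y i m))\<^sup>2) \<le> (real (card {A<..B}) + real (card K) * P) *
             (\<Sum>n\<in>{A<..B}. (norm (of_bool (R m n) * of_real (\<beta> n) :: complex))\<^sup>2)"
        unfolding y_def by (rule dual_large_sieve[OF K _ P]) (use bd off in auto)
      also have "\<dots> \<le> (real (card {A<..B}) + real (card K) * P) * b2"
        using P unfolding b2_def by (intro mult_left_mono sum_mono) (auto simp: norm_mult)
      finally show ?thesis by (simp add: k_def)
    qed
    have "(\<Sum>m\<in>{1..M}. (norm (\<Sum>i\<in>K. c i * f i m))\<^sup>2) \<le> 
       (\<Sum>i\<in>K. (norm (c i))\<^sup>2 * (\<Sum>m\<in>{1..M}. (norm (f i m))\<^sup>2)) + P * (real (B - A) * b2) * (\<Sum>i\<in>K. norm (c i))\<^sup>2"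
      by (rule almost_orthogonal_bound[OF K _ off']) (use P b20 in auto)
    also have "(\<Sum>i\<in>K. (norm (c i))\<^sup>2 * (\<Sum>m\<in>{1..M}. (norm (f i m))\<^sup>2)) \<le> (\<Sum>i\<in>K. 1 * (\<Sum>m\<in>{1..M}. (norm (y i m))\<^sup>2))"
    proof (intro sum_mono mult_mono)
      fix i m assume "i \<in> K"
      have "norm (f i m) \<le> 1 * norm (y i m)" unfolding f_def norm_mult using bd[OF \<open>i \<in> K\<close>] by (intro mult_right_mono) auto
      thus "(norm (f i m))\<^sup>2 \<le> (norm (y i m))\<^sup>2" by (intro power_mono) auto
    qed (use cn in \<open>auto simp: power_le_one intro: sum_nonneg\<close>)
    also have "\<dots> = (\<Sum>m\<in>{1..M}. \<Sum>i\<in>K. (norm (y i m))\<^sup>2)" by (simp add: sum.swap[of _ K])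
    also have "\<dots> \<le> (\<Sum>m\<in>{1..M}. (real (B - A) + k * P) * b2)" by (intro sum_mono LSm)
    also have "(\<Sum>i\<in>K. norm (c i))\<^sup>2 \<le> k\<^sup>2"
    proof (rule power_mono)
      show "(\<Sum>i\<in>K. norm (c i)) \<le> k" unfolding k_def using sum_mono[of K "\<lambda>i. norm (c i)" "\<lambda>_. 1"] cn by simp
    qed (auto intro: sum_nonneg)
    finally show ?thesis using P b20 by (simp add: algebra_simps mult_right_mono)
  qed
  finally have "T\<^sup>2 \<le> (\<Sum>m\<in>{1..M}. (\<alpha> m)\<^sup>2) * ((real M * (real (B - A) + k * P) + k\<^sup>2 * P * real (B - A)) * b2)"
    by (simp add: mult_left_mono sum_nonneg)
  hence "T \<le> sqrt ((\<Sum>m\<in>{1..M}. (\<alpha> m)\<^sup>2) * ((real M * (real (B - A) + k * P) + k\<^sup>2 * P * real (B - A)) * b2))"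
    by (rule real_le_rsqrt)
  thus ?thesis unfolding T_def S_def k_def b2_def by (simp add: real_sqrt_mult mult_ac)
qed

section \<open>Vaughan's identity and divisor sums\<close>

definition moebius :: "nat \<Rightarrow> real" where
  "moebius n = (if squarefree n then (-1) ^ card (prime_factors n) else 0)"

lemma abs_moebius_le: "\<bar>moebius n\<bar> \<le> 1"
  by (simp add: moebius_def)

lemma moebius_prime_mult:
  assumes p: "prime p" and np: "\<not> p dvd d" and d: "d > 0"
  shows "moebius (p * d) = - moebius d"
proof -
  have cop: "coprime p d" using p np by (simp add: prime_imp_coprime)
  have sq: "squarefree (p * d) \<longleftrightarrow> squarefree d"
    using cop p squarefree_prime[of p] by (auto intro: squarefree_mult_coprime squarefree_multD)
  have "prime_factors (p * d) = insert p (prime_factors d)"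
    using p d by (subst prime_factors_product) (auto simp: prime_prime_factors)
  moreover have "p \<notin> prime_factors d" using np by auto
  ultimately show ?thesis by (simp add: moebius_def sq)
qed

text \<open>Fix a prime \<open>p\<close> dividing \<open>n\<close>. Divisors prime to
  \<open>p\<close> cancel against their multiples by \<open>p\<close>, and divisors divisible by
  \<open>p\<^sup>2\<close> contribute zero.\<close>

lemma moebius_sum:
  assumes n: "n > 0"
  shows "(\<Sum>d | d dvd n. moebius d) = of_bool (n = 1)"
proof (cases "n = 1")
  case True thus ?thesis by (simp add: moebius_def)
next
  case False
  then obtain p where p: "prime p" "p dvd n" using prime_factor_nat by blast
  have fin: "finite {d. d dvd n}" using n by auto
  have "(\<Sum>d | d dvd n. moebius d) = (\<Sum>d | d dvd n \<and> \<not> p dvd d. moebius d) + (\<Sum>d | d dvd n \<and> p dvd d. moebius d)"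
    by (subst sum.union_disjoint[symmetric]) (auto intro: finite_subset[OF _ fin] sum.cong)
  also have "(\<Sum>d | d dvd n \<and> p dvd d. moebius d) = (\<Sum>d\<in>(\<lambda>e. p * e) ` {e. e dvd n \<and> \<not> p dvd e}. moebius d)"
  proof (rule sum.mono_neutral_right)
    show "finite {d. d dvd n \<and> p dvd d}" by (rule finite_subset[OF _ fin]) auto
    show "(\<lambda>e. p * e) ` {e. e dvd n \<and> \<not> p dvd e} \<subseteq> {d. d dvd n \<and> p dvd d}"
      using p by (auto intro!: divides_mult prime_imp_coprime)
    show "\<forall>i\<in>{d. d dvd n \<and> p dvd d} - (\<lambda>e. p * e) ` {e. e dvd n \<and> \<not> p dvd e}. moebius i = 0"
    proof
      fix d assume "d \<in> {d. d dvd n \<and> p dvd d} - (\<lambda>e. p * e) ` {e. e dvd n \<and> \<not> p dvd e}"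
      hence d: "d dvd n" "p dvd d" and nd: "d \<notin> (\<lambda>e. p * e) ` {e. e dvd n \<and> \<not> p dvd e}" by auto
      from d(2) obtain e where e: "d = p * e" by (elim dvdE)
      have "e dvd n" using d(1) unfolding e by (rule dvd_mult_right)
      hence "p dvd e" using nd e by auto
      hence "p\<^sup>2 dvd d" by (auto simp: power2_eq_square e)
      hence "\<not> squarefree d" using p(1) by (auto simp: squarefree_def not_prime_1)
      thus "moebius d = 0" by (simp add: moebius_def)
    qed
  qed
  also have "\<dots> = (\<Sum>e | e dvd n \<and> \<not> p dvd e. moebius (p * e))"
    using p by (subst sum.reindex) (auto simp: inj_on_def)
  also have "\<dots> = (\<Sum>e | e dvd n \<and> \<not> p dvd e. - moebius e)"
    using p n by (intro sum.cong refl moebius_prime_mult) (auto intro: Nat.gr0I)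
  finally show ?thesis using False by (simp add: sum_negf)
qed

text \<open>Divisor sums are written over a fixed box \<open>{1..X}\<close> with an indicator, so
  that sums over different \<open>n\<close> have a common index set and can be interchanged
  freely.\<close>

lemma sum_of_bool_dvd:
  fixes f :: "nat \<Rightarrow> real"
  assumes "n > 0" "n \<le> X"
  shows "(\<Sum>d\<in>{1..X}. of_bool (d dvd n) * f d) = (\<Sum>d | d dvd n. f d)"
proof -
  have "{d\<in>{1..X}. d dvd n} = {d. d dvd n}"
    using assms by (auto dest: dvd_imp_le intro: Nat.gr0I simp: Suc_le_eq intro: order_trans)
  thus ?thesis by (simp add: of_bool_def if_distrib if_distribR sum.inter_filter[symmetric] cong: if_cong)
qed

lemma mult_dvd_iff_div:
  fixes b c n :: nat assumes "c > 0" shows "b * c dvd n \<longleftrightarrow> c dvd n \<and> b dvd n div c"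
  using assms by (metis dvd_div_iff_mult dvd_mult_right mult.commute neq0_conv)

lemma sum_moebius_box:
  assumes "n > 0" "n \<le> X" "c > 0"
  shows "(\<Sum>b\<in>{1..X}. of_bool (b * c dvd n) * moebius b) = of_bool (c = n)"
proof (cases "c dvd n")
  case True
  have "n div c > 0" "n div c \<le> X" using True assms by (auto simp: dvd_imp_le intro: order_trans[OF div_le_dividend])
  hence "(\<Sum>b\<in>{1..X}. of_bool (b dvd n div c) * moebius b) = of_bool (n div c = 1)"
    by (simp only: sum_of_bool_dvd moebius_sum)
  moreover have "n div c = 1 \<longleftrightarrow> c = n" using True assms by (auto elim!: dvdE)
  ultimately show ?thesis using True assms by (simp add: mult_dvd_iff_div)
next
  case False thus ?thesis using assms by (auto simp: mult_dvd_iff_div)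
qed

lemma sum_mangoldt_box:
  assumes "n > 0" "n \<le> X" "b > 0"
  shows "(\<Sum>c\<in>{1..X}. of_bool (b * c dvd n) * mangoldt c) = of_bool (b dvd n) * ln (real (n div b))"
proof (cases "b dvd n")
  case True
  have "n div b > 0" "n div b \<le> X" using True assms by (auto simp: dvd_imp_le intro: order_trans[OF div_le_dividend])
  hence "(\<Sum>c\<in>{1..X}. of_bool (c dvd n div b) * mangoldt c) = ln (real (n div b))"
    by (subst sum_of_bool_dvd) (auto simp: mangoldt_sum)
  thus ?thesis using True assms by (simp add: mult_dvd_iff_div mult.commute[of b])
next
  case False thus ?thesis using assms by (auto simp: mult_dvd_iff_div mult.commute[of b])
qed

lemma sum_Icc_split:
  fixes f :: "nat \<Rightarrow> 'a::comm_monoid_add"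
  assumes "V \<le> X" shows "sum f {1..X} = sum f {1..V} + sum f {V<..X}"
proof -
  have "{1..X} = {1..V} \<union> {V<..X}" using assms by auto
  thus ?thesis by (metis (no_types, lifting) finite_atLeastAtMost finite_greaterThanAtMost sum.union_disjoint disjoint_iff atLeastAtMost_iff greaterThanAtMost_iff not_le)
qed

text \<open>Over the full box of pairs \<open>(b, c)\<close> the Moebius sum over \<open>b\<close>
  isolates \<open>c = n\<close>, so the total is \<open>mangoldt n\<close>. The box is cut at
  \<open>b = V\<close>, and the part \<open>b > V\<close> again at \<open>c = U\<close>. The strip
  \<open>b > V\<close>, \<open>c \<le> U\<close> is rewritten as all \<open>b\<close> minus
  \<open>b \<le> V\<close>.\<close>

lemma vaughan_identity:
  assumes n: "U < n" "n \<le> X" and V: "V \<le> X"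
  shows "mangoldt n = (\<Sum>b\<in>{1..V}. of_bool (b dvd n) * moebius b * ln (real (n div b)))
     - (\<Sum>b\<in>{1..V}. \<Sum>c\<in>{1..U}. of_bool (b * c dvd n) * moebius b * mangoldt c)
     + (\<Sum>c\<in>{U<..X}. \<Sum>b\<in>{V<..X}. of_bool (b * c dvd n) * moebius b * mangoldt c)"
proof -
  define F where "F = (\<lambda>b c. of_bool (b * c dvd n) * moebius b * mangoldt c :: real)"
  have n0: "n > 0" and UX: "U \<le> X" using n by auto
  have cs: "(\<Sum>b\<in>{1..X}. F b c) = of_bool (c = n) * mangoldt c" if "c > 0" for c
    using sum_moebius_box[OF n0 n(2) that] by (simp add: F_def sum_distrib_right[symmetric])
  have bs: "(\<Sum>c\<in>{1..X}. F b c) = of_bool (b dvd n) * moebius b * ln (real (n div b))" if "b > 0" for b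
  proof -
    have "(\<Sum>c\<in>{1..X}. F b c) = (\<Sum>c\<in>{1..X}. of_bool (b * c dvd n) * mangoldt c) * moebius b"
      unfolding F_def sum_distrib_right by (intro sum.cong refl) simp
    thus ?thesis unfolding sum_mangoldt_box[OF n0 n(2) that] by simp
  qed
  have "mangoldt n = (\<Sum>c\<in>{1..X}. of_bool (c = n) * mangoldt c)"
    using n by (simp add: of_bool_def if_distrib if_distribR cong: if_cong)
  also have "\<dots> = (\<Sum>c\<in>{1..X}. \<Sum>b\<in>{1..X}. F b c)" by (intro sum.cong refl cs[symmetric]) auto
  also have "\<dots> = (\<Sum>b\<in>{1..X}. \<Sum>c\<in>{1..X}. F b c)" by (rule sum.swap)
  also have "\<dots> = (\<Sum>b\<in>{1..V}. \<Sum>c\<in>{1..X}. F b c) + (\<Sum>b\<in>{V<..X}. \<Sum>c\<in>{1..X}. F b c)"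
    by (rule sum_Icc_split[OF V])
  also have "(\<Sum>b\<in>{V<..X}. \<Sum>c\<in>{1..X}. F b c) = (\<Sum>b\<in>{V<..X}. \<Sum>c\<in>{1..U}. F b c) + (\<Sum>b\<in>{V<..X}. \<Sum>c\<in>{U<..X}. F b c)"
    by (simp only: sum_Icc_split[OF UX] sum.distrib)
  also have "(\<Sum>b\<in>{V<..X}. \<Sum>c\<in>{1..U}. F b c) = (\<Sum>b\<in>{1..X}. \<Sum>c\<in>{1..U}. F b c) - (\<Sum>b\<in>{1..V}. \<Sum>c\<in>{1..U}. F b c)"
    by (simp only: sum_Icc_split[OF V] add_diff_cancel_left')
  also have "(\<Sum>b\<in>{1..X}. \<Sum>c\<in>{1..U}. F b c) = (\<Sum>c\<in>{1..U}. \<Sum>b\<in>{1..X}. F b c)" by (rule sum.swap)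
  \<comment> \<open>Summing over all \<open>b\<close> leaves only \<open>c = n\<close>, which
    \<open>c \<le> U < n\<close> excludes.\<close>
  also have "\<dots> = 0"
  proof (rule sum.neutral, rule ballI)
    fix c assume "c \<in> {1..U}"
    thus "(\<Sum>b\<in>{1..X}. F b c) = 0" using n cs[of c] by auto
  qed
  also have "(\<Sum>b\<in>{1..V}. \<Sum>c\<in>{1..X}. F b c) = (\<Sum>b\<in>{1..V}. of_bool (b dvd n) * moebius b * ln (real (n div b)))"
    by (intro sum.cong refl bs) auto
  also have "(\<Sum>b\<in>{V<..X}. \<Sum>c\<in>{U<..X}. F b c) = (\<Sum>c\<in>{U<..X}. \<Sum>b\<in>{V<..X}. F b c)" by (rule sum.swap)
  finally show ?thesis unfolding F_def by simp
qed

lemma harmonic_le: "M \<le> x \<Longrightarrow> x \<ge> 1 \<Longrightarrow> (\<Sum>k\<in>{1..M}. 1 / real k) \<le> 1 + ln (real x)"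
proof -
  assume M: "M \<le> x" "x \<ge> 1"
  have "(\<Sum>k\<in>{1..M}. 1 / real k) \<le> (\<Sum>k\<in>{1..x}. 1 / real k)" using M by (intro sum_mono2) auto
  also have "\<dots> = harm x" by (simp add: harm_def inverse_eq_divide)
  also have "harm x \<le> 1 + ln (real x)"
    using decseqD[OF decseq_harm_diff_ln, of 0 "x - 1"] M(2) by (simp add: harm_expand)
  finally show ?thesis .
qed


lemma sum_multiples:
  fixes F :: "nat \<Rightarrow> 'a::semiring_1"
  assumes "b > 0"
  shows "(\<Sum>n\<in>{y<..x}. of_bool (b dvd n) * F n) = (\<Sum>k\<in>{y div b<..x div b}. F (b * k))"
proof -
  have "(\<Sum>n\<in>{y<..x}. of_bool (b dvd n) * F n) = (\<Sum>n\<in>{n\<in>{y<..x}. b dvd n}. F n)"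
    by (simp add: of_bool_def if_distrib if_distribR sum.inter_filter[symmetric] cong: if_cong)
  also have "{n\<in>{y<..x}. b dvd n} = (\<lambda>k. b * k) ` {y div b<..x div b}"
    using assms by (auto simp: image_iff div_less_iff_less_mult less_eq_div_iff_mult_less_eq mult.commute elim!: dvdE)
  also have "sum F \<dots> = (\<Sum>k\<in>{y div b<..x div b}. F (b * k))"
    using assms by (subst sum.reindex) (auto simp: inj_on_def)
  finally show ?thesis .
qed

text \<open>The second coefficient of the type II sum: after writing \<open>n = c * m\<close>, all
  \<open>b > U\<close> dividing the cofactor \<open>m\<close> are collected. It is therefore
  supported on \<open>m > U\<close> for positive \<open>m\<close>.\<close>

definition vaughan_coeff :: "nat \<Rightarrow> nat \<Rightarrow> nat \<Rightarrow> real" where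
  "vaughan_coeff U x m = (\<Sum>b\<in>{U<..x}. of_bool (b dvd m) * moebius b)"

text \<open>Both cutoffs are \<open>U\<close>, and \<open>U \<le> y\<close> makes the identity
  available for every \<open>n\<close> in the range. The first two sums are type I (smooth in
  \<open>k\<close>); the third is bilinear with coefficients that carry no structure.\<close>

lemma vaughan_sum:
  fixes g :: "nat \<Rightarrow> complex"
  assumes Uy: "U \<le> y" and yx: "y \<le> x"
  shows "(\<Sum>n\<in>{y<..x}. of_real (mangoldt n) * g n) =
     (\<Sum>b\<in>{1..U}. of_real (moebius b) * (\<Sum>k\<in>{y div b<..x div b}. of_real (ln (real k)) * g (b * k)))
   - (\<Sum>b\<in>{1..U}. \<Sum>c\<in>{1..U}. of_real (moebius b * mangoldt c) * (\<Sum>k\<in>{y div (b*c)<..x div (b*c)}. g (b * c * k)))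
   + (\<Sum>c\<in>{1..x}. \<Sum>m\<in>{1..x}. of_bool (y < c * m \<and> c * m \<le> x) *
        of_real (of_bool (U < c) * mangoldt c * vaughan_coeff U x m) * g (c * m))"
proof -
  define T1 where "T1 = (\<lambda>n. \<Sum>b\<in>{1..U}. of_bool (b dvd n) * moebius b * ln (real (n div b)))"
  define T2 where "T2 = (\<lambda>n. \<Sum>b\<in>{1..U}. \<Sum>c\<in>{1..U}. of_bool (b * c dvd n) * moebius b * (mangoldt c :: real))"
  define T3 where "T3 = (\<lambda>n. \<Sum>c\<in>{U<..x}. \<Sum>b\<in>{U<..x}. of_bool (b * c dvd n) * moebius b * (mangoldt c :: real))"
  have [simp]: "complex_of_real (of_bool P) = of_bool P" for P by (cases P) auto
  have "(\<Sum>n\<in>{y<..x}. of_real (mangoldt n) * g n) = (\<Sum>n\<in>{y<..x}. of_real (T1 n - T2 n + T3 n) * g n)"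
  proof (intro sum.cong refl)
    fix n assume "n \<in> {y<..x}"
    hence "mangoldt n = T1 n - T2 n + T3 n"
      unfolding T1_def T2_def T3_def using assms by (intro vaughan_identity) auto
    thus "of_real (mangoldt n) * g n = of_real (T1 n - T2 n + T3 n) * g n" by (simp only:)
  qed
  also have "\<dots> = (\<Sum>n\<in>{y<..x}. of_real (T1 n) * g n) - (\<Sum>n\<in>{y<..x}. of_real (T2 n) * g n) + (\<Sum>n\<in>{y<..x}. of_real (T3 n) * g n)"
    by (simp only: of_real_add of_real_diff ring_distribs sum.distrib sum_subtractf)
  also have "(\<Sum>n\<in>{y<..x}. of_real (T1 n) * g n) = (\<Sum>b\<in>{1..U}. \<Sum>n\<in>{y<..x}. of_bool (b dvd n) * (of_real (moebius b) * (of_real (ln (real (n div b))) * g n)))"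
    unfolding T1_def of_real_sum sum_distrib_right
    by (subst sum.swap) (simp add: mult.assoc)
  also have "\<dots> = (\<Sum>b\<in>{1..U}. of_real (moebius b) * (\<Sum>k\<in>{y div b<..x div b}. of_real (ln (real k)) * g (b * k)))"
    by (intro sum.cong refl) (subst sum_multiples, auto simp: sum_distrib_left)
  also have "(\<Sum>n\<in>{y<..x}. of_real (T2 n) * g n) = (\<Sum>n\<in>{y<..x}. \<Sum>b\<in>{1..U}. \<Sum>c\<in>{1..U}. of_bool (b * c dvd n) * (of_real (moebius b * mangoldt c) * g n))"
    unfolding T2_def of_real_sum sum_distrib_right
    by (simp add: mult.assoc del: of_real_mangoldt)
  also have "\<dots> = (\<Sum>b\<in>{1..U}. \<Sum>c\<in>{1..U}. \<Sum>n\<in>{y<..x}. of_bool (b * c dvd n) * (of_real (moebius b * mangoldt c) * g n))"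
    by (subst sum.swap) (intro sum.cong refl sum.swap)
  also have "\<dots> = (\<Sum>b\<in>{1..U}. \<Sum>c\<in>{1..U}. of_real (moebius b * mangoldt c) * (\<Sum>k\<in>{y div (b*c)<..x div (b*c)}. g (b * c * k)))"
    by (intro sum.cong refl) (subst sum_multiples, auto simp: sum_distrib_left)
  also have "(\<Sum>n\<in>{y<..x}. of_real (T3 n) * g n) = (\<Sum>n\<in>{y<..x}. \<Sum>c\<in>{U<..x}. of_bool (c dvd n) * (of_real (mangoldt c * vaughan_coeff U x (n div c)) * g n))"
  proof (intro sum.cong refl)
    fix n assume n: "n \<in> {y<..x}"
    have "T3 n = (\<Sum>c\<in>{U<..x}. of_bool (c dvd n) * (mangoldt c * vaughan_coeff U x (n div c)))"
      unfolding T3_def vaughan_coeff_def sum_distrib_left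
      by (intro sum.cong refl) (simp add: mult_dvd_iff_div of_bool_conj)
    thus "of_real (T3 n) * g n = (\<Sum>c\<in>{U<..x}. of_bool (c dvd n) * (of_real (mangoldt c * vaughan_coeff U x (n div c)) * g n))"
      by (simp add: sum_distrib_right mult.assoc del: of_real_mangoldt)
  qed
  also have "\<dots> = (\<Sum>c\<in>{U<..x}. \<Sum>n\<in>{y<..x}. of_bool (c dvd n) * (of_real (mangoldt c * vaughan_coeff U x (n div c)) * g n))"
    by (rule sum.swap)
  also have "\<dots> = (\<Sum>c\<in>{U<..x}. \<Sum>m\<in>{y div c<..x div c}. of_real (mangoldt c * vaughan_coeff U x m) * g (c * m))"
    by (rule sum.cong[OF refl]) (subst sum_multiples, auto)
  also have "\<dots> = (\<Sum>c\<in>{U<..x}. \<Sum>m\<in>{1..x}. of_bool (y < c * m \<and> c * m \<le> x) *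
        of_real (of_bool (U < c) * mangoldt c * vaughan_coeff U x m) * g (c * m))"
  proof (rule sum.cong[OF refl])
    fix c assume c: "c \<in> {U<..x}"
    have "{m\<in>{1..x}. y < c * m \<and> c * m \<le> x} = {y div c<..x div c}"
    proof -
      have "m \<le> x" if "c * m \<le> x" for m
        using that c by (metis One_nat_def Suc_leI greaterThanAtMost_iff le_trans mult_le_mono1 nat_mult_1 not_gr_zero not_less_zero)
      thus ?thesis using c by (auto simp: div_less_iff_less_mult less_eq_div_iff_mult_less_eq mult.commute intro!: Suc_leI Nat.gr0I)
    qed
    hence "(\<Sum>m\<in>{y div c<..x div c}. of_real (mangoldt c * vaughan_coeff U x m) * g (c * m)) =
      (\<Sum>m\<in>{1..x}. if y < c * m \<and> c * m \<le> x then of_real (mangoldt c * vaughan_coeff U x m) * g (c * m) else 0)"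
      by (simp add: sum.inter_filter[symmetric])
    also have "\<dots> = (\<Sum>m\<in>{1..x}. of_bool (y < c * m \<and> c * m \<le> x) *
        of_real (of_bool (U < c) * mangoldt c * vaughan_coeff U x m) * g (c * m))"
      using c by (intro sum.cong refl) auto
    finally show "(\<Sum>m\<in>{y div c<..x div c}. of_real (mangoldt c * vaughan_coeff U x m) * g (c * m)) = \<dots>" .
  qed
  also have "\<dots> = (\<Sum>c\<in>{1..x}. \<Sum>m\<in>{1..x}. of_bool (y < c * m \<and> c * m \<le> x) *
        of_real (of_bool (U < c) * mangoldt c * vaughan_coeff U x m) * g (c * m))"
    by (rule sum.mono_neutral_left) auto
  finally show ?thesis .
qed

text \<open>Summation by parts. Since \<open>ln\<close> increases, its last value together with its
  total variation is at most \<open>2 * ln x\<close>; this is why the hypothesis must cover every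
  initial segment and not just the full sum.\<close>

lemma abel_ln_bound:
  fixes g :: "nat \<Rightarrow> complex"
  assumes T: "\<And>h. h \<le> hi \<Longrightarrow> norm (\<Sum>k\<in>{lo<..h}. g k) \<le> T" and lx: "lo < hi" "hi \<le> x"
  shows "norm (\<Sum>k\<in>{lo<..hi}. of_real (ln (real k)) * g k) \<le> 2 * ln (real x) * T"
proof -
  define G where "G = (\<lambda>h. \<Sum>k\<in>{lo<..h}. g k)"
  have G0: "G lo = 0" by (simp add: G_def)
  have T0: "T \<ge> 0" using T[of hi] by (rule order_trans[OF norm_ge_zero]) simp
  have eq: "(\<Sum>k\<in>{lo<..lo + Suc j}. of_real (ln (real k)) * g k) =
     of_real (ln (real (lo + Suc j))) * G (lo + Suc j) -
       (\<Sum>k\<in>{lo<..lo + j}. of_real (ln (real (Suc k)) - ln (real k)) * G k)" for j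
  proof (induction j)
    case 0
    have "{lo<..Suc lo} = {Suc lo}" by auto
    thus ?case by (simp add: G_def)
  next
    case (Suc j)
    have 1: "{lo<..lo + Suc (Suc j)} = insert (lo + Suc (Suc j)) {lo<..lo + Suc j}" by auto
    have 2: "{lo<..lo + Suc j} = insert (lo + Suc j) {lo<..lo + j}" by auto
    have G: "G (lo + Suc (Suc j)) = G (lo + Suc j) + g (lo + Suc (Suc j))"
      unfolding G_def 1 by simp
    have "(\<Sum>k\<in>{lo<..lo + Suc (Suc j)}. of_real (ln (real k)) * g k) =
       of_real (ln (real (lo + Suc (Suc j)))) * g (lo + Suc (Suc j)) + (\<Sum>k\<in>{lo<..lo + Suc j}. of_real (ln (real k)) * g k)"
      unfolding 1 by (subst sum.insert) auto
    also note Suc.IH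
    also have "of_real (ln (real (lo + Suc (Suc j)))) * g (lo + Suc (Suc j)) +
       (of_real (ln (real (lo + Suc j))) * G (lo + Suc j) -
         (\<Sum>k\<in>{lo<..lo + j}. of_real (ln (real (Suc k)) - ln (real k)) * G k)) =
       of_real (ln (real (lo + Suc (Suc j)))) * G (lo + Suc (Suc j)) -
        (of_real (ln (real (Suc (lo + Suc j))) - ln (real (lo + Suc j))) * G (lo + Suc j) +
          (\<Sum>k\<in>{lo<..lo + j}. of_real (ln (real (Suc k)) - ln (real k)) * G k))"
      unfolding G by (simp add: algebra_simps)
    also have "of_real (ln (real (Suc (lo + Suc j))) - ln (real (lo + Suc j))) * G (lo + Suc j) +
          (\<Sum>k\<in>{lo<..lo + j}. of_real (ln (real (Suc k)) - ln (real k)) * G k) =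
       (\<Sum>k\<in>{lo<..lo + Suc j}. of_real (ln (real (Suc k)) - ln (real k)) * G k)"
      unfolding 2 by (subst sum.insert) auto
    finally show ?case .
  qed
  obtain j where j: "hi = lo + Suc j" using lx(1) less_iff_Suc_add by auto
  have tel: "(\<Sum>k\<in>{lo<..lo + j}. ln (real (Suc k)) - ln (real k)) = ln (real (lo + Suc j)) - ln (real (Suc lo))" for j
  proof (induction j)
    case (Suc j)
    have "{lo<..lo + Suc j} = insert (lo + Suc j) {lo<..lo + j}" by auto
    thus ?case using Suc.IH by simp
  qed simp
  have "norm (\<Sum>k\<in>{lo<..hi}. of_real (ln (real k)) * g k) \<le>
     norm (of_real (ln (real hi)) * G hi) + norm (\<Sum>k\<in>{lo<..lo + j}. of_real (ln (real (Suc k)) - ln (real k)) * G k)"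
    unfolding j eq by (rule norm_triangle_ineq4)
  also have "norm (of_real (ln (real hi)) * G hi) \<le> ln (real hi) * T"
    using T[of hi] lx unfolding norm_mult norm_of_real G_def by (intro mult_mono) auto
  also have "norm (\<Sum>k\<in>{lo<..lo + j}. of_real (ln (real (Suc k)) - ln (real k)) * G k) \<le>
     (\<Sum>k\<in>{lo<..lo + j}. (ln (real (Suc k)) - ln (real k)) * T)"
  proof (rule order_trans[OF norm_sum], rule sum_mono)
    fix k assume k: "k \<in> {lo<..lo + j}"
    have "norm (G k) \<le> T" unfolding G_def using k j by (intro T) auto
    moreover have "\<bar>ln (real (Suc k)) - ln (real k)\<bar> = ln (real (Suc k)) - ln (real k)" using k by simp
    ultimately show "norm (of_real (ln (real (Suc k)) - ln (real k)) * G k) \<le> (ln (real (Suc k)) - ln (real k)) * T"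
      unfolding norm_mult norm_of_real using k by (intro mult_mono) auto
  qed
  also have "\<dots> = (ln (real hi) - ln (real (Suc lo))) * T"
    unfolding sum_distrib_right[symmetric] tel j ..
  also have "\<dots> \<le> ln (real hi) * T" using T0 by (intro mult_right_mono) auto
  finally have "norm (\<Sum>k\<in>{lo<..hi}. of_real (ln (real k)) * g k) \<le> 2 * ln (real hi) * T" by (simp add: mult_ac)
  also have "\<dots> \<le> 2 * ln (real x) * T" using lx T0 by (intro mult_right_mono) auto
  finally show ?thesis .
qed

text \<open>The mean square of the divisor function. A pair \<open>a\<close>, \<open>b\<close> has
  about \<open>M / lcm a b = M * gcd a b / (a * b)\<close> common multiples, and the sums over
  \<open>a\<close> and \<open>b\<close> separate once the gcd is replaced by a sum over common
  divisors; three harmonic sums result.\<close>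

lemma sum_divisor_count_square:
  assumes "M \<le> x" "x \<ge> 1"
  shows "(\<Sum>m\<in>{1..M}. (\<Sum>b\<in>{1..x}. of_bool (b dvd m) :: real)\<^sup>2) \<le> real M * (1 + ln (real x)) ^ 3"
proof -
  define L where "L = 1 + ln (real x)"
  have L1: "L \<ge> 1" using assms by (simp add: L_def)
  have har: "(\<Sum>k\<in>{1..N}. 1 / real k) \<le> L" if "N \<le> x" for N
    unfolding L_def by (rule harmonic_le) (use that assms in auto)
  have har0: "(\<Sum>k\<in>{1..N}. 1 / real k) \<ge> 0" for N by (intro sum_nonneg) auto
  have "(\<Sum>m\<in>{1..M}. (\<Sum>b\<in>{1..x}. of_bool (b dvd m) :: real)\<^sup>2) = 
     (\<Sum>m\<in>{1..M}. \<Sum>a\<in>{1..x}. \<Sum>b\<in>{1..x}. of_bool (lcm a b dvd m))"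
    unfolding power2_eq_square sum_product
    by (intro sum.cong refl) (simp only: of_bool_conj[symmetric] lcm_least_iff)
  also have "\<dots> = (\<Sum>a\<in>{1..x}. \<Sum>b\<in>{1..x}. \<Sum>m\<in>{1..M}. of_bool (lcm a b dvd m))"
    by (subst sum.swap) (intro sum.cong refl sum.swap)
  also have "\<dots> \<le> (\<Sum>a\<in>{1..x}. \<Sum>b\<in>{1..x}. real M * (\<Sum>g\<in>{1..x}. of_bool (g dvd a) * (of_bool (g dvd b) * (real g / (real a * real b)))))"
  proof (intro sum_mono)
    fix a b assume ab: "a \<in> {1..x}" "b \<in> {1..x}"
    have M0: "{1..M} = {0<..M}" by auto
    have "(\<Sum>m\<in>{1..M}. of_bool (lcm a b dvd m) :: real) = (\<Sum>m\<in>{0<..M}. of_bool (lcm a b dvd m) * 1)"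
      unfolding M0 mult_1_right ..
    also have "\<dots> = real (M div lcm a b)" using ab by (subst sum_multiples[OF lcm_pos_nat]) simp_all
    also have "\<dots> \<le> real M / real (lcm a b)" by (rule of_nat_div_le_of_nat)
    also have "\<dots> = real M * (real (gcd a b) / (real a * real b))"
    proof -
      have e: "real a * real b = real (gcd a b) * real (lcm a b)"
        unfolding of_nat_mult[symmetric] using prod_gcd_lcm_nat[of a b] by presburger
      have "gcd a b > 0" using ab by auto
      thus ?thesis unfolding e by simp
    qed
    \<comment> \<open>The gcd is one of the common divisors \<open>g\<close>, so summing
      \<open>g\<close> over all of them only enlarges the term, and the conditions on
      \<open>a\<close> and \<open>b\<close> become independent.\<close>
    also have "\<dots> \<le> real M * (\<Sum>g\<in>{1..x}. of_bool (g dvd a) * (of_bool (g dvd b) * (real g / (real a * real b))))"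
    proof (rule mult_left_mono)
      have gx: "gcd a b \<in> {1..x}" using ab by (auto simp: Suc_le_eq intro: order_trans[OF gcd_le1_nat])
      have "real (gcd a b) / (real a * real b) = (\<Sum>g\<in>{gcd a b}. of_bool (g dvd a) * (of_bool (g dvd b) * (real g / (real a * real b))))"
        by simp
      also have "\<dots> \<le> (\<Sum>g\<in>{1..x}. of_bool (g dvd a) * (of_bool (g dvd b) * (real g / (real a * real b))))"
        using gx by (intro sum_mono2) auto
      finally show "real (gcd a b) / (real a * real b) \<le> \<dots>" .
    qed auto
    finally show "(\<Sum>m\<in>{1..M}. of_bool (lcm a b dvd m) :: real) \<le> \<dots>" .
  qed
  also have "\<dots> = real M * (\<Sum>a\<in>{1..x}. \<Sum>b\<in>{1..x}. \<Sum>g\<in>{1..x}. of_bool (g dvd a) * (of_bool (g dvd b) * (real g / (real a * real b))))"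
    by (simp only: sum_distrib_left)
  also have "(\<Sum>a\<in>{1..x}. \<Sum>b\<in>{1..x}. \<Sum>g\<in>{1..x}. of_bool (g dvd a) * (of_bool (g dvd b) * (real g / (real a * real b)))) =
     (\<Sum>a\<in>{1..x}. \<Sum>g\<in>{1..x}. \<Sum>b\<in>{1..x}. of_bool (g dvd a) * (of_bool (g dvd b) * (real g / (real a * real b))))"
    by (intro sum.cong refl sum.swap)
  also have "\<dots> = (\<Sum>g\<in>{1..x}. \<Sum>a\<in>{1..x}. \<Sum>b\<in>{1..x}. of_bool (g dvd a) * (of_bool (g dvd b) * (real g / (real a * real b))))"
    by (rule sum.swap)
  also have "(\<Sum>g\<in>{1..x}. \<Sum>a\<in>{1..x}. \<Sum>b\<in>{1..x}. of_bool (g dvd a) * (of_bool (g dvd b) * (real g / (real a * real b)))) \<le> (\<Sum>g\<in>{1..x}. (1 / real g) * (L * L))"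
  proof (rule sum_mono)
    fix g assume g: "g \<in> {1..x}"
    have "(\<Sum>a\<in>{1..x}. \<Sum>b\<in>{1..x}. of_bool (g dvd a) * (of_bool (g dvd b) * (real g / (real a * real b)))) =
      (\<Sum>a\<in>{0<..x}. of_bool (g dvd a) * (\<Sum>b\<in>{0<..x}. of_bool (g dvd b) * (real g / (real a * real b))))"
      unfolding sum_distrib_left by (rule sum.cong[OF _ sum.cong]) auto
    also have "\<dots> = (\<Sum>i\<in>{0<..x div g}. \<Sum>j\<in>{0<..x div g}. real g / (real (g * i) * real (g * j)))"
    proof -
      have g0: "g > 0" using g by auto
      show ?thesis by (simp only: sum_multiples[OF g0] div_0)
    qed
    also have "\<dots> = (1 / real g) * ((\<Sum>i\<in>{1..x div g}. 1 / real i) * (\<Sum>j\<in>{1..x div g}. 1 / real j))"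
    proof -
      have e: "{0<..x div g} = {1..x div g}" by auto
      show ?thesis using g unfolding e
        by (simp only: sum_product, simp only: sum_distrib_left, intro sum.cong refl) (auto simp: field_simps)
    qed
    also have "\<dots> \<le> (1 / real g) * (L * L)"
      using har[of "x div g"] har0[of "x div g"] L1 by (intro mult_left_mono mult_mono) auto
    finally show "(\<Sum>a\<in>{1..x}. \<Sum>b\<in>{1..x}. of_bool (g dvd a) * (of_bool (g dvd b) * (real g / (real a * real b)))) \<le> (1 / real g) * (L * L)" .
  qed
  also have "(\<Sum>g\<in>{1..x}. (1 / real g) * (L * L)) = (\<Sum>g\<in>{1..x}. 1 / real g) * (L * L)"
    by (simp add: sum_distrib_right)
  also have "\<dots> \<le> L * (L * L)" using har[of x] L1 by (intro mult_right_mono) auto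
  finally show ?thesis unfolding L_def[symmetric] by (simp add: power3_eq_cube mult_left_mono mult.assoc)
qed


lemma vaughan_coeff_eq_0: "m \<le> U \<Longrightarrow> m > 0 \<Longrightarrow> vaughan_coeff U x m = 0"
  unfolding vaughan_coeff_def by (intro sum.neutral) (auto dest: dvd_imp_le)

lemma sum_vaughan_coeff_square:
  assumes "M \<le> x" "x \<ge> 1"
  shows "(\<Sum>m\<in>{1..M}. (vaughan_coeff U x m)\<^sup>2) \<le> real M * (1 + ln (real x)) ^ 3"
proof -
  have "\<bar>vaughan_coeff U x m\<bar> \<le> (\<Sum>b\<in>{1..x}. of_bool (b dvd m))" for m
  proof -
    have "\<bar>vaughan_coeff U x m\<bar> \<le> (\<Sum>b\<in>{U<..x}. \<bar>of_bool (b dvd m) * moebius b\<bar>)"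
      unfolding vaughan_coeff_def by (rule sum_abs)
    also have "\<dots> \<le> (\<Sum>b\<in>{U<..x}. of_bool (b dvd m))"
      by (intro sum_mono) (use abs_moebius_le in \<open>auto simp: abs_mult\<close>)
    also have "\<dots> \<le> (\<Sum>b\<in>{1..x}. of_bool (b dvd m))" by (intro sum_mono2) auto
    finally show ?thesis .
  qed
  hence "(vaughan_coeff U x m)\<^sup>2 \<le> (\<Sum>b\<in>{1..x}. of_bool (b dvd m))\<^sup>2" for m
    by (metis abs_ge_zero power2_abs power_mono)
  hence "(\<Sum>m\<in>{1..M}. (vaughan_coeff U x m)\<^sup>2) \<le> (\<Sum>m\<in>{1..M}. (\<Sum>b\<in>{1..x}. of_bool (b dvd m) :: real)\<^sup>2)"
    by (intro sum_mono)
  also note sum_divisor_count_square[OF assms]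
  finally show ?thesis .
qed

text \<open>The third power of the logarithm is chosen to match
  \<open>sum_vaughan_coeff_square\<close>, so that one constant serves both coefficient sequences,
  which exchange roles later.\<close>

lemma sum_mangoldt_square:
  assumes "M \<le> x" "x \<ge> 1"
  shows "(\<Sum>m\<in>{1..M}. (mangoldt m :: real)\<^sup>2) \<le> real M * (1 + ln (real x)) ^ 3"
proof -
  have "(\<Sum>m\<in>{1..M}. (mangoldt m :: real)\<^sup>2) \<le> (\<Sum>m\<in>{1..M}. (1 + ln (real x)) ^ 3)"
  proof (rule sum_mono)
    fix m assume m: "m \<in> {1..M}"
    have L: "1 \<le> 1 + ln (real x)" using assms by simp
    have "mangoldt m \<le> ln (real m)" using m by (intro mangoldt_le) auto
    also have "\<dots> \<le> ln (real x)" using m assms by simp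
    finally have "(mangoldt m)\<^sup>2 \<le> (1 + ln (real x))\<^sup>2" by (intro power_mono mangoldt_nonneg) simp
    also have "\<dots> \<le> (1 + ln (real x)) ^ 3" using L by (intro power_increasing) auto
    finally show "(mangoldt m)\<^sup>2 \<le> (1 + ln (real x)) ^ 3" .
  qed
  thus ?thesis by simp
qed

section \<open>Dyadic decomposition and the general bound for families of sums over primes\<close>

lemma sum_dyadic:
  fixes f :: "nat \<Rightarrow> 'a::comm_monoid_add"
  shows "(\<Sum>n\<in>{U<..U * 2 ^ J}. f n) = (\<Sum>j<J. \<Sum>n\<in>{U * 2 ^ j<..2 * (U * 2 ^ j)}. f n)"
proof (induction J)
  case (Suc J)
  have "{U<..U * 2 ^ Suc J} = {U<..U * 2 ^ J} \<union> {U * 2 ^ J<..2 * (U * 2 ^ J)}"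
  proof -
    have "U < n" if "U * 2 ^ J < n" for n by (rule le_less_trans[OF _ that]) simp
    moreover have "n \<le> 2 * (U * 2 ^ J)" if "n \<le> U * 2 ^ J" for n using that by linarith
    ultimately show ?thesis by (auto simp: not_less not_le)
  qed
  hence "(\<Sum>n\<in>{U<..U * 2 ^ Suc J}. f n) = (\<Sum>n\<in>{U<..U * 2 ^ J}. f n) + (\<Sum>n\<in>{U * 2 ^ J<..2 * (U * 2 ^ J)}. f n)"
    by (simp only:) (rule sum.union_disjoint, auto)
  thus ?case using Suc.IH by simp
qed simp

text \<open>A type II estimate on dyadic blocks with \<open>N * N \<le> x\<close> yields one for all
  \<open>U < n \<le> s\<close> with \<open>s * s \<le> x\<close>. In a block the mean squares
  contribute \<open>sqrt (x / N)\<close> and \<open>sqrt (2 * N)\<close>, so \<open>N\<close>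
  cancels and every block costs the same.\<close>

lemma bilinear_dyadic:
  fixes g :: "'i \<Rightarrow> nat \<Rightarrow> complex" and \<alpha> \<beta> :: "nat \<Rightarrow> real"
  assumes E: "E \<ge> 0" and U: "U \<ge> 1" and C: "C \<ge> 0"
    and TII: "\<And>N \<alpha> \<beta>. U \<le> N \<Longrightarrow> N * N \<le> x \<Longrightarrow>
        (\<Sum>i\<in>K. norm (\<Sum>n\<in>{N<..2*N}. \<Sum>m\<in>{1..x div N}.
           of_bool (y < m * n \<and> m * n \<le> x) * of_real (\<alpha> m * \<beta> n) * g i (m * n)))
        \<le> E * sqrt (\<Sum>m\<in>{1..x div N}. (\<alpha> m)\<^sup>2) * sqrt (\<Sum>n\<in>{N<..2*N}. (\<beta> n)\<^sup>2)"
    and A: "\<And>M. M \<le> x \<Longrightarrow> (\<Sum>m\<in>{1..M}. (\<alpha> m)\<^sup>2) \<le> real M * C"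
    and B: "\<And>M. M \<le> x \<Longrightarrow> (\<Sum>m\<in>{1..M}. (\<beta> m)\<^sup>2) \<le> real M * C"
    and s: "s * s \<le> x" "s \<le> U * 2 ^ J"
  shows "(\<Sum>i\<in>K. norm (\<Sum>n\<in>{U<..s}. \<Sum>m\<in>{1..x}.
           of_bool (y < m * n \<and> m * n \<le> x) * of_real (\<alpha> m * \<beta> n) * g i (m * n)))
        \<le> real J * (E * sqrt (2 * real x) * C)"
proof -
  \<comment> \<open>Truncating \<open>\<beta>\<close> at \<open>s\<close> allows the dyadic blocks
    to run past \<open>s\<close>.\<close>
  define b where "b = (\<lambda>n. of_bool (n \<le> s) * \<beta> n)"
  define w where "w = (\<lambda>i n m. of_bool (y < m * n \<and> m * n \<le> x) * of_real (\<alpha> m * b n) * g i (m * n))"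
  have sx: "s \<le> x"
  proof (cases "s = 0")
    case False
    hence "s * 1 \<le> s * s" by (intro mult_le_mono2) auto
    thus ?thesis using s(1) by linarith
  qed auto
  have eq: "(\<Sum>n\<in>{U<..s}. \<Sum>m\<in>{1..x}. of_bool (y < m * n \<and> m * n \<le> x) * of_real (\<alpha> m * \<beta> n) * g i (m * n))
        = (\<Sum>j<J. \<Sum>n\<in>{U * 2 ^ j<..2 * (U * 2 ^ j)}. \<Sum>m\<in>{1..x}. w i n m)" for i
  proof -
    have "(\<Sum>n\<in>{U<..s}. \<Sum>m\<in>{1..x}. of_bool (y < m * n \<and> m * n \<le> x) * of_real (\<alpha> m * \<beta> n) * g i (m * n))
        = (\<Sum>n\<in>{U<..s}. \<Sum>m\<in>{1..x}. w i n m)"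
      by (intro sum.cong refl) (auto simp: w_def b_def)
    also have "\<dots> = (\<Sum>n\<in>{U<..U * 2 ^ J}. \<Sum>m\<in>{1..x}. w i n m)"
      using s by (intro sum.mono_neutral_left) (auto simp: w_def b_def)
    also note sum_dyadic
    finally show ?thesis .
  qed
  have "(\<Sum>i\<in>K. norm (\<Sum>n\<in>{U<..s}. \<Sum>m\<in>{1..x}.
           of_bool (y < m * n \<and> m * n \<le> x) * of_real (\<alpha> m * \<beta> n) * g i (m * n)))
     \<le> (\<Sum>i\<in>K. \<Sum>j<J. norm (\<Sum>n\<in>{U * 2 ^ j<..2 * (U * 2 ^ j)}. \<Sum>m\<in>{1..x}. w i n m))"
    unfolding eq by (intro sum_mono norm_sum)
  also have "\<dots> = (\<Sum>j<J. \<Sum>i\<in>K. norm (\<Sum>n\<in>{U * 2 ^ j<..2 * (U * 2 ^ j)}. \<Sum>m\<in>{1..x}. w i n m))"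
    by (rule sum.swap)
  also have "\<dots> \<le> (\<Sum>j<J. E * sqrt (2 * real x) * C)"
  proof (rule sum_mono)
    fix j assume "j \<in> {..<J}"
    define N where "N = U * 2 ^ j"
    have NU: "U \<le> N" and N0: "N > 0" using U by (auto simp: N_def)
    show "(\<Sum>i\<in>K. norm (\<Sum>n\<in>{U * 2 ^ j<..2 * (U * 2 ^ j)}. \<Sum>m\<in>{1..x}. w i n m)) \<le> E * sqrt (2 * real x) * C"
    \<comment> \<open>If \<open>N * N > x\<close>, the block starts beyond \<open>s\<close>, where
      the truncated coefficients vanish.\<close>
    proof (cases "N * N \<le> x")
      case False
      have "s < N"
      proof (rule ccontr)
        assume "\<not> s < N"
        hence "N * N \<le> s * s" by (intro mult_le_mono) auto
        thus False using False s by auto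
      qed
      hence "(\<Sum>n\<in>{N<..2 * N}. \<Sum>m\<in>{1..x}. w i n m) = 0" for i
        by (intro sum.neutral ballI) (auto simp: w_def b_def)
      thus ?thesis using E C unfolding N_def[symmetric] by simp
    next
      case True
      have "(\<Sum>n\<in>{N<..2 * N}. \<Sum>m\<in>{1..x}. w i n m) = (\<Sum>n\<in>{N<..2 * N}. \<Sum>m\<in>{1..x div N}. w i n m)" for i
      proof (rule sum.cong[OF refl], rule sum.mono_neutral_right)
        fix n assume n: "n \<in> {N<..2 * N}"
        show "{1..x div N} \<subseteq> {1..x}" using N0 by (auto intro: order_trans[OF _ div_le_dividend])
        show "\<forall>m\<in>{1..x} - {1..x div N}. w i n m = 0"
        proof
          fix m assume m: "m \<in> {1..x} - {1..x div N}"
          hence "x div N < m" by auto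
          hence "x < m * N" using N0 by (simp add: div_less_iff_less_mult)
          also have "\<dots> \<le> m * n" using n by (intro mult_le_mono) auto
          finally show "w i n m = 0" by (simp add: w_def)
        qed
      qed auto
      hence "(\<Sum>i\<in>K. norm (\<Sum>n\<in>{N<..2 * N}. \<Sum>m\<in>{1..x}. w i n m)) = (\<Sum>i\<in>K. norm (\<Sum>n\<in>{N<..2 * N}. \<Sum>m\<in>{1..x div N}. w i n m))"
        by simp
      also have "\<dots> \<le> E * sqrt (\<Sum>m\<in>{1..x div N}. (\<alpha> m)\<^sup>2) * sqrt (\<Sum>n\<in>{N<..2*N}. (b n)\<^sup>2)"
        unfolding w_def by (rule TII[OF NU True])
      also have "\<dots> \<le> E * sqrt (real (x div N) * C) * sqrt (2 * real N * C)"
      proof (intro mult_mono real_sqrt_le_mono A)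
        show "x div N \<le> x" by simp
        have "(\<Sum>n\<in>{N<..2*N}. (b n)\<^sup>2) = (\<Sum>n\<in>{N<..min (2*N) s}. (b n)\<^sup>2)"
          by (rule sum.mono_neutral_right) (auto simp: b_def)
        also have "\<dots> \<le> (\<Sum>n\<in>{1..min (2*N) s}. (b n)\<^sup>2)" by (intro sum_mono2) auto
        also have "\<dots> \<le> (\<Sum>n\<in>{1..min (2*N) s}. (\<beta> n)\<^sup>2)" by (intro sum_mono) (auto simp: b_def)
        also have "\<dots> \<le> real (min (2*N) s) * C" using sx by (intro B) auto
        also have "\<dots> \<le> 2 * real N * C" using C by (intro mult_right_mono) auto
        finally show "(\<Sum>n\<in>{N<..2*N}. (b n)\<^sup>2) \<le> 2 * real N * C" .
      qed (use E C in \<open>auto intro!: sum_nonneg mult_nonneg_nonneg\<close>)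
      also have "\<dots> = E * sqrt ((2 * (real (x div N) * real N)) * C\<^sup>2)"
        by (simp add: real_sqrt_mult[symmetric] power2_eq_square mult_ac del: real_sqrt_mult_self real_sqrt_abs real_sqrt_abs2)
      also have "\<dots> \<le> E * sqrt ((2 * real x) * C\<^sup>2)"
      proof (intro mult_left_mono real_sqrt_le_mono mult_right_mono)
        have "x div N * N \<le> x" by simp
        thus "real (x div N) * real N \<le> real x" by (metis of_nat_le_iff of_nat_mult)
      qed (use E in auto)
      also have "\<dots> = E * sqrt (2 * real x) * C" using C by (simp add: real_sqrt_mult)
      finally show ?thesis unfolding N_def .
    qed
  qed
  finally show ?thesis by simp
qed

text \<open>The form in which Vaughan's identity is used throughout. Type I sums are bounded for
  each member of the family separately, type II sums only on average over the family, which is what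
  a large sieve provides. A single sum is covered by a family with one element. Type II bounds are
  required only for \<open>N * N \<le> x\<close>, because in a product up to \<open>x\<close> one
  factor is at most its square root.\<close>

theorem vaughan_family_bound:
  fixes g :: "'i \<Rightarrow> nat \<Rightarrow> complex" and T :: "nat \<Rightarrow> real"
  assumes K: "finite K" and E: "E \<ge> 0" and U: "U \<ge> 1" and Uy: "U \<le> y" and yx: "y \<le> x" and UU: "U * U \<le> x" and J: "x \<le> 2 ^ J"
    and TI: "\<And>i t h. i \<in> K \<Longrightarrow> 1 \<le> t \<Longrightarrow> t \<le> U * U \<Longrightarrow> h \<le> x div t \<Longrightarrow> norm (\<Sum>k\<in>{y div t<..h}. g i (t * k)) \<le> T t"
    and TII: "\<And>N \<alpha> \<beta>. U \<le> N \<Longrightarrow> N * N \<le> x \<Longrightarrow>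
        (\<Sum>i\<in>K. norm (\<Sum>n\<in>{N<..2*N}. \<Sum>m\<in>{1..x div N}.
           of_bool (y < m * n \<and> m * n \<le> x) * of_real (\<alpha> m * \<beta> n) * g i (m * n)))
        \<le> E * sqrt (\<Sum>m\<in>{1..x div N}. (\<alpha> m)\<^sup>2) * sqrt (\<Sum>n\<in>{N<..2*N}. (\<beta> n)\<^sup>2)"
  shows "(\<Sum>i\<in>K. norm (\<Sum>n\<in>{y<..x}. of_real (mangoldt n) * g i n))
     \<le> 3 * real (card K) * (1 + ln (real x)) * (\<Sum>t\<in>{1..U*U}. T t)
        + 2 * real J * (E * sqrt (2 * real x) * (1 + ln (real x)) ^ 3)"
proof -
  define L where "L = 1 + ln (real x)"
  have x1: "x \<ge> 1" using U Uy yx by simp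
  have L1: "L \<ge> 1" using x1 by (simp add: L_def)
  define s where "s = nat \<lfloor>sqrt (real x)\<rfloor>"
  have s1: "s * s \<le> x"
  proof -
    have "real s \<le> sqrt (real x)" by (simp add: s_def)
    hence "real s * real s \<le> sqrt (real x) * sqrt (real x)" by (intro mult_mono) auto
    hence "real (s * s) \<le> real x" by simp
    thus ?thesis by (simp only: of_nat_le_iff)
  qed
  have s2: "x < (s + 1) * (s + 1)"
  proof -
    have "sqrt (real x) < real (s + 1)" by (simp add: s_def) linarith
    hence "sqrt (real x) * sqrt (real x) < real (s + 1) * real (s + 1)" by (intro mult_strict_mono) auto
    hence "real x < real ((s + 1) * (s + 1))" by (simp add: algebra_simps)
    thus ?thesis by (simp only: of_nat_less_iff)
  qed
  have sJ: "s \<le> U * 2 ^ J"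
  proof -
    have "s \<le> s * s" by (cases s) auto
    also note s1 also note J also have "2 ^ J \<le> U * 2 ^ J" using U by simp
    finally show ?thesis .
  qed
  define TT where "TT = (\<lambda>i b. norm (\<Sum>k\<in>{y div b<..x div b}. g i (b * k)))"
  define A where "A = (\<lambda>c. of_bool (U < c) * mangoldt c :: real)"
  define H where "H = vaughan_coeff U x"
  define S3 where "S3 = (\<lambda>i. \<Sum>c\<in>{1..x}. \<Sum>m\<in>{1..x}. of_bool (y < c * m \<and> c * m \<le> x) * of_real (A c * H m) * g i (c * m))"
  define S3a where "S3a = (\<lambda>i. \<Sum>n\<in>{U<..s}. \<Sum>m\<in>{1..x}. of_bool (y < m * n \<and> m * n \<le> x) * of_real (H m * A n) * g i (m * n))"
  define S3b where "S3b = (\<lambda>i. \<Sum>n\<in>{U<..s}. \<Sum>m\<in>{1..x}. of_bool (y < m * n \<and> m * n \<le> x) * of_real ((of_bool (s < m) * A m) * H n) * g i (m * n))"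
  have sx: "s \<le> x" using s1 by (cases s) auto
  \<comment> \<open>By \<open>s2\<close> the factors \<open>c\<close> and \<open>m\<close> cannot
    both exceed \<open>s\<close>. Pairs with \<open>c \<le> s\<close> form \<open>S3a\<close>; the
    others have \<open>m \<le> s\<close> and form \<open>S3b\<close>, in which the two coefficient
    sequences are interchanged.\<close>
  have S3: "S3 i = S3a i + S3b i" for i
  proof -
    define w where "w = (\<lambda>c m. of_bool (y < c * m \<and> c * m \<le> x) * of_real (A c * H m) * g i (c * m))"
    have w0: "w c m = of_bool (c \<in> {U<..s}) * w c m + of_bool (m \<in> {U<..s}) * (of_bool (s < c) * w c m)"
      if "m \<ge> 1" for c m
    proof (cases "c * m \<le> x")
      case True
      have "c \<le> s \<or> m \<le> s"
      proof (rule ccontr)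
        assume "\<not> (c \<le> s \<or> m \<le> s)"
        hence "(s + 1) * (s + 1) \<le> c * m" by (intro mult_le_mono) auto
        thus False using s2 True by simp
      qed
      thus ?thesis using that vaughan_coeff_eq_0[of m U x] by (auto simp: w_def A_def H_def not_less)
    qed (auto simp: w_def)
    have "S3 i = (\<Sum>c\<in>{1..x}. \<Sum>m\<in>{1..x}. w c m)" by (simp add: S3_def w_def)
    also have "\<dots> = (\<Sum>c\<in>{1..x}. \<Sum>m\<in>{1..x}. of_bool (c \<in> {U<..s}) * w c m + of_bool (m \<in> {U<..s}) * (of_bool (s < c) * w c m))"
      by (rule sum.cong[OF refl], rule sum.cong[OF refl], rule w0) auto
    also have "\<dots> = (\<Sum>c\<in>{1..x}. \<Sum>m\<in>{1..x}. of_bool (c \<in> {U<..s}) * w c m) + (\<Sum>m\<in>{1..x}. \<Sum>c\<in>{1..x}. of_bool (m \<in> {U<..s}) * (of_bool (s < c) * w c m))"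
      unfolding sum.distrib by (subst (3) sum.swap) (rule refl)
    also have "(\<Sum>c\<in>{1..x}. \<Sum>m\<in>{1..x}. of_bool (c \<in> {U<..s}) * w c m) = (\<Sum>c\<in>{U<..s}. \<Sum>m\<in>{1..x}. of_bool (c \<in> {U<..s}) * w c m)"
      using sx by (intro sum.mono_neutral_right) auto
    also have "\<dots> = S3a i" unfolding S3a_def
      by (intro sum.cong refl) (auto simp: w_def mult_ac)
    also have "(\<Sum>m\<in>{1..x}. \<Sum>c\<in>{1..x}. of_bool (m \<in> {U<..s}) * (of_bool (s < c) * w c m)) = (\<Sum>m\<in>{U<..s}. \<Sum>c\<in>{1..x}. of_bool (m \<in> {U<..s}) * (of_bool (s < c) * w c m))"
      using sx by (intro sum.mono_neutral_right) auto
    also have "\<dots> = S3b i" unfolding S3b_def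
      by (intro sum.cong refl) (auto simp: w_def)
    finally show ?thesis .
  qed
  have bA: "(\<Sum>m\<in>{1..M}. (A m)\<^sup>2) \<le> real M * L ^ 3" if "M \<le> x" for M
    using sum_mangoldt_square[OF that x1] unfolding L_def
    by (rule order_trans[rotated]) (intro sum_mono, auto simp: A_def)
  have bA': "(\<Sum>m\<in>{1..M}. (of_bool (s < m) * A m)\<^sup>2) \<le> real M * L ^ 3" if "M \<le> x" for M
    using bA[OF that] by (rule order_trans[rotated]) (intro sum_mono, auto)
  have bH: "(\<Sum>m\<in>{1..M}. (H m)\<^sup>2) \<le> real M * L ^ 3" if "M \<le> x" for M
    using sum_vaughan_coeff_square[OF that x1] unfolding L_def H_def .
  have L30: "L ^ 3 \<ge> 0" using L1 by simp
  have B3a: "(\<Sum>i\<in>K. norm (S3a i)) \<le> real J * (E * sqrt (2 * real x) * L ^ 3)"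
    unfolding S3a_def by (rule bilinear_dyadic[OF E U L30 TII bH bA s1 sJ])
  have B3b: "(\<Sum>i\<in>K. norm (S3b i)) \<le> real J * (E * sqrt (2 * real x) * L ^ 3)"
    unfolding S3b_def by (rule bilinear_dyadic[OF E U L30 TII bA' bH s1 sJ])
  have one: "norm (\<Sum>n\<in>{y<..x}. of_real (mangoldt n) * g i n) \<le> 3 * L * (\<Sum>t\<in>{1..U*U}. T t) + norm (S3 i)"
    if i: "i \<in> K" for i
  proof -
    have T0: "T t \<ge> 0" if "t \<in> {1..U*U}" for t
      using TI[OF i, of t 0] that by (meson atLeastAtMost_iff norm_ge_zero order_trans zero_le)
    define P1 where "P1 = (\<Sum>b\<in>{1..U}. of_real (moebius b) * (\<Sum>k\<in>{y div b<..x div b}. of_real (ln (real k)) * g i (b * k)))"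
    define P2 where "P2 = (\<Sum>b\<in>{1..U}. \<Sum>c\<in>{1..U}. of_real (moebius b * mangoldt c) * (\<Sum>k\<in>{y div (b*c)<..x div (b*c)}. g i (b * c * k)))"
    have "norm (\<Sum>n\<in>{y<..x}. of_real (mangoldt n) * g i n) = norm (P1 - P2 + S3 i)"
      unfolding vaughan_sum[OF Uy yx] P1_def P2_def S3_def A_def H_def ..
    also have "\<dots> \<le> norm P1 + norm P2 + norm (S3 i)"
      using norm_triangle_ineq[of "P1 - P2" "S3 i"] norm_triangle_ineq4[of P1 P2] by linarith
    also have "norm P1 \<le> (\<Sum>b\<in>{1..U}. 2 * L * T b)"
      unfolding P1_def
    proof (rule order_trans[OF norm_sum], rule sum_mono)
      fix b assume b: "b \<in> {1..U}"
      have bU: "b \<in> {1..U*U}" using b by (auto intro: order_trans[OF _ le_square])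
      have "norm (\<Sum>k\<in>{y div b<..x div b}. of_real (ln (real k)) * g i (b * k)) \<le> 2 * ln (real x) * T b"
      proof (cases "y div b < x div b")
        case True
        show ?thesis using bU by (intro abel_ln_bound[OF _ True] TI[OF i]) auto
      next
        case False
        thus ?thesis using T0[OF bU] x1 by simp
      qed
      also have "\<dots> \<le> 2 * L * T b" using T0[OF bU] by (intro mult_right_mono) (auto simp: L_def)
      finally have *: "norm (\<Sum>k\<in>{y div b<..x div b}. of_real (ln (real k)) * g i (b * k)) \<le> 2 * L * T b" .
      have "\<bar>moebius b\<bar> * norm (\<Sum>k\<in>{y div b<..x div b}. of_real (ln (real k)) * g i (b * k)) \<le> 1 * (2 * L * T b)"
        by (intro mult_mono * abs_moebius_le) auto
      thus "norm (of_real (moebius b) * (\<Sum>k\<in>{y div b<..x div b}. of_real (ln (real k)) * g i (b * k))) \<le> 2 * L * T b"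
        by (simp add: norm_mult)
    qed
    also have "\<dots> \<le> (\<Sum>b\<in>{1..U*U}. 2 * L * T b)"
      using T0 L1 by (intro sum_mono2) (auto intro: order_trans[OF _ le_square])
    also have "norm P2 \<le> (\<Sum>b\<in>{1..U}. \<Sum>c\<in>{1..U}. mangoldt c * T (b * c))"
      unfolding P2_def
    proof (rule order_trans[OF norm_sum], rule sum_mono, rule order_trans[OF norm_sum], rule sum_mono)
      fix b c assume bc: "b \<in> {1..U}" "c \<in> {1..U}"
      have "norm (\<Sum>k\<in>{y div (b*c)<..x div (b*c)}. g i (b * c * k)) \<le> T (b * c)"
        using bc by (intro TI[OF i]) (auto intro: mult_le_mono simp: Suc_le_eq)
      hence "(\<bar>moebius b\<bar> * mangoldt c) * norm (\<Sum>k\<in>{y div (b*c)<..x div (b*c)}. g i (b * c * k)) \<le> (1 * mangoldt c) * T (b * c)"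
        by (intro mult_mono abs_moebius_le) (auto simp: mangoldt_nonneg)
      thus "norm (of_real (moebius b * mangoldt c) * (\<Sum>k\<in>{y div (b*c)<..x div (b*c)}. g i (b * c * k))) \<le> mangoldt c * T (b * c)"
        by (simp add: norm_mult)
    qed
    \<comment> \<open>Grouping by \<open>t = b * c\<close> gives \<open>T t\<close> the weight of
      \<open>mangoldt\<close> summed over divisors of \<open>t\<close>, hence at most
      \<open>ln t\<close>; no divisor function is lost.\<close>
    also have "\<dots> \<le> (\<Sum>b\<in>{1..U}. \<Sum>c\<in>{1..U}. \<Sum>t\<in>{1..U*U}. of_bool (t = b * c) * (mangoldt c * T t))"
    proof (intro sum_mono)
      fix b c assume bc: "b \<in> {1..U}" "c \<in> {1..U}"
      hence "b * c \<in> {1..U*U}" by (auto intro: mult_le_mono simp: Suc_le_eq)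
      thus "mangoldt c * T (b * c) \<le> (\<Sum>t\<in>{1..U*U}. of_bool (t = b * c) * (mangoldt c * T t))"
        by (simp add: of_bool_def if_distrib if_distribR cong: if_cong)
    qed
    also have "\<dots> = (\<Sum>t\<in>{1..U*U}. \<Sum>c\<in>{1..U}. \<Sum>b\<in>{1..U}. of_bool (t = b * c) * (mangoldt c * T t))"
      by (subst sum.swap, subst (2) sum.swap, subst sum.swap) (rule refl)
    also have "\<dots> \<le> (\<Sum>t\<in>{1..U*U}. L * T t)"
    proof (rule sum_mono)
      fix t assume t: "t \<in> {1..U*U}"
      show "(\<Sum>c\<in>{1..U}. \<Sum>b\<in>{1..U}. of_bool (t = b * c) * (mangoldt c * T t)) \<le> L * T t"
      proof -
        have True: "t \<le> x" using t UU by auto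
        have "(\<Sum>c\<in>{1..U}. \<Sum>b\<in>{1..U}. of_bool (t = b * c) * (mangoldt c * T t)) \<le> (\<Sum>c\<in>{1..U}. of_bool (c dvd t) * mangoldt c * T t)"
        proof (rule sum_mono)
          fix c assume c: "c \<in> {1..U}"
          show "(\<Sum>b\<in>{1..U}. of_bool (t = b * c) * (mangoldt c * T t)) \<le> of_bool (c dvd t) * mangoldt c * T t"
          proof (cases "c dvd t")
            case True
            have "(\<Sum>b\<in>{1..U}. of_bool (t = b * c) * (mangoldt c * T t)) = (\<Sum>b\<in>{1..U}. of_bool (b = t div c) * (mangoldt c * T t))"
              using True c by (intro sum.cong refl) auto
            also have "\<dots> \<le> mangoldt c * T t"
              using T0[OF t] mangoldt_nonneg[of c] by (auto simp: of_bool_def if_distrib if_distribR cong: if_cong)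
            finally show ?thesis using True by simp
          next
            case False
            hence "(\<Sum>b\<in>{1..U}. of_bool (t = b * c) * (mangoldt c * T t)) = 0" by (intro sum.neutral) auto
            thus ?thesis using False by simp
          qed
        qed
        also have "\<dots> \<le> (\<Sum>c\<in>{1..x}. of_bool (c dvd t) * mangoldt c * T t)"
          using Uy yx T0[OF t] mangoldt_nonneg by (intro sum_mono2) auto
        also have "\<dots> = (\<Sum>c\<in>{1..x}. of_bool (c dvd t) * mangoldt c) * T t" by (simp only: sum_distrib_right)
        also have "(\<Sum>c\<in>{1..x}. of_bool (c dvd t) * mangoldt c) = ln (real t)"
          using t True by (subst sum_of_bool_dvd) (auto simp: mangoldt_sum)
        also have "\<dots> * T t \<le> L * T t" using t True T0[OF t] by (intro mult_right_mono) (auto simp: L_def intro!: add_increasing)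
        finally show ?thesis .
      qed
    qed
    finally have "norm (\<Sum>n\<in>{y<..x}. of_real (mangoldt n) * g i n) \<le>
        2 * L * (\<Sum>t\<in>{1..U*U}. T t) + L * (\<Sum>t\<in>{1..U*U}. T t) + norm (S3 i)"
      by (simp only: sum_distrib_left add_ac)
    thus ?thesis by (simp only: algebra_simps)
  qed
  have "(\<Sum>i\<in>K. norm (\<Sum>n\<in>{y<..x}. of_real (mangoldt n) * g i n)) \<le> (\<Sum>i\<in>K. 3 * L * (\<Sum>t\<in>{1..U*U}. T t) + norm (S3 i))"
    by (intro sum_mono one)
  also have "\<dots> \<le> (\<Sum>i\<in>K. 3 * L * (\<Sum>t\<in>{1..U*U}. T t) + (norm (S3a i) + norm (S3b i)))"
    unfolding S3 by (intro sum_mono add_left_mono norm_triangle_ineq)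
  also have "\<dots> = real (card K) * (3 * L * (\<Sum>t\<in>{1..U*U}. T t)) + ((\<Sum>i\<in>K. norm (S3a i)) + (\<Sum>i\<in>K. norm (S3b i)))"
    by (simp add: sum.distrib)
  finally show ?thesis using B3a B3b unfolding L_def[symmetric] by (simp add: algebra_simps)
qed

section \<open>Characters modulo a product of distinct primes\<close>

lemmas cong_mod_def = unique_euclidean_semiring_class.cong_def

definition proot :: "nat \<Rightarrow> nat" where
  "proot q = (SOME g. residue_primroot q g)"

text \<open>The discrete logarithm to the base \<open>proot q\<close>; unspecified when \<open>q\<close> divides \<open>n\<close>.\<close>

definition ind :: "nat \<Rightarrow> nat \<Rightarrow> nat" where
  "ind q n = (SOME i. i < q - 1 \<and> [proot q ^ i = n] (mod q))"

text \<open>The \<open>j\<close>-th Dirichlet character modulo the prime \<open>q\<close>: it sends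
  the chosen primitive root to the \<open>j\<close>-th power of
  \<open>exp (2 * pi * i / (q - 1))\<close>. The index \<open>j = 0\<close> is the principal
  character.\<close>

definition dchar :: "nat \<Rightarrow> nat \<Rightarrow> nat \<Rightarrow> complex" where
  "dchar q j n = (if q dvd n then 0 else cis (2 * pi / real (q - 1)) ^ (j * ind q n))"

lemma proot: assumes "prime q" shows "residue_primroot q (proot q)"
proof -
  have "\<exists>g. residue_primroot q g" using prime_primitive_root_exists[of q] assms prime_gt_1_nat by auto
  thus ?thesis unfolding proot_def by (rule someI_ex)
qed

lemma proot_coprime: "prime q \<Longrightarrow> coprime q (proot q)"
  using proot residue_primroot_def by blast

lemma ord_proot: "prime q \<Longrightarrow> ord q (proot q) = q - 1"
  using proot[of q] by (simp add: residue_primroot_def totient_prime)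

lemma ind:
  assumes q: "prime q" and n: "\<not> q dvd n"
  shows "ind q n < q - 1" "[proot q ^ ind q n = n] (mod q)"
proof -
  have q1: "q > 1" using q prime_gt_1_nat by auto
  have "bij_betw (\<lambda>i. proot q ^ i mod q) {..<totient q} (totatives q)"
    by (rule residue_primroot_is_generator[OF q1 proot[OF q]])
  moreover have "n mod q \<in> totatives q"
  proof -
    have "coprime n q" using prime_imp_coprime[OF q n] by (simp add: coprime_commute)
    thus ?thesis using n q1 by (auto simp: totatives_def mod_greater_zero_iff_not_dvd intro: less_imp_le)
  qed
  ultimately obtain i where "i < totient q" "n mod q = proot q ^ i mod q" by (auto simp: bij_betw_def)
  hence "i < q - 1 \<and> [proot q ^ i = n] (mod q)" using q by (simp add: totient_prime cong_mod_def)
  hence "ind q n < q - 1 \<and> [proot q ^ ind q n = n] (mod q)" unfolding ind_def by (rule someI)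
  thus "ind q n < q - 1" "[proot q ^ ind q n = n] (mod q)" by auto
qed

lemma proot_power_cong_iff: "prime q \<Longrightarrow> [proot q ^ a = proot q ^ b] (mod q) \<longleftrightarrow> [a = b] (mod (q - 1))"
  using order_divides_expdiff[OF proot_coprime, of q a b] by (simp add: ord_proot)

lemma cis_root_power_cong:
  assumes "m > 0" "[a = b] (mod m)"
  shows "cis (2 * pi / real m) ^ a = cis (2 * pi / real m) ^ b"
proof -
  have 1: "cis (2 * pi / real m) ^ m = 1" using assms(1) by (simp add: Complex.DeMoivre)
  have "cis (2 * pi / real m) ^ k = cis (2 * pi / real m) ^ (k mod m)" for k
  proof -
    have "cis (2 * pi / real m) ^ k = cis (2 * pi / real m) ^ (m * (k div m) + k mod m)" by simp
    also have "\<dots> = cis (2 * pi / real m) ^ (k mod m)" unfolding power_add power_mult 1 by simp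
    finally show ?thesis .
  qed
  thus ?thesis using assms(2) unfolding cong_mod_def by metis
qed

lemma cis_root_power_eq_1:
  assumes "m > 0" "k < m" "cis (2 * pi / real m) ^ k = 1"
  shows "k = 0"
proof (rule ccontr)
  assume "k \<noteq> 0"
  have "cis (2 * pi * real k / real m) = 1" using assms(3) by (simp add: Complex.DeMoivre mult_ac)
  moreover have "cis (2 * pi * real k / real m) = exp (\<i> * (2 * pi * real k / real m))"
    by (simp add: cis_conv_exp)
  ultimately obtain n :: int where "2 * pi * real k / real m = of_int (2 * n) * pi"
    by (auto simp: exp_eq_1)
  hence "real k = of_int n * real m" using assms(1) by (simp add: field_simps)
  hence "int k = n * int m" by (metis of_int_eq_iff of_int_mult of_int_of_nat_eq)
  have "0 < int k" "int k < int m" "0 < int m" using \<open>k \<noteq> 0\<close> assms by auto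
  hence "0 < n" using \<open>int k = n * int m\<close> by (simp add: zero_less_mult_iff)
  hence "1 * int m \<le> n * int m" by (intro mult_right_mono) auto
  thus False using \<open>int k = n * int m\<close> \<open>int k < int m\<close> by linarith
qed

lemma dchar_mult: assumes q: "prime q" shows "dchar q j (m * n) = dchar q j m * dchar q j n"
proof (cases "q dvd m \<or> q dvd n")
  case True thus ?thesis by (auto simp: dchar_def)
next
  case False
  hence nd: "\<not> q dvd m * n" using q by (simp add: prime_dvd_mult_iff)
  have "[proot q ^ ind q (m * n) = proot q ^ (ind q m + ind q n)] (mod q)"
    unfolding power_add using ind(2)[OF q nd] ind(2)[OF q, of m] ind(2)[OF q, of n] False
    by (meson cong_mult cong_sym cong_trans)
  hence "[ind q (m * n) = ind q m + ind q n] (mod (q - 1))" using q by (simp add: proot_power_cong_iff)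
  hence "[j * ind q (m * n) = j * ind q m + j * ind q n] (mod (q - 1))"
    using cong_scalar_left by (fastforce simp: algebra_simps)
  hence "cis (2 * pi / real (q - 1)) ^ (j * ind q (m * n)) = cis (2 * pi / real (q - 1)) ^ (j * ind q m + j * ind q n)"
    using prime_gt_1_nat[OF q] by (intro cis_root_power_cong) auto
  thus ?thesis using False nd by (simp add: dchar_def power_add)
qed

lemma ind_cong:
  assumes "[m = n] (mod q)" shows "ind q m = ind q n"
proof -
  have "(\<lambda>i. i < q - 1 \<and> [proot q ^ i = m] (mod q)) = (\<lambda>i. i < q - 1 \<and> [proot q ^ i = n] (mod q))"
    using assms by (auto simp: cong_mod_def)
  thus ?thesis by (simp add: ind_def)
qed

lemma dchar_cong: "[m = n] (mod q) \<Longrightarrow> dchar q j m = dchar q j n"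
  using cong_dvd_iff[of m n q] by (simp add: dchar_def ind_cong)

lemma norm_dchar: "norm (dchar q j n) = of_bool (\<not> q dvd n)"
  by (simp add: dchar_def norm_power)

lemma dchar_0: "dchar q 0 n = of_bool (\<not> q dvd n)"
  by (simp add: dchar_def)

lemma ind_eq_0_iff:
  assumes q: "prime q" and n: "\<not> q dvd n"
  shows "ind q n = 0 \<longleftrightarrow> [n = 1] (mod q)"
proof
  assume "ind q n = 0"
  thus "[n = 1] (mod q)" using ind(2)[OF q n] by (simp add: cong_sym)
next
  assume "[n = 1] (mod q)"
  hence "[proot q ^ ind q n = proot q ^ 0] (mod q)" using ind(2)[OF q n] by (metis cong_trans power_0)
  hence "[ind q n = 0] (mod (q - 1))" using q proot_power_cong_iff by blast
  thus "ind q n = 0" using ind(1)[OF q n] by (simp add: cong_mod_def)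
qed

lemma geometric_root_sum:
  fixes z :: complex assumes "z ^ m = 1" shows "(\<Sum>j<m. z ^ j) = (if z = 1 then of_nat m else 0)"
  using assms by (auto simp: geometric_sum)

lemma dchar_sum_chars:
  assumes q: "prime q" and n: "\<not> q dvd n"
  shows "(\<Sum>j<q-1. dchar q j n) = of_nat (q - 1) * of_bool ([n = 1] (mod q))"
proof -
  define z where "z = cis (2 * pi / real (q - 1)) ^ ind q n"
  have q1: "q - 1 > 0" using prime_gt_1_nat[OF q] by simp
  have "z ^ (q - 1) = 1"
    unfolding z_def power_mult[symmetric] using cis_root_power_cong[OF q1, of "ind q n * (q-1)" 0] by (simp add: cong_mod_def)
  moreover have "(\<Sum>j<q-1. dchar q j n) = (\<Sum>j<q-1. z ^ j)"
    using n by (simp add: dchar_def z_def power_mult[symmetric] mult.commute)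
  moreover have "z = 1 \<longleftrightarrow> [n = 1] (mod q)"
    unfolding ind_eq_0_iff[OF q n, symmetric] z_def using cis_root_power_eq_1[OF q1 ind(1)[OF q n]] by auto
  ultimately show ?thesis by (simp add: geometric_root_sum)
qed

text \<open>Running through the units as powers of the primitive root turns the sum into a geometric
  series over a full period, whose ratio \<open>z\<close> differs from \<open>1\<close> because the
  indices do.\<close>

lemma dchar_orthogonal:
  assumes q: "prime q" and j: "j < q - 1" "j' < q - 1" "j \<noteq> j'"
  shows "(\<Sum>n<q. dchar q j n * cnj (dchar q j' n)) = 0"
proof -
  define w where "w = cis (2 * pi / real (q - 1))"
  define z where "z = w ^ j * cnj w ^ j'"
  have q1: "q > 1" using prime_gt_1_nat[OF q] by simp
  have w1: "w ^ (q - 1) = 1" unfolding w_def using cis_root_power_cong[of "q-1" "q-1" 0] q1 by (simp add: cong_mod_def)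
  have ww: "w * cnj w = 1" by (simp add: w_def cis_cnj cis_mult)
  have zq: "z ^ (q - 1) = 1"
  proof -
    have "z ^ (q - 1) = (w ^ (q - 1)) ^ j * cnj (w ^ (q - 1)) ^ j'"
      unfolding z_def power_mult_distrib complex_cnj_power power_mult[symmetric] mult.commute[of "q - 1"] ..
    thus ?thesis unfolding w1 by simp
  qed
  have z1: "z \<noteq> 1"
  proof
    assume z: "z = 1"
    have "w ^ j = w ^ j * (w * cnj w) ^ j'" by (simp add: ww)
    also have "\<dots> = z * w ^ j'" by (simp add: z_def power_mult_distrib mult_ac)
    finally have e: "w ^ j = w ^ j'" by (simp add: z)
    have False if ab: "a < b" "b < q - 1" "w ^ a = w ^ b" for a b
    proof -
      have "a + (b - a) = b" using ab by simp
      hence "w ^ b = w ^ a * w ^ (b - a)" by (metis power_add)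
      hence "w ^ (b - a) = 1" using ab by (simp add: w_def)
      hence "b - a = 0" unfolding w_def using ab by (intro cis_root_power_eq_1[of "q-1"]) auto
      thus False using ab by simp
    qed
    from this[of j j'] this[of j' j] show False using j e by (metis linorder_neqE_nat)
  qed
  have bij: "bij_betw (\<lambda>i. proot q ^ i mod q) {..<q-1} (totatives q)"
    using residue_primroot_is_generator[OF q1 proot[OF q]] q by (simp add: totient_prime)
  have tot: "totatives q = {n\<in>{..<q}. \<not> q dvd n}"
  proof (rule equalityI; rule subsetI)
    fix n assume n: "n \<in> totatives q"
    hence "\<not> q dvd n" using q1 by (auto simp: totatives_def)
    moreover from this have "n \<noteq> q" by auto
    ultimately show "n \<in> {n\<in>{..<q}. \<not> q dvd n}" using n by (auto simp: totatives_def)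
  next
    fix n assume "n \<in> {n\<in>{..<q}. \<not> q dvd n}"
    hence n: "n < q" "\<not> q dvd n" by auto
    have "coprime n q" using prime_imp_coprime[OF q n(2)] by (simp add: coprime_commute)
    thus "n \<in> totatives q" using n by (auto simp: totatives_def intro!: Nat.gr0I)
  qed
  have "(\<Sum>n<q. dchar q j n * cnj (dchar q j' n)) = (\<Sum>n\<in>totatives q. dchar q j n * cnj (dchar q j' n))"
    unfolding tot by (intro sum.mono_neutral_right) (auto simp: dchar_def)
  also have "\<dots> = (\<Sum>i<q-1. dchar q j (proot q ^ i mod q) * cnj (dchar q j' (proot q ^ i mod q)))"
    by (rule sum.reindex_bij_betw[OF bij, symmetric])
  also have "\<dots> = (\<Sum>i<q-1. z ^ i)"
  proof (rule sum.cong[OF refl])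
    fix i assume i: "i \<in> {..<q-1}"
    have nd: "\<not> q dvd proot q ^ i" using proot_coprime[OF q] q
      by (meson coprime_common_divisor dvd_refl not_prime_unit prime_dvd_power)
    have "[proot q ^ ind q (proot q ^ i) = proot q ^ i] (mod q)" by (rule ind(2)[OF q nd])
    hence "[ind q (proot q ^ i) = i] (mod (q - 1))" by (simp only: proot_power_cong_iff[OF q])
    hence ii: "ind q (proot q ^ i) = i" using ind(1)[OF q nd] i by (simp add: cong_mod_def)
    have "dchar q k (proot q ^ i mod q) = w ^ (k * i)" for k
    proof -
      have "dchar q k (proot q ^ i mod q) = dchar q k (proot q ^ i)" by (rule dchar_cong) (simp add: cong_mod_def)
      thus ?thesis using nd by (simp add: dchar_def ii w_def)
    qed
    thus "dchar q j (proot q ^ i mod q) * cnj (dchar q j' (proot q ^ i mod q)) = z ^ i"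
      by (simp add: z_def power_mult_distrib power_mult)
  qed
  also have "\<dots> = 0" using geometric_root_sum[OF zq] z1 by simp
  finally show ?thesis .
qed

text \<open>Here \<open>j = 0\<close> gives the constant \<open>1\<close> instead of the principal character, so that a product over all of \<open>Q\<close>
  depends only on the primes in its support.\<close>

definition dchar1 :: "nat \<Rightarrow> nat \<Rightarrow> nat \<Rightarrow> complex" where
  "dchar1 q j n = (if j = 0 then 1 else dchar q j n)"

lemma dchar1_mult: "prime q \<Longrightarrow> dchar1 q j (m * n) = dchar1 q j m * dchar1 q j n"
  by (simp add: dchar1_def dchar_mult)

lemma norm_dchar1_le: "norm (dchar1 q j n) \<le> 1"
  by (simp add: dchar1_def norm_dchar)

lemma dchar1_cong: "[m = n] (mod q) \<Longrightarrow> dchar1 q j m = dchar1 q j n"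
  by (simp add: dchar1_def dchar_cong)

lemma dchar1_orthogonal:
  assumes q: "prime q" and j: "j < q - 1" "j' < q - 1" "j \<noteq> j'"
  shows "(\<Sum>n<q. dchar1 q j n * cnj (dchar1 q j' n)) = 0"
proof -
  have "(\<Sum>n<q. dchar1 q j n * cnj (dchar1 q j' n)) = (\<Sum>n<q. dchar q j n * cnj (dchar q j' n))"
    using j(3) by (intro sum.cong refl) (auto simp: dchar1_def dchar_def)
  thus ?thesis by (simp add: dchar_orthogonal[OF assms])
qed

text \<open>The Chinese remainder theorem: the pair of residues modulo \<open>a\<close> and
  \<open>b\<close> is a bijective coordinate on \<open>{..<a*b}\<close>.\<close>

lemma sum_coprime_product:
  fixes F G :: "nat \<Rightarrow> 'a::comm_semiring_1"
  assumes ab: "coprime a b" "a > 0" "b > 0"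
    and F: "\<And>n. F (n mod a) = F n" and G: "\<And>n. G (n mod b) = G n"
  shows "(\<Sum>n<a*b. F n * G n) = (\<Sum>n<a. F n) * (\<Sum>n<b. G n)"
proof -
  have inj: "inj_on (\<lambda>n. (n mod a, n mod b)) {..<a*b}"
  proof (rule inj_onI)
    fix x y assume "x \<in> {..<a*b}" "y \<in> {..<a*b}" "(x mod a, x mod b) = (y mod a, y mod b)"
    moreover from this have "[x = y] (mod (a * b))" using ab by (intro coprime_cong_mult_nat) (auto simp: cong_mod_def)
    ultimately show "x = y" by (simp add: cong_mod_def)
  qed
  have "(\<lambda>n. (n mod a, n mod b)) ` {..<a*b} = {..<a} \<times> {..<b}"
  proof (rule card_subset_eq)
    show "card ((\<lambda>n. (n mod a, n mod b)) ` {..<a*b}) = card ({..<a} \<times> {..<b})"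
      by (simp add: card_image[OF inj])
  qed (use ab in auto)
  hence bij: "bij_betw (\<lambda>n. (n mod a, n mod b)) {..<a*b} ({..<a} \<times> {..<b})"
    using inj by (simp add: bij_betw_def)
  have "(\<Sum>n<a*b. F n * G n) = (\<Sum>n<a*b. (\<lambda>(x,y). F x * G y) (n mod a, n mod b))"
    by (simp add: F G)
  also have "\<dots> = (\<Sum>(x,y)\<in>{..<a} \<times> {..<b}. F x * G y)" by (rule sum.reindex_bij_betw[OF bij])
  also have "\<dots> = (\<Sum>n<a. F n) * (\<Sum>n<b. G n)" by (simp add: sum_product sum.cartesian_product)
  finally show ?thesis .
qed

lemma sum_prime_product:
  fixes h :: "nat \<Rightarrow> nat \<Rightarrow> 'a::comm_semiring_1"
  assumes "finite A" "\<And>q. q \<in> A \<Longrightarrow> prime q" "\<And>q n. q \<in> A \<Longrightarrow> h q (n mod q) = h q n"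
  shows "(\<Sum>n<\<Prod>A. \<Prod>q\<in>A. h q n) = (\<Prod>q\<in>A. \<Sum>n<q. h q n)"
  using assms
proof (induction A rule: finite_induct)
  case empty thus ?case by simp
next
  case (insert p A)
  have cop: "coprime p (\<Prod>A)"
    using insert.hyps insert.prems(1) by (intro prod_coprime_right) (auto intro: primes_coprime)
  have pos: "\<Prod>A > 0" using insert.prems(1) insert.hyps by (auto intro!: prod_pos prime_gt_0_nat)
  have per: "(\<Prod>q\<in>A. h q (n mod \<Prod>A)) = (\<Prod>q\<in>A. h q n)" for n
  proof (rule prod.cong[OF refl])
    fix q assume q: "q \<in> A"
    have "h q (n mod \<Prod>A) = h q ((n mod \<Prod>A) mod q)" using insert.prems(2) q by simp
    also have "(n mod \<Prod>A) mod q = n mod q" using insert.hyps q by (intro mod_mod_cancel dvd_prodI) auto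
    also have "h q (n mod q) = h q n" using insert.prems(2) q by simp
    finally show "h q (n mod \<Prod>A) = h q n" .
  qed
  have "(\<Sum>n<\<Prod>(insert p A). \<Prod>q\<in>insert p A. h q n) = (\<Sum>n<p * \<Prod>A. h p n * (\<Prod>q\<in>A. h q n))"
    using insert.hyps by simp
  also have "\<dots> = (\<Sum>n<p. h p n) * (\<Sum>n<\<Prod>A. \<Prod>q\<in>A. h q n)"
    using insert.prems per pos by (intro sum_coprime_product cop) (auto intro: prime_gt_0_nat)
  also have "(\<Sum>n<\<Prod>A. \<Prod>q\<in>A. h q n) = (\<Prod>q\<in>A. \<Sum>n<q. h q n)"
    using insert.prems by (intro insert.IH) auto
  finally show ?case using insert.hyps by simp
qed

text \<open>Every complete period contributes zero wherever it starts, so blocks of length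
  \<open>P\<close> can be removed until at most \<open>P\<close> terms remain.\<close>

lemma periodic_sum_bound:
  fixes F :: "nat \<Rightarrow> complex"
  assumes P: "P > 0" and per: "\<And>n. F (n mod P) = F n" and bd: "\<And>n. norm (F n) \<le> 1"
    and zero: "(\<Sum>n<P. F n) = 0"
  shows "norm (\<Sum>n\<in>{a<..b}. F n) \<le> real P"
proof -
  have per': "F (n + P) = F n" for n using per[of "n + P"] per[of n] by simp
  have full: "(\<Sum>n\<in>{a<..a+P}. F n) = 0" for a
  proof (induction a)
    case 0
    have "{0<..0+P} = insert P {0<..<P}" using P by auto
    hence "(\<Sum>n\<in>{0<..0+P}. F n) = F P + (\<Sum>n\<in>{0<..<P}. F n)" by simp
    also have "F P = F 0" using per'[of 0] by simp
    also have "F 0 + (\<Sum>n\<in>{0<..<P}. F n) = (\<Sum>n\<in>insert 0 {0<..<P}. F n)" by simp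
    also have "insert 0 {0<..<P} = {..<P}" using P by auto
    finally show ?case using zero by simp
  next
    case (Suc a)
    have "F (Suc a) + (\<Sum>n\<in>{Suc a<..Suc a+P}. F n) = (\<Sum>n\<in>{a<..Suc a + P}. F n)"
    proof -
      have "{a<..Suc a + P} = insert (Suc a) {Suc a<..Suc a+P}" by auto
      thus ?thesis by simp
    qed
    also have "{a<..Suc a + P} = insert (Suc a + P) {a<..a+P}" using P by auto
    also have "(\<Sum>n\<in>insert (Suc a + P) {a<..a+P}. F n) = F (Suc a + P)" using Suc.IH by simp
    also have "\<dots> = F (Suc a)" by (rule per')
    finally show ?case by simp
  qed
  show ?thesis
  proof (induction b rule: less_induct)
    case (less b)
    show ?case
    proof (cases "b \<le> a + P")
      case True
      have "norm (\<Sum>n\<in>{a<..b}. F n) \<le> (\<Sum>n\<in>{a<..b}. 1)" by (rule sum_norm_le) (rule bd)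
      also have "\<dots> \<le> real P" using True by simp
      finally show ?thesis .
    next
      case False
      hence "{a<..b} = {a<..b-P} \<union> {b-P<..b-P+P}" by auto
      hence "(\<Sum>n\<in>{a<..b}. F n) = (\<Sum>n\<in>{a<..b-P}. F n) + (\<Sum>n\<in>{b-P<..b-P+P}. F n)"
        by (simp only:) (rule sum.union_disjoint, auto)
      also have "\<dots> = (\<Sum>n\<in>{a<..b-P}. F n)" by (simp only: full add_0_right)
      finally show ?thesis using less.IH[of "b - P"] False P by simp
    qed
  qed
qed

definition chi :: "nat set \<Rightarrow> (nat \<Rightarrow> nat) \<Rightarrow> nat \<Rightarrow> complex" where
  "chi Q J n = (\<Prod>q\<in>Q. dchar1 q (J q) n)"

text \<open>The product of these primes is the conductor of \<open>chi Q J\<close>, since a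
  nonprincipal character modulo a prime is primitive.\<close>

definition supp :: "nat set \<Rightarrow> (nat \<Rightarrow> nat) \<Rightarrow> nat set" where
  "supp Q J = {q\<in>Q. J q \<noteq> 0}"

text \<open>Exponent vectors indexing the characters modulo \<open>\<Prod>Q\<close>. Taking
  extensional functions keeps the indexing free of repetitions.\<close>

abbreviation chars :: "nat set \<Rightarrow> (nat \<Rightarrow> nat) set" where
  "chars Q \<equiv> PiE Q (\<lambda>q. {..<q - 1})"

lemma chi_mult: "(\<And>q. q \<in> Q \<Longrightarrow> prime q) \<Longrightarrow> chi Q J (m * n) = chi Q J m * chi Q J n"
  by (simp add: chi_def dchar1_mult prod.distrib)

lemma norm_chi_le: "norm (chi Q J n) \<le> 1"
  unfolding chi_def prod_norm[symmetric] by (intro prod_le_1) (auto simp: norm_dchar1_le)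

text \<open>The product has period \<open>\<Prod>A\<close>, where \<open>A\<close> is the union of
  the two supports, and its sum over a period factorises over the primes of \<open>A\<close>. At a
  prime where \<open>J\<close> and \<open>J'\<close> differ the factor is zero. The bound thus
  depends on the conductors only, not on the possibly huge \<open>\<Prod>Q\<close>.\<close>

lemma chi_orthogonal:
  assumes Q: "finite Q" "\<And>q. q \<in> Q \<Longrightarrow> prime q" and z: "\<And>q. q \<in> Q \<Longrightarrow> q \<le> z"
    and J: "J \<in> chars Q" "J' \<in> chars Q" "J \<noteq> J'"
  shows "norm (\<Sum>n\<in>{a<..b}. chi Q J n * cnj (chi Q J' n)) \<le> real z ^ (card (supp Q J) + card (supp Q J'))"
proof -
  define A where "A = supp Q J \<union> supp Q J'"
  define h where "h = (\<lambda>q n. dchar1 q (J q) n * cnj (dchar1 q (J' q) n))"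
  have AQ: "A \<subseteq> Q" and finA: "finite A" using Q by (auto simp: A_def supp_def)
  obtain p where p: "p \<in> Q" "J p \<noteq> J' p" using J by (metis PiE_ext)
  have pA: "p \<in> A" using p by (auto simp: A_def supp_def)
  have eq: "chi Q J n * cnj (chi Q J' n) = (\<Prod>q\<in>A. h q n)" for n
  proof -
    have "chi Q J n * cnj (chi Q J' n) = (\<Prod>q\<in>Q. h q n)" by (simp add: chi_def h_def prod.distrib)
    also have "\<dots> = (\<Prod>q\<in>A. h q n)"
      using Q(1) AQ by (intro prod.mono_neutral_right) (auto simp: A_def supp_def h_def dchar1_def)
    finally show ?thesis .
  qed
  have hper: "h q (n mod q) = h q n" for q n
    unfolding h_def by (intro arg_cong2[where f = "(*)"] arg_cong[where f = cnj] dchar1_cong) (auto simp: cong_mod_def)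
  have hb: "norm (h q n) \<le> 1" for q n
    unfolding h_def norm_mult complex_mod_cnj by (intro mult_le_one norm_dchar1_le) auto
  have pos: "\<Prod>A > 0" using AQ Q(2) by (intro prod_pos) (meson prime_gt_0_nat subsetD)
  have "norm (\<Sum>n\<in>{a<..b}. \<Prod>q\<in>A. h q n) \<le> real (\<Prod>A)"
  proof (rule periodic_sum_bound[OF pos])
    fix n
    show "(\<Prod>q\<in>A. h q (n mod \<Prod>A)) = (\<Prod>q\<in>A. h q n)"
    proof (rule prod.cong[OF refl])
      fix q assume q: "q \<in> A"
      have "h q (n mod \<Prod>A) = h q ((n mod \<Prod>A) mod q)" by (simp only: hper)
      also have "(n mod \<Prod>A) mod q = n mod q" using finA q by (intro mod_mod_cancel dvd_prodI) auto
      finally show "h q (n mod \<Prod>A) = h q n" by (simp only: hper)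
    qed
    show "norm (\<Prod>q\<in>A. h q n) \<le> 1" unfolding prod_norm[symmetric] by (intro prod_le_1) (auto simp: hb)
  next
    have "(\<Sum>n<\<Prod>A. \<Prod>q\<in>A. h q n) = (\<Prod>q\<in>A. \<Sum>n<q. h q n)"
      using finA AQ Q by (intro sum_prime_product) (auto simp: hper)
    also have "\<dots> = 0"
    proof (rule prod_zero[OF finA], rule bexI[OF _ pA])
      show "(\<Sum>n<p. h p n) = 0" unfolding h_def using p J Q by (intro dchar1_orthogonal) (auto simp: PiE_iff)
    qed
    finally show "(\<Sum>n<\<Prod>A. \<Prod>q\<in>A. h q n) = 0" .
  qed
  also have "real (\<Prod>A) \<le> real z ^ (card (supp Q J) + card (supp Q J'))"
  proof -
    have z1: "z \<ge> 1" using z[OF p(1)] prime_ge_1_nat[OF Q(2)[OF p(1)]] by linarith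
    have "\<Prod>A \<le> (\<Prod>q\<in>A. z)" using AQ z by (intro prod_mono) auto
    also have "\<dots> = z ^ card A" by simp
    also have "\<dots> \<le> z ^ (card (supp Q J) + card (supp Q J'))"
      using z1 unfolding A_def by (intro power_increasing card_Un_le) auto
    finally show ?thesis by (metis of_nat_le_iff of_nat_power)
  qed
  finally show ?thesis by (simp only: eq)
qed

lemma chi_sum_bound:
  assumes Q: "finite Q" "\<And>q. q \<in> Q \<Longrightarrow> prime q" and z: "\<And>q. q \<in> Q \<Longrightarrow> q \<le> z"
    and J: "J \<in> chars Q" "supp Q J \<noteq> {}"
  shows "norm (\<Sum>n\<in>{a<..b}. chi Q J n) \<le> real z ^ card (supp Q J)"
proof -
  define J0 where "J0 = (\<lambda>q\<in>Q. 0::nat)"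
  have 0: "J0 \<in> chars Q" using prime_gt_1_nat[OF Q(2)] by (auto simp: J0_def)
  have s0: "supp Q J0 = {}" by (auto simp: supp_def J0_def)
  have c0: "chi Q J0 n = 1" for n by (simp add: chi_def J0_def dchar1_def)
  have "J \<noteq> J0" using J s0 by auto
  from chi_orthogonal[OF Q z J(1) 0 this] show ?thesis by (simp add: c0 s0)
qed

lemma PiE_supp_subset:
  assumes "d \<subseteq> Q" "\<And>q. q \<in> Q \<Longrightarrow> prime q"
  shows "{J \<in> chars Q. supp Q J \<subseteq> d} = PiE Q (\<lambda>q. if q \<in> d then {..<q - 1} else {0})"
proof -
  have pos: "q \<in> Q \<Longrightarrow> 0 < q - 1" for q using prime_gt_1_nat[OF assms(2)] by simp
  show ?thesis
  proof (rule equalityI; rule subsetI)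
    fix J assume "J \<in> {J \<in> chars Q. supp Q J \<subseteq> d}"
    hence "J \<in> extensional Q" "\<forall>q\<in>Q. J q < q - 1" "\<forall>q\<in>Q. q \<notin> d \<longrightarrow> J q = 0"
      by (auto simp: supp_def PiE_iff)
    thus "J \<in> PiE Q (\<lambda>q. if q \<in> d then {..<q - 1} else {0})"
      unfolding PiE_iff by simp
  next
    fix J assume J: "J \<in> PiE Q (\<lambda>q. if q \<in> d then {..<q - 1} else {0})"
    have "J q \<in> {..<q - 1} \<and> (J q \<noteq> 0 \<longrightarrow> q \<in> d)" if "q \<in> Q" for q
      using PiE_mem[OF J that] pos[OF that] by (cases "q \<in> d") auto
    moreover have "J \<in> extensional Q" using J by (simp add: PiE_iff)
    ultimately show "J \<in> {J \<in> chars Q. supp Q J \<subseteq> d}" by (simp add: supp_def PiE_iff) blast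
  qed
qed

text \<open>On \<open>n\<close> prime to \<open>Q\<close> the value \<open>1\<close> given by
  \<open>dchar1\<close> at index \<open>0\<close> coincides with the principal character. The
  \<open>J\<close> supported in \<open>d\<close> therefore run through all characters modulo
  \<open>\<Prod>d\<close>, and orthogonality holds prime by prime.\<close>

lemma sum_chi_supp_subset:
  assumes Q: "finite Q" "\<And>q. q \<in> Q \<Longrightarrow> prime q" and d: "d \<subseteq> Q" and n: "\<And>q. q \<in> Q \<Longrightarrow> \<not> q dvd n"
  shows "(\<Sum>J | J \<in> chars Q \<and> supp Q J \<subseteq> d. chi Q J n) = of_nat (\<Prod>q\<in>d. q - 1) * of_bool ([n = 1] (mod \<Prod>d))"
proof -
  have find: "finite d" using d Q finite_subset by blast
  have "(\<Sum>J | J \<in> chars Q \<and> supp Q J \<subseteq> d. chi Q J n) = (\<Sum>J\<in>PiE Q (\<lambda>q. if q \<in> d then {..<q - 1} else {0}). \<Prod>q\<in>Q. dchar1 q (J q) n)"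
    using PiE_supp_subset[OF d Q(2)] by (simp add: chi_def)
  also have "\<dots> = (\<Prod>q\<in>Q. \<Sum>j\<in>(if q \<in> d then {..<q - 1} else {0}). dchar1 q j n)"
    using Q(1) by (intro prod_sum_PiE[symmetric]) auto
  also have "\<dots> = (\<Prod>q\<in>d. \<Sum>j\<in>{..<q - 1}. dchar1 q j n)"
    using Q(1) d by (intro prod.mono_neutral_cong_right) (auto simp: dchar1_def)
  also have "\<dots> = (\<Prod>q\<in>d. of_nat (q - 1) * of_bool ([n = 1] (mod q)))"
  proof (rule prod.cong[OF refl])
    fix q assume "q \<in> d"
    hence q: "prime q" "\<not> q dvd n" using d Q n by auto
    have "(\<Sum>j\<in>{..<q - 1}. dchar1 q j n) = (\<Sum>j<q-1. dchar q j n)"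
      by (intro sum.cong refl) (auto simp: dchar1_def dchar_0 q)
    thus "(\<Sum>j\<in>{..<q - 1}. dchar1 q j n) = of_nat (q - 1) * of_bool ([n = 1] (mod q))"
      by (simp only: dchar_sum_chars[OF q])
  qed
  also have "\<dots> = of_nat (\<Prod>q\<in>d. q - 1) * (\<Prod>q\<in>d. of_bool ([n = 1] (mod q)))" by (simp add: prod.distrib)
  also have "(\<Prod>q\<in>d. of_bool ([n = 1] (mod q))) = (of_bool ([n = 1] (mod \<Prod>d)) :: complex)"
  proof (cases "\<forall>q\<in>d. [n = 1] (mod q)")
    case True
    hence "[n = 1] (mod \<Prod>d)"
    proof (intro coprime_cong_prod_nat)
      fix i j assume ij: "i \<in> d" "j \<in> d" "i \<noteq> j"
      show "coprime i j" by (rule primes_coprime) (use ij d Q(2) in auto)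
    qed auto
    thus ?thesis using True by simp
  next
    case False
    then obtain q where q: "q \<in> d" "\<not> [n = 1] (mod q)" by auto
    hence "\<not> [n = 1] (mod \<Prod>d)" using find by (meson cong_dvd_modulus_nat dvd_prodI)
    moreover have "(\<Prod>q\<in>d. of_bool ([n = 1] (mod q))) = (0 :: complex)"
      using q find by (intro prod_zero) (auto intro!: bexI[of _ q])
    ultimately show ?thesis by simp
  qed
  finally show ?thesis .
qed

lemma card_chars_supp_subset:
  assumes Q: "finite Q" "\<And>q. q \<in> Q \<Longrightarrow> prime q" and d: "d \<subseteq> Q"
  shows "card {J. J \<in> chars Q \<and> supp Q J \<subseteq> d} = (\<Prod>q\<in>d. q - 1)"
proof -
  have "card {J. J \<in> chars Q \<and> supp Q J \<subseteq> d} = (\<Prod>q\<in>Q. card (if q \<in> d then {..<q - 1} else {0}))"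
    using card_PiE[OF Q(1), of "\<lambda>q. if q \<in> d then {..<q - 1} else {0}"] PiE_supp_subset[OF d Q(2)] by simp
  also have "\<dots> = (\<Prod>q\<in>d. q - 1)"
    using Q(1) d by (intro prod.mono_neutral_cong_right) auto
  finally show ?thesis .
qed

section \<open>Chebyshev bounds\<close>

definition psi :: "nat \<Rightarrow> real" where "psi N = (\<Sum>n\<in>{1..N}. mangoldt n)"

text \<open>\<open>ln\<close> is the divisor sum of \<open>mangoldt\<close>, and \<open>d\<close>
  has \<open>n div d\<close> multiples up to \<open>n\<close>. The free upper end \<open>X\<close>
  lets \<open>fact n\<close> and \<open>fact (2 * n)\<close> be compared term by term over one
  range.\<close>

lemma ln_fact_mangoldt:
  assumes "n \<le> X"
  shows "ln (fact n :: real) = (\<Sum>d\<in>{1..X}. mangoldt d * real (n div d))"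
proof -
  have "ln (fact n :: real) = (\<Sum>m\<in>{1..n}. ln (real m))"
    unfolding fact_prod of_nat_prod by (subst ln_prod) auto
  also have "\<dots> = (\<Sum>m\<in>{1..n}. \<Sum>d\<in>{1..X}. of_bool (d dvd m) * mangoldt d)"
  proof (rule sum.cong[OF refl])
    fix m assume m: "m \<in> {1..n}"
    have "{d\<in>{1..X}. d dvd m} = {d. d dvd m}" using m assms
      by (auto simp: Suc_le_eq intro!: Nat.gr0I dest: dvd_imp_le)
    moreover have "ln (real m) = (\<Sum>d | d dvd m. mangoldt d)" using m by (subst mangoldt_sum) auto
    ultimately show "ln (real m) = (\<Sum>d\<in>{1..X}. of_bool (d dvd m) * mangoldt d)"
      by (simp add: of_bool_def if_distrib if_distribR sum.inter_filter[symmetric] cong: if_cong)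
  qed
  also have "\<dots> = (\<Sum>d\<in>{1..X}. \<Sum>m\<in>{1..n}. of_bool (d dvd m) * mangoldt d)" by (rule sum.swap)
  also have "\<dots> = (\<Sum>d\<in>{1..X}. mangoldt d * real (n div d))"
  proof (rule sum.cong[OF refl])
    fix d assume d: "d \<in> {1..X}"
    have "{m\<in>{1..n}. d dvd m} = (\<lambda>k. d * k) ` {1..n div d}"
      using d by (auto simp: image_iff less_eq_div_iff_mult_less_eq mult.commute elim!: dvdE)
    hence "card {m\<in>{1..n}. d dvd m} = n div d"
      using d by (simp add: card_image inj_on_def)
    moreover have "(\<Sum>m\<in>{1..n}. of_bool (d dvd m) * mangoldt d) = (\<Sum>m\<in>{m\<in>{1..n}. d dvd m}. mangoldt d :: real)"
      by (simp add: of_bool_def if_distrib if_distribR sum.inter_filter[symmetric] cong: if_cong)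
    ultimately show "(\<Sum>m\<in>{1..n}. of_bool (d dvd m) * mangoldt d) = mangoldt d * real (n div d)" by simp
  qed
  finally show ?thesis .
qed

lemma ln_central_binomial:
  "ln (real ((2 * n) choose n)) = (\<Sum>d\<in>{1..2*n}. mangoldt d * (real ((2 * n) div d) - 2 * real (n div d)))"
proof -
  have "real ((2 * n) choose n) = fact (2 * n) / (fact n * fact n)"
    using binomial_fact[of n "2 * n", where ?'a = real] by simp
  hence "ln (real ((2 * n) choose n)) = ln (fact (2 * n)) - (ln (fact n) + ln (fact n))"
    by (simp add: ln_div ln_mult)
  also have "\<dots> = (\<Sum>d\<in>{1..2*n}. mangoldt d * real ((2 * n) div d)) - 2 * (\<Sum>d\<in>{1..2*n}. mangoldt d * real (n div d))"
    by (subst (1 2 3) ln_fact_mangoldt[of _ "2 * n"]) auto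
  also have "\<dots> = (\<Sum>d\<in>{1..2*n}. mangoldt d * (real ((2 * n) div d) - 2 * real (n div d)))"
    unfolding sum_distrib_left sum_subtractf[symmetric] by (intro sum.cong refl) (simp add: algebra_simps)
  finally show ?thesis .
qed

lemma double_div_bounds:
  fixes n d :: nat assumes "d > 0"
  shows "real ((2 * n) div d) - 2 * real (n div d) \<ge> 0" "real ((2 * n) div d) - 2 * real (n div d) \<le> 1"
proof -
  have "2 * (n div d) \<le> (2 * n) div d" "(2 * n) div d \<le> 2 * (n div d) + 1"
  proof -
    have e: "2 * n = 2 * (n mod d) + 2 * (n div d) * d" by (metis div_mult_mod_eq add.commute distrib_left mult.assoc)
    have "(2 * n) div d = 2 * (n mod d) div d + 2 * (n div d)" using assms by (subst e) simp
    moreover have "2 * (n mod d) div d \<le> 1"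
    proof -
      have "2 * (n mod d) < 2 * d" using assms by simp
      hence "2 * (n mod d) div d < 2" using assms by (simp add: div_less_iff_less_mult)
      thus ?thesis by simp
    qed
    ultimately show "2 * (n div d) \<le> (2 * n) div d" "(2 * n) div d \<le> 2 * (n div d) + 1" by auto
  qed
  thus "real ((2 * n) div d) - 2 * real (n div d) \<ge> 0" "real ((2 * n) div d) - 2 * real (n div d) \<le> 1" by linarith+
qed

text \<open>Each \<open>mangoldt d\<close> occurs in the logarithm of the central binomial
  coefficient with a factor \<open>0\<close> or \<open>1\<close>. The upper bound for this factor is
  used here; in the companion estimate the factor is at least \<open>1\<close> for
  \<open>n < d \<le> 2 * n\<close>.\<close>

lemma psi_ge_central: "ln (real ((2 * n) choose n)) \<le> psi (2 * n)"
  unfolding ln_central_binomial psi_def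
proof (rule sum_mono)
  fix d assume "d \<in> {1..2 * n}"
  hence "real ((2 * n) div d) - 2 * real (n div d) \<le> 1" by (intro double_div_bounds) auto
  thus "mangoldt d * (real ((2 * n) div d) - 2 * real (n div d)) \<le> mangoldt d"
    using mangoldt_nonneg[of d] by (metis mult_left_mono mult_1_right)
qed

lemma psi_diff_le: "psi (2 * n) - psi n \<le> real n * ln 4"
proof -
  have "psi (2 * n) - psi n = (\<Sum>d\<in>{n<..2*n}. mangoldt d)"
  proof -
    have "{1..2*n} = {1..n} \<union> {n<..2*n}" by auto
    hence "psi (2 * n) = psi n + (\<Sum>d\<in>{n<..2*n}. mangoldt d)"
      unfolding psi_def by (simp only:) (rule sum.union_disjoint, auto)
    thus ?thesis by simp
  qed
  also have "\<dots> \<le> (\<Sum>d\<in>{n<..2*n}. mangoldt d * (real ((2 * n) div d) - 2 * real (n div d)))"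
  proof (rule sum_mono)
    fix d assume d: "d \<in> {n<..2*n}"
    hence "(2 * n) div d \<ge> 1" "n div d = 0" by (auto simp: div_greater_zero_iff Suc_le_eq)
    hence "mangoldt d * 1 \<le> mangoldt d * (real ((2 * n) div d) - 2 * real (n div d))"
      by (intro mult_left_mono mangoldt_nonneg) auto
    thus "mangoldt d \<le> mangoldt d * (real ((2 * n) div d) - 2 * real (n div d))" by simp
  qed
  also have "\<dots> \<le> (\<Sum>d\<in>{1..2*n}. mangoldt d * (real ((2 * n) div d) - 2 * real (n div d)))"
    by (rule sum_mono2) (auto intro!: mult_nonneg_nonneg mangoldt_nonneg double_div_bounds)
  also have "\<dots> = ln (real ((2 * n) choose n))" by (rule ln_central_binomial[symmetric])
  also have "\<dots> \<le> ln (4 ^ n)"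
  proof -
    have "(2 * n) choose n \<le> 2 ^ (2 * n)" by (rule binomial_le_pow2)
    hence "real ((2 * n) choose n) \<le> 4 ^ n" by (simp add: power_mult)
    thus ?thesis by (subst ln_le_cancel_iff) auto
  qed
  also have "\<dots> = real n * ln 4" by (simp add: ln_realpow)
  finally show ?thesis .
qed

lemma psi_mono: "M \<le> N \<Longrightarrow> psi M \<le> psi N"
  unfolding psi_def by (rule sum_mono2) (auto simp: mangoldt_nonneg)

lemma psi_le: "psi N \<le> 2 * ln 4 * real N"
proof (induction N rule: less_induct)
  case (less N)
  show ?case
  proof (cases "N < 3")
    case True
    hence "N = 0 \<or> N = 1 \<or> N = 2" by auto
    moreover have "psi 2 \<le> 2 * ln 4 * 2"
    proof -
      have "psi 2 = ln 2" by (simp add: psi_def numeral_2_eq_2 mangoldt_def) (simp add: aprimedivisor_of_prime numeral_2_eq_2[symmetric] two_is_prime_nat)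
      moreover have "ln (2::real) \<le> ln 4" "ln (4::real) \<ge> 0" by auto
      ultimately show ?thesis by linarith
    qed
    ultimately show ?thesis by (auto simp: psi_def)
  next
    case False
    \<comment> \<open>Halving with upward rounding. The recursion closes because
      \<open>2 * n \<le> N + 1\<close> and \<open>N \<ge> 3\<close> give
      \<open>3 * n \<le> 2 * N\<close>.\<close>
    define n where "n = (N + 1) div 2"
    have n: "n < N" "N \<le> 2 * n" "2 * n \<le> N + 1" using False by (auto simp: n_def)
    have "psi N \<le> psi (2 * n)" using n by (intro psi_mono)
    also have "\<dots> \<le> psi n + real n * ln 4" using psi_diff_le[of n] by simp
    also have "psi n \<le> 2 * ln 4 * real n" by (rule less.IH[OF n(1)])
    also have "2 * ln 4 * real n + real n * ln 4 = ln 4 * (3 * real n)" by (simp add: algebra_simps)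
    also have "\<dots> \<le> ln 4 * (2 * real N)" using n False by (intro mult_left_mono) auto
    finally show ?thesis by simp
  qed
qed

lemma psi_ge:
  assumes "N \<ge> 2" shows "psi N \<ge> (real N - 1) * ln 2 - ln (real N)"
proof -
  define n where "n = N div 2"
  have n: "n > 0" "2 * n \<le> N" "N \<le> 2 * n + 1" using assms by (auto simp: n_def)
  have "4 ^ n / (2 * real n) \<le> real ((2 * n) choose n)"
    using central_binomial_lower_bound[OF n(1)] by simp
  hence "ln (4 ^ n / (2 * real n)) \<le> ln (real ((2 * n) choose n))"
    using n by (subst ln_le_cancel_iff) auto
  also have "\<dots> \<le> psi (2 * n)" by (rule psi_ge_central)
  also have "\<dots> \<le> psi N" using n by (intro psi_mono)
  finally have "psi N \<ge> ln (4 ^ n / (2 * real n))" .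
  moreover have "ln (4 ^ n / (2 * real n)) = real n * ln 4 - ln (2 * real n)"
    using n by (simp add: ln_div ln_realpow)
  moreover have "ln (2 * real n) \<le> ln (real N)" using n by (subst ln_le_cancel_iff) auto
  moreover have "real n * ln 4 = (2 * real n) * ln 2" using ln_realpow[of 2 2] by simp
  moreover have "(real N - 1) * ln 2 \<le> (2 * real n) * ln 2" using n by (intro mult_right_mono) auto
  ultimately show ?thesis by linarith
qed

text \<open>The ratio \<open>16\<close> makes the crude upper bound harmless: \<open>psi x\<close>
  is at least about \<open>ln 2 * x\<close>, while
  \<open>psi (x div 16) \<le> 2 * ln 4 * x / 16 = ln 2 * x / 4\<close>. The remaining
  \<open>3/4 * ln 2\<close> exceeds \<open>1/4\<close> with room to spare.\<close>

lemma chebyshev_interval: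
  "\<exists>x0. \<forall>x\<ge>x0. (\<Sum>n\<in>{x div 16<..x}. mangoldt n) \<ge> real x / 4"
proof -
  have "eventually (\<lambda>x::nat. (real x - 1) * ln 2 - ln (real x) - ln 2 * real x / 4 \<ge> real x / 4) at_top"
  proof -
    have l: "ln (2::real) \<ge> 2/3" using ln2_ge_two_thirds by simp
    have "eventually (\<lambda>x::nat. real x / 4 \<ge> 0 \<and> (real x - 1) * (2/3) - ln (real x) - (2/3) * real x / 4 \<ge> real x / 4) at_top"
      by (intro eventually_conj; real_asymp)
    thus ?thesis
      using eventually_ge_at_top[of 2]
    proof eventually_elim
      case (elim x)
      have "(2/3) * (3/4 * real x - 1) \<le> ln 2 * (3/4 * real x - 1)" using l elim by (intro mult_right_mono) auto
      thus ?case using elim by (simp add: algebra_simps)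
    qed
  qed
  then obtain x0 where x0: "\<And>x. x \<ge> x0 \<Longrightarrow> (real x - 1) * ln 2 - ln (real x) - ln 2 * real x / 4 \<ge> real x / 4"
    unfolding eventually_at_top_linorder by blast
  have "(\<Sum>n\<in>{x div 16<..x}. mangoldt n) \<ge> real x / 4" if x: "x \<ge> max x0 2" for x
  proof -
    have "{1..x} = {1..x div 16} \<union> {x div 16<..x}" by auto
    hence "psi x = psi (x div 16) + (\<Sum>n\<in>{x div 16<..x}. mangoldt n)"
      unfolding psi_def by (simp only:) (rule sum.union_disjoint, auto)
    moreover have "psi (x div 16) \<le> 2 * ln 4 * real (x div 16)" by (rule psi_le)
    moreover have "2 * ln 4 * real (x div 16) \<le> 2 * ln 4 * (real x / 16)"
      using of_nat_div_le_of_nat[of x 16, where ?'a = real] by (intro mult_left_mono) auto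
    moreover have "2 * ln (4::real) * (real x / 16) = ln 2 * real x / 4" using ln_realpow[of 2 2] by simp
    moreover have "psi x \<ge> (real x - 1) * ln 2 - ln (real x)" using x by (intro psi_ge) auto
    moreover have "(real x - 1) * ln 2 - ln (real x) - ln 2 * real x / 4 \<ge> real x / 4" using x0[of x] x by simp
    ultimately show ?thesis by linarith
  qed
  thus ?thesis by blast
qed

text \<open>Only prime powers \<open>p ^ i\<close> with \<open>i \<ge> 2\<close> matter. They have
  \<open>p \<le> sqrt x\<close> and \<open>i \<le> log 2 x\<close>, which bounds their number, and
  each weight is at most \<open>ln x\<close>.\<close>

lemma sum_mangoldt_nonprime:
  assumes "x \<ge> 1"
  shows "(\<Sum>n | n \<in> {1..x} \<and> \<not> prime n. mangoldt n) \<le> sqrt (real x) * (2 * ln (real x)) * ln (real x)"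
proof -
  define S where "S = {n\<in>{1..x}. primepow n \<and> \<not> prime n}"
  define r where "r = nat \<lfloor>sqrt (real x)\<rfloor>"
  define k where "k = nat \<lfloor>log 2 (real x)\<rfloor>"
  have lx: "ln (real x) \<ge> 0" using assms by simp
  have "S \<subseteq> (\<lambda>(p, i). p ^ i) ` ({1..r} \<times> {1..k})"
  proof
    fix n assume n: "n \<in> S"
    hence "primepow n" "n \<le> x" by (auto simp: S_def)
    then obtain p i where pi: "prime p" "i > 0" "n = p ^ i" by (auto simp: primepow_def)
    have "i \<noteq> 1" using n pi by (auto simp: S_def)
    hence i2: "i \<ge> 2" using pi by simp
    have p2: "p \<ge> 2" using pi prime_ge_2_nat by auto
    have "p ^ 2 \<le> p ^ i" using i2 p2 by (intro power_increasing) auto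
    hence "p ^ 2 \<le> x" using \<open>n \<le> x\<close> pi by simp
    hence "(real p)\<^sup>2 \<le> real x" by (metis of_nat_le_iff of_nat_power)
    hence "real p \<le> sqrt (real x)" by (rule real_le_rsqrt)
    hence pr: "p \<le> r" by (simp add: r_def le_nat_floor)
    have "2 ^ i \<le> p ^ i" using p2 by (intro power_mono) auto
    hence "2 ^ i \<le> x" using \<open>n \<le> x\<close> pi(3) by linarith
    hence "2 ^ i \<le> real x" by (metis of_nat_le_iff of_nat_power of_nat_numeral)
    hence "real i \<le> log 2 (real x)" using assms by (intro le_log_of_power) auto
    hence "i \<le> k" by (simp add: k_def le_nat_floor)
    thus "n \<in> (\<lambda>(p, i). p ^ i) ` ({1..r} \<times> {1..k})" using pi pr p2 i2 by (intro image_eqI[of _ _ "(p, i)"]) auto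
  qed
  hence "card S \<le> card ((\<lambda>(p, i). p ^ i) ` ({1..r} \<times> {1..k}))" by (intro card_mono) auto
  also have "\<dots> \<le> card ({1..r} \<times> {1..k})" by (rule card_image_le) auto
  also have "\<dots> = r * k" by simp
  finally have "real (card S) \<le> real r * real k" by (metis of_nat_le_iff of_nat_mult)
  also have "\<dots> \<le> sqrt (real x) * (2 * ln (real x))"
  proof (rule mult_mono)
    show "real r \<le> sqrt (real x)" by (simp add: r_def)
    have "log 2 (real x) \<le> 2 * ln (real x)"
    proof -
      have "log 2 (real x) = ln (real x) * (1 / ln 2)" by (simp add: log_def)
      also have "\<dots> \<le> ln (real x) * 2" using ln2_ge_two_thirds lx by (intro mult_left_mono) (auto simp: field_simps)
      finally show ?thesis by simp
    qed
    moreover have "log 2 (real x) \<ge> 0" using assms by simp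
    ultimately show "real k \<le> 2 * ln (real x)" unfolding k_def by linarith
  qed auto
  finally have cS: "real (card S) \<le> sqrt (real x) * (2 * ln (real x))" .
  have "(\<Sum>n | n \<in> {1..x} \<and> \<not> prime n. mangoldt n) = (\<Sum>n\<in>S. mangoldt n :: real)"
    unfolding S_def by (intro sum.mono_neutral_right) (auto simp: mangoldt_def)
  also have "\<dots> \<le> (\<Sum>n\<in>S. ln (real x))"
  proof (rule sum_mono)
    fix n assume "n \<in> S"
    hence n: "n > 0" "n \<le> x" by (auto simp: S_def)
    have "mangoldt n \<le> ln (real n)" by (rule mangoldt_le[OF n(1)])
    also have "\<dots> \<le> ln (real x)" using n by simp
    finally show "mangoldt n \<le> ln (real x)" .
  qed
  also have "\<dots> = real (card S) * ln (real x)" by simp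
  also have "\<dots> \<le> sqrt (real x) * (2 * ln (real x)) * ln (real x)" by (intro mult_right_mono cS lx)
  finally show ?thesis .
qed

section \<open>The van der Corput method\<close>

definition e2 :: "real \<Rightarrow> complex" where "e2 t = cis (2 * pi * t)"

lemma norm_e2 [simp]: "norm (e2 t) = 1" by (simp add: e2_def)
lemma e2_add: "e2 (s + t) = e2 s * e2 t" by (simp add: e2_def cis_mult algebra_simps)
lemma e2_int: "e2 (of_int k) = 1"
  using cis_multiple_2pi[of "of_int k"] by (simp add: e2_def)
lemma e2_minus: "e2 (- t) = cnj (e2 t)" by (simp add: e2_def cis_cnj)

lemma sin_pi_ge:
  assumes "0 \<le> d" "d \<le> 1/4" shows "sin (pi * d) \<ge> 2 * d"
proof -
  have "convex_on {0..pi} (\<lambda>x. - sin x)"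
    by (rule f''_ge0_imp_convex[where f' = "\<lambda>x. - cos x" and f'' = sin])
       (auto intro!: derivative_eq_intros sin_ge_zero)
  from convex_onD[OF this, of "2*d" 0 "pi/2"] assms show ?thesis by (simp add: algebra_simps)
qed

lemma cot_diff:
  assumes "sin a \<noteq> 0" "sin b \<noteq> (0::real)" shows "cot a - cot b = sin (b - a) / (sin a * sin b)"
  using assms by (simp add: cot_def sin_diff field_simps)

text \<open>Each term is written as \<open>w n\<close> times the difference of consecutive
  exponentials and the sum is summed by parts. The real part of \<open>w\<close> is constant and its
  imaginary part is half a cotangent of a monotone argument, so the total variation telescopes and
  is controlled by the cotangent at \<open>pi * d\<close>.\<close>

lemma kusmin_landau_0:
  fixes f :: "nat \<Rightarrow> real"
  defines "g \<equiv> \<lambda>n. f (Suc n) - f n"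
  assumes d: "0 < d" "d \<le> 1/4"
    and rng: "\<And>n. a \<le> n \<Longrightarrow> n < b \<Longrightarrow> d \<le> g n \<and> g n \<le> 1 - d"
    and mono: "\<And>n. a \<le> n \<Longrightarrow> Suc n < b \<Longrightarrow> g n \<le> g (Suc n)"
  shows "norm (\<Sum>n\<in>{a..<b}. e2 (f n)) \<le> 2 / d"
proof (cases "a < b")
  case False thus ?thesis using d by simp
next
  case True
  define C where "C = 1 / (2 * d)"
  define th where "th = (\<lambda>n. pi * g n)"
  \<comment> \<open>These are the real and imaginary parts of
    \<open>1 / (e2 (g n) - 1)\<close>.\<close>
  define w where "w = (\<lambda>n. Complex (-1/2) (- cot (th n) / 2))"
  define z where "z = (\<lambda>n. e2 (f n))"
  have th: "0 < th n" "th n < pi" if "a \<le> n" "n < b" for n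
    using rng[OF that] d unfolding th_def by (auto intro!: mult_pos_pos)
  have sth: "sin (th n) > 0" if "a \<le> n" "n < b" for n using th[OF that] by (rule sin_gt_zero)
  have sd: "sin (pi * d) \<ge> 2 * d" using d by (intro sin_pi_ge) auto
  have sdpos: "sin (pi * d) > 0" using sd d by linarith
  have cotd: "cot (pi * d) \<le> C"
  proof -
    have "cot (pi * d) \<le> 1 / sin (pi * d)" unfolding cot_def using sdpos by (intro divide_right_mono) auto
    also have "\<dots> \<le> C" unfolding C_def using sd d by (intro divide_left_mono) (auto intro!: mult_pos_pos sdpos)
    finally show ?thesis .
  qed
  have cot_anti: "cot y \<le> cot x" if "0 < x" "x \<le> y" "y < pi" for x y :: real
  proof -
    have "sin x > 0" "sin y > 0" "sin (y - x) \<ge> 0" using that by (auto intro!: sin_gt_zero sin_ge_zero)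
    hence "0 \<le> sin (y - x) / (sin x * sin y)" by (intro divide_nonneg_pos mult_pos_pos)
    thus ?thesis using cot_diff[of x y] \<open>sin x > 0\<close> \<open>sin y > 0\<close> by simp
  qed
  have cotb: "\<bar>cot (th n)\<bar> \<le> C" if "a \<le> n" "n < b" for n
  proof -
    have "cot (th n) \<le> cot (pi * d)"
      using rng[OF that] d th[OF that] by (intro cot_anti) (auto simp: th_def)
    moreover have "cot (pi - pi * d) \<le> cot (th n)"
    proof (rule cot_anti)
      have "pi * (d + g n) \<le> pi * 1" using rng[OF that] by (intro mult_left_mono) auto
      thus "th n \<le> pi - pi * d" by (simp add: th_def algebra_simps)
    qed (use d th[OF that] in auto)
    moreover have "cot (pi - pi * d) = - cot (pi * d)" by (simp add: cot_def sin_diff cos_diff)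
    ultimately show ?thesis using cotd by linarith
  qed
  have wz: "z n = w n * (z (Suc n) - z n)" if "a \<le> n" "n < b" for n
  proof -
    have "z (Suc n) = z n * e2 (g n)" unfolding z_def g_def by (simp add: e2_add[symmetric])
    hence "w n * (z (Suc n) - z n) = z n * (w n * (e2 (g n) - 1))" by (simp add: algebra_simps)
    also have "w n * (e2 (g n) - 1) = 1"
    proof -
      have e: "e2 (g n) = cis (2 * th n)" by (simp add: e2_def th_def mult_ac)
      have s: "sin (th n) \<noteq> 0" using sth[OF that] by simp
      define S where "S = sin (th n)"
      define K where "K = cos (th n)"
      have s': "S \<noteq> 0" using s by (simp add: S_def)
      have c2: "cos (2 * th n) = 1 - 2 * S * S" by (simp add: cos_double_sin power2_eq_square S_def)
      have s2: "sin (2 * th n) = 2 * S * K" by (simp add: sin_double S_def K_def)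
      have sc: "K * K + S * S = 1" using sin_cos_squared_add2[of "th n"] by (simp add: power2_eq_square S_def K_def)
      have "e2 (g n) - 1 = Complex (- 2 * S * S) (2 * S * K)"
        unfolding e cis.ctr c2 s2 by (simp add: complex_eq_iff)
      moreover have "w n = Complex (-1/2) (- (K / S) / 2)" by (simp add: w_def cot_def S_def K_def)
      moreover have "K / S / 2 * (2 * S * K) = K * K" "K / S / 2 * (2 * S * S) = S * K" using s' by (simp_all add: field_simps)
      ultimately show ?thesis using sc by (auto simp: complex_eq_iff)
    qed
    finally show ?thesis by simp
  qed
  have abel: "(\<Sum>n\<in>{a..<a + Suc k}. w n * (z (Suc n) - z n)) =
     w (a + k) * z (a + Suc k) - w a * z a - (\<Sum>n\<in>{a..<a + k}. (w (Suc n) - w n) * z (Suc n))" for k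
  proof (induction k)
    case (Suc k)
    have "{a..<a + Suc (Suc k)} = insert (a + Suc k) {a..<a + Suc k}" by auto
    hence "(\<Sum>n\<in>{a..<a + Suc (Suc k)}. w n * (z (Suc n) - z n)) =
       w (a + Suc k) * (z (Suc (a + Suc k)) - z (a + Suc k)) + (\<Sum>n\<in>{a..<a + Suc k}. w n * (z (Suc n) - z n))" by simp
    moreover have "{a..<a + Suc k} = insert (a + k) {a..<a + k}" by auto
    ultimately show ?case unfolding Suc.IH by (simp add: algebra_simps)
  qed (simp add: algebra_simps)
  obtain k where k: "b = a + Suc k" using True less_iff_Suc_add by auto
  have tel: "(\<Sum>n\<in>{a..<a + k}. (cot (th n) - cot (th (Suc n))) / 2) = (cot (th a) - cot (th (a + k))) / 2"
    for k by (induction k) (auto simp: algebra_simps diff_divide_distrib add_divide_distrib)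
  have wn: "norm (w n) \<le> 1/2 + C/2" if "a \<le> n" "n < b" for n
    using cmod_le[of "w n"] cotb[OF that] by (simp add: w_def)
  have "(\<Sum>n\<in>{a..<b}. e2 (f n)) = (\<Sum>n\<in>{a..<b}. w n * (z (Suc n) - z n))"
    by (rule sum.cong[OF refl], subst wz[symmetric]) (auto simp: z_def)
  also have "\<dots> = w (a + k) * z (a + Suc k) - w a * z a - (\<Sum>n\<in>{a..<a + k}. (w (Suc n) - w n) * z (Suc n))"
    unfolding k by (rule abel)
  also have "norm \<dots> \<le> norm (w (a + k) * z (a + Suc k)) + norm (w a * z a) + norm (\<Sum>n\<in>{a..<a + k}. (w (Suc n) - w n) * z (Suc n))"
    by (rule order_trans[OF norm_triangle_ineq4 add_right_mono[OF norm_triangle_ineq4]])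
  also have "norm (w (a + k) * z (a + Suc k)) \<le> 1/2 + C/2" using wn[of "a + k"] k by (simp add: norm_mult z_def)
  also have "norm (w a * z a) \<le> 1/2 + C/2" using wn[of a] k by (simp add: norm_mult z_def)
  also have "norm (\<Sum>n\<in>{a..<a + k}. (w (Suc n) - w n) * z (Suc n)) \<le> (\<Sum>n\<in>{a..<a + k}. (cot (th n) - cot (th (Suc n))) / 2)"
  proof (rule order_trans[OF norm_sum], rule sum_mono)
    fix n assume n: "n \<in> {a..<a + k}"
    have "w (Suc n) - w n = Complex 0 ((cot (th n) - cot (th (Suc n))) / 2)" by (simp add: w_def complex_eq_iff algebra_simps diff_divide_distrib)
    hence "norm (w (Suc n) - w n) = \<bar>(cot (th n) - cot (th (Suc n))) / 2\<bar>" by (simp add: cmod_def)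
    moreover have "cot (th (Suc n)) \<le> cot (th n)"
      using n k th[of n] th[of "Suc n"] mono[of n] by (intro cot_anti) (auto simp: th_def)
    ultimately show "norm ((w (Suc n) - w n) * z (Suc n)) \<le> (cot (th n) - cot (th (Suc n))) / 2"
      by (simp add: norm_mult z_def)
  qed
  also have "\<dots> \<le> C"
    unfolding tel using cotb[of a] cotb[of "a + k"] k by (auto simp: abs_le_iff)
  finally have "norm (\<Sum>n\<in>{a..<b}. e2 (f n)) \<le> 1 + 2 * C" by simp
  also have "\<dots> \<le> 2 / d" using d by (simp add: C_def field_simps)
  finally show ?thesis .
qed

text \<open>Subtracting \<open>k * n\<close> from the phase shifts every slope by the integer
  \<open>k\<close> and leaves the exponentials unchanged.\<close>

lemma kusmin_landau:
  fixes f :: "nat \<Rightarrow> real" and k :: int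
  defines "g \<equiv> \<lambda>n. f (Suc n) - f n"
  assumes d: "0 < d" "d \<le> 1/4"
    and rng: "\<And>n. a \<le> n \<Longrightarrow> n < b \<Longrightarrow> of_int k + d \<le> g n \<and> g n \<le> of_int k + 1 - d"
    and mono: "\<And>n. a \<le> n \<Longrightarrow> Suc n < b \<Longrightarrow> g n \<le> g (Suc n)"
  shows "norm (\<Sum>n\<in>{a..<b}. e2 (f n)) \<le> 2 / d"
proof -
  define f' where "f' = (\<lambda>n. f n - of_int (k * int n))"
  have e: "e2 (f' n) = e2 (f n)" for n
  proof -
    have "e2 (f n) = e2 (f' n + of_int (k * int n))" by (simp add: f'_def)
    thus ?thesis by (simp only: e2_add e2_int mult_1_right)
  qed
  have "norm (\<Sum>n\<in>{a..<b}. e2 (f' n)) \<le> 2 / d"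
    using rng mono unfolding g_def
    by (intro kusmin_landau_0[OF d]) (auto simp: f'_def algebra_simps)
  thus ?thesis by (simp only: e)
qed

text \<open>The second derivative test. The range is cut where the integer part of the slope
  \<open>g\<close> changes, which gives at most \<open>C * l * (b - a) + 2\<close> blocks. Inside a
  block, slopes within \<open>d\<close> of an integer are counted trivially; the remaining indices
  form an interval to which Kusmin-Landau applies, so a block costs at most
  \<open>5 / d\<close>.\<close>

lemma van_der_corput:
  fixes f :: "nat \<Rightarrow> real"
  defines "g \<equiv> \<lambda>n. f (Suc n) - f n"
  assumes l: "l > 0" and C: "C \<ge> 1"
    and rng: "\<And>n. a \<le> n \<Longrightarrow> Suc n < b \<Longrightarrow> l \<le> g (Suc n) - g n \<and> g (Suc n) - g n \<le> C * l"
  shows "norm (\<Sum>n\<in>{a..<b}. e2 (f n)) \<le> 5 * C * sqrt l * real (b - a) + 10 / sqrt l"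
\<comment> \<open>For \<open>l > 1/16\<close> the trivial bound is already smaller than the first
  term; \<open>l \<le> 1/16\<close> ensures \<open>sqrt l \<le> 1/4\<close>, as Kusmin-Landau
  requires.\<close>
proof (cases "a < b \<and> l \<le> 1/16")
  case False
  have sl: "sqrt l \<ge> 1/4" if "l > 1/16"
  proof -
    have "sqrt (1/16) \<le> sqrt l" using that by (intro real_sqrt_le_mono) auto
    moreover have "sqrt (1/16) = 1/4" by (rule real_sqrt_unique) (auto simp: power2_eq_square)
    ultimately show ?thesis by simp
  qed
  have "norm (\<Sum>n\<in>{a..<b}. e2 (f n)) \<le> (\<Sum>n\<in>{a..<b}. 1)" by (rule sum_norm_le) simp
  also have "\<dots> = 1 * real (b - a)" by simp
  also have "\<dots> \<le> 5 * C * sqrt l * real (b - a)"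
  proof (cases "a < b")
    case True
    hence "sqrt l \<ge> 1/4" using False sl by auto
    hence "1 * (1/4) \<le> (5 * C) * sqrt l" using C by (intro mult_mono) auto
    moreover have "5 * (1 * (1/4)) \<le> 5 * (C * sqrt l)" using C \<open>sqrt l \<ge> 1/4\<close> by (intro mult_left_mono mult_mono) auto
    ultimately show ?thesis by (intro mult_right_mono) auto
  qed auto
  also have "\<dots> \<le> \<dots> + 10 / sqrt l" using l by simp
  finally show ?thesis .
next
  case True
  hence ab: "a < b" and l16: "l \<le> 1/16" by auto
  \<comment> \<open>The balancing choice: slopes grow by at least \<open>l\<close> per step, so a
    window of width \<open>d\<close> holds at most \<open>d / l + 1 = 1 / d + 1\<close> of them, of
    the same order as the Kusmin-Landau bound \<open>2 / d\<close>.\<close>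
  define d where "d = sqrt l"
  have d: "0 < d" "d \<le> 1/4" and dd: "d * d = l"
  proof -
    show "0 < d" "d * d = l" using l by (auto simp: d_def)
    have "sqrt l \<le> sqrt (1/16)" using l16 by (intro real_sqrt_le_mono) auto
    moreover have "sqrt (1/16) = 1/4" by (rule real_sqrt_unique) (auto simp: power2_eq_square)
    ultimately show "d \<le> 1/4" by (simp add: d_def)
  qed
  have grow: "real (m - n) * l \<le> g m - g n \<and> g m - g n \<le> real (m - n) * (C * l)" if "a \<le> n" "n \<le> m" "m < b" for n m
    using that(2,3)
  proof (induction m rule: dec_induct)
    case (step m)
    have "l \<le> g (Suc m) - g m \<and> g (Suc m) - g m \<le> C * l" using step that by (intro rng) auto
    thus ?case using step by (simp add: Suc_diff_le algebra_simps)
  qed auto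
  have mono: "g n \<le> g m" if "a \<le> n" "n \<le> m" "m < b" for n m
    using grow[OF that] l by (smt (verit) mult_nonneg_nonneg of_nat_0_le_iff)
  have cnt: "real (card {n\<in>{a..<b}. u \<le> g n \<and> g n \<le> u + d}) \<le> 1/d + 1" for u
  proof (cases "{n\<in>{a..<b}. u \<le> g n \<and> g n \<le> u + d} = {}")
    case True thus ?thesis using d by (simp only: True) simp
  next
    case False
    define S where "S = {n\<in>{a..<b}. u \<le> g n \<and> g n \<le> u + d}"
    have fin: "finite S" and ne: "S \<noteq> {}" using False by (auto simp: S_def)
    define p where "p = Min S" define q where "q = Max S"
    have pq: "p \<in> S" "q \<in> S" "p \<le> q" using fin ne by (auto simp: p_def q_def)
    have "card S \<le> card {p..q}" using fin by (intro card_mono) (auto simp: p_def q_def)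
    hence "real (card S) \<le> real (q - p) + 1" using pq by simp
    moreover have "real (q - p) * l \<le> d" using grow[of p q] pq by (auto simp: S_def)
    hence "real (q - p) * d * d \<le> 1 * d" using dd by (simp add: mult.assoc)
    hence "real (q - p) * d \<le> 1" using d by (simp only: mult_le_cancel_right)
    hence "real (q - p) \<le> 1/d" using d by (simp add: field_simps)
    ultimately show ?thesis by (simp add: S_def)
  qed
  define K where "K = {\<lfloor>g a\<rfloor>..\<lfloor>g (b - 1)\<rfloor>}"
  have block: "norm (\<Sum>n\<in>{n\<in>{a..<b}. \<lfloor>g n\<rfloor> = k}. e2 (f n)) \<le> 5 / d" for k
  proof -
    define M where "M = {n\<in>{a..<b}. of_int k + d \<le> g n \<and> g n \<le> of_int k + 1 - d}"
    define A1 where "A1 = {n\<in>{a..<b}. \<lfloor>g n\<rfloor> = k} - M"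
    have MB: "M \<subseteq> {n\<in>{a..<b}. \<lfloor>g n\<rfloor> = k}" using d by (auto simp: M_def floor_eq_iff)
    have finM: "finite M" by (simp add: M_def)
    have normM: "norm (\<Sum>n\<in>M. e2 (f n)) \<le> 2 / d"
    proof (cases "M = {}")
      case True thus ?thesis using d by simp
    next
      case False
      define p where "p = Min M" define q where "q = Max M"
      have pq: "p \<in> M" "q \<in> M" using finM False by (auto simp: p_def q_def)
      have "M = {p..<Suc q}"
      proof (rule equalityI; rule subsetI)
        fix n assume "n \<in> M" thus "n \<in> {p..<Suc q}" using finM by (auto simp: p_def q_def less_Suc_eq_le)
      next
        fix n assume n: "n \<in> {p..<Suc q}"
        have "g p \<le> g n" "g n \<le> g q" using n pq by (auto intro!: mono simp: M_def)
        thus "n \<in> M" using pq n by (auto simp: M_def)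
      qed
      moreover have "norm (\<Sum>n\<in>{p..<Suc q}. e2 (f n)) \<le> 2 / d"
      proof (rule kusmin_landau[OF d])
        fix n assume "p \<le> n" "n < Suc q"
        hence "n \<in> M" using calculation by auto
        thus "of_int k + d \<le> f (Suc n) - f n \<and> f (Suc n) - f n \<le> of_int k + 1 - d" by (simp add: M_def g_def)
      next
        fix n assume "p \<le> n" "Suc n < Suc q"
        thus "f (Suc n) - f n \<le> f (Suc (Suc n)) - f (Suc n)" using mono[of n "Suc n"] pq by (auto simp: M_def g_def)
      qed
      ultimately show ?thesis by simp
    qed
    define c1 where "c1 = card {n\<in>{a..<b}. of_int k \<le> g n \<and> g n \<le> of_int k + d}"
    define c2 where "c2 = card {n\<in>{a..<b}. of_int k + 1 - d \<le> g n \<and> g n \<le> (of_int k + 1 - d) + d}"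
    have "card A1 \<le> card ({n\<in>{a..<b}. of_int k \<le> g n \<and> g n \<le> of_int k + d} \<union> {n\<in>{a..<b}. of_int k + 1 - d \<le> g n \<and> g n \<le> (of_int k + 1 - d) + d})"
      by (intro card_mono) (auto simp: A1_def M_def floor_eq_iff)
    also have "\<dots> \<le> c1 + c2" unfolding c1_def c2_def by (rule card_Un_le)
    finally have "real (card A1) \<le> real c1 + real c2" by linarith
    also have "\<dots> \<le> (1/d + 1) + (1/d + 1)" unfolding c1_def c2_def by (intro add_mono cnt)
    finally have cA: "real (card A1) \<le> 2/d + 2" by simp
    have "(\<Sum>n\<in>{n\<in>{a..<b}. \<lfloor>g n\<rfloor> = k}. e2 (f n)) = (\<Sum>n\<in>A1. e2 (f n)) + (\<Sum>n\<in>M. e2 (f n))"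
      unfolding A1_def using MB by (intro sum.subset_diff) auto
    also have "norm \<dots> \<le> real (card A1) + 2/d"
    proof -
      have "norm (\<Sum>n\<in>A1. e2 (f n)) \<le> (\<Sum>n\<in>A1. 1)" by (rule sum_norm_le) simp
      thus ?thesis using normM norm_triangle_ineq[of "\<Sum>n\<in>A1. e2 (f n)" "\<Sum>n\<in>M. e2 (f n)"] by simp
    qed
    also have "\<dots> \<le> 5 / d"
    proof -
      have "2 \<le> 1 / d" using d by (simp add: field_simps)
      thus ?thesis using cA by (simp add: field_simps)
    qed
    finally show ?thesis .
  qed
  have "(\<Sum>n\<in>{a..<b}. e2 (f n)) = (\<Sum>k\<in>K. \<Sum>n\<in>{n\<in>{a..<b}. \<lfloor>g n\<rfloor> = k}. e2 (f n))"
    by (rule sum.group[symmetric]) (use ab in \<open>auto simp: K_def intro!: floor_mono mono\<close>)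
  also have "norm \<dots> \<le> (\<Sum>k\<in>K. 5 / d)" by (rule sum_norm_le) (rule block)
  also have "\<dots> = real (card K) * (5 / d)" by simp
  also have "real (card K) \<le> C * l * real (b - a) + 2"
  proof -
    have gg: "g a \<le> g (b - 1)" using ab by (intro mono) auto
    hence "real (card K) = of_int (\<lfloor>g (b - 1)\<rfloor> - \<lfloor>g a\<rfloor> + 1)" using floor_mono[OF gg] by (simp add: K_def)
    also have "\<dots> \<le> (g (b - 1) - g a) + 2" by linarith
    also have "g (b - 1) - g a \<le> real (b - 1 - a) * (C * l)" using grow[of a "b-1"] ab by auto
    also have "\<dots> \<le> real (b - a) * (C * l)" using C l by (intro mult_right_mono) auto
    finally show ?thesis by (simp add: mult_ac)
  qed
  also have "(C * l * real (b - a) + 2) * (5 / d) = 5 * C * d * real (b - a) + 10 / d"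
    unfolding dd[symmetric] using d by (simp add: field_simps)
  finally show ?thesis using d by (simp add: d_def divide_right_mono)
qed


section \<open>Power phases along arithmetic progressions\<close>

lemma second_difference_powr:
  fixes A g u d :: real
  assumes u: "u > 0" and d: "d > 0"
  shows "\<exists>x. u < x \<and> x < u + 2 * d \<and>
     A * (u + 2 * d) powr g - 2 * (A * (u + d) powr g) + A * u powr g = d\<^sup>2 * (A * g * (g - 1) * x powr (g - 2))"
proof -
  define F where "F = (\<lambda>t. A * t powr g)"
  define F1 where "F1 = (\<lambda>t. A * g * t powr (g - 1))"
  define F2 where "F2 = (\<lambda>t. A * g * (g - 1) * t powr (g - 2))"
  have D1: "(F has_real_derivative F1 t) (at t)" if "t > 0" for t
    unfolding F_def F1_def using that by (auto intro!: derivative_eq_intros simp: powr_diff)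
  have D2: "(F1 has_real_derivative F2 t) (at t)" if "t > 0" for t
    unfolding F1_def F2_def using DERIV_cmult[OF has_real_derivative_powr[OF that, of "g - 1"], of "A * g"] by (simp add: mult.assoc)
  have "\<exists>x>u. x < u + d \<and> (\<lambda>t. F (t + d) - F t) (u + d) - (\<lambda>t. F (t + d) - F t) u = (u + d - u) * (F1 (x + d) - F1 x)"
    using u d by (intro MVT2) (auto intro!: derivative_eq_intros D1 DERIV_shift[THEN iffD1] simp: DERIV_shift[symmetric])
  then obtain x where x: "u < x" "x < u + d" "F (u + d + d) - F (u + d) - (F (u + d) - F u) = d * (F1 (x + d) - F1 x)" by auto
  have "\<exists>y>x. y < x + d \<and> F1 (x + d) - F1 x = (x + d - x) * F2 y"
    using x u d by (intro MVT2 D2) auto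
  then obtain y where y: "x < y" "y < x + d" "F1 (x + d) - F1 x = d * F2 y" by auto
  have "F (u + 2 * d) - 2 * F (u + d) + F u = d\<^sup>2 * F2 y"
    using x(3) unfolding y(3) by (simp add: algebra_simps power2_eq_square)
  thus ?thesis unfolding F_def F2_def using x y by (intro exI[of _ y]) auto
qed

lemma cong_residue_Ioc:
  fixes d r lo hi :: nat assumes d: "d > 0"
  shows "\<exists>a b r0. bij_betw (\<lambda>t. r0 + d * t) {a..<b} {m\<in>{lo<..hi}. [m = r] (mod d)} \<and> real (b - a) \<le> real hi / real d + 1"
proof -
  define r0 where "r0 = r mod d"
  define T where "T = {t. r0 + d * t \<in> {lo<..hi}}"
  have Teq: "T = {t. lo < r0 + d * t} \<inter> {t. r0 + d * t \<le> hi}" by (auto simp: T_def)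
  have tle: "t \<le> r0 + d * t" for t using d by (simp add: trans_le_add2)
  have finT: "finite T" by (rule finite_subset[of _ "{..hi}"]) (use tle order_trans in \<open>auto simp: T_def\<close>)
  have img: "(\<lambda>t. r0 + d * t) ` T = {m\<in>{lo<..hi}. [m = r] (mod d)}"
  proof (rule equalityI; rule subsetI)
    fix m assume "m \<in> (\<lambda>t. r0 + d * t) ` T"
    thus "m \<in> {m\<in>{lo<..hi}. [m = r] (mod d)}"
      by (auto simp: T_def r0_def unique_euclidean_semiring_class.cong_def)
  next
    fix m assume m: "m \<in> {m\<in>{lo<..hi}. [m = r] (mod d)}"
    hence "m = r0 + d * (m div d)" by (simp add: r0_def unique_euclidean_semiring_class.cong_def) (metis mod_mult_div_eq)
    thus "m \<in> (\<lambda>t. r0 + d * t) ` T" using m by (intro image_eqI[of _ _ "m div d"]) (auto simp: T_def)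
  qed
  have inj: "inj_on (\<lambda>t. r0 + d * t) T" using d by (auto simp: inj_on_def)
  have "\<exists>a b. T = {a..<b} \<and> real (b - a) \<le> real hi / real d + 1"
  proof (cases "T = {}")
    case True thus ?thesis by (intro exI[of _ 0]) auto
  next
    case False
    define a where "a = Min T" define b where "b = Max T"
    have ab: "a \<in> T" "b \<in> T" "a \<le> b" using finT False by (auto simp: a_def b_def)
    have "T = {a..<Suc b}"
    proof (rule equalityI; rule subsetI)
      fix t assume "t \<in> T" thus "t \<in> {a..<Suc b}" using finT by (auto simp: a_def b_def less_Suc_eq_le)
    next
      fix t assume t: "t \<in> {a..<Suc b}"
      have 1: "r0 + d * a \<le> r0 + d * t" and 2: "r0 + d * t \<le> r0 + d * b" using t by auto
      have "lo < r0 + d * a" "r0 + d * b \<le> hi" using ab by (auto simp: T_def)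
      hence "lo < r0 + d * t" "r0 + d * t \<le> hi" using 1 2 by linarith+
      thus "t \<in> T" by (simp add: T_def)
    qed
    moreover have "real (Suc b - a) \<le> real hi / real d + 1"
    proof -
      have "d * b \<le> hi" using ab by (auto simp: T_def)
      hence "real d * real b \<le> real hi" by (metis of_nat_le_iff of_nat_mult)
      hence "real b \<le> real hi / real d" using d by (simp add: field_simps)
      thus ?thesis using ab by (simp add: of_nat_diff)
    qed
    ultimately show ?thesis by blast
  qed
  then obtain a b where "T = {a..<b}" "real (b - a) \<le> real hi / real d + 1" by blast
  hence "bij_betw (\<lambda>t. r0 + d * t) {a..<b} {m\<in>{lo<..hi}. [m = r] (mod d)} \<and> real (b - a) \<le> real hi / real d + 1"
    using inj img by (simp add: bij_betw_def)
  thus ?thesis by blast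
qed

text \<open>Along a progression of difference \<open>d\<close> the second difference of
  \<open>A * m powr g\<close> is about \<open>\<bar>A\<bar> * d\<^sup>2 * B powr (g - 2)\<close>. It
  is positive for \<open>A < 0\<close>, since \<open>g * (g - 1) < 0\<close>; positive
  \<open>A\<close> follows by conjugation. The intermediate point lies between \<open>B / 64\<close>
  and \<open>2 * B\<close>, so the second differences vary by a factor of at most
  \<open>128\<^sup>2 = 16384\<close>. The range down to \<open>B / 64\<close> leaves room for
  summation intervals obtained from \<open>(x div 16, x]\<close> by division.\<close>

theorem vdc_power_progression:
  fixes g :: real
  assumes g: "0 < g" "g < 1"
  shows "\<exists>C>0. \<forall>A B d r lo hi. A \<noteq> 0 \<longrightarrow> d \<ge> (1::nat) \<longrightarrow> real d \<le> B \<longrightarrow> B / 64 \<le> real lo \<longrightarrow> real hi \<le> B \<longrightarrow>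
     norm (\<Sum>m\<in>{m\<in>{lo<..hi}. [m = r] (mod d)}. e2 (A * real m powr g))
       \<le> C * ((B / real d + 1) * sqrt (\<bar>A\<bar> * real d ^ 2 * B powr (g - 2)) + 1 / sqrt (\<bar>A\<bar> * real d ^ 2 * B powr (g - 2)))"
proof -
  define c1 where "c1 = g * (1 - g) * 2 powr (g - 2)"
  define C where "C = 5 * 16384 + 10 / sqrt c1"
  have c1: "0 < c1" "c1 \<le> 1"
  proof -
    show "0 < c1" using g by (simp add: c1_def)
    have "2 powr (g - 2) \<le> 2 powr 0" using g by (intro powr_mono) auto
    hence "c1 \<le> 1 * 1 * 1" unfolding c1_def using g by (intro mult_mono) auto
    thus "c1 \<le> 1" by simp
  qed
  have C: "C > 0" using c1 by (simp add: C_def add_pos_pos)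
  have main: "norm (\<Sum>m\<in>{m\<in>{lo<..hi}. [m = r] (mod d)}. e2 (A * real m powr g))
       \<le> C * ((B / real d + 1) * sqrt (\<bar>A\<bar> * real d ^ 2 * B powr (g - 2)) + 1 / sqrt (\<bar>A\<bar> * real d ^ 2 * B powr (g - 2)))"
    if A: "A < 0" and d: "d \<ge> (1::nat)" and dB: "real d \<le> B" and lo: "B / 64 \<le> real lo" and hi: "real hi \<le> B" for A B d r lo hi
  proof -
    define \<mu> where "\<mu> = \<bar>A\<bar> * real d ^ 2 * B powr (g - 2)"
    have B0: "B > 0" using d dB by linarith
    have mu: "\<mu> > 0" unfolding \<mu>_def using A d B0 by (intro mult_pos_pos) auto
    define l where "l = c1 * \<mu>"
    have l0: "l > 0" using c1 mu by (simp add: l_def)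
    obtain a b r0 where ab: "bij_betw (\<lambda>t. r0 + d * t) {a..<b} {m\<in>{lo<..hi}. [m = r] (mod d)}" "real (b - a) \<le> real hi / real d + 1"
      using cong_residue_Ioc[of d lo hi r] d by auto
    define f where "f = (\<lambda>t. A * real (r0 + d * t) powr g)"
    have "(\<Sum>m\<in>{m\<in>{lo<..hi}. [m = r] (mod d)}. e2 (A * real m powr g)) = (\<Sum>t\<in>{a..<b}. e2 (f t))"
      unfolding f_def by (rule sum.reindex_bij_betw[OF ab(1), symmetric])
    also have "norm \<dots> \<le> 5 * 16384 * sqrt l * real (b - a) + 10 / sqrt l"
    proof (rule van_der_corput[OF l0])
      fix t assume t: "a \<le> t" "Suc t < b"
      define u where "u = real (r0 + d * t)"
      have "r0 + d * t \<in> {m\<in>{lo<..hi}. [m = r] (mod d)}" "r0 + d * Suc t \<in> {m\<in>{lo<..hi}. [m = r] (mod d)}"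
        using bij_betw_apply[OF ab(1), of t] bij_betw_apply[OF ab(1), of "Suc t"] t by (simp_all only: atLeastLessThan_iff) auto
      hence u: "real lo < u" "u + real d \<le> real hi" unfolding u_def by (auto simp: algebra_simps simp del: of_nat_add of_nat_mult)
      have u0: "u > 0" using u(1) by linarith
      obtain x where x: "u < x" "x < u + 2 * real d"
        "A * (u + 2 * real d) powr g - 2 * (A * (u + real d) powr g) + A * u powr g = (real d)\<^sup>2 * (A * g * (g - 1) * x powr (g - 2))"
        using second_difference_powr[OF u0, of "real d" A g] d by auto
      have eq: "f (Suc (Suc t)) - f (Suc t) - (f (Suc t) - f t) = \<bar>A\<bar> * real d ^ 2 * (g * (1 - g) * x powr (g - 2))"
      proof -
        have "f (Suc (Suc t)) - f (Suc t) - (f (Suc t) - f t) = A * (u + 2 * real d) powr g - 2 * (A * (u + real d) powr g) + A * u powr g"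
          unfolding f_def u_def by (simp add: algebra_simps)
        thus ?thesis unfolding x(3) using A by (simp add: algebra_simps)
      qed
      have xB: "B / 64 < x" "x \<le> 2 * B" using x u lo hi dB by linarith+
      have x1: "(2 * B) powr (g - 2) \<le> x powr (g - 2)" using xB B0 g by (intro powr_mono2') auto
      have x2: "x powr (g - 2) \<le> (B / 64) powr (g - 2)" using xB B0 g by (intro powr_mono2') auto
      have p: "0 \<le> \<bar>A\<bar> * real d ^ 2 * (g * (1 - g))" using g by simp
      have "l = (\<bar>A\<bar> * real d ^ 2 * (g * (1 - g))) * (2 * B) powr (g - 2)"
        unfolding l_def c1_def \<mu>_def using B0 by (simp add: powr_mult mult_ac)
      also have "\<dots> \<le> (\<bar>A\<bar> * real d ^ 2 * (g * (1 - g))) * x powr (g - 2)" by (rule mult_left_mono[OF x1 p])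
      finally have L1: "l \<le> f (Suc (Suc t)) - f (Suc t) - (f (Suc t) - f t)" unfolding eq by (simp add: mult_ac)
      have "(\<bar>A\<bar> * real d ^ 2 * (g * (1 - g))) * x powr (g - 2) \<le> (\<bar>A\<bar> * real d ^ 2 * (g * (1 - g))) * (B / 64) powr (g - 2)"
        by (rule mult_left_mono[OF x2 p])
      also have "(B / 64) powr (g - 2) = (2 * B * (1/128)) powr (g - 2)" by simp
      also have "\<dots> = (2 * B) powr (g - 2) * (1/128) powr (g - 2)" by (rule powr_mult)
      also have "(1/128) powr (g - 2) = 128 powr (2 - g)" by (simp add: powr_divide powr_diff field_simps)
      also have "(\<bar>A\<bar> * real d ^ 2 * (g * (1 - g))) * ((2 * B) powr (g - 2) * 128 powr (2 - g)) = l * 128 powr (2 - g)"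
        unfolding l_def c1_def \<mu>_def using B0 by (simp add: powr_mult mult_ac)
      also have "\<dots> \<le> l * 128 powr 2" using l0 g by (intro mult_left_mono powr_mono) auto
      also have "\<dots> = 16384 * l" by simp
      finally show "l \<le> f (Suc (Suc t)) - f (Suc t) - (f (Suc t) - f t) \<and> f (Suc (Suc t)) - f (Suc t) - (f (Suc t) - f t) \<le> 16384 * l"
        using L1 unfolding eq by (simp add: mult_ac)
    qed simp
    also have "\<dots> \<le> 5 * 16384 * ((B / real d + 1) * sqrt \<mu>) + 10 / sqrt c1 * (1 / sqrt \<mu>)"
    proof (rule add_mono)
      have "sqrt l \<le> sqrt \<mu>" using c1 mu by (simp add: l_def)
      moreover have "real (b - a) \<le> B / real d + 1" using ab(2) hi d by (smt (verit) divide_right_mono of_nat_0_le_iff)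
      ultimately have "sqrt l * real (b - a) \<le> sqrt \<mu> * (B / real d + 1)" using mu by (intro mult_mono) auto
      hence "5 * 16384 * (sqrt l * real (b - a)) \<le> 5 * 16384 * (sqrt \<mu> * (B / real d + 1))" by (intro mult_left_mono) auto
      thus "5 * 16384 * sqrt l * real (b - a) \<le> 5 * 16384 * ((B / real d + 1) * sqrt \<mu>)" by (simp only: mult_ac)
      show "10 / sqrt l \<le> 10 / sqrt c1 * (1 / sqrt \<mu>)" by (simp add: l_def real_sqrt_mult)
    qed
    also have "\<dots> \<le> C * ((B / real d + 1) * sqrt \<mu>) + C * (1 / sqrt \<mu>)"
      using B0 mu c1 unfolding C_def by (intro add_mono mult_right_mono) auto
    finally show ?thesis unfolding \<mu>_def by (simp add: distrib_left)
  qed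
  have "norm (\<Sum>m\<in>{m\<in>{lo<..hi}. [m = r] (mod d)}. e2 (A * real m powr g))
       \<le> C * ((B / real d + 1) * sqrt (\<bar>A\<bar> * real d ^ 2 * B powr (g - 2)) + 1 / sqrt (\<bar>A\<bar> * real d ^ 2 * B powr (g - 2)))"
    if A: "A \<noteq> 0" and rest: "d \<ge> (1::nat)" "real d \<le> B" "B / 64 \<le> real lo" "real hi \<le> B" for A B d r lo hi
  proof (cases "A < 0")
    case True thus ?thesis using main rest by blast
  next
    case False
    have "cnj (\<Sum>m\<in>{m\<in>{lo<..hi}. [m = r] (mod d)}. e2 (A * real m powr g)) = (\<Sum>m\<in>{m\<in>{lo<..hi}. [m = r] (mod d)}. e2 ((-A) * real m powr g))"
      unfolding cnj_sum by (intro sum.cong refl) (simp add: e2_minus)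
    hence "norm (\<Sum>m\<in>{m\<in>{lo<..hi}. [m = r] (mod d)}. e2 (A * real m powr g)) = norm (\<Sum>m\<in>{m\<in>{lo<..hi}. [m = r] (mod d)}. e2 ((-A) * real m powr g))"
      by (subst complex_mod_cnj[symmetric]) (simp only:)
    also have "\<dots> \<le> C * ((B / real d + 1) * sqrt (\<bar>-A\<bar> * real d ^ 2 * B powr (g - 2)) + 1 / sqrt (\<bar>-A\<bar> * real d ^ 2 * B powr (g - 2)))"
      using False A rest by (intro main) auto
    finally show ?thesis by simp
  qed
  thus ?thesis using C by blast
qed

section \<open>Minorants for short arcs\<close>

lemma sum_e2_roots:
  assumes "N \<ge> 2" shows "(\<Sum>j<N. e2 (real j / real N)) = 0"
proof -
  define z where "z = e2 (1 / real N)"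
  have zj: "e2 (real j / real N) = z ^ j" for j
    by (simp add: z_def e2_def Complex.DeMoivre mult_ac)
  have zN: "z ^ N = 1" using zj[of N] assms e2_int[of 1] by simp
  have "z \<noteq> 1"
  proof
    assume "z = 1"
    hence "cos (2 * pi / real N) = 1" by (simp add: z_def e2_def complex_eq_iff)
    moreover have "cos (2 * pi / real N) < cos 0"
      using assms by (intro cos_monotone_0_pi) (auto simp: field_simps)
    ultimately show False by simp
  qed
  thus ?thesis unfolding zj using zN by (simp add: geometric_sum)
qed

lemma sum_sin_square:
  assumes "N \<ge> 2" shows "(\<Sum>j<N. (sin (pi * real j / real N))\<^sup>2) = real N / 2"
proof -
  have "(\<Sum>j<N. cos (2 * pi * (real j / real N))) = Re (\<Sum>j<N. e2 (real j / real N))"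
    by (simp add: e2_def)
  hence 0: "(\<Sum>j<N. cos (2 * (pi * real j / real N))) = 0" using sum_e2_roots[OF assms] by (simp add: mult_ac)
  have "(sin x)\<^sup>2 = 1/2 - cos (2 * x) / 2" for x :: real using cos_double_sin[of x] by (simp add: field_simps)
  hence "(\<Sum>j<N. (sin (pi * real j / real N))\<^sup>2) = (\<Sum>j<N. 1/2) - (\<Sum>j<N. cos (2 * (pi * real j / real N))) / 2"
    by (simp only: sum_subtractf sum_divide_distrib)
  thus ?thesis unfolding 0 by simp
qed

lemma Re_e2: "of_real (cos (2 * pi * t)) = (e2 t + e2 (- t)) / 2"
  by (simp add: e2_def complex_eq_iff)

text \<open>Multiplication by the cosine averages neighbouring coefficients, and the sines are an
  eigenvector of this averaging with eigenvalue \<open>cos (pi / N)\<close>. They vanish at both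
  ends, so the only defects appear at the frequencies \<open>0\<close> and \<open>N\<close>. This is
  the extremal choice behind the positive mean of the minorant.\<close>

lemma sine_polynomial_identity:
  fixes t :: real
  assumes N: "N \<ge> 2"
  defines "s \<equiv> \<lambda>j. sin (pi * real j / real N)"
  defines "D \<equiv> (\<Sum>j\<le>N. of_real (s j) * e2 (real j * t))"
  shows "of_real (cos (2 * pi * t)) * D = of_real (cos (pi / real N)) * D + of_real (s 1 / 2) * (1 + e2 (real N * t))"
proof -
  obtain m where m: "N = Suc m" "m \<ge> 1" using N by (cases N) auto
  have s0: "s 0 = 0" and sN: "s N = 0" using N by (auto simp: s_def)
  have sm: "s m = s 1"
  proof -
    have "pi * real m / real N = pi - pi * 1 / real N" using m by (simp add: field_simps)
    thus ?thesis by (simp add: s_def)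
  qed
  have rec: "s j + s (Suc (Suc j)) = 2 * cos (pi / real N) * s (Suc j)" for j
  proof -
    define x where "x = pi * real (Suc j) / real N" define h where "h = pi / real N"
    have "pi * real j / real N = x - h" "pi * real (Suc (Suc j)) / real N = x + h"
      using N by (simp_all add: x_def h_def field_simps)
    hence "s j = sin (x - h)" "s (Suc (Suc j)) = sin (x + h)" "s (Suc j) = sin x" by (simp_all only: s_def x_def)
    thus ?thesis unfolding h_def[symmetric] by (simp add: sin_add sin_diff)
  qed
  have Dm: "D = (\<Sum>j<m. of_real (s (Suc j)) * e2 (real (Suc j) * t))"
  proof -
    have "D = (\<Sum>j\<le>m. of_real (s j) * e2 (real j * t))" unfolding D_def m using sN m by simp
    also have "\<dots> = (\<Sum>j<Suc m. of_real (s j) * e2 (real j * t))" by (simp add: lessThan_Suc_atMost)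
    also have "\<dots> = (\<Sum>j<m. of_real (s (Suc j)) * e2 (real (Suc j) * t))"
      unfolding sum.lessThan_Suc_shift using s0 by simp
    finally show ?thesis .
  qed
  have e1: "e2 t * e2 (real j * t) = e2 (real (Suc j) * t)" for j by (simp add: e2_add[symmetric] algebra_simps)
  have e2': "e2 (- t) * e2 (real (Suc j) * t) = e2 (real j * t)" for j by (simp add: e2_add[symmetric] algebra_simps)
  have up: "e2 t * D = (\<Sum>j<m. of_real (s j) * e2 (real (Suc j) * t)) + of_real (s m) * e2 (real N * t)"
  proof -
    have "e2 t * D = (\<Sum>j<m. of_real (s (Suc j)) * e2 (real (Suc (Suc j)) * t))"
      unfolding Dm sum_distrib_left by (intro sum.cong refl) (simp only: mult.left_commute[of "e2 t"] e1)
    also have "\<dots> = (\<Sum>j<Suc m. of_real (s j) * e2 (real (Suc j) * t))"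
      unfolding sum.lessThan_Suc_shift using s0 by simp
    finally show ?thesis by (simp add: m)
  qed
  have down: "e2 (- t) * D = (\<Sum>j<m. of_real (s (Suc (Suc j))) * e2 (real (Suc j) * t)) + of_real (s 1)"
  proof -
    have "e2 (- t) * D = (\<Sum>j<m. of_real (s (Suc j)) * e2 (real j * t))"
      unfolding Dm sum_distrib_left by (intro sum.cong refl) (simp only: mult.left_commute[of "e2 (- t)"] e2')
    also have "\<dots> = (\<Sum>j<Suc m. of_real (s (Suc j)) * e2 (real j * t))" using sN m by simp
    also have "\<dots> = of_real (s 1) + (\<Sum>j<m. of_real (s (Suc (Suc j))) * e2 (real (Suc j) * t))"
      unfolding sum.lessThan_Suc_shift by (simp add: e2_def)
    finally show ?thesis by simp
  qed
  have "of_real (cos (2 * pi * t)) * D = (e2 t * D + e2 (- t) * D) / 2" unfolding Re_e2 by (simp add: algebra_simps)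
  also have "\<dots> = ((\<Sum>j<m. of_real (s j + s (Suc (Suc j))) * e2 (real (Suc j) * t)) + of_real (s m) * e2 (real N * t) + of_real (s 1)) / 2"
    unfolding up down by (simp add: sum.distrib algebra_simps)
  also have "(\<Sum>j<m. of_real (s j + s (Suc (Suc j))) * e2 (real (Suc j) * t)) = of_real (2 * cos (pi / real N)) * D"
    unfolding Dm rec sum_distrib_left by (simp add: mult_ac)
  finally show ?thesis by (simp add: sm algebra_simps add_divide_distrib)
qed

lemma one_minus_cos_le: "1 - cos x \<le> x\<^sup>2 / 2" for x :: real
proof -
  have "1 - cos x = 2 * (sin (x / 2))\<^sup>2" using cos_double_sin[of "x / 2"] by simp
  also have "(sin (x / 2))\<^sup>2 \<le> (x / 2)\<^sup>2" by (metis abs_sin_x_le_abs_x power2_abs power_mono abs_ge_zero)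
  finally show ?thesis by (simp add: power2_eq_square)
qed

text \<open>With \<open>D\<close> as in the previous identity, the minorant is \<open>(cos (2 * pi * t) - cos (pi * \<delta>)) * (norm (D t))\<^sup>2\<close> for
  \<open>t = u n - \<delta> / 2\<close>: it is positive only for \<open>t\<close> within \<open>\<delta> / 2\<close> of an integer, and by the identity its mean is positive
  once \<open>N\<close> exceeds \<open>1 / \<delta>\<close>.\<close>

lemma circle_minorant_sum:
  fixes w u :: "'n \<Rightarrow> real"
  assumes A: "finite A" and w: "\<And>n. n \<in> A \<Longrightarrow> w n \<ge> 0" and d: "0 < \<delta>" "\<delta> \<le> 1/3" and M: "M \<ge> 0"
    and bd: "\<And>k. 1 \<le> k \<Longrightarrow> real k \<le> 3 / \<delta> \<Longrightarrow> norm (\<Sum>n\<in>A. of_real (w n) * e2 (real k * u n)) \<le> M"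
  shows "50 * (\<Sum>n | n \<in> A \<and> frac (u n) < \<delta>. w n) \<ge> \<delta> * (\<Sum>n\<in>A. w n) - 60 * M"
proof -
  define \<alpha> where "\<alpha> = pi * \<delta>"
  \<comment> \<open>\<open>N \<ge> 2 / \<delta>\<close> gives
    \<open>pi / N \<le> \<alpha> / 2\<close>, which keeps the eigenvalue \<open>cos (pi / N)\<close>
    above \<open>cos \<alpha>\<close> by a multiple of \<open>\<delta>\<^sup>2\<close>;
    \<open>N \<le> 3 / \<delta>\<close> keeps all frequencies within the range of the hypothesis
    \<open>bd\<close>.\<close>
  define N where "N = nat \<lceil>2 / \<delta>\<rceil>"
  have N1: "real N \<ge> 2 / \<delta>" unfolding N_def by linarith
  have N2: "real N \<le> 3 / \<delta>"
  proof -
    have "real N \<le> 2 / \<delta> + 1" using d by (simp add: N_def)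
    also have "1 \<le> 1 / \<delta>" using d by simp
    finally show ?thesis by (simp add: add_divide_distrib[symmetric])
  qed
  have N6: "N \<ge> 2"
  proof -
    have "2 / \<delta> \<ge> 6" using d by (simp add: field_simps)
    thus ?thesis using N1 by linarith
  qed
  define s where "s = (\<lambda>j. sin (pi * real j / real N))"
  define D where "D = (\<lambda>t. \<Sum>j\<le>N. of_real (s j) * e2 (real j * t))"
  \<comment> \<open>The shift centres the arc: \<open>frac (u n) < \<delta>\<close> means that
    \<open>t n\<close> is within \<open>\<delta> / 2\<close> of an integer. It changes each
    exponential sum only by a unimodular factor.\<close>
  define t where "t = (\<lambda>n. u n - \<delta> / 2)"
  define S where "S = (\<lambda>k. \<Sum>n\<in>A. of_real (w n) * e2 (k * t n))"
  define W where "W = (\<Sum>n\<in>A. w n)"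
  define P where "P = (\<lambda>t. (cos (2 * pi * t) - cos \<alpha>) * (norm (D t))\<^sup>2)"
  define c where "c = cos (pi / real N) - cos \<alpha>"
  have W0: "W \<ge> 0" unfolding W_def using w by (intro sum_nonneg)
  have s_nonneg: "s j \<ge> 0" if "j \<le> N" for j
    unfolding s_def using that N6 by (intro sin_ge_zero) (auto simp: field_simps)
  have s_le: "s j \<le> 1" for j by (simp add: s_def)
  have s0: "s 0 = 0" "s N = 0" using N6 by (auto simp: s_def)
  have ssum: "(\<Sum>j\<le>N. s j) \<le> real N"
  proof -
    have "(\<Sum>j\<le>N. s j) = (\<Sum>j<N. s j)" using s0 by (simp add: lessThan_Suc_atMost[symmetric])
    also have "\<dots> \<le> (\<Sum>j<N. 1)" by (intro sum_mono s_le)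
    finally show ?thesis by simp
  qed
  have ssum0: "(\<Sum>j\<le>N. s j) \<ge> 0" by (intro sum_nonneg s_nonneg) auto
  have ssq: "(\<Sum>j\<le>N. (s j)\<^sup>2) = real N / 2"
    using sum_sin_square[OF N6] s0 by (simp add: lessThan_Suc_atMost[symmetric] s_def)
  have a: "0 < \<alpha>" "\<alpha> \<le> pi / 3" using d by (auto simp: \<alpha>_def)
  have aN: "\<alpha> * real N \<le> 3 * pi" using N2 d by (simp add: \<alpha>_def field_simps)
  have \<alpha>N2: "(\<alpha> * real N)\<^sup>2 \<le> 90"
  proof -
    have "(\<alpha> * real N)\<^sup>2 \<le> (3 * pi)\<^sup>2" using aN a by (intro power_mono) auto
    also have "(3 * pi)\<^sup>2 = 9 * (pi * pi)" by (simp add: power2_eq_square)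
    also have "pi * pi \<le> 3.1416 * 3.1416" using pi_less_4 pi_approx by (intro mult_mono) auto
    finally show ?thesis by (simp add: power2_eq_square)
  qed
  have cle: "0 \<le> c" "c \<le> \<alpha>\<^sup>2 / 2" "c \<ge> 3/2 * \<delta>\<^sup>2"
  proof -
    have "pi / real N \<le> \<alpha> / 2" using N1 N6 d by (simp add: \<alpha>_def field_simps)
    hence c1: "cos (pi / real N) \<ge> cos (\<alpha> / 2)" using a by (intro cos_monotone_0_pi_le) auto
    have "cos (\<alpha> / 2) - cos \<alpha> = 2 * sin (pi * (3/4 * \<delta>)) * sin (pi * (\<delta> / 4))"
      using cos_diff_cos[of "\<alpha>/2" \<alpha>] by (simp add: \<alpha>_def field_simps)
    moreover have "2 * sin (pi * (3/4 * \<delta>)) * sin (pi * (\<delta> / 4)) \<ge> 2 * (2 * (3/4 * \<delta>)) * (2 * (\<delta> / 4))"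
      using d by (intro mult_mono sin_pi_ge) (auto intro!: sin_ge_zero simp: field_simps)
    ultimately show "c \<ge> 3/2 * \<delta>\<^sup>2" using c1 by (simp add: c_def power2_eq_square)
    thus "0 \<le> c" by (rule order_trans[rotated]) simp
    have "c \<le> 1 - cos \<alpha>" by (simp add: c_def)
    thus "c \<le> \<alpha>\<^sup>2 / 2" using one_minus_cos_le[of \<alpha>] by linarith
  qed
  have Dn: "norm (D t) \<le> real N" for t
  proof -
    have "norm (D t) \<le> (\<Sum>j\<le>N. s j)" unfolding D_def
      by (rule order_trans[OF norm_sum]) (intro sum_mono, auto simp: norm_mult s_nonneg)
    thus ?thesis using ssum by linarith
  qed
  have Pup: "P (t n) \<le> 50 * of_bool (frac (u n) < \<delta>)" for n
  proof (cases "frac (u n) < \<delta>")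
    case True
    have "P (t n) \<le> (\<alpha>\<^sup>2 / 2) * (real N)\<^sup>2"
      unfolding P_def
    proof (intro mult_mono power_mono Dn)
      have "cos (2 * pi * t n) - cos \<alpha> \<le> 1 - cos \<alpha>" by simp
      thus "cos (2 * pi * t n) - cos \<alpha> \<le> \<alpha>\<^sup>2 / 2" using one_minus_cos_le[of \<alpha>] by linarith
    qed auto
    also have "\<dots> = (\<alpha> * real N)\<^sup>2 / 2" by (simp add: power_mult_distrib)
    also have "\<dots> \<le> 50" using \<alpha>N2 by simp
    finally show ?thesis using True by simp
  next
    case False
    define x where "x = 2 * pi * frac (u n) - \<alpha>"
    have "2 * pi * t n = x + 2 * pi * of_int \<lfloor>u n\<rfloor>" by (simp add: x_def t_def \<alpha>_def frac_def algebra_simps)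
    hence cx: "cos (2 * pi * t n) = cos x"
      using cos_int_2pin[of "\<lfloor>u n\<rfloor>"] sin_int_2pin[of "\<lfloor>u n\<rfloor>"] by (simp add: cos_add mult_ac)
    have "\<alpha> \<le> x"
    proof -
      have "2 * pi * frac (u n) \<ge> 2 * pi * \<delta>" using False by (intro mult_left_mono) auto
      thus ?thesis by (simp add: x_def \<alpha>_def)
    qed
    moreover have "x \<le> 2 * pi - \<alpha>"
    proof -
      have "2 * pi * frac (u n) \<le> 2 * pi * 1" using frac_lt_1[of "u n"] by (intro mult_left_mono) auto
      thus ?thesis by (simp add: x_def)
    qed
    ultimately have "cos x \<le> cos \<alpha>"
    proof (cases "x \<le> pi")
      case True thus ?thesis using a \<open>\<alpha> \<le> x\<close> by (intro cos_monotone_0_pi_le) auto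
    next
      case False
      have "cos x = cos (2 * pi - x)" by (simp add: cos_diff)
      also have "\<dots> \<le> cos \<alpha>" using a False \<open>x \<le> 2 * pi - \<alpha>\<close> by (intro cos_monotone_0_pi_le) auto
      finally show ?thesis .
    qed
    hence "P (t n) \<le> 0" unfolding P_def cx by (intro mult_nonpos_nonneg) auto
    thus ?thesis using False by simp
  qed
  have Sk: "norm (S k) \<le> M" if k: "k = of_int i" "i \<noteq> 0" "\<bar>of_int i\<bar> \<le> real N" for k i
  proof -
    have pos: "norm (S (real m)) \<le> M" if "m \<ge> 1" "real m \<le> real N" for m
    proof -
      have "S (real m) = e2 (- (real m * \<delta> / 2)) * (\<Sum>n\<in>A. of_real (w n) * e2 (real m * u n))"
        unfolding S_def t_def sum_distrib_left by (intro sum.cong refl) (simp add: e2_add[symmetric] mult_ac algebra_simps)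
      thus ?thesis using bd[of m] that N2 by (simp add: norm_mult)
    qed
    have cj: "S (- k) = cnj (S k)" for k unfolding S_def cnj_sum by (intro sum.cong refl) (simp add: e2_minus)
    show ?thesis
    proof (cases "i > 0")
      case True
      thus ?thesis using pos[of "nat i"] k by simp
    next
      case False
      hence "norm (S (- k)) \<le> M" using pos[of "nat (- i)"] k by simp
      thus ?thesis by (simp add: cj)
    qed
  qed
  have key: "of_real (\<Sum>n\<in>A. w n * P (t n)) = of_real c * (\<Sum>n\<in>A. of_real (w n) * (D (t n) * cnj (D (t n)))) +
       of_real (s 1 / 2) * (\<Sum>n\<in>A. of_real (w n) * ((1 + e2 (real N * t n)) * cnj (D (t n))))"
  proof -
    have "of_real (P x) = of_real c * (D x * cnj (D x)) + of_real (s 1 / 2) * ((1 + e2 (real N * x)) * cnj (D x))" for x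
    proof -
      have "of_real (P x) = (of_real (cos (2 * pi * x)) * D x - of_real (cos \<alpha>) * D x) * cnj (D x)"
        unfolding P_def of_real_mult complex_norm_square by (simp add: algebra_simps)
      also have "of_real (cos (2 * pi * x)) * D x = of_real (cos (pi / real N)) * D x + of_real (s 1 / 2) * (1 + e2 (real N * x))"
        using sine_polynomial_identity[OF N6, of x] unfolding D_def s_def .
      finally show ?thesis by (simp add: c_def algebra_simps)
    qed
    thus ?thesis by (simp add: sum_distrib_left sum.distrib algebra_simps)
  qed
  have DD: "(\<Sum>n\<in>A. of_real (w n) * (D (t n) * cnj (D (t n)))) = (\<Sum>i\<le>N. \<Sum>j\<le>N. of_real (s i * s j) * S (real i - real j))"
  proof -
    have "(\<Sum>n\<in>A. of_real (w n) * (D (t n) * cnj (D (t n)))) = (\<Sum>n\<in>A. \<Sum>i\<le>N. \<Sum>j\<le>N. of_real (w n) * (of_real (s i * s j) * e2 ((real i - real j) * t n)))"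
    proof (rule sum.cong[OF refl])
      fix n
      have "D (t n) * cnj (D (t n)) = (\<Sum>i\<le>N. \<Sum>j\<le>N. (of_real (s i) * e2 (real i * t n)) * cnj (of_real (s j) * e2 (real j * t n)))"
        unfolding D_def cnj_sum by (rule sum_product)
      also have "\<dots> = (\<Sum>i\<le>N. \<Sum>j\<le>N. of_real (s i * s j) * e2 ((real i - real j) * t n))"
        by (intro sum.cong refl) (simp add: e2_minus[symmetric] e2_add[symmetric] algebra_simps)
      finally show "of_real (w n) * (D (t n) * cnj (D (t n))) = (\<Sum>i\<le>N. \<Sum>j\<le>N. of_real (w n) * (of_real (s i * s j) * e2 ((real i - real j) * t n)))"
        by (simp only: sum_distrib_left)
    qed
    also have "\<dots> = (\<Sum>i\<le>N. \<Sum>n\<in>A. \<Sum>j\<le>N. of_real (w n) * (of_real (s i * s j) * e2 ((real i - real j) * t n)))" by (rule sum.swap)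
    also have "\<dots> = (\<Sum>i\<le>N. \<Sum>j\<le>N. \<Sum>n\<in>A. of_real (w n) * (of_real (s i * s j) * e2 ((real i - real j) * t n)))"
      by (rule sum.cong[OF refl], rule sum.swap)
    finally show ?thesis unfolding S_def sum_distrib_left by (simp only: mult_ac)
  qed
  \<comment> \<open>The pairs \<open>i = j\<close> carry frequency zero and give the mean
    \<open>N / 2 * W\<close>; all other pairs have a nonzero frequency of size at most
    \<open>N\<close>, hence are bounded by \<open>M\<close>.\<close>
  have DD2: "norm ((\<Sum>n\<in>A. of_real (w n) * (D (t n) * cnj (D (t n)))) - of_real (real N / 2 * W)) \<le> (real N)\<^sup>2 * M"
  proof -
    have S0: "S 0 = of_real W" by (simp add: S_def W_def e2_def)
    have "of_real (real N / 2 * W) = (\<Sum>i\<le>N. \<Sum>j\<le>N. of_bool (i = j) * (of_real (s i * s j) * S 0))"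
    proof -
      have "(\<Sum>i\<le>N. \<Sum>j\<le>N. of_bool (i = j) * (of_real (s i * s j) * S 0)) = (\<Sum>i\<le>N. of_real ((s i)\<^sup>2) * S 0)"
        by (intro sum.cong refl) (simp add: of_bool_def if_distrib if_distribR power2_eq_square cong: if_cong)
      also have "\<dots> = of_real (\<Sum>i\<le>N. (s i)\<^sup>2) * S 0" by (simp only: of_real_sum sum_distrib_right)
      finally show ?thesis unfolding ssq S0 by simp
    qed
    hence "(\<Sum>n\<in>A. of_real (w n) * (D (t n) * cnj (D (t n)))) - of_real (real N / 2 * W) =
       (\<Sum>i\<le>N. \<Sum>j\<le>N. of_real (s i * s j) * S (real i - real j) - of_bool (i = j) * (of_real (s i * s j) * S 0))"
      unfolding DD by (simp only: sum_subtractf)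
    also have "norm \<dots> \<le> (\<Sum>i\<le>N. \<Sum>j\<le>N. (s i * s j) * M)"
    proof (rule order_trans[OF norm_sum], rule sum_mono, rule order_trans[OF norm_sum], rule sum_mono)
      fix i j assume ij: "i \<in> {..N}" "j \<in> {..N}"
      show "norm (of_real (s i * s j) * S (real i - real j) - of_bool (i = j) * (of_real (s i * s j) * S 0)) \<le> (s i * s j) * M"
      proof (cases "i = j")
        case True thus ?thesis using M s_nonneg ij by simp
      next
        case False
        have "norm (S (real i - real j)) \<le> M"
          using ij False by (intro Sk[of _ "int i - int j"]) auto
        hence "(s i * s j) * norm (S (real i - real j)) \<le> (s i * s j) * M"
          using s_nonneg ij by (intro mult_left_mono mult_nonneg_nonneg) auto
        thus ?thesis using False s_nonneg[of i] s_nonneg[of j] ij by (simp add: norm_mult)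
      qed
    qed
    also have "\<dots> = ((\<Sum>i\<le>N. s i) * (\<Sum>j\<le>N. s j)) * M"
      unfolding sum_product by (simp only: sum_distrib_right)
    also have "\<dots> \<le> (real N * real N) * M" using ssum ssum0 M by (intro mult_right_mono mult_mono) auto
    finally show ?thesis by (simp add: power2_eq_square)
  qed
  have DD3: "norm (\<Sum>n\<in>A. of_real (w n) * ((1 + e2 (real N * t n)) * cnj (D (t n)))) \<le> 2 * real N * M"
  proof -
    have "(\<Sum>n\<in>A. of_real (w n) * ((1 + e2 (real N * t n)) * cnj (D (t n)))) = (\<Sum>n\<in>A. \<Sum>j\<le>N. of_real (w n) * (of_real (s j) * (e2 ((- real j) * t n) + e2 ((real N - real j) * t n))))"
    proof (rule sum.cong[OF refl])
      fix n
      have "(1 + e2 (real N * t n)) * cnj (D (t n)) = (\<Sum>j\<le>N. (1 + e2 (real N * t n)) * cnj (of_real (s j) * e2 (real j * t n)))"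
        unfolding D_def cnj_sum by (rule sum_distrib_left)
      also have "\<dots> = (\<Sum>j\<le>N. of_real (s j) * (e2 ((- real j) * t n) + e2 ((real N - real j) * t n)))"
      proof (rule sum.cong[OF refl])
        fix j
        have "e2 ((real N - real j) * t n) = e2 (real N * t n) * e2 ((- real j) * t n)" by (simp add: e2_add[symmetric] algebra_simps)
        moreover have "cnj (e2 (real j * t n)) = e2 ((- real j) * t n)" by (simp add: e2_minus[symmetric])
        ultimately show "(1 + e2 (real N * t n)) * cnj (of_real (s j) * e2 (real j * t n)) = of_real (s j) * (e2 ((- real j) * t n) + e2 ((real N - real j) * t n))"
          by (simp add: algebra_simps)
      qed
      finally show "of_real (w n) * ((1 + e2 (real N * t n)) * cnj (D (t n))) = (\<Sum>j\<le>N. of_real (w n) * (of_real (s j) * (e2 ((- real j) * t n) + e2 ((real N - real j) * t n))))"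
        by (simp only: sum_distrib_left)
    qed
    also have "\<dots> = (\<Sum>j\<le>N. \<Sum>n\<in>A. of_real (w n) * (of_real (s j) * (e2 ((- real j) * t n) + e2 ((real N - real j) * t n))))" by (rule sum.swap)
    also have "\<dots> = (\<Sum>j\<le>N. of_real (s j) * (S (- real j) + S (real N - real j)))"
      unfolding S_def by (intro sum.cong refl) (simp only: sum.distrib[symmetric] sum_distrib_left, simp add: algebra_simps)
    also have "norm \<dots> \<le> (\<Sum>j\<le>N. s j * (M + M))"
    proof (rule order_trans[OF norm_sum], rule sum_mono)
      fix j assume j: "j \<in> {..N}"
      show "norm (of_real (s j) * (S (- real j) + S (real N - real j))) \<le> s j * (M + M)"
      proof (cases "j = 0 \<or> j = N")
        case True thus ?thesis using s0 by auto
      next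
        case False
        have "norm (S (- real j)) \<le> M" using j False by (intro Sk[of _ "- int j"]) auto
        moreover have "norm (S (real N - real j)) \<le> M" using j False by (intro Sk[of _ "int N - int j"]) auto
        ultimately have "norm (S (- real j) + S (real N - real j)) \<le> M + M" by (meson add_mono norm_triangle_ineq order_trans)
        thus ?thesis using s_nonneg[of j] j by (simp add: norm_mult mult_left_mono)
      qed
    qed
    also have "\<dots> = (\<Sum>j\<le>N. s j) * (M + M)" by (rule sum_distrib_right[symmetric])
    also have "\<dots> \<le> real N * (M + M)" using ssum M by (intro mult_right_mono) auto
    finally show ?thesis by simp
  qed
  have s1: "s 1 * real N \<le> 4"
  proof -
    have "s 1 \<le> pi / real N" using sin_x_le_x[of "pi / real N"] by (simp add: s_def)
    hence "s 1 * real N \<le> pi" using N6 by (simp add: field_simps)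
    thus ?thesis using pi_less_4 by linarith
  qed
  have "(\<Sum>n\<in>A. w n * P (t n)) \<ge> c * (real N / 2 * W) - 49 * M"
  proof -
    define X where "X = (\<Sum>n\<in>A. of_real (w n) * (D (t n) * cnj (D (t n))))"
    define Y where "Y = (\<Sum>n\<in>A. of_real (w n) * ((1 + e2 (real N * t n)) * cnj (D (t n))))"
    have "of_real (\<Sum>n\<in>A. w n * P (t n)) - of_real (c * (real N / 2 * W)) = of_real c * (X - of_real (real N / 2 * W)) + of_real (s 1 / 2) * Y"
      unfolding key X_def[symmetric] Y_def[symmetric] by (simp add: algebra_simps)
    hence "\<bar>(\<Sum>n\<in>A. w n * P (t n)) - c * (real N / 2 * W)\<bar> = norm (of_real c * (X - of_real (real N / 2 * W)) + of_real (s 1 / 2) * Y)"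
      by (metis norm_of_real of_real_diff)
    also have "\<dots> \<le> c * norm (X - of_real (real N / 2 * W)) + s 1 / 2 * norm Y"
      by (rule order_trans[OF norm_triangle_ineq]) (use cle s_nonneg[of 1] N6 in \<open>simp add: norm_mult\<close>)
    also have "c * norm (X - of_real (real N / 2 * W)) \<le> (\<alpha>\<^sup>2 / 2) * ((real N)\<^sup>2 * M)"
      using DD2 cle unfolding X_def by (intro mult_mono) auto
    also have "\<dots> = (\<alpha> * real N)\<^sup>2 / 2 * M" by (simp add: power_mult_distrib)
    also have "\<dots> \<le> 90 / 2 * M" using \<alpha>N2 M by (intro mult_right_mono divide_right_mono) auto
    also have "s 1 / 2 * norm Y \<le> s 1 / 2 * (2 * real N * M)"
      using DD3 s_nonneg[of 1] N6 unfolding Y_def by (intro mult_left_mono) auto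
    also have "\<dots> = (s 1 * real N) * M" by simp
    also have "\<dots> \<le> 4 * M" using s1 M by (intro mult_right_mono) auto
    finally show ?thesis by (simp add: abs_le_iff)
  qed
  moreover have "(\<Sum>n\<in>A. w n * P (t n)) \<le> 50 * (\<Sum>n | n \<in> A \<and> frac (u n) < \<delta>. w n)"
  proof -
    have "(\<Sum>n\<in>A. w n * P (t n)) \<le> (\<Sum>n\<in>A. w n * (50 * of_bool (frac (u n) < \<delta>)))"
      by (intro sum_mono mult_left_mono Pup w)
    also have "\<dots> = 50 * (\<Sum>n\<in>A. if frac (u n) < \<delta> then w n else 0)"
      unfolding sum_distrib_left by (intro sum.cong refl) auto
    also have "(\<Sum>n\<in>A. if frac (u n) < \<delta> then w n else 0) = (\<Sum>n\<in>{n\<in>A. frac (u n) < \<delta>}. w n)"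
      using A by (simp add: sum.inter_filter)
    finally show ?thesis by simp
  qed
  moreover have "c * (real N / 2 * W) \<ge> \<delta> * W"
  proof -
    have "(3/2 * \<delta>\<^sup>2) * (2 / \<delta> / 2) \<le> c * (real N / 2)" using cle N1 d by (intro mult_mono) auto
    hence "\<delta> \<le> c * (real N / 2)" using d by (simp add: power2_eq_square)
    hence "\<delta> * W \<le> c * (real N / 2) * W" using W0 by (intro mult_right_mono)
    thus ?thesis by (simp add: mult_ac)
  qed
  ultimately show ?thesis using M unfolding W_def by linarith
qed

section \<open>Short products equal to one\<close>

text \<open>Here index \<open>0\<close> means the principal character, so this is a genuine
  character modulo \<open>\<Prod>Q\<close>, as wanted for its values on units. It agrees with
  \<open>chi\<close> on numbers prime to \<open>Q\<close>.\<close>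

definition fchar :: "nat set \<Rightarrow> (nat \<Rightarrow> nat) \<Rightarrow> nat \<Rightarrow> complex" where
  "fchar Q J n = (\<Prod>q\<in>Q. dchar q (J q) n)"

lemma fchar_mult: "(\<And>q. q \<in> Q \<Longrightarrow> prime q) \<Longrightarrow> fchar Q J (m * n) = fchar Q J m * fchar Q J n"
  by (simp add: fchar_def dchar_mult prod.distrib)

lemma fchar_1: "(\<And>q. q \<in> Q \<Longrightarrow> prime q) \<Longrightarrow> fchar Q J 1 = 1"
proof -
  assume Q: "\<And>q. q \<in> Q \<Longrightarrow> prime q"
  have "dchar q (J q) 1 = 1" if "q \<in> Q" for q
    using Q[OF that] prime_gt_1_nat[OF Q[OF that]] ind_eq_0_iff[OF Q[OF that], of 1] by (auto simp: dchar_def not_prime_1)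
  thus ?thesis by (simp add: fchar_def)
qed

lemma fchar_prod:
  assumes "\<And>q. q \<in> Q \<Longrightarrow> prime q" and "finite S"
  shows "fchar Q J (\<Prod>S) = (\<Prod>p\<in>S. fchar Q J p)"
  using assms(2) by (induction S rule: finite_induct) (use fchar_1[OF assms(1), simplified] fchar_mult[OF assms(1)] in auto)

lemma sum_fchar:
  assumes Q: "finite Q" "\<And>q. q \<in> Q \<Longrightarrow> prime q" and n: "\<And>q. q \<in> Q \<Longrightarrow> \<not> q dvd n"
  shows "(\<Sum>J\<in>chars Q. fchar Q J n) = of_nat (card (chars Q)) * of_bool ([n = 1] (mod \<Prod>Q))"
proof -
  have eq: "chi Q J n = fchar Q J n" for J
    unfolding chi_def fchar_def using n by (intro prod.cong refl) (auto simp: dchar1_def dchar_0)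
  have "{J. J \<in> chars Q \<and> supp Q J \<subseteq> Q} = chars Q" by (auto simp: supp_def)
  thus ?thesis using sum_chi_supp_subset[OF Q order_refl n] card_chars_supp_subset[OF Q order_refl] by (simp add: eq)
qed

lemma fchar_root_of_unity:
  assumes Q: "finite Q" "\<And>q. q \<in> Q \<Longrightarrow> prime q" and n: "\<And>q. q \<in> Q \<Longrightarrow> \<not> q dvd n"
    and l: "\<And>q. q \<in> Q \<Longrightarrow> (q - 1) dvd l"
  shows "fchar Q J n ^ l = 1"
proof -
  have "dchar q (J q) n ^ l = 1" if q: "q \<in> Q" for q
  proof -
    have q1: "q - 1 > 0" using prime_gt_1_nat[OF Q(2)[OF q]] by simp
    have "[J q * ind q n * l = 0] (mod (q - 1))" using l[OF q] by (auto simp: cong_0_iff)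
    hence "cis (2 * pi / real (q - 1)) ^ (J q * ind q n * l) = cis (2 * pi / real (q - 1)) ^ 0"
      by (rule cis_root_power_cong[OF q1])
    thus ?thesis using n[OF q] unfolding dchar_def by (simp add: power_mult)
  qed
  thus ?thesis by (simp add: fchar_def prod_power_distrib)
qed

text \<open>For each \<open>p\<close> in turn, \<open>a p\<close> is the most frequent value at
  \<open>p\<close> among the characters not yet matched. There are at most \<open>l\<close> possible
  values, so each choice removes at least a proportion \<open>1 / l\<close> of those
  characters.\<close>

lemma greedy_character_values:
  assumes P: "finite P" and R: "finite R" "card R \<le> l" and l: "l > 0" and X: "finite X"
    and val: "\<And>p J. p \<in> P \<Longrightarrow> J \<in> X \<Longrightarrow> f J p \<in> R"
  shows "\<exists>a. (\<forall>p\<in>P. a p \<in> insert (1::complex) R) \<and> real (card {J\<in>X. \<forall>p\<in>P. f J p \<noteq> a p}) \<le> real (card X) * (1 - 1 / real l) ^ card P"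
  using P val
proof (induction P rule: finite_induct)
  case empty thus ?case by auto
next
  case (insert p P)
  then obtain a where a: "\<forall>p\<in>P. a p \<in> insert (1::complex) R"
    "real (card {J\<in>X. \<forall>p\<in>P. f J p \<noteq> a p}) \<le> real (card X) * (1 - 1 / real l) ^ card P" by blast
  define Y where "Y = {J\<in>X. \<forall>p\<in>P. f J p \<noteq> a p}"
  have finY: "finite Y" using X by (simp add: Y_def)
  \<comment> \<open>The value \<open>1\<close> is adjoined only to have a choice when no character
    is left and \<open>R\<close> may be empty.\<close>
  have "\<exists>b\<in>insert 1 R. real (card {J\<in>Y. f J p = b}) \<ge> real (card Y) / real l"
  proof (cases "Y = {}")
    case True thus ?thesis by (intro bexI[of _ 1]) auto
  next
    case False
    have Rne: "R \<noteq> {}" using False insert.prems by (auto simp: Y_def)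
    show ?thesis
    proof (rule ccontr)
      assume "\<not> ?thesis"
      hence less: "real (card {J\<in>Y. f J p = b}) < real (card Y) / real l" if "b \<in> R" for b using that by (auto simp: not_le)
      have "card Y = (\<Sum>b\<in>R. card {J\<in>Y. f J p = b})"
      proof -
        have "(\<Sum>b\<in>R. \<Sum>J\<in>{J\<in>Y. f J p = b}. 1) = (\<Sum>J\<in>Y. 1 :: nat)"
          using insert.prems by (intro sum.group finY R(1)) (auto simp: Y_def)
        thus ?thesis by simp
      qed
      hence "real (card Y) = (\<Sum>b\<in>R. real (card {J\<in>Y. f J p = b}))" by simp
      also have "\<dots> < (\<Sum>b\<in>R. real (card Y) / real l)" by (intro sum_strict_mono R less Rne)
      also have "\<dots> = real (card R) * (real (card Y) / real l)" by simp
      also have "\<dots> \<le> real l * (real (card Y) / real l)" using R(2) by (intro mult_right_mono) auto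
      also have "\<dots> = real (card Y)" using l by simp
      finally show False by simp
    qed
  qed
  then obtain b where b: "b \<in> insert 1 R" "real (card {J\<in>Y. f J p = b}) \<ge> real (card Y) / real l" by blast
  define a' where "a' = a(p := b)"
  have "{J\<in>X. \<forall>p'\<in>insert p P. f J p' \<noteq> a' p'} = Y - {J\<in>Y. f J p = b}"
    using insert.hyps by (auto simp: Y_def a'_def)
  hence "real (card {J\<in>X. \<forall>p'\<in>insert p P. f J p' \<noteq> a' p'}) = real (card Y) - real (card {J\<in>Y. f J p = b})"
    using finY by (simp add: card_Diff_subset of_nat_diff card_mono)
  also have "\<dots> \<le> real (card Y) * (1 - 1 / real l)" using b(2) by (simp add: algebra_simps)
  also have "\<dots> \<le> (real (card X) * (1 - 1 / real l) ^ card P) * (1 - 1 / real l)"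
    using a(2) l by (intro mult_right_mono) (auto simp: Y_def)
  also have "\<dots> = real (card X) * (1 - 1 / real l) ^ card (insert p P)" using insert.hyps by simp
  finally have "real (card {J\<in>X. \<forall>p'\<in>insert p P. f J p' \<noteq> a' p'}) \<le> real (card X) * (1 - 1 / real l) ^ card (insert p P)" .
  moreover have "\<forall>p'\<in>insert p P. a' p' \<in> insert 1 R" using a(1) b(1) by (auto simp: a'_def)
  ultimately show ?case by blast
qed

text \<open>Choose roots of unity \<open>a p\<close> such that every character takes the value
  \<open>a p\<close> at some \<open>p\<close> in \<open>P\<close>. Then the product of the
  \<open>a p - fchar Q J p\<close> vanishes for every \<open>J\<close>. Expanding it and summing
  over \<open>J\<close> leaves, by orthogonality, only subsets with product congruent to
  \<open>1\<close>; the empty set alone would give a nonzero total, so there is another one.\<close>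

theorem product_one_subset:
  assumes Q: "finite Q" "\<And>q. q \<in> Q \<Longrightarrow> prime q" and P: "finite P"
    and cop: "\<And>p q. p \<in> P \<Longrightarrow> q \<in> Q \<Longrightarrow> \<not> q dvd p"
    and l: "l > 0" "\<And>q. q \<in> Q \<Longrightarrow> (q - 1) dvd l"
    and big: "real (card P) > real l * ln (real (\<Prod>Q))"
  shows "\<exists>S\<subseteq>P. S \<noteq> {} \<and> [\<Prod>S = 1] (mod \<Prod>Q)"
proof (rule ccontr)
  assume no: "\<not> ?thesis"
  define X where "X = chars Q"
  have finX: "finite X" unfolding X_def using Q(1) by (intro finite_PiE) auto
  have cX: "card X = (\<Prod>q\<in>Q. q - 1)" unfolding X_def by (simp add: card_PiE[OF Q(1)])
  have cXpos: "card X > 0" unfolding cX using Q prime_gt_1_nat by (intro prod_pos) force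
  define R where "R = {z::complex. z ^ l = 1}"
  have R: "finite R" "card R \<le> l" using l(1) by (auto simp: R_def card_roots_unity_eq finite_roots_unity)
  have "fchar Q J p \<in> R" if "p \<in> P" "J \<in> X" for p J
    unfolding R_def using fchar_root_of_unity[OF Q cop[OF that(1)] l(2)] by simp
  then obtain a where a: "\<forall>p\<in>P. a p \<in> insert 1 R"
    "real (card {J\<in>X. \<forall>p\<in>P. fchar Q J p \<noteq> a p}) \<le> real (card X) * (1 - 1 / real l) ^ card P"
    using greedy_character_values[OF P R l(1) finX, of "fchar Q"] by blast
  \<comment> \<open>There are at most \<open>\<Prod>Q\<close> characters and the unmatched share
    decays like \<open>exp (- card P / l)\<close>, so \<open>big\<close> leaves fewer than one
    unmatched character, hence none.\<close>
  have "real (card X) * (1 - 1 / real l) ^ card P < 1"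
  proof -
    have "1 - 1 / real l \<le> exp (- (1 / real l))" using exp_ge_add_one_self[of "- (1 / real l)"] by simp
    hence "(1 - 1 / real l) ^ card P \<le> exp (- (1 / real l)) ^ card P" using l(1) by (intro power_mono) auto
    also have "\<dots> = exp (- (real (card P) / real l))" by (simp add: exp_of_nat_mult[symmetric])
    also have "\<dots> < exp (- ln (real (card X)))"
    proof -
      have "card X \<le> \<Prod>Q" unfolding cX by (intro prod_mono) auto
      hence "real (card X) \<le> real (\<Prod>Q)" by (simp only: of_nat_le_iff)
      hence "ln (real (card X)) \<le> ln (real (\<Prod>Q))" using cXpos by (intro ln_mono) auto
      moreover have "ln (real (\<Prod>Q)) < real (card P) / real l" using big l(1) by (simp add: field_simps)
      ultimately show ?thesis by simp
    qed
    also have "\<dots> = 1 / real (card X)" using cXpos by (simp add: exp_minus inverse_eq_divide)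
    finally show ?thesis using cXpos by (simp add: field_simps)
  qed
  hence "real (card {J\<in>X. \<forall>p\<in>P. fchar Q J p \<noteq> a p}) < 1" using a(2) by linarith
  hence "{J\<in>X. \<forall>p\<in>P. fchar Q J p \<noteq> a p} = {}" using finX by auto
  hence kill: "\<exists>p\<in>P. a p = fchar Q J p" if "J \<in> X" for J using that by fastforce
  have a0: "a p \<noteq> 0" if "p \<in> P" for p using a(1) that l(1) by (auto simp: R_def zero_power)
  have "0 = (\<Sum>J\<in>X. \<Prod>p\<in>P. (a p + - fchar Q J p))"
    using P kill by (intro sum.neutral[symmetric] ballI prod_zero) auto
  also have "\<dots> = (\<Sum>J\<in>X. \<Sum>S\<in>Pow P. (\<Prod>p\<in>P - S. a p) * (\<Prod>p\<in>S. - fchar Q J p))"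
    using prod_add[OF P, of "\<lambda>p. - fchar Q J p" a for J] by (simp only: add.commute mult.commute)
  also have "\<dots> = (\<Sum>S\<in>Pow P. \<Sum>J\<in>X. (\<Prod>p\<in>P - S. a p) * (\<Prod>p\<in>S. - fchar Q J p))" by (rule sum.swap)
  also have "\<dots> = (\<Sum>S\<in>Pow P. (\<Prod>p\<in>P - S. a p) * (-1) ^ card S * (of_nat (card X) * of_bool ([\<Prod>S = 1] (mod \<Prod>Q))))"
  proof (rule sum.cong[OF refl])
    fix S assume S: "S \<in> Pow P"
    hence finS: "finite S" using P finite_subset by auto
    have nd: "\<not> q dvd \<Prod>S" if "q \<in> Q" for q
      using prime_dvd_prod_iff[OF finS Q(2)[OF that]] cop that S by auto
    have "(\<Prod>p\<in>S. - fchar Q J p) = (-1) ^ card S * fchar Q J (\<Prod>S)" for J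
    proof -
      have "(\<Prod>p\<in>S. - fchar Q J p) = (\<Prod>p\<in>S. (-1) * fchar Q J p)" by simp
      also have "\<dots> = (-1) ^ card S * (\<Prod>p\<in>S. fchar Q J p)" by (simp only: prod.distrib prod_constant)
      finally show ?thesis by (simp only: fchar_prod[OF Q(2) finS])
    qed
    hence "(\<Sum>J\<in>X. (\<Prod>p\<in>P - S. a p) * (\<Prod>p\<in>S. - fchar Q J p)) = (\<Prod>p\<in>P - S. a p) * (-1) ^ card S * (\<Sum>J\<in>X. fchar Q J (\<Prod>S))"
      by (simp add: sum_distrib_left mult_ac)
    also have "(\<Sum>J\<in>X. fchar Q J (\<Prod>S)) = of_nat (card X) * of_bool ([\<Prod>S = 1] (mod \<Prod>Q))"
      unfolding X_def by (rule sum_fchar[OF Q nd])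
    finally show "(\<Sum>J\<in>X. (\<Prod>p\<in>P - S. a p) * (\<Prod>p\<in>S. - fchar Q J p)) = (\<Prod>p\<in>P - S. a p) * (-1) ^ card S * (of_nat (card X) * of_bool ([\<Prod>S = 1] (mod \<Prod>Q)))" .
  qed
  also have "\<dots> = (\<Sum>S\<in>{{}}. (\<Prod>p\<in>P - S. a p) * (-1) ^ card S * (of_nat (card X) * of_bool ([\<Prod>S = 1] (mod \<Prod>Q))))"
    using P no by (intro sum.mono_neutral_right) auto
  also have "\<dots> = (\<Prod>p\<in>P. a p) * of_nat (card X)" by simp
  finally show False using P a0 cXpos by auto
qed

section \<open>Primes in progressions to smooth moduli, on average\<close>

lemma hyperbola_section_interval:
  "\<exists>a b. {m\<in>{1..M}. (y < m * n \<and> m * n \<le> x) \<and> (y < m * n' \<and> m * n' \<le> x)} = {a<..(b::nat)}"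
proof (cases "n = 0 \<or> n' = 0")
  case True
  hence "{m\<in>{1..M}. (y < m * n \<and> m * n \<le> x) \<and> (y < m * n' \<and> m * n' \<le> x)} = {0<..0::nat}" by auto
  thus ?thesis by blast
next
  case False
  hence "y < m * n \<longleftrightarrow> y div n < m" "m * n \<le> x \<longleftrightarrow> m \<le> x div n" "y < m * n' \<longleftrightarrow> y div n' < m" "m * n' \<le> x \<longleftrightarrow> m \<le> x div n'" for m
    by (auto simp: div_less_iff_less_mult less_eq_div_iff_mult_less_eq)
  hence "{m\<in>{1..M}. (y < m * n \<and> m * n \<le> x) \<and> (y < m * n' \<and> m * n' \<le> x)} =
     {max (y div n) (y div n')<..min M (min (x div n) (x div n'))}" by auto
  thus ?thesis by blast
qed

text \<open>Characters are treated in levels according to the number \<open>m\<close> of primes in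
  their conductor, so that incomplete sums have the uniform bounds \<open>z ^ m\<close> and, for two
  distinct characters, \<open>z ^ (2 * m)\<close>. The first serves the type I sums, the second is
  the \<open>P\<close> of the bilinear sieve.\<close>

lemma character_sums_level:
  fixes x z m U Jx :: nat
  assumes Q: "finite Q" "\<And>q. q \<in> Q \<Longrightarrow> prime q" and z: "\<And>q. q \<in> Q \<Longrightarrow> q \<le> z" and m: "m \<ge> 1"
    and U: "U \<ge> 1" "U \<le> x div 16" "U * U \<le> x" and Jx: "x \<le> 2 ^ Jx"
  defines "K \<equiv> {J\<in>chars Q. card (supp Q J) = m}"
  defines "k \<equiv> real (card K)" and "P \<equiv> real z ^ (2 * m)" and "L \<equiv> 1 + ln (real x)"
  shows "(\<Sum>J\<in>K. norm (\<Sum>n\<in>{x div 16<..x}. of_real (mangoldt n) * chi Q J n))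
     \<le> 3 * k * L * (real (U * U) * real z ^ m)
       + 2 * real Jx * (sqrt (real x + real x * (k * P) / real U + k\<^sup>2 * P * sqrt (real x)) * sqrt (2 * real x) * L ^ 3)"
proof -
  have finK: "finite K" unfolding K_def using Q(1) by (intro finite_subset[OF _ finite_PiE[OF Q(1), of "\<lambda>q. {..<q - 1}"]]) auto
  have k0: "k \<ge> 0" by (simp add: k_def)
  have P0: "P \<ge> 0" by (simp add: P_def)
  have "(\<Sum>J\<in>K. norm (\<Sum>n\<in>{x div 16<..x}. of_real (mangoldt n) * chi Q J n))
     \<le> 3 * real (card K) * (1 + ln (real x)) * (\<Sum>t\<in>{1..U*U}. real z ^ m)
       + 2 * real Jx * (sqrt (real x + real x * (k * P) / real U + k\<^sup>2 * P * sqrt (real x)) * sqrt (2 * real x) * (1 + ln (real x)) ^ 3)"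
  proof (rule vaughan_family_bound[OF finK _ U(1,2) _ U(3) Jx])
    fix J t h assume J: "J \<in> K"
    have "(\<Sum>k\<in>{x div 16 div t<..h}. chi Q J (t * k)) = chi Q J t * (\<Sum>k\<in>{x div 16 div t<..h}. chi Q J k)"
      by (simp add: chi_mult[OF Q(2)] sum_distrib_left)
    also have "norm \<dots> \<le> 1 * real z ^ card (supp Q J)"
      unfolding norm_mult using J m
      by (intro mult_mono norm_chi_le chi_sum_bound[OF Q z]) (auto simp: K_def)
    finally show "norm (\<Sum>k\<in>{x div 16 div t<..h}. chi Q J (t * k)) \<le> real z ^ m" using J by (simp add: K_def)
  next
    fix N and \<alpha> \<beta> :: "nat \<Rightarrow> real"
    assume N: "U \<le> N" "N * N \<le> x"
    have N0: "N > 0" using N U by simp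
    have off: "norm (\<Sum>n\<in>{a<..b}. chi Q i n * cnj (chi Q j n)) \<le> P" if "i \<in> K" "j \<in> K" "i \<noteq> j" for i j a b
    proof -
      have "i \<in> chars Q" "j \<in> chars Q" "card (supp Q i) + card (supp Q j) = 2 * m" using that by (auto simp: K_def)
      thus ?thesis using chi_orthogonal[OF Q z, of i j a b] that(3) unfolding P_def by simp
    qed
    have "(\<Sum>i\<in>K. norm (\<Sum>n\<in>{N<..2*N}. \<Sum>m\<in>{1..x div N}.
           of_bool (x div 16 < m * n \<and> m * n \<le> x) * of_real (\<alpha> m * \<beta> n) * chi Q i (m * n)))
      \<le> sqrt (\<Sum>m\<in>{1..x div N}. (\<alpha> m)\<^sup>2) * sqrt (\<Sum>n\<in>{N<..2*N}. (\<beta> n)\<^sup>2)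
        * sqrt (real (x div N) * (real (2*N - N) + real (card K) * P) + (real (card K))\<^sup>2 * P * real (2*N - N))"
      by (rule bilinear_large_sieve[OF finK P0 norm_chi_le chi_mult[OF Q(2)] off])
         (use hyperbola_section_interval in auto)
    \<comment> \<open>\<open>N \<ge> U\<close> is used in the term with \<open>x div N\<close>, and
      \<open>N \<le> sqrt x\<close> in the one with the factor \<open>N\<close>.\<close>
    also have "\<dots> \<le> sqrt (\<Sum>m\<in>{1..x div N}. (\<alpha> m)\<^sup>2) * sqrt (\<Sum>n\<in>{N<..2*N}. (\<beta> n)\<^sup>2)
        * sqrt (real x + real x * (k * P) / real U + k\<^sup>2 * P * sqrt (real x))"
    proof (intro mult_left_mono real_sqrt_le_mono)
      have MN: "real (x div N) * real N \<le> real x"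
      proof -
        have "x div N * N \<le> x" by simp
        thus ?thesis by (metis of_nat_le_iff of_nat_mult)
      qed
      have M: "real (x div N) \<le> real x / real U"
      proof -
        have "real (x div N) \<le> real x / real N" by (rule of_nat_div_le_of_nat)
        also have "\<dots> \<le> real x / real U" using N U by (intro divide_left_mono) auto
        finally show ?thesis .
      qed
      have Ns: "real N \<le> sqrt (real x)"
      proof (rule real_le_rsqrt)
        have "real (N * N) \<le> real x" using N(2) by (simp only: of_nat_le_iff)
        thus "(real N)\<^sup>2 \<le> real x" by (simp add: power2_eq_square)
      qed
      have "real (x div N) * (real N + k * P) + k\<^sup>2 * P * real N = real (x div N) * real N + real (x div N) * (k * P) + k\<^sup>2 * P * real N"
        by (simp add: algebra_simps)
      also have "\<dots> \<le> real x + real x / real U * (k * P) + k\<^sup>2 * P * sqrt (real x)"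
        using MN M Ns k0 P0 by (intro add_mono mult_right_mono mult_left_mono) auto
      finally show "real (x div N) * (real (2*N - N) + real (card K) * P) + (real (card K))\<^sup>2 * P * real (2*N - N)
         \<le> real x + real x * (k * P) / real U + k\<^sup>2 * P * sqrt (real x)" by (simp add: k_def)
    qed (auto intro!: sum_nonneg mult_nonneg_nonneg)
    finally show "(\<Sum>i\<in>K. norm (\<Sum>n\<in>{N<..2*N}. \<Sum>m\<in>{1..x div N}.
           of_bool (x div 16 < m * n \<and> m * n \<le> x) * of_real (\<alpha> m * \<beta> n) * chi Q i (m * n)))
        \<le> sqrt (real x + real x * (k * P) / real U + k\<^sup>2 * P * sqrt (real x)) * sqrt (\<Sum>m\<in>{1..x div N}. (\<alpha> m)\<^sup>2) * sqrt (\<Sum>n\<in>{N<..2*N}. (\<beta> n)\<^sup>2)"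
      by (simp only: mult_ac)
  qed (use k0 P0 in auto)
  thus ?thesis unfolding k_def[symmetric] L_def by simp
qed

section \<open>Counting moduli and averaging over them\<close>

lemma card_subsets_containing:
  assumes "finite Q" "f \<subseteq> Q" "card f \<le> u"
  shows "card {d. d \<subseteq> Q \<and> card d = u \<and> f \<subseteq> d} = (card Q - card f) choose (u - card f)"
proof -
  have finf: "finite f" using assms finite_subset by blast
  have "bij_betw (\<lambda>e. f \<union> e) {e. e \<subseteq> Q - f \<and> card e = u - card f} {d. d \<subseteq> Q \<and> card d = u \<and> f \<subseteq> d}"
  proof (rule bij_betwI[where g = "\<lambda>d. d - f"])
    show "(\<lambda>e. f \<union> e) \<in> {e. e \<subseteq> Q - f \<and> card e = u - card f} \<rightarrow> {d. d \<subseteq> Q \<and> card d = u \<and> f \<subseteq> d}"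
    proof
      fix e assume e: "e \<in> {e. e \<subseteq> Q - f \<and> card e = u - card f}"
      hence "finite e" using assms(1) by (auto intro: finite_subset)
      hence "card (f \<union> e) = card f + card e" using e finf by (intro card_Un_disjoint) auto
      thus "f \<union> e \<in> {d. d \<subseteq> Q \<and> card d = u \<and> f \<subseteq> d}" using e assms by auto
    qed
    show "(\<lambda>d. d - f) \<in> {d. d \<subseteq> Q \<and> card d = u \<and> f \<subseteq> d} \<rightarrow> {e. e \<subseteq> Q - f \<and> card e = u - card f}"
      using finf by (auto simp: card_Diff_subset)
  qed auto
  hence "card {d. d \<subseteq> Q \<and> card d = u \<and> f \<subseteq> d} = card {e. e \<subseteq> Q - f \<and> card e = u - card f}"
    by (simp add: bij_betw_same_card)
  also have "\<dots> = card (Q - f) choose (u - card f)" using assms(1) by (intro n_subsets) auto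
  finally show ?thesis using assms finf by (simp add: card_Diff_subset)
qed

lemma prod_pred_le:
  fixes f Q :: "nat set"
  assumes "f \<subseteq> Q" "finite Q" "\<And>q. q \<in> Q \<Longrightarrow> q \<le> z" shows "(\<Prod>q\<in>f. q - 1) \<le> z ^ card f"
proof -
  have "(\<Prod>q\<in>f. q - 1) \<le> (\<Prod>q\<in>f. z)" by (rule prod_mono) (use assms in \<open>auto intro: le_trans[OF diff_le_self]\<close>)
  thus ?thesis by simp
qed

lemma card_chars_level:
  assumes Q: "finite Q" "\<And>q. q \<in> Q \<Longrightarrow> prime q" and z: "\<And>q. q \<in> Q \<Longrightarrow> q \<le> z"
  shows "card {J\<in>chars Q. card (supp Q J) = m} \<le> (card Q choose m) * z ^ m"
proof -
  have "{J\<in>chars Q. card (supp Q J) = m} \<subseteq> (\<Union>f\<in>{f. f \<subseteq> Q \<and> card f = m}. {J. J \<in> chars Q \<and> supp Q J \<subseteq> f})"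
  proof
    fix J assume J: "J \<in> {J\<in>chars Q. card (supp Q J) = m}"
    hence "supp Q J \<in> {f. f \<subseteq> Q \<and> card f = m}" by (simp add: supp_def)
    moreover have "J \<in> {J'. J' \<in> chars Q \<and> supp Q J' \<subseteq> supp Q J}" using J by blast
    ultimately show "J \<in> (\<Union>f\<in>{f. f \<subseteq> Q \<and> card f = m}. {J. J \<in> chars Q \<and> supp Q J \<subseteq> f})"
      by (rule UN_I)
  qed
  hence "card {J\<in>chars Q. card (supp Q J) = m} \<le> card (\<Union>f\<in>{f. f \<subseteq> Q \<and> card f = m}. {J. J \<in> chars Q \<and> supp Q J \<subseteq> f})"
    using Q(1) by (intro card_mono finite_UN_I finite_subset[OF _ finite_PiE[OF Q(1), of "\<lambda>q. {..<q - 1}"]]) auto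
  also have "\<dots> \<le> (\<Sum>f\<in>{f. f \<subseteq> Q \<and> card f = m}. card {J. J \<in> chars Q \<and> supp Q J \<subseteq> f})"
    using Q(1) by (intro card_UN_le) auto
  also have "\<dots> \<le> (\<Sum>f\<in>{f. f \<subseteq> Q \<and> card f = m}. z ^ m)"
  proof (rule sum_mono)
    fix f assume f: "f \<in> {f. f \<subseteq> Q \<and> card f = m}"
    thus "card {J. J \<in> chars Q \<and> supp Q J \<subseteq> f} \<le> z ^ m"
      using card_chars_supp_subset[OF Q, of f] prod_pred_le[of f Q z] z Q(1) by auto
  qed
  also have "\<dots> = (card Q choose m) * z ^ m" using n_subsets[OF Q(1)] by simp
  finally show ?thesis .
qed

lemma binomial_diag_mono: "m \<le> u \<Longrightarrow> u \<le> n \<Longrightarrow> (n - m) choose (u - m) \<le> n choose u"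
proof (induction m)
  case (Suc m)
  have "n - m = Suc (n - Suc m)" "u - m = Suc (u - Suc m)" using Suc.prems by auto
  hence "(n - Suc m) choose (u - Suc m) \<le> (n - m) choose (u - m)" by simp
  also have "\<dots> \<le> n choose u" using Suc by auto
  finally show ?case .
qed simp

text \<open>Among all \<open>u\<close>-subsets of an \<open>n\<close>-set, at most a proportion
  \<open>u / n\<close> contains a given nonempty \<open>m\<close>-subset. This saving replaces any
  knowledge about characters of small conductor.\<close>

lemma binomial_ratio_le:
  assumes "1 \<le> m" "m \<le> u" "u \<le> n"
  shows "n * ((n - m) choose (u - m)) \<le> u * (n choose u)"
proof -
  have "(n - m) choose (u - m) \<le> (n - 1) choose (u - 1)"
    using binomial_diag_mono[of "m - 1" "u - 1" "n - 1"] assms by simp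
  hence "n * ((n - m) choose (u - m)) \<le> n * ((n - 1) choose (u - 1))" by simp
  also have "\<dots> = u * (n choose u)" using times_binomial_minus1_eq[of u n] assms by simp
  finally show ?thesis .
qed


text \<open>A set of primes stands for the squarefree modulus that is its product.\<close>

definition usets :: "nat set \<Rightarrow> nat \<Rightarrow> nat set set" where
  "usets Q u = {d. d \<subseteq> Q \<and> card d = u}"

lemma finite_usets: "finite Q \<Longrightarrow> finite (usets Q u)"
  unfolding usets_def by (rule finite_subset[of _ "Pow Q"]) auto

lemma card_usets: "finite Q \<Longrightarrow> card (usets Q u) = card Q choose u"
  unfolding usets_def by (rule n_subsets)

text \<open>The weight of \<open>d\<close> is the number of characters modulo
  \<open>\<Prod>d\<close>, so orthogonality is applied without division. After interchanging sums, a
  character is counted once for each \<open>d\<close> that contains its support: the trivial one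
  \<open>card Q choose u\<close> times, which is the main term, and one of level \<open>m\<close>
  exactly \<open>(card Q - m) choose (u - m)\<close> times.\<close>

lemma sum_usets_progression_ge:
  fixes x z u :: nat
  assumes Q: "finite Q" "\<And>q. q \<in> Q \<Longrightarrow> prime q" and z: "\<And>q. q \<in> Q \<Longrightarrow> q \<le> z" and zx: "z \<le> x div 16"
    and u: "u \<le> card Q" and x: "x \<ge> 1" and z1: "z \<ge> 1"
  defines "S \<equiv> \<lambda>J. \<Sum>n\<in>{x div 16<..x}. of_real (mangoldt n) * chi Q J n"
  shows "(\<Sum>d\<in>usets Q u. real (\<Prod>q\<in>d. q - 1) * (\<Sum>n\<in>{x div 16<..x}. of_bool ([n = 1] (mod \<Prod>d)) * mangoldt n))
     \<ge> real (card Q choose u) * (\<Sum>n\<in>{x div 16<..x}. mangoldt n)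
       - (\<Sum>m\<in>{1..u}. real ((card Q - m) choose (u - m)) * (\<Sum>J | J \<in> chars Q \<and> card (supp Q J) = m. norm (S J)))
       - real (card Q choose u) * real z ^ u * (sqrt (real x) * (2 * ln (real x)) * ln (real x))"
proof -
  define D where "D = card Q choose u"
  define I where "I = {x div 16<..x}"
  define X where "X = chars Q"
  define J0 where "J0 = (\<lambda>q\<in>Q. 0::nat)"
  define N where "N = (\<lambda>J. card {d\<in>usets Q u. supp Q J \<subseteq> d})"
  define R where "R = (\<lambda>n. \<Sum>J\<in>X. of_nat (N J) * chi Q J n)"
  define F where "F = (\<lambda>n. \<Sum>d\<in>usets Q u. real (\<Prod>q\<in>d. q - 1) * of_bool ([n = 1] (mod \<Prod>d)))"
  define cop where "cop = (\<lambda>n. \<forall>q\<in>Q. \<not> q dvd n)"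
  have finX: "finite X" unfolding X_def using Q(1) by (intro finite_PiE) auto
  have finU: "finite (usets Q u)" using Q(1) by (rule finite_usets)
  have R_alt: "R n = (\<Sum>d\<in>usets Q u. \<Sum>J | J \<in> X \<and> supp Q J \<subseteq> d. chi Q J n)" for n
  proof -
    have "R n = (\<Sum>J\<in>X. \<Sum>d\<in>usets Q u. if supp Q J \<subseteq> d then chi Q J n else 0)"
      unfolding R_def N_def using finU by (intro sum.cong refl) (simp add: sum.inter_filter[symmetric])
    also have "\<dots> = (\<Sum>d\<in>usets Q u. \<Sum>J\<in>X. if supp Q J \<subseteq> d then chi Q J n else 0)" by (rule sum.swap)
    also have "\<dots> = (\<Sum>d\<in>usets Q u. \<Sum>J | J \<in> X \<and> supp Q J \<subseteq> d. chi Q J n)"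
      using finX by (intro sum.cong[OF refl]) (simp add: sum.inter_filter[symmetric])
    finally show ?thesis .
  qed
  have RF: "R n = of_real (F n)" if "cop n" for n
    unfolding R_alt F_def of_real_sum
  proof (rule sum.cong[OF refl])
    fix d assume "d \<in> usets Q u"
    hence d: "d \<subseteq> Q" by (simp add: usets_def)
    show "(\<Sum>J | J \<in> X \<and> supp Q J \<subseteq> d. chi Q J n) = of_real (real (\<Prod>q\<in>d. q - 1) * of_bool ([n = 1] (mod \<Prod>d)))"
      unfolding X_def using sum_chi_supp_subset[OF Q d, of n] that by (simp add: cop_def)
  qed
  have Rn: "norm (R n) \<le> real D * real z ^ u" for n
  proof -
    have "norm (R n) \<le> (\<Sum>d\<in>usets Q u. real z ^ u)"
      unfolding R_alt
    proof (rule order_trans[OF norm_sum], rule sum_mono)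
      fix d assume "d \<in> usets Q u"
      hence d: "d \<subseteq> Q" "card d = u" by (auto simp: usets_def)
      have "norm (\<Sum>J | J \<in> X \<and> supp Q J \<subseteq> d. chi Q J n) \<le> (\<Sum>J | J \<in> X \<and> supp Q J \<subseteq> d. 1)"
        by (rule sum_norm_le) (rule norm_chi_le)
      also have "\<dots> = real (\<Prod>q\<in>d. q - 1)" using card_chars_supp_subset[OF Q d(1)] by (simp add: X_def)
      also have "\<dots> \<le> real z ^ u" using prod_pred_le[OF d(1) Q(1) z] d(2) by (metis of_nat_le_iff of_nat_power)
      finally show "norm (\<Sum>J | J \<in> X \<and> supp Q J \<subseteq> d. chi Q J n) \<le> real z ^ u" .
    qed
    thus ?thesis by (simp add: D_def card_usets[OF Q(1)])
  qed
  have F0: "F n \<ge> 0" for n unfolding F_def by (intro sum_nonneg mult_nonneg_nonneg of_nat_0_le_iff) auto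
  have "(\<Sum>n\<in>I. mangoldt n * F n) \<ge> (\<Sum>n\<in>I. mangoldt n * Re (R n)) - real D * real z ^ u * (sqrt (real x) * (2 * ln (real x)) * ln (real x))"
  proof -
    \<comment> \<open>\<open>R n\<close> equals \<open>F n\<close> unless some \<open>q\<close> in
      \<open>Q\<close> divides \<open>n\<close>. As \<open>q \<le> z \<le> x div 16 < n\<close>,
      such an \<open>n\<close> is not prime, and the discrepancy is charged to the prime
      powers.\<close>
    have "mangoldt n * Re (R n) \<le> mangoldt n * F n + (if \<not> prime n then mangoldt n else 0) * (real D * real z ^ u)" if n: "n \<in> I" for n
    proof (cases "cop n")
      case True
      have "0 \<le> (if \<not> prime n then mangoldt n else 0) * (real D * real z ^ u)" by (simp add: mangoldt_nonneg)
      thus ?thesis using RF[OF True] by simp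
    next
      case False
      then obtain q where q: "q \<in> Q" "q dvd n" by (auto simp: cop_def)
      have "\<not> prime n"
      proof
        assume "prime n"
        hence "q = n" using primes_dvd_imp_eq[OF Q(2)[OF q(1)] _ q(2)] by simp
        thus False using z[OF q(1)] zx n by (simp add: I_def)
      qed
      have "Re (R n) \<le> real D * real z ^ u" using Rn[of n] complex_Re_le_cmod[of "R n"] by linarith
      hence "mangoldt n * Re (R n) \<le> mangoldt n * (real D * real z ^ u)" by (intro mult_left_mono mangoldt_nonneg)
      thus ?thesis using \<open>\<not> prime n\<close> mult_nonneg_nonneg[OF mangoldt_nonneg F0] by (smt (verit))
    qed
    hence "(\<Sum>n\<in>I. mangoldt n * Re (R n)) \<le> (\<Sum>n\<in>I. mangoldt n * F n + (if \<not> prime n then mangoldt n else 0) * (real D * real z ^ u))"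
      by (rule sum_mono)
    also have "\<dots> = (\<Sum>n\<in>I. mangoldt n * F n) + (\<Sum>n\<in>I. if \<not> prime n then mangoldt n else 0) * (real D * real z ^ u)"
      by (simp only: sum.distrib sum_distrib_right)
    also have "(\<Sum>n\<in>I. if \<not> prime n then mangoldt n else 0) \<le> (\<Sum>n | n \<in> {1..x} \<and> \<not> prime n. mangoldt n :: real)"
    proof -
      have "(\<Sum>n\<in>I. if \<not> prime n then mangoldt n else 0) = (\<Sum>n\<in>{n\<in>I. \<not> prime n}. mangoldt n :: real)"
        by (rule sum.inter_filter[symmetric]) (simp add: I_def)
      also have "\<dots> \<le> (\<Sum>n | n \<in> {1..x} \<and> \<not> prime n. mangoldt n)"
        by (rule sum_mono2) (auto simp: I_def mangoldt_nonneg)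
      finally show ?thesis .
    qed
    also have "\<dots> \<le> sqrt (real x) * (2 * ln (real x)) * ln (real x)" by (rule sum_mangoldt_nonprime[OF x])
    finally show ?thesis by (simp add: mult_right_mono mult_ac)
  qed
  also have "(\<Sum>n\<in>I. mangoldt n * F n) = (\<Sum>d\<in>usets Q u. real (\<Prod>q\<in>d. q - 1) * (\<Sum>n\<in>I. of_bool ([n = 1] (mod \<Prod>d)) * mangoldt n))"
    unfolding F_def sum_distrib_left by (subst sum.swap) (simp only: mult_ac)
  finally have main: "(\<Sum>d\<in>usets Q u. real (\<Prod>q\<in>d. q - 1) * (\<Sum>n\<in>I. of_bool ([n = 1] (mod \<Prod>d)) * mangoldt n))
     \<ge> (\<Sum>n\<in>I. mangoldt n * Re (R n)) - real D * real z ^ u * (sqrt (real x) * (2 * ln (real x)) * ln (real x))" .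
  have J0: "J0 \<in> X" "supp Q J0 = {}" and c0: "chi Q J0 n = 1" for n
    using prime_gt_1_nat[OF Q(2)] by (auto simp: J0_def X_def supp_def chi_def dchar1_def)
  have J0_unique: "J = J0" if "J \<in> X" "supp Q J = {}" for J
  proof (rule PiE_ext[of J Q "\<lambda>q. {..<q - 1}" J0])
    fix q assume "q \<in> Q"
    thus "J q = J0 q" using that(2) by (auto simp: supp_def J0_def)
  qed (use that J0 in \<open>auto simp: X_def\<close>)
  have N0: "N J0 = D" using card_usets[OF Q(1), of u] by (simp add: N_def J0 D_def)
  have Nm: "N J = (card Q - m) choose (u - m)" if "card (supp Q J) = m" "m \<le> u" for J m
  proof -
    have "N J = card {d. d \<subseteq> Q \<and> card d = u \<and> supp Q J \<subseteq> d}" by (simp add: N_def usets_def conj_ac)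
    also have "\<dots> = (card Q - card (supp Q J)) choose (u - card (supp Q J))"
      using that by (intro card_subsets_containing[OF Q(1)]) (auto simp: supp_def)
    finally show ?thesis using that by simp
  qed
  have Nbig: "N J = 0" if "card (supp Q J) > u" for J
  proof -
    have "\<not> supp Q J \<subseteq> d" if "d \<in> usets Q u" for d
    proof
      assume "supp Q J \<subseteq> d"
      moreover have "finite d" "card d = u" using that Q(1) by (auto simp: usets_def intro: finite_subset)
      ultimately have "card (supp Q J) \<le> u" using card_mono by blast
      thus False using \<open>card (supp Q J) > u\<close> by simp
    qed
    hence "{d\<in>usets Q u. supp Q J \<subseteq> d} = {}" by auto
    thus ?thesis by (simp only: N_def card.empty)
  qed
  have SJ0: "S J0 = of_real (\<Sum>n\<in>I. mangoldt n)" by (simp add: S_def c0 I_def)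
  have "of_real (\<Sum>n\<in>I. mangoldt n) * of_nat D + (\<Sum>J\<in>X - {J0}. of_nat (N J) * S J) = (\<Sum>J\<in>X. of_nat (N J) * S J)"
    using sum.remove[OF finX J0(1), of "\<lambda>J. of_nat (N J) * S J"] by (simp only: N0 SJ0 mult.commute)
  also have "\<dots> = (\<Sum>n\<in>I. of_real (mangoldt n) * R n)"
    unfolding S_def R_def sum_distrib_left I_def[symmetric] by (subst sum.swap) (simp only: mult_ac)
  finally have eq: "(\<Sum>n\<in>I. of_real (mangoldt n) * R n) = of_real (\<Sum>n\<in>I. mangoldt n) * of_nat D + (\<Sum>J\<in>X - {J0}. of_nat (N J) * S J)" by simp
  have "(\<Sum>n\<in>I. mangoldt n * Re (R n)) = Re (\<Sum>n\<in>I. of_real (mangoldt n) * R n)"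
    by simp
  also have "\<dots> = real D * (\<Sum>n\<in>I. mangoldt n) + Re (\<Sum>J\<in>X - {J0}. of_nat (N J) * S J)"
    unfolding eq by (simp add: mult.commute)
  finally have 1: "(\<Sum>n\<in>I. mangoldt n * Re (R n)) = real D * (\<Sum>n\<in>I. mangoldt n) + Re (\<Sum>J\<in>X - {J0}. of_nat (N J) * S J)" .
  have "Re (\<Sum>J\<in>X - {J0}. of_nat (N J) * S J) \<ge> - (\<Sum>m\<in>{1..u}. real ((card Q - m) choose (u - m)) * (\<Sum>J | J \<in> X \<and> card (supp Q J) = m. norm (S J)))"
  proof -
    have "norm (\<Sum>J\<in>X - {J0}. of_nat (N J) * S J) \<le> (\<Sum>J\<in>X - {J0}. real (N J) * norm (S J))"
      by (rule order_trans[OF norm_sum]) (simp add: norm_mult)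
    also have "\<dots> = (\<Sum>J\<in>{J\<in>X. card (supp Q J) \<in> {1..u}}. real (N J) * norm (S J))"
    proof (rule sum.mono_neutral_right)
      show "finite (X - {J0})" using finX by simp
      show "{J\<in>X. card (supp Q J) \<in> {1..u}} \<subseteq> X - {J0}" using J0 by auto
      show "\<forall>i\<in>X - {J0} - {J\<in>X. card (supp Q J) \<in> {1..u}}. real (N i) * norm (S i) = 0"
      proof
        fix J assume J: "J \<in> X - {J0} - {J\<in>X. card (supp Q J) \<in> {1..u}}"
        have "supp Q J \<noteq> {}" using J J0_unique by auto
        hence "card (supp Q J) \<noteq> 0" using Q(1) by (auto simp: supp_def)
        hence "card (supp Q J) > u" using J by auto
        thus "real (N J) * norm (S J) = 0" by (simp add: Nbig)
      qed
    qed
    also have "\<dots> = (\<Sum>m\<in>{1..u}. \<Sum>J\<in>{J\<in>{J\<in>X. card (supp Q J) \<in> {1..u}}. card (supp Q J) = m}. real (N J) * norm (S J))"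
      using finX by (intro sum.group[symmetric]) auto
    also have "\<dots> = (\<Sum>m\<in>{1..u}. real ((card Q - m) choose (u - m)) * (\<Sum>J | J \<in> X \<and> card (supp Q J) = m. norm (S J)))"
    proof (rule sum.cong[OF refl])
      fix m assume m: "m \<in> {1..u}"
      have "{J\<in>{J\<in>X. card (supp Q J) \<in> {1..u}}. card (supp Q J) = m} = {J. J \<in> X \<and> card (supp Q J) = m}" using m by auto
      thus "(\<Sum>J\<in>{J\<in>{J\<in>X. card (supp Q J) \<in> {1..u}}. card (supp Q J) = m}. real (N J) * norm (S J)) =
         real ((card Q - m) choose (u - m)) * (\<Sum>J | J \<in> X \<and> card (supp Q J) = m. norm (S J))"
        unfolding sum_distrib_left using m by (intro sum.cong) (auto simp: Nm)
    qed
    finally show ?thesis using abs_Re_le_cmod[of "\<Sum>J\<in>X - {J0}. of_nat (N J) * S J"] by linarith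
  qed
  thus ?thesis using main 1 unfolding D_def I_def X_def by linarith
qed


text \<open>The multiplicity of a level is combined with the number of its characters before
  estimating: their product is \<open>card Q choose u\<close> times only
  \<open>2 ^ u * z ^ m\<close>, whereas the separate factors may be huge. Where no character count
  is present, the multiplicity is bounded by the proportion \<open>u / card Q\<close>.\<close>

lemma weight_bounds:
  fixes x z m u U Jx :: nat
  assumes Q: "finite Q" "\<And>q. q \<in> Q \<Longrightarrow> prime q" and z: "\<And>q. q \<in> Q \<Longrightarrow> q \<le> z" and m: "1 \<le> m" "m \<le> u"
    and z1: "z \<ge> 1" and u: "u \<le> card Q"
    and U: "U \<ge> 1" "U \<le> x div 16" "U * U \<le> x" and Jx: "x \<le> 2 ^ Jx"
  defines "Z \<equiv> real z ^ u" and "L \<equiv> 1 + ln (real x)" and "D \<equiv> real (card Q choose u)"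
  shows "real ((card Q - m) choose (u - m)) * (\<Sum>J | J \<in> chars Q \<and> card (supp Q J) = m. norm (\<Sum>n\<in>{x div 16<..x}. of_real (mangoldt n) * chi Q J n))
     \<le> D * (3 * L * real (U * U) * (2 ^ u * Z\<^sup>2)
         + 2 * real Jx * sqrt 2 * L ^ 3 * (real x * (real u / real (card Q)) + real x * (2 ^ u * (Z * sqrt Z)) / sqrt (real U)
              + sqrt (real x) * (2 ^ u * Z\<^sup>2) * sqrt (sqrt (real x))))"
proof -
  define w where "w = real ((card Q - m) choose (u - m))"
  define k where "k = real (card {J\<in>chars Q. card (supp Q J) = m})"
  define P where "P = real z ^ (2 * m)"
  define c where "c = real (card Q choose m)"
  define b where "b = real (u choose m)"
  have x1: "x \<ge> 1" using U by simp
  have L1: "L \<ge> 1" using x1 by (simp add: L_def)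
  have nonneg: "w \<ge> 0" "k \<ge> 0" "P \<ge> 0" "c \<ge> 0" "b \<ge> 0" "D \<ge> 0" by (simp_all add: w_def k_def P_def c_def b_def D_def)
  have zr: "real z \<ge> 1" using z1 by simp
  have zm: "1 \<le> real z ^ m" "real z ^ m \<le> Z" using zr m unfolding Z_def by (auto intro: power_increasing)
  have Z1: "Z \<ge> 1" using zm by linarith
  have kc: "k \<le> c * real z ^ m"
    using card_chars_level[OF Q z, of m] unfolding k_def c_def by (metis (no_types, lifting) of_nat_le_iff of_nat_mult of_nat_power)
  \<comment> \<open>Counting pairs of an \<open>m\<close>-subset inside a \<open>u\<close>-subset of
    \<open>Q\<close> in two ways.\<close>
  have wc: "w * c = D * b"
    using choose_mult[of m u "card Q"] m u unfolding w_def c_def D_def b_def by (metis of_nat_mult mult.commute)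
  have b2: "b \<le> 2 ^ u" using binomial_le_pow2[of u m] unfolding b_def by (metis of_nat_le_iff of_nat_numeral of_nat_power)
  have c1: "c \<ge> 1" using m u unfolding c_def by (simp add: Suc_le_eq zero_less_binomial)
  have wk: "w * k \<le> D * (2 ^ u * real z ^ m)"
  proof -
    have "w * k \<le> w * (c * real z ^ m)" using kc nonneg by (intro mult_left_mono)
    also have "\<dots> = D * (b * real z ^ m)" using wc by (simp add: mult.assoc[symmetric])
    also have "\<dots> \<le> D * (2 ^ u * real z ^ m)" using b2 nonneg by (intro mult_left_mono mult_right_mono) auto
    finally show ?thesis .
  qed
  have wk2: "w * k * real z ^ m \<le> D * (2 ^ u * Z\<^sup>2)"
  proof -
    have "w * k * real z ^ m \<le> D * (2 ^ u * real z ^ m) * real z ^ m" using wk by (intro mult_right_mono) auto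
    also have "\<dots> = D * (2 ^ u * (real z ^ m * real z ^ m))" by simp
    also have "\<dots> \<le> D * (2 ^ u * (Z * Z))" using zm Z1 nonneg by (intro mult_left_mono mult_mono) auto
    finally show ?thesis by (simp add: power2_eq_square)
  qed
  have "P = (real z ^ m)\<^sup>2" unfolding P_def by (simp only: mult.commute[of 2] power_mult)
  hence sP: "sqrt P = real z ^ m" by simp
  have wsk: "w * sqrt (k * P) \<le> D * (2 ^ u * (Z * sqrt Z))"
  proof -
    \<comment> \<open>The square root is given a full factor \<open>c\<close> instead of
      \<open>sqrt c\<close>, because the multiplicity \<open>w\<close> combines with
      \<open>c\<close> through \<open>wc\<close>.\<close>
    have "sqrt k \<le> sqrt (c * c * real z ^ m)"
    proof (rule real_sqrt_le_mono)
      have "c * 1 \<le> c * c" using c1 by (intro mult_left_mono) auto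
      hence "c * real z ^ m \<le> c * c * real z ^ m" by (intro mult_right_mono) auto
      thus "k \<le> c * c * real z ^ m" using kc by linarith
    qed
    also have "\<dots> = c * sqrt (real z ^ m)" using c1 by (simp add: real_sqrt_mult)
    also have "\<dots> \<le> c * sqrt Z" using zm c1 by (intro mult_left_mono real_sqrt_le_mono) auto
    finally have "w * (sqrt k * real z ^ m) \<le> w * (c * sqrt Z * Z)"
      using zm Z1 c1 nonneg by (intro mult_left_mono mult_mono) auto
    also have "\<dots> = (w * c) * (Z * sqrt Z)" by (simp only: mult_ac)
    also have "\<dots> = D * (b * (Z * sqrt Z))" unfolding wc by (simp only: mult_ac)
    also have "\<dots> \<le> D * (2 ^ u * (Z * sqrt Z))" using b2 Z1 nonneg by (intro mult_left_mono mult_right_mono) auto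
    finally show ?thesis by (simp add: real_sqrt_mult sP)
  qed
  have wQ: "w \<le> D * (real u / real (card Q))"
  proof -
    have "real (card Q) * w \<le> real u * D"
      using binomial_ratio_le[OF m u] unfolding w_def D_def by (metis of_nat_le_iff of_nat_mult)
    moreover have "card Q > 0" using m u by simp
    ultimately show ?thesis by (simp add: field_simps)
  qed
  have "(\<Sum>J | J \<in> chars Q \<and> card (supp Q J) = m. norm (\<Sum>n\<in>{x div 16<..x}. of_real (mangoldt n) * chi Q J n))
     \<le> 3 * k * L * (real (U * U) * real z ^ m) + 2 * real Jx * (sqrt (real x + real x * (k * P) / real U + k\<^sup>2 * P * sqrt (real x)) * sqrt (2 * real x) * L ^ 3)"
    unfolding k_def P_def L_def by (rule character_sums_level[OF Q z m(1) U Jx])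
  also have "sqrt (real x + real x * (k * P) / real U + k\<^sup>2 * P * sqrt (real x)) \<le> sqrt (real x) + sqrt (real x) * sqrt (k * P) / sqrt (real U) + k * real z ^ m * sqrt (sqrt (real x))"
  proof -
    have "sqrt (real x + real x * (k * P) / real U + k\<^sup>2 * P * sqrt (real x)) \<le> sqrt (real x + real x * (k * P) / real U) + sqrt (k\<^sup>2 * P * sqrt (real x))"
      using nonneg by (intro sqrt_add_le_add_sqrt) auto
    also have "sqrt (real x + real x * (k * P) / real U) \<le> sqrt (real x) + sqrt (real x * (k * P) / real U)"
      using nonneg by (intro sqrt_add_le_add_sqrt) auto
    also have "sqrt (real x * (k * P) / real U) = sqrt (real x) * sqrt (k * P) / sqrt (real U)"
      by (simp add: real_sqrt_mult real_sqrt_divide)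
    also have "sqrt (k\<^sup>2 * P * sqrt (real x)) = k * real z ^ m * sqrt (sqrt (real x))"
      using nonneg by (simp add: real_sqrt_mult sP)
    finally show ?thesis by simp
  qed
  finally have "w * (\<Sum>J | J \<in> chars Q \<and> card (supp Q J) = m. norm (\<Sum>n\<in>{x div 16<..x}. of_real (mangoldt n) * chi Q J n))
     \<le> w * (3 * k * L * (real (U * U) * real z ^ m) + 2 * real Jx * ((sqrt (real x) + sqrt (real x) * sqrt (k * P) / sqrt (real U) + k * real z ^ m * sqrt (sqrt (real x))) * sqrt (2 * real x) * L ^ 3))"
    using nonneg L1 by (simp add: mult_left_mono mult_right_mono)
  also have "\<dots> = 3 * L * real (U * U) * (w * k * real z ^ m) + 2 * real Jx * sqrt 2 * L ^ 3 *
      ((sqrt (real x) * sqrt (real x)) * w + (sqrt (real x) * sqrt (real x)) * (w * sqrt (k * P)) / sqrt (real U) + sqrt (real x) * (w * k * real z ^ m) * sqrt (sqrt (real x)))"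
    by (simp add: real_sqrt_mult algebra_simps add_divide_distrib del: real_sqrt_mult_self)
  also have "\<dots> = 3 * L * real (U * U) * (w * k * real z ^ m) + 2 * real Jx * sqrt 2 * L ^ 3 *
      (real x * w + real x * (w * sqrt (k * P)) / sqrt (real U) + sqrt (real x) * (w * k * real z ^ m) * sqrt (sqrt (real x)))"
    by simp
  also have "\<dots> \<le> 3 * L * real (U * U) * (D * (2 ^ u * Z\<^sup>2)) + 2 * real Jx * sqrt 2 * L ^ 3 *
      (real x * (D * (real u / real (card Q))) + real x * (D * (2 ^ u * (Z * sqrt Z))) / sqrt (real U) + sqrt (real x) * (D * (2 ^ u * Z\<^sup>2)) * sqrt (sqrt (real x)))"
    using wk2 wsk wQ L1 by (intro add_mono mult_left_mono mult_right_mono divide_right_mono) auto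
  finally show ?thesis unfolding w_def[symmetric] by (simp add: algebra_simps)
qed

text \<open>Apart from logarithms the terms have the exponents
  \<open>2 * 0.374 + 0.002 + 2 * 0.123 = 0.996\<close>,
  \<open>1 + 0.002 + 1.5 * 0.123 - 0.187 = 0.9995\<close> and
  \<open>3/4 + 0.002 + 2 * 0.123 = 0.998\<close>. The exponent \<open>0.374\<close> of the Vaughan
  cutoff is squeezed between the first two. In the remaining term, \<open>ln x ^ 6\<close> in the
  denominator outweighs the four logarithms in front.\<close>

lemma progression_average_eventually:
  "eventually (\<lambda>x::real.
     3 * (1 + ln x) * (x powr (374/1000))\<^sup>2 * (x powr (2/1000) * (x powr (123/1000))\<^sup>2)
      + 2 * (2 * (1 + ln x)) * sqrt 2 * (1 + ln x) ^ 3 *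
        (x * (1 / ln x ^ 6) + x * (x powr (2/1000) * (x powr (123/1000) * sqrt (x powr (123/1000)))) / sqrt (x powr (374/1000) / 2)
          + sqrt x * (x powr (2/1000) * (x powr (123/1000))\<^sup>2) * sqrt (sqrt x))
      + x powr (123/1000) * (sqrt x * (2 * ln x) * ln x) \<le> x / 8) at_top"
  by real_asymp


theorem progression_average:
  "\<exists>x0. \<forall>x\<ge>x0. \<forall>Q z u. finite Q \<longrightarrow> (\<forall>q\<in>Q. prime q \<and> q \<le> z) \<longrightarrow> 1 \<le> u \<longrightarrow> u \<le> card Q \<longrightarrow>
     real z ^ u \<le> real x powr (123/1000) \<longrightarrow> 2 ^ u \<le> real x powr (1/1000) \<longrightarrow>
     (real u)\<^sup>2 * ln (real x) ^ 6 \<le> real (card Q) \<longrightarrow>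
     (\<Sum>d\<in>usets Q u. real (\<Prod>q\<in>d. q - 1) * (\<Sum>n\<in>{x div 16<..x}. of_bool ([n = 1] (mod \<Prod>d)) * mangoldt n))
       \<ge> real (card Q choose u) * (real x / 8)"
proof -
  obtain x1 where x1: "\<And>x. x \<ge> x1 \<Longrightarrow> (\<Sum>n\<in>{x div 16<..x}. mangoldt n) \<ge> real x / 4"
    using chebyshev_interval by blast
  have ev1: "eventually (\<lambda>x::nat. 
     3 * (1 + ln (real x)) * (real x powr (374/1000))\<^sup>2 * (real x powr (2/1000) * (real x powr (123/1000))\<^sup>2)
      + 2 * (2 * (1 + ln (real x))) * sqrt 2 * (1 + ln (real x)) ^ 3 *
        (real x * (1 / ln (real x) ^ 6) + real x * (real x powr (2/1000) * (real x powr (123/1000) * sqrt (real x powr (123/1000)))) / sqrt (real x powr (374/1000) / 2)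
          + sqrt (real x) * (real x powr (2/1000) * (real x powr (123/1000))\<^sup>2) * sqrt (sqrt (real x)))
      + real x powr (123/1000) * (sqrt (real x) * (2 * ln (real x)) * ln (real x)) \<le> real x / 8) at_top"
    using progression_average_eventually filterlim_real_sequentially by (rule eventually_compose_filterlim)
  have ev2: "eventually (\<lambda>x::nat. real x powr (374/1000) \<ge> 2 \<and> real x powr (374/1000) \<le> real x / 16 - 1 \<and> real x powr (123/1000) \<le> real x / 16 - 1 \<and> real x \<ge> 3) at_top"
    by (intro eventually_conj; real_asymp)
  obtain x2 where x2: "\<And>x. x \<ge> x2 \<Longrightarrow>
     3 * (1 + ln (real x)) * (real x powr (374/1000))\<^sup>2 * (real x powr (2/1000) * (real x powr (123/1000))\<^sup>2)
      + 2 * (2 * (1 + ln (real x))) * sqrt 2 * (1 + ln (real x)) ^ 3 *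
        (real x * (1 / ln (real x) ^ 6) + real x * (real x powr (2/1000) * (real x powr (123/1000) * sqrt (real x powr (123/1000)))) / sqrt (real x powr (374/1000) / 2)
          + sqrt (real x) * (real x powr (2/1000) * (real x powr (123/1000))\<^sup>2) * sqrt (sqrt (real x)))
      + real x powr (123/1000) * (sqrt (real x) * (2 * ln (real x)) * ln (real x)) \<le> real x / 8 \<and>
     real x powr (374/1000) \<ge> 2 \<and> real x powr (374/1000) \<le> real x / 16 - 1 \<and> real x powr (123/1000) \<le> real x / 16 - 1 \<and> real x \<ge> 3"
    using eventually_conj[OF ev1 ev2] unfolding eventually_at_top_linorder by metis
  show ?thesis
  proof (intro exI[of _ "max x1 x2"] allI impI)
    fix x Q z u
    assume x: "x \<ge> max x1 x2" and finQ: "finite Q" and Qz: "\<forall>q\<in>Q. prime q \<and> q \<le> z" and u: "1 \<le> u" "u \<le> card Q"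
      and Zx: "real z ^ u \<le> real x powr (123/1000)" and ux: "2 ^ u \<le> real x powr (1/1000)"
      and uQ: "(real u)\<^sup>2 * ln (real x) ^ 6 \<le> real (card Q)"
    note X = x2[of x, OF max.boundedE[OF x]]
    define Z where "Z = real z ^ u"
    define L where "L = 1 + ln (real x)"
    define D where "D = real (card Q choose u)"
    define U where "U = nat \<lfloor>real x powr (374/1000)\<rfloor>"
    define Jx where "Jx = nat \<lceil>log 2 (real x)\<rceil>"
    have Q: "\<And>q. q \<in> Q \<Longrightarrow> prime q" and z: "\<And>q. q \<in> Q \<Longrightarrow> q \<le> z" using Qz by auto
    have "Q \<noteq> {}" using u by auto
    then obtain q where "q \<in> Q" by blast
    hence z1: "z \<ge> 1" using z[of q] prime_ge_1_nat[OF Q[of q]] by linarith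
    have xr: "real x \<ge> 3" using X x by simp
    have L1: "L \<ge> 1" using xr by (simp add: L_def)
    have Z1: "Z \<ge> 1" using z1 by (simp add: Z_def)
    have zx: "z \<le> x div 16"
    proof -
      have "real z \<le> Z" unfolding Z_def using power_increasing[of 1 u "real z"] u z1 by simp
      also have "\<dots> \<le> real x / 16 - 1" using Zx X x by (simp add: Z_def)
      also have "\<dots> \<le> real (x div 16)" by linarith
      finally show ?thesis by simp
    qed
    have U1: "real U \<le> real x powr (374/1000)" "real U \<ge> real x powr (374/1000) / 2"
      using X x by (auto simp: U_def) linarith
    have Upos: "U \<ge> 1" using U1(2) X x by (simp add: Suc_le_eq)
    have U2: "U \<le> x div 16"
    proof -
      have "real U \<le> real x / 16 - 1" using U1 X x by simp
      also have "\<dots> \<le> real (x div 16)" by linarith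
      finally show ?thesis by simp
    qed
    have UU: "U * U \<le> x"
    proof -
      have "real U * real U \<le> real x powr (374/1000) * real x powr (374/1000)" using U1 by (intro mult_mono) auto
      also have "\<dots> = real x powr (748/1000)" by (simp add: powr_add[symmetric])
      also have "\<dots> \<le> real x powr 1" using xr by (intro powr_mono) auto
      finally have "real (U * U) \<le> real x" using xr by simp
      thus ?thesis by (simp only: of_nat_le_iff)
    qed
    have lg: "log 2 (real x) \<ge> 0" using xr by simp
    have Jx: "x \<le> 2 ^ Jx"
    proof -
      have "real x = 2 powr log 2 (real x)" using xr by simp
      also have "\<dots> \<le> 2 powr real Jx" unfolding Jx_def by (intro powr_mono) (use lg in linarith)+
      also have "\<dots> = real (2 ^ Jx)" by (simp add: powr_realpow)
      finally show ?thesis by (simp only: of_nat_le_iff)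
    qed
    have JL: "real Jx \<le> 2 * L"
    proof -
      have "real Jx \<le> log 2 (real x) + 1" using lg by (simp add: Jx_def)
      also have "log 2 (real x) = ln (real x) * (1 / ln 2)" by (simp add: log_def)
      also have "\<dots> \<le> ln (real x) * 2" using ln2_ge_two_thirds xr by (intro mult_left_mono) (auto simp: field_simps)
      finally show ?thesis by (simp add: L_def)
    qed
    define B where "B = 3 * L * real (U * U) * (2 ^ u * Z\<^sup>2)
         + 2 * real Jx * sqrt 2 * L ^ 3 * (real x * (real u / real (card Q)) + real x * (2 ^ u * (Z * sqrt Z)) / sqrt (real U)
              + sqrt (real x) * (2 ^ u * Z\<^sup>2) * sqrt (sqrt (real x)))"
    have "(\<Sum>m\<in>{1..u}. real ((card Q - m) choose (u - m)) * (\<Sum>J | J \<in> chars Q \<and> card (supp Q J) = m. norm (\<Sum>n\<in>{x div 16<..x}. of_real (mangoldt n) * chi Q J n)))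
       \<le> (\<Sum>m\<in>{1..u}. D * B)"
      unfolding B_def D_def L_def Z_def
      by (intro sum_mono weight_bounds[OF finQ Q z _ _ z1 u(2) Upos U2 UU Jx]) auto
    also have "\<dots> = D * (real u * B)" by simp
    finally have err: "(\<Sum>m\<in>{1..u}. real ((card Q - m) choose (u - m)) * (\<Sum>J | J \<in> chars Q \<and> card (supp Q J) = m. norm (\<Sum>n\<in>{x div 16<..x}. of_real (mangoldt n) * chi Q J n)))
       \<le> D * (real u * B)" .
    have u2: "real u * 2 ^ u \<le> real x powr (2/1000)"
    proof -
      have "real u \<le> 2 ^ u" using less_exp[of u] by (metis less_imp_le of_nat_le_iff of_nat_numeral of_nat_power)
      hence "real u \<le> real x powr (1/1000)" using ux by linarith
      hence "real u * 2 ^ u \<le> real x powr (1/1000) * real x powr (1/1000)" using ux by (intro mult_mono) auto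
      thus ?thesis by (simp add: powr_add[symmetric])
    qed
    \<comment> \<open>One factor \<open>u\<close> is the proportion \<open>u / card Q\<close> of
      moduli met by a character, the other comes from adding up \<open>u\<close> levels; hence
      \<open>u\<^sup>2\<close> in the hypothesis on \<open>card Q\<close>.\<close>
    have uQ': "real u * (real u / real (card Q)) \<le> 1 / ln (real x) ^ 6"
    proof -
      have "ln (real x) > 0" using xr by simp
      moreover have "real (card Q) > 0" using u by simp
      ultimately show ?thesis using uQ by (simp add: field_simps power2_eq_square)
    qed
    have Zx': "Z \<le> real x powr (123/1000)" using Zx by (simp add: Z_def)
    have "real u * B = 3 * L * real (U * U) * ((real u * 2 ^ u) * Z\<^sup>2)
         + 2 * real Jx * sqrt 2 * L ^ 3 * (real x * (real u * (real u / real (card Q))) + real x * ((real u * 2 ^ u) * (Z * sqrt Z)) / sqrt (real U)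
              + sqrt (real x) * ((real u * 2 ^ u) * Z\<^sup>2) * sqrt (sqrt (real x)))"
      unfolding B_def by (simp add: algebra_simps add_divide_distrib)
    also have "\<dots> \<le> 3 * L * (real x powr (374/1000))\<^sup>2 * (real x powr (2/1000) * (real x powr (123/1000))\<^sup>2)
         + 2 * (2 * L) * sqrt 2 * L ^ 3 * (real x * (1 / ln (real x) ^ 6) + real x * (real x powr (2/1000) * (real x powr (123/1000) * sqrt (real x powr (123/1000)))) / sqrt (real x powr (374/1000) / 2)
              + sqrt (real x) * (real x powr (2/1000) * (real x powr (123/1000))\<^sup>2) * sqrt (sqrt (real x)))"
    proof (intro add_mono mult_mono order_refl frac_le real_sqrt_le_mono power_mono u2 uQ' Zx' JL U1(2))
      show "real (U * U) \<le> (real x powr (374/1000))\<^sup>2"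
        using U1(1) by (simp add: power2_eq_square mult_mono)
    qed (use L1 Z1 xr in \<open>auto intro!: add_nonneg_nonneg mult_nonneg_nonneg divide_nonneg_nonneg\<close>)
    finally have uB: "real u * B \<le> 3 * L * (real x powr (374/1000))\<^sup>2 * (real x powr (2/1000) * (real x powr (123/1000))\<^sup>2)
         + 2 * (2 * L) * sqrt 2 * L ^ 3 * (real x * (1 / ln (real x) ^ 6) + real x * (real x powr (2/1000) * (real x powr (123/1000) * sqrt (real x powr (123/1000)))) / sqrt (real x powr (374/1000) / 2)
              + sqrt (real x) * (real x powr (2/1000) * (real x powr (123/1000))\<^sup>2) * sqrt (sqrt (real x)))" .
    have "Z * (sqrt (real x) * (2 * ln (real x)) * ln (real x)) \<le> real x powr (123/1000) * (sqrt (real x) * (2 * ln (real x)) * ln (real x))"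
      using Zx' xr by (intro mult_right_mono) auto
    hence tot: "real u * B + Z * (sqrt (real x) * (2 * ln (real x)) * ln (real x)) \<le> real x / 8"
      using uB X x unfolding L_def by linarith
    have D0: "D \<ge> 0" by (simp add: D_def)
    have "D * (\<Sum>n\<in>{x div 16<..x}. mangoldt n) - D * (real u * B) - D * Z * (sqrt (real x) * (2 * ln (real x)) * ln (real x)) \<ge> D * (real x / 8)"
    proof -
      have "D * (real x / 4) \<le> D * (\<Sum>n\<in>{x div 16<..x}. mangoldt n)" using x1[of x] x D0 by (intro mult_left_mono) auto
      moreover have "D * (real u * B + Z * (sqrt (real x) * (2 * ln (real x)) * ln (real x))) \<le> D * (real x / 8)"
        using tot D0 by (intro mult_left_mono)
      ultimately show ?thesis by (simp add: algebra_simps)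
    qed
    moreover have "(\<Sum>d\<in>usets Q u. real (\<Prod>q\<in>d. q - 1) * (\<Sum>n\<in>{x div 16<..x}. of_bool ([n = 1] (mod \<Prod>d)) * mangoldt n))
     \<ge> D * (\<Sum>n\<in>{x div 16<..x}. mangoldt n)
       - (\<Sum>m\<in>{1..u}. real ((card Q - m) choose (u - m)) * (\<Sum>J | J \<in> chars Q \<and> card (supp Q J) = m. norm (\<Sum>n\<in>{x div 16<..x}. of_real (mangoldt n) * chi Q J n)))
       - D * Z * (sqrt (real x) * (2 * ln (real x)) * ln (real x))"
      unfolding D_def Z_def using xr by (intro sum_usets_progression_ge[OF finQ Q z zx u(2) _ z1]) auto
    ultimately show "(\<Sum>d\<in>usets Q u. real (\<Prod>q\<in>d. q - 1) * (\<Sum>n\<in>{x div 16<..x}. of_bool ([n = 1] (mod \<Prod>d)) * mangoldt n))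
       \<ge> real (card Q choose u) * (real x / 8)"
      using err unfolding D_def by linarith
  qed
qed

section \<open>Exponential sums over primes in progressions\<close>

text \<open>Cauchy-Schwarz with differencing confined to windows of length \<open>R\<close>. First
  \<open>\<alpha>\<close> is removed, then the windows are separated at the cost of their number
  \<open>N / R + 2\<close>, and only pairs \<open>n\<close>, \<open>n'\<close> in a common window
  remain. Short differences keep the phases of the cross sums slowly varying, so that van der
  Corput's bound is effective.\<close>

lemma window_bound:
  fixes c :: "nat \<Rightarrow> nat \<Rightarrow> complex" and \<alpha> \<beta> :: "nat \<Rightarrow> real"
  assumes R: "R > 0" and fin: "finite A"
    and W: "\<And>n. n \<in> {N<..2*N} \<Longrightarrow> (\<Sum>n'\<in>{n'\<in>{N<..2*N}. n' div R = n div R}. norm (\<Sum>m\<in>A. c m n * cnj (c m n'))) \<le> W"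
    and W0: "W \<ge> 0"
  shows "norm (\<Sum>n\<in>{N<..2*N}. \<Sum>m\<in>A. of_real (\<alpha> m * \<beta> n) * c m n)
     \<le> sqrt (\<Sum>m\<in>A. (\<alpha> m)\<^sup>2) * sqrt (\<Sum>n\<in>{N<..2*N}. (\<beta> n)\<^sup>2) * sqrt ((real N / real R + 2) * W)"
proof -
  define I where "I = {N<..2*N}"
  define V where "V = {N div R..(2*N) div R}"
  define y where "y = (\<lambda>v m. \<Sum>n\<in>{n\<in>I. n div R = v}. of_real (\<beta> n) * c m n)"
  define G where "G = (\<lambda>n n'. \<Sum>m\<in>A. c m n * cnj (c m n'))"
  define S where "S = (\<Sum>n\<in>I. \<Sum>m\<in>A. of_real (\<alpha> m * \<beta> n) * c m n)"
  have finI: "finite I" by (simp add: I_def)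
  have Gsym: "norm (G n n') = norm (G n' n)" for n n'
  proof -
    have "cnj (G n n') = G n' n" unfolding G_def cnj_sum by (intro sum.cong refl) (simp add: mult.commute)
    thus ?thesis by (metis complex_mod_cnj)
  qed
  have cV: "real (card V) \<le> real N / real R + 2"
  proof -
    have e: "real (card V) \<le> real ((2 * N) div R) + 1 - real (N div R)"
      unfolding V_def using div_le_mono[of N "2*N" R] by (simp add: of_nat_diff)
    have 1: "real ((2 * N) div R) \<le> 2 * real N / real R"
      using of_nat_div_le_of_nat[of "2*N" R, where ?'a = real] by simp
    have "real N < real R * (real (N div R) + 1)"
    proof -
      have "N < R * (N div R + 1)" using R by (simp add: dividend_less_times_div)
      hence "real N < real (R * (N div R + 1))" by (simp only: of_nat_less_iff)
      thus ?thesis by (simp add: algebra_simps)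
    qed
    hence "real N / real R < real (N div R) + 1" using R by (simp add: field_simps)
    thus ?thesis using e 1 by simp
  qed
  have block: "(\<Sum>m\<in>A. (norm (y v m))\<^sup>2) \<le> W * (\<Sum>n\<in>{n\<in>I. n div R = v}. (\<beta> n)\<^sup>2)" for v
  proof -
    define B where "B = {n\<in>I. n div R = v}"
    have "complex_of_real (\<Sum>m\<in>A. (norm (y v m))\<^sup>2) = (\<Sum>n\<in>B. \<Sum>n'\<in>B. of_real (\<beta> n) * cnj (of_real (\<beta> n')) * (\<Sum>m\<in>A. c m n * cnj (c m n')))"
      unfolding y_def B_def[symmetric] by (rule sum_norm_square_expand)
    hence "(\<Sum>m\<in>A. (norm (y v m))\<^sup>2) = norm (\<Sum>n\<in>B. \<Sum>n'\<in>B. of_real (\<beta> n) * cnj (of_real (\<beta> n')) * G n n')"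
      unfolding G_def by (metis (no_types, lifting) abs_of_nonneg norm_of_real sum_nonneg zero_le_power2)
    also have "\<dots> \<le> (\<Sum>n\<in>B. \<Sum>n'\<in>B. \<bar>\<beta> n\<bar> * \<bar>\<beta> n'\<bar> * norm (G n n'))"
      by (rule order_trans[OF norm_sum] sum_mono)+ (simp add: norm_mult)
    \<comment> \<open>The arithmetic-geometric mean inequality together with the symmetry of the
      norms reduces the quadratic form to row sums, for which \<open>W\<close> is available.\<close>
    also have "\<dots> \<le> (\<Sum>n\<in>B. \<Sum>n'\<in>B. ((\<beta> n)\<^sup>2 * norm (G n n') + (\<beta> n')\<^sup>2 * norm (G n' n)) / 2)"
    proof (intro sum_mono)
      fix n n'
      have "0 \<le> (\<bar>\<beta> n\<bar> - \<bar>\<beta> n'\<bar>)\<^sup>2" by simp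
      hence "\<bar>\<beta> n\<bar> * \<bar>\<beta> n'\<bar> \<le> ((\<beta> n)\<^sup>2 + (\<beta> n')\<^sup>2) / 2" by (simp add: power2_diff)
      hence "\<bar>\<beta> n\<bar> * \<bar>\<beta> n'\<bar> * norm (G n n') \<le> ((\<beta> n)\<^sup>2 + (\<beta> n')\<^sup>2) / 2 * norm (G n n')" by (intro mult_right_mono) auto
      also have "\<dots> = ((\<beta> n)\<^sup>2 * norm (G n n') + (\<beta> n')\<^sup>2 * norm (G n' n)) / 2" by (simp add: Gsym[of n' n] algebra_simps)
      finally show "\<bar>\<beta> n\<bar> * \<bar>\<beta> n'\<bar> * norm (G n n') \<le> \<dots>" .
    qed
    also have "\<dots> = ((\<Sum>n\<in>B. \<Sum>n'\<in>B. (\<beta> n)\<^sup>2 * norm (G n n')) + (\<Sum>n\<in>B. \<Sum>n'\<in>B. (\<beta> n')\<^sup>2 * norm (G n' n))) / 2"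
      by (simp only: sum_divide_distrib[symmetric] sum.distrib)
    also have "(\<Sum>n\<in>B. \<Sum>n'\<in>B. (\<beta> n')\<^sup>2 * norm (G n' n)) = (\<Sum>n\<in>B. \<Sum>n'\<in>B. (\<beta> n)\<^sup>2 * norm (G n n'))"
      by (rule sum.swap)
    also have "((\<Sum>n\<in>B. \<Sum>n'\<in>B. (\<beta> n)\<^sup>2 * norm (G n n')) + (\<Sum>n\<in>B. \<Sum>n'\<in>B. (\<beta> n)\<^sup>2 * norm (G n n'))) / 2 = (\<Sum>n\<in>B. (\<beta> n)\<^sup>2 * (\<Sum>n'\<in>B. norm (G n n')))"
      by (simp only: sum_distrib_left) (simp only: mult_2[symmetric] nonzero_mult_div_cancel_left[OF zero_neq_numeral[symmetric]])
    also have "\<dots> \<le> (\<Sum>n\<in>B. (\<beta> n)\<^sup>2 * W)"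
    proof (intro sum_mono mult_left_mono)
      fix n assume n: "n \<in> B"
      have "B = {n'\<in>{N<..2*N}. n' div R = n div R}" using n by (auto simp: B_def I_def)
      thus "(\<Sum>n'\<in>B. norm (G n n')) \<le> W" using W[of n] n unfolding G_def by (auto simp: B_def I_def)
    qed auto
    also have "\<dots> = W * (\<Sum>n\<in>B. (\<beta> n)\<^sup>2)" unfolding sum_distrib_right[symmetric] by (rule mult.commute)
    finally show ?thesis unfolding B_def .
  qed
  have grp: "(\<Sum>v\<in>V. \<Sum>n\<in>{n\<in>I. n div R = v}. h n) = (\<Sum>n\<in>I. h n)" for h :: "nat \<Rightarrow> 'b::comm_monoid_add"
    using finI by (intro sum.group) (auto simp: V_def I_def intro!: div_le_mono)
  have Sm: "S = (\<Sum>m\<in>A. of_real (\<alpha> m) * (\<Sum>v\<in>V. y v m))"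
    unfolding S_def y_def grp by (subst sum.swap) (simp add: sum_distrib_left mult_ac)
  have "norm S \<le> (\<Sum>m\<in>A. \<bar>\<alpha> m\<bar> * norm (\<Sum>v\<in>V. y v m))"
    unfolding Sm by (rule order_trans[OF norm_sum]) (simp add: norm_mult)
  hence "(norm S)\<^sup>2 \<le> (\<Sum>m\<in>A. \<bar>\<alpha> m\<bar> * norm (\<Sum>v\<in>V. y v m))\<^sup>2" by (intro power_mono) auto
  also have "\<dots> \<le> (\<Sum>m\<in>A. \<bar>\<alpha> m\<bar>\<^sup>2) * (\<Sum>m\<in>A. (norm (\<Sum>v\<in>V. y v m))\<^sup>2)" by (rule Cauchy_Schwarz_ineq_sum)
  also have "\<dots> \<le> (\<Sum>m\<in>A. \<bar>\<alpha> m\<bar>\<^sup>2) * ((real N / real R + 2) * (W * (\<Sum>n\<in>I. (\<beta> n)\<^sup>2)))"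
  proof (rule mult_left_mono)
    have "(\<Sum>m\<in>A. (norm (\<Sum>v\<in>V. y v m))\<^sup>2) \<le> (\<Sum>m\<in>A. real (card V) * (\<Sum>v\<in>V. (norm (y v m))\<^sup>2))"
    proof (rule sum_mono)
      fix m
      have "(norm (\<Sum>v\<in>V. y v m))\<^sup>2 \<le> (\<Sum>v\<in>V. norm (y v m))\<^sup>2" by (intro power_mono norm_sum) auto
      also have "\<dots> \<le> (\<Sum>v\<in>V. (norm (y v m))\<^sup>2) * real (card V)" by (rule sum_squared_le_sum_of_squares)
      finally show "(norm (\<Sum>v\<in>V. y v m))\<^sup>2 \<le> real (card V) * (\<Sum>v\<in>V. (norm (y v m))\<^sup>2)" by (simp add: mult.commute)
    qed
    also have "\<dots> = real (card V) * (\<Sum>v\<in>V. \<Sum>m\<in>A. (norm (y v m))\<^sup>2)"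
      by (simp add: sum_distrib_left[symmetric] sum.swap[of _ A])
    also have "\<dots> \<le> real (card V) * (\<Sum>v\<in>V. W * (\<Sum>n\<in>{n\<in>I. n div R = v}. (\<beta> n)\<^sup>2))"
      by (intro mult_left_mono sum_mono block) auto
    also have "\<dots> = real (card V) * (W * (\<Sum>n\<in>I. (\<beta> n)\<^sup>2))" by (simp only: sum_distrib_left[symmetric] grp)
    also have "\<dots> \<le> (real N / real R + 2) * (W * (\<Sum>n\<in>I. (\<beta> n)\<^sup>2))"
      using W0 by (intro mult_right_mono cV mult_nonneg_nonneg sum_nonneg) auto
    finally show "(\<Sum>m\<in>A. (norm (\<Sum>v\<in>V. y v m))\<^sup>2) \<le> (real N / real R + 2) * (W * (\<Sum>n\<in>I. (\<beta> n)\<^sup>2))" .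
  qed (auto intro: sum_nonneg)
  finally have "norm S \<le> sqrt ((\<Sum>m\<in>A. \<bar>\<alpha> m\<bar>\<^sup>2) * ((real N / real R + 2) * (W * (\<Sum>n\<in>I. (\<beta> n)\<^sup>2))))"
    by (rule real_le_rsqrt)
  thus ?thesis unfolding S_def I_def by (simp add: real_sqrt_mult mult_ac)
qed

lemma cong_mult_one_solutions:
  fixes t d :: nat
  shows "(\<forall>k. \<not> [t * k = 1] (mod d)) \<or> (\<exists>r. \<forall>k. [t * k = 1] (mod d) \<longleftrightarrow> [k = r] (mod d))"
proof (cases "coprime t d")
  case True
  then obtain r where r: "[t * r = 1] (mod d)" using cong_solve_coprime_nat by auto
  have "[t * k = 1] (mod d) \<longleftrightarrow> [k = r] (mod d)" for k
  proof -
    have "[t * k = 1] (mod d) \<longleftrightarrow> [t * k = t * r] (mod d)" using r by (meson cong_sym cong_trans)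
    also have "\<dots> \<longleftrightarrow> [k = r] (mod d)" using True by (simp add: cong_mult_lcancel_nat coprime_commute)
    finally show ?thesis .
  qed
  thus ?thesis by blast
next
  case False
  have "\<not> [t * k = 1] (mod d)" for k
  proof
    assume "[t * k = 1] (mod d)"
    hence "coprime (t * k) d" by (metis cong_imp_coprime cong_sym coprime_1_left)
    thus False using False by simp
  qed
  thus ?thesis by blast
qed

lemma card_residue_window:
  fixes R d :: nat
  assumes "R > 0" "d > 0"
  shows "real (card {n\<in>{n\<in>S. n div R = v}. [n = a] (mod d)}) \<le> real R / real d + 2"
proof -
  have sub: "{n\<in>{n\<in>S. n div R = v}. [n = a] (mod d)} \<subseteq> {n\<in>{v * R..<v * R + R}. [n = a] (mod d)}"
  proof
    fix n assume n: "n \<in> {n\<in>{n\<in>S. n div R = v}. [n = a] (mod d)}"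
    hence "n = v * R + n mod R" by auto
    moreover have "n mod R < R" using assms by simp
    ultimately have "n \<in> {v * R..<v * R + R}" by auto
    thus "n \<in> {n\<in>{v * R..<v * R + R}. [n = a] (mod d)}" using n by auto
  qed
  have inj: "inj_on (\<lambda>n. n div d) {n\<in>{v * R..<v * R + R}. [n = a] (mod d)}"
  proof (rule inj_onI)
    fix n n' assume "n \<in> {n\<in>{v * R..<v * R + R}. [n = a] (mod d)}" "n' \<in> {n\<in>{v * R..<v * R + R}. [n = a] (mod d)}" "n div d = n' div d"
    hence "n mod d = n' mod d" "n div d = n' div d" by (auto simp: unique_euclidean_semiring_class.cong_def)
    thus "n = n'" by (metis div_mult_mod_eq)
  qed
  have img: "(\<lambda>n. n div d) ` {n\<in>{v * R..<v * R + R}. [n = a] (mod d)} \<subseteq> {(v * R) div d..(v * R + R - 1) div d}"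
    by (auto intro!: div_le_mono)
  have "card {n\<in>{n\<in>S. n div R = v}. [n = a] (mod d)} \<le> card {n\<in>{v * R..<v * R + R}. [n = a] (mod d)}"
    by (intro card_mono sub) auto
  also have "\<dots> = card ((\<lambda>n. n div d) ` {n\<in>{v * R..<v * R + R}. [n = a] (mod d)})" by (rule card_image[OF inj, symmetric])
  also have "\<dots> \<le> card {(v * R) div d..(v * R + R - 1) div d}" by (intro card_mono img) auto
  finally have "card {n\<in>{n\<in>S. n div R = v}. [n = a] (mod d)} \<le> (v * R + R - 1) div d + 1 - (v * R) div d" by simp
  moreover have "(v * R) div d \<le> (v * R + R - 1) div d" using assms by (intro div_le_mono) simp
  ultimately have "card {n\<in>{n\<in>S. n div R = v}. [n = a] (mod d)} + (v * R) div d \<le> (v * R + R - 1) div d + 1" by linarith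
  hence "real (card {n\<in>{n\<in>S. n div R = v}. [n = a] (mod d)} + (v * R) div d) \<le> real ((v * R + R - 1) div d + 1)"
    by (simp only: of_nat_le_iff)
  hence "real (card {n\<in>{n\<in>S. n div R = v}. [n = a] (mod d)}) \<le> real ((v * R + R - 1) div d) + 1 - real ((v * R) div d)"
    unfolding of_nat_add by linarith
  also have "real ((v * R + R - 1) div d) \<le> (real (v * R) + real R) / real d"
  proof -
    have "real ((v * R + R - 1) div d) \<le> real (v * R + R - 1) / real d" by (rule of_nat_div_le_of_nat)
    also have "\<dots> \<le> real (v * R + R) / real d"
      by (intro divide_right_mono) (simp_all only: of_nat_le_iff of_nat_0_le_iff diff_le_self)
    also have "\<dots> = (real (v * R) + real R) / real d" by (simp only: of_nat_add)
    finally show ?thesis .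
  qed
  finally have F: "real (card {n\<in>{n\<in>S. n div R = v}. [n = a] (mod d)}) \<le> (real (v * R) + real R) / real d + 1 - real ((v * R) div d)" by simp
  have "real (v * R) / real d < real ((v * R) div d) + 1"
  proof -
    have "v * R < d * ((v * R) div d + 1)" using assms by (simp add: dividend_less_times_div)
    hence "real (v * R) < real (d * ((v * R) div d + 1))" by (simp only: of_nat_less_iff)
    hence "real (v * R) < real d * (real ((v * R) div d) + 1)" by (simp only: of_nat_mult of_nat_add of_nat_1)
    thus ?thesis using assms by (simp add: field_simps del: of_nat_mult)
  qed
  thus ?thesis using F unfolding add_divide_distrib by linarith
qed

lemma powr_diff_bounds:
  fixes g :: real and n n' N :: nat
  assumes g: "0 < g" "g < 1" and n: "N < n" "n < n'" "n' \<le> 2 * N"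
  shows "real n' powr g - real n powr g \<le> real N powr (g - 1) * real (n' - n)"
    and "real n' powr g - real n powr g \<ge> g * (2 * real N) powr (g - 1)"
proof -
  have N0: "N > 0" using n by linarith
  have "\<exists>x>real n. x < real n' \<and> real n' powr g - real n powr g = (real n' - real n) * (g * x powr (g - 1))"
    using n by (intro MVT2) (auto intro!: derivative_eq_intros simp: powr_diff)
  then obtain x where x: "real n < x" "x < real n'" "real n' powr g - real n powr g = (real n' - real n) * (g * x powr (g - 1))" by blast
  have "x powr (g - 1) \<le> real N powr (g - 1)" using x n N0 g by (intro powr_mono2') auto
  hence "g * x powr (g - 1) \<le> 1 * real N powr (g - 1)" using g by (intro mult_mono) auto
  hence "(real n' - real n) * (g * x powr (g - 1)) \<le> (real n' - real n) * (1 * real N powr (g - 1))" using n by (intro mult_left_mono) auto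
  thus "real n' powr g - real n powr g \<le> real N powr (g - 1) * real (n' - n)" unfolding x(3) using n by (simp add: of_nat_diff mult.commute)
  have "(2 * real N) powr (g - 1) \<le> x powr (g - 1)" using x n N0 g by (intro powr_mono2') auto
  hence "1 * (g * (2 * real N) powr (g - 1)) \<le> (real n' - real n) * (g * x powr (g - 1))" using n g by (intro mult_mono) auto
  thus "real n' powr g - real n powr g \<ge> g * (2 * real N) powr (g - 1)" unfolding x(3) by simp
qed

definition psf :: "real \<Rightarrow> nat \<Rightarrow> nat \<Rightarrow> nat \<Rightarrow> complex" where
  "psf g d h n = of_bool ([n = 1] (mod d)) * e2 (real h * real n powr g)"

text \<open>The conclusion of \<open>vdc_power_progression\<close> for one constant, packaged so
  that the same \<open>C\<close> can be passed through the estimates below.\<close>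

definition vdc_const :: "real \<Rightarrow> real \<Rightarrow> bool" where
  "vdc_const g C \<longleftrightarrow> C > 0 \<and> (\<forall>A B d r lo hi. A \<noteq> 0 \<longrightarrow> d \<ge> (1::nat) \<longrightarrow> real d \<le> B \<longrightarrow> B / 64 \<le> real lo \<longrightarrow> real hi \<le> B \<longrightarrow>
     norm (\<Sum>m\<in>{m\<in>{lo<..hi}. [m = r] (mod d)}. e2 (A * real m powr g))
       \<le> C * ((B / real d + 1) * sqrt (\<bar>A\<bar> * real d ^ 2 * B powr (g - 2)) + 1 / sqrt (\<bar>A\<bar> * real d ^ 2 * B powr (g - 2))))"

text \<open>The factor \<open>d\<close> in the square root of the second difference cancels against
  the number of terms of the progression, as \<open>(B / d + 1) * d \<le> 2 * B\<close>. The result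
  is uniform in \<open>d\<close>.\<close>

lemma vdc_progression_bound:
  assumes C: "vdc_const g C" and A: "A \<noteq> 0" and d: "d \<ge> (1::nat)" "real d \<le> B" and lo: "B / 64 \<le> real lo" and hi: "real hi \<le> B"
    and mu: "0 < \<mu>1" "\<mu>1 \<le> \<bar>A\<bar> * B powr (g - 2)" "\<bar>A\<bar> * B powr (g - 2) \<le> \<mu>2"
  shows "norm (\<Sum>m\<in>{m\<in>{lo<..hi}. [m = r] (mod d)}. e2 (A * real m powr g)) \<le> C * (2 * B * sqrt \<mu>2 + 1 / sqrt \<mu>1)"
proof -
  define \<mu> where "\<mu> = \<bar>A\<bar> * B powr (g - 2)"
  have C0: "C > 0" using C by (simp add: vdc_const_def)
  have B0: "B > 0" using d by linarith
  have mu0: "\<mu> > 0" using mu by (simp add: \<mu>_def)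
  have e: "sqrt (\<bar>A\<bar> * real d ^ 2 * B powr (g - 2)) = real d * sqrt \<mu>" by (simp add: \<mu>_def real_sqrt_mult mult_ac)
  have "norm (\<Sum>m\<in>{m\<in>{lo<..hi}. [m = r] (mod d)}. e2 (A * real m powr g))
       \<le> C * ((B / real d + 1) * (real d * sqrt \<mu>) + 1 / (real d * sqrt \<mu>))"
    using C A d lo hi unfolding vdc_const_def e[symmetric] by blast
  also have "\<dots> \<le> C * (2 * B * sqrt \<mu>2 + 1 / sqrt \<mu>1)"
  proof (intro mult_left_mono add_mono)
    have "(B / real d + 1) * (real d * sqrt \<mu>) = (B + real d) * sqrt \<mu>" using d by (simp add: field_simps)
    also have "\<dots> \<le> (2 * B) * sqrt \<mu>2" using d mu B0 by (intro mult_mono real_sqrt_le_mono) (auto simp: \<mu>_def)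
    finally show "(B / real d + 1) * (real d * sqrt \<mu>) \<le> 2 * B * sqrt \<mu>2" .
    have "1 * sqrt \<mu>1 \<le> real d * sqrt \<mu>" using d mu by (intro mult_mono real_sqrt_le_mono) (auto simp: \<mu>_def)
    thus "1 / (real d * sqrt \<mu>) \<le> 1 / sqrt \<mu>1" using mu by (intro divide_left_mono) (use d mu0 in \<open>auto intro!: mult_pos_pos\<close>)
  qed (use C0 in auto)
  finally show ?thesis .
qed

text \<open>The phase is \<open>A * k powr g\<close> with \<open>A = h * t powr g\<close> on a range
  of size \<open>B = x / t\<close>, so
  \<open>A * B powr (g - 2) = h * t\<^sup>2 * x powr (g - 2)\<close>. The factor \<open>t\<close>
  from its square root cancels against \<open>B\<close>, leaving \<open>x powr (1/2)\<close>; the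
  second term is \<open>x powr (1 - g / 2)\<close>, and \<open>1 - g / 2 < 0.51\<close>.\<close>

lemma ps_type1:
  assumes C: "vdc_const g C" and g: "145/147 < g" "g < 1" and d: "d \<ge> 1" and h: "h \<ge> (1::nat)" and hx: "real h \<le> C0 * real x powr (1 - g)"
    and t: "1 \<le> t" and big: "real d \<le> real x / real t" "real x / real t \<ge> 96" and H: "H \<le> x div t"
  shows "norm (\<Sum>k\<in>{x div 16 div t<..H}. psf g d h (t * k)) \<le> C * (2 * sqrt C0 + 1) * real x powr (51/100)"
proof -
  define B where "B = real x / real t"
  define A where "A = real h * real t powr g"
  have C0: "C > 0" using C by (simp add: vdc_const_def)
  have x1: "real x \<ge> 1" using big t by (simp add: field_simps)
  have C00: "C0 \<ge> 0"
  proof (rule ccontr)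
    assume "\<not> C0 \<ge> 0"
    hence "C0 * real x powr (1 - g) \<le> 0" by (intro mult_nonpos_nonneg) auto
    thus False using hx h by simp
  qed
  have T0: "C * (2 * sqrt C0 + 1) * real x powr (51/100) \<ge> 0" using C0 C00 by simp
  have eq: "(\<Sum>k\<in>{x div 16 div t<..H}. psf g d h (t * k)) = (\<Sum>k\<in>{k\<in>{x div 16 div t<..H}. [t * k = 1] (mod d)}. e2 (A * real k powr g))"
  proof -
    have "(\<Sum>k\<in>{x div 16 div t<..H}. psf g d h (t * k)) = (\<Sum>k\<in>{x div 16 div t<..H}. if [t * k = 1] (mod d) then e2 (A * real k powr g) else 0)"
      unfolding psf_def A_def by (intro sum.cong refl) (simp add: powr_mult mult.assoc)
    also have "\<dots> = (\<Sum>k\<in>{k\<in>{x div 16 div t<..H}. [t * k = 1] (mod d)}. e2 (A * real k powr g))"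
      by (rule sum.inter_filter[symmetric]) simp
    finally show ?thesis .
  qed
  from cong_mult_one_solutions[of t d] show ?thesis
  proof
    assume "\<forall>k. \<not> [t * k = 1] (mod d)"
    thus ?thesis unfolding eq using T0 by simp
  next
    assume "\<exists>r. \<forall>k. [t * k = 1] (mod d) \<longleftrightarrow> [k = r] (mod d)"
    then obtain r where r: "\<And>k. [t * k = 1] (mod d) \<longleftrightarrow> [k = r] (mod d)" by blast
    have Ab: "\<bar>A\<bar> * B powr (g - 2) = real h * (real t)\<^sup>2 * real x powr (g - 2)"
    proof -
      have "real t powr g * (real x / real t) powr (g - 2) = real t powr g / real t powr (g - 2) * real x powr (g - 2)"
        using t x1 by (simp add: powr_divide)
      also have "real t powr g / real t powr (g - 2) = real t powr 2" using t by (simp add: powr_diff[symmetric])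
      finally show ?thesis using t by (simp add: A_def B_def mult_ac)
    qed
    have "norm (\<Sum>k\<in>{k\<in>{x div 16 div t<..H}. [k = r] (mod d)}. e2 (A * real k powr g))
       \<le> C * (2 * B * sqrt (real h * (real t)\<^sup>2 * real x powr (g - 2)) + 1 / sqrt (real x powr (g - 2)))"
    proof (rule vdc_progression_bound[OF C])
      show "A \<noteq> 0" using h t by (simp add: A_def)
      show "d \<ge> 1" "real d \<le> B" using d big by (auto simp: B_def)
      have "real (x div 16 div t) \<ge> (real x / 16 - 1) / real t - 1"
      proof -
        have "real x / 16 - 1 \<le> real (x div 16)" by linarith
        hence "(real x / 16 - 1) / real t \<le> real (x div 16) / real t" by (intro divide_right_mono) auto
        also have "\<dots> \<le> real (x div 16 div t) + 1"
        proof -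
          have "x div 16 < t * (x div 16 div t + 1)" using t by (simp add: dividend_less_times_div)
          hence "real (x div 16) < real (t * (x div 16 div t + 1))" by (simp only: of_nat_less_iff)
          hence "real (x div 16) \<le> real t * (real (x div 16 div t) + 1)" by (simp add: algebra_simps)
          thus ?thesis using t by (simp add: field_simps)
        qed
        finally show ?thesis by simp
      qed
      moreover have "(real x / 16 - 1) / real t - 1 \<ge> B / 64"
      proof -
        have "1 / real t \<le> 1" using t by simp
        moreover have "B \<ge> 96" using big(2) by (simp add: B_def)
        ultimately have "B / 16 - 1 / real t - 1 \<ge> B / 64" by linarith
        thus ?thesis by (simp add: B_def diff_divide_distrib)
      qed
      ultimately show "B / 64 \<le> real (x div 16 div t)" by linarith
      have "real H \<le> real (x div t)" using H by simp
      also have "\<dots> \<le> B" unfolding B_def by (rule of_nat_div_le_of_nat)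
      finally show "real H \<le> B" .
      show "0 < real x powr (g - 2)" using x1 by simp
      have "1 * 1 * real x powr (g - 2) \<le> real h * (real t)\<^sup>2 * real x powr (g - 2)"
        using h t by (intro mult_mono mult_right_mono) auto
      thus "real x powr (g - 2) \<le> \<bar>A\<bar> * B powr (g - 2)" unfolding Ab by simp
      show "\<bar>A\<bar> * B powr (g - 2) \<le> real h * (real t)\<^sup>2 * real x powr (g - 2)" unfolding Ab ..
    qed
    also have "\<dots> \<le> C * (2 * sqrt C0 * real x powr (51/100) + real x powr (51/100))"
    proof (intro mult_left_mono add_mono)
      have "sqrt (real h * (real t)\<^sup>2 * real x powr (g - 2)) = real t * sqrt (real h * real x powr (g - 2))"
        using t by (simp add: real_sqrt_mult)
      hence "2 * B * sqrt (real h * (real t)\<^sup>2 * real x powr (g - 2)) = 2 * real x * sqrt (real h * real x powr (g - 2))"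
        using t by (simp add: B_def)
      also have "\<dots> \<le> 2 * real x * sqrt (C0 * real x powr (1 - g) * real x powr (g - 2))"
        using hx by (intro mult_left_mono real_sqrt_le_mono mult_right_mono) auto
      also have "real x powr (1 - g) * real x powr (g - 2) = real x powr (-1)" unfolding powr_add[symmetric] by simp
      hence "C0 * real x powr (1 - g) * real x powr (g - 2) = C0 * real x powr (-1)" by (simp only: mult.assoc)
      also have "sqrt (C0 * real x powr (-1)) = sqrt C0 * real x powr (-1/2)"
      proof -
        have "sqrt (real x powr (-1)) = (real x powr (-1)) powr (1/2)" by (rule powr_half_sqrt[symmetric]) simp
        also have "\<dots> = real x powr (-1/2)" unfolding powr_powr by simp
        finally show ?thesis by (simp only: real_sqrt_mult)
      qed
      also have "2 * real x * (sqrt C0 * real x powr (-1/2)) = 2 * sqrt C0 * (real x powr 1 * real x powr (-1/2))" using x1 by simp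
      also have "real x powr 1 * real x powr (-1/2) = real x powr (1/2)" by (simp only: powr_add[symmetric]) simp
      also have "2 * sqrt C0 * real x powr (1/2) \<le> 2 * sqrt C0 * real x powr (51/100)" using x1 C00 by (intro mult_left_mono powr_mono) auto
      finally show "2 * B * sqrt (real h * (real t)\<^sup>2 * real x powr (g - 2)) \<le> 2 * sqrt C0 * real x powr (51/100)" .
      have "1 / sqrt (real x powr (g - 2)) = real x powr (- ((g - 2) / 2))"
        using x1 by (simp add: powr_half_sqrt[symmetric] powr_powr powr_minus inverse_eq_divide)
      also have "\<dots> \<le> real x powr (51/100)"
      proof (rule powr_mono)
        have "- ((g - 2) / 2) = 1 - g / 2" by (simp add: field_simps)
        thus "- ((g - 2) / 2) \<le> 51 / 100" using g by linarith
      qed (use x1 in auto)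
      finally show "1 / sqrt (real x powr (g - 2)) \<le> real x powr (51/100)" .
    qed (use C0 in auto)
    finally show ?thesis unfolding eq r by (simp add: algebra_simps)
  qed
qed


lemma card_residue_Ioc_le:
  assumes "d > 0" shows "real (card {m\<in>{1..M}. [m = r] (mod d)}) \<le> real M / real d + 1"
proof -
  obtain a b r0 where ab: "bij_betw (\<lambda>t. r0 + d * t) {a..<b} {m\<in>{0<..M}. [m = r] (mod d)}" "real (b - a) \<le> real M / real d + 1"
    using cong_residue_Ioc[OF assms, of 0 M r] by blast
  have "{m\<in>{1..M}. [m = r] (mod d)} = {m\<in>{0<..M}. [m = r] (mod d)}" by auto
  thus ?thesis using bij_betw_same_card[OF ab(1)] ab(2) by simp
qed

lemma sum_delta_le:
  fixes f :: "'a \<Rightarrow> real"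
  assumes "finite B" "\<And>n'. n' \<in> B \<Longrightarrow> f n' \<le> (if n' = n then a else if P n' then e else 0)" "a \<ge> 0" "e \<ge> 0"
    and "real (card {n'\<in>B. P n'}) \<le> k"
  shows "sum f B \<le> a + k * e"
proof -
  have "sum f B \<le> (\<Sum>n'\<in>B. (if n' = n then a else 0) + (if P n' then e else 0))"
    by (rule sum_mono, rule order_trans[OF assms(2)]) (use assms(3,4) in auto)
  also have "\<dots> = (\<Sum>n'\<in>B. if n' = n then a else 0) + (\<Sum>n'\<in>{n'\<in>B. P n'}. e)"
    using assms(1) by (simp only: sum.distrib sum.inter_filter)
  also have "(\<Sum>n'\<in>B. if n' = n then a else 0) \<le> a" using assms(1,3) by (simp add: sum.delta')
  also have "(\<Sum>n'\<in>{n'\<in>B. P n'}. e) \<le> k * e" using assms(4,5) by (simp add: mult_right_mono)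
  finally show ?thesis by simp
qed

text \<open>Both \<open>n * m\<close> and \<open>n' * m\<close> must be \<open>1\<close> modulo
  \<open>d\<close>, which forces \<open>n\<close> and \<open>n'\<close> to be congruent. A window
  therefore has one diagonal pair, bounded by the number of admissible \<open>m\<close>, and at most
  \<open>R / d + 2\<close> further ones. Each of the latter is a power sum over a progression with
  coefficient of size at most \<open>h * N powr (g - 1) * R\<close>, bounded by
  \<open>E0\<close>.\<close>

lemma ps_type2:
  fixes x N R d h :: nat and \<alpha> \<beta> :: "nat \<Rightarrow> real"
  assumes C: "vdc_const g C" and g: "145/147 < g" "g < 1" and d: "d \<ge> 1" and h: "h \<ge> (1::nat)" and hx: "real h \<le> C0 * real x powr (1 - g)"
    and N: "N \<ge> 1" and big: "real d \<le> real x / real N" "real x / real N \<ge> 96" and R: "R > 0"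
  defines "E0 \<equiv> C * (2 * sqrt C0 * sqrt (real R * real x / real N) + 2 * real x powr (51/100) / sqrt (real N))"
  shows "norm (\<Sum>n\<in>{N<..2*N}. \<Sum>m\<in>{1..x div N}. of_bool (x div 16 < m * n \<and> m * n \<le> x) * of_real (\<alpha> m * \<beta> n) * psf g d h (m * n))
     \<le> sqrt (\<Sum>m\<in>{1..x div N}. (\<alpha> m)\<^sup>2) * sqrt (\<Sum>n\<in>{N<..2*N}. (\<beta> n)\<^sup>2)
        * sqrt ((real N / real R + 2) * (real x / (real N * real d) + 1 + (real R / real d + 2) * E0))"
proof -
  define M where "M = x div N"
  define y where "y = x div 16"
  define c where "c = (\<lambda>m n. of_bool (y < m * n \<and> m * n \<le> x) * psf g d h (m * n))"
  define B where "B = real x / real N"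
  have C1: "C > 0" using C by (simp add: vdc_const_def)
  have x0: "real x > 0" using big N by (simp add: field_simps)
  have x1: "real x \<ge> 1" using x0 by simp
  have C00: "C0 \<ge> 0"
  proof (rule ccontr)
    assume "\<not> C0 \<ge> 0"
    hence "C0 * real x powr (1 - g) \<le> 0" by (intro mult_nonpos_nonneg) auto
    thus False using hx h by simp
  qed
  have E0: "E0 \<ge> 0" unfolding E0_def using C1 C00 by (intro mult_nonneg_nonneg add_nonneg_nonneg divide_nonneg_nonneg) auto
  have d0: "d > 0" using d by simp
  have MB: "real M \<le> B" unfolding M_def B_def by (rule of_nat_div_le_of_nat)
  have cnorm: "norm (c m n) \<le> of_bool ([n * m = 1] (mod d))" for m n
    by (auto simp: c_def psf_def norm_mult mult.commute)
  have diag: "norm (\<Sum>m\<in>{1..M}. c m n * cnj (c m n)) \<le> real M / real d + 1" for n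
  proof -
    have "norm (\<Sum>m\<in>{1..M}. c m n * cnj (c m n)) \<le> (\<Sum>m\<in>{1..M}. of_bool ([n * m = 1] (mod d)))"
    proof (rule sum_norm_le)
      fix m
      have "norm (c m n * cnj (c m n)) \<le> of_bool ([n * m = 1] (mod d)) * of_bool ([n * m = 1] (mod d))"
        unfolding norm_mult complex_mod_cnj by (intro mult_mono cnorm) auto
      thus "norm (c m n * cnj (c m n)) \<le> of_bool ([n * m = 1] (mod d))"
        by (simp only: of_bool_conj[symmetric] conj_absorb)
    qed
    also have "\<dots> = real (card {m\<in>{1..M}. [n * m = 1] (mod d)})" by (simp add: Int_def)
    also have "\<dots> \<le> real M / real d + 1"
      using cong_mult_one_solutions[of n d]
    proof
      assume "\<forall>k. \<not> [n * k = 1] (mod d)" thus ?thesis by simp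
    next
      assume "\<exists>r. \<forall>k. [n * k = 1] (mod d) \<longleftrightarrow> [k = r] (mod d)"
      then obtain r where "\<And>k. [n * k = 1] (mod d) \<longleftrightarrow> [k = r] (mod d)" by blast
      thus ?thesis using card_residue_Ioc_le[OF d0, of M r] by simp
    qed
    finally show ?thesis .
  qed
  have offc: "norm (\<Sum>m\<in>{1..M}. c m n * cnj (c m n')) \<le> (if [n' = n] (mod d) then E0 else 0)"
    if n: "n \<in> {N<..2*N}" "n' \<in> {N<..2*N}" "n div R = n' div R" "n \<noteq> n'" for n n'
  proof (cases "[n' = n] (mod d)")
    case False
    \<comment> \<open>If both congruences held, \<open>n * n' * m\<close> would be congruent to
      \<open>n\<close> as well as to \<open>n'\<close>.\<close>
    have "c m n * cnj (c m n') = 0" for m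
    proof (cases "[n * m = 1] (mod d) \<and> [n' * m = 1] (mod d)")
      case True
      have "[n = n * (n' * m)] (mod d)" using cong_scalar_left[of "n' * m" 1 d n] True by (simp add: cong_sym)
      moreover have "[n' * (n * m) = n'] (mod d)" using cong_scalar_left[of "n * m" 1 d n'] True by simp
      ultimately have "[n' = n] (mod d)" by (metis cong_sym cong_trans mult.left_commute)
      thus ?thesis using False by simp
    next
      case False
      hence "norm (c m n) = 0 \<or> norm (c m n') = 0" using cnorm[of m n] cnorm[of m n'] by auto
      thus ?thesis by auto
    qed
    hence "(\<Sum>m\<in>{1..M}. c m n * cnj (c m n')) = 0" by (intro sum.neutral ballI)
    thus ?thesis using False by simp
  next
    case True
    define A where "A = real h * (real n powr g - real n' powr g)"
    define lo where "lo = max (y div n) (y div n')"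
    define hi where "hi = min M (min (x div n) (x div n'))"
    have n0: "n > 0" "n' > 0" using n by auto
    have iff: "y < m * n \<longleftrightarrow> y div n < m" "m * n \<le> x \<longleftrightarrow> m \<le> x div n" "y < m * n' \<longleftrightarrow> y div n' < m" "m * n' \<le> x \<longleftrightarrow> m \<le> x div n'" for m
      using n0 by (auto simp: div_less_iff_less_mult less_eq_div_iff_mult_less_eq)
    have eqn: "[n' * m = 1] (mod d) \<longleftrightarrow> [n * m = 1] (mod d)" for m
      using True by (meson cong_scalar_right cong_sym cong_trans)
    have prod: "c m n * cnj (c m n') = (if m \<in> {lo<..hi} \<and> [n * m = 1] (mod d) then e2 (A * real m powr g) else 0)" if "m \<in> {1..M}" for m
    proof -
      have "e2 (real h * real (m * n) powr g) * cnj (e2 (real h * real (m * n') powr g)) = e2 (A * real m powr g)"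
        unfolding e2_minus[symmetric] e2_add[symmetric] A_def by (simp add: powr_mult algebra_simps)
      moreover have "m \<in> {lo<..hi} \<longleftrightarrow> (y < m * n \<and> m * n \<le> x) \<and> (y < m * n' \<and> m * n' \<le> x)"
        unfolding iff lo_def hi_def using that by auto
      ultimately show ?thesis unfolding c_def psf_def using eqn[of m] by (auto simp: mult.commute)
    qed
    have "(\<Sum>m\<in>{1..M}. c m n * cnj (c m n')) = (\<Sum>m\<in>{1..M}. if m \<in> {lo<..hi} \<and> [n * m = 1] (mod d) then e2 (A * real m powr g) else 0)"
      by (intro sum.cong refl prod)
    also have "\<dots> = (\<Sum>m\<in>{m\<in>{1..M}. m \<in> {lo<..hi} \<and> [n * m = 1] (mod d)}. e2 (A * real m powr g))"
      by (rule sum.inter_filter[symmetric]) simp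
    also have "{m\<in>{1..M}. m \<in> {lo<..hi} \<and> [n * m = 1] (mod d)} = {m\<in>{lo<..hi}. [n * m = 1] (mod d)}"
      by (auto simp: hi_def)
    finally have S: "(\<Sum>m\<in>{1..M}. c m n * cnj (c m n')) = (\<Sum>m\<in>{m\<in>{lo<..hi}. [n * m = 1] (mod d)}. e2 (A * real m powr g))" .
    from cong_mult_one_solutions[of n d] have "norm (\<Sum>m\<in>{m\<in>{lo<..hi}. [n * m = 1] (mod d)}. e2 (A * real m powr g)) \<le> E0"
    proof
      assume "\<forall>k. \<not> [n * k = 1] (mod d)" thus ?thesis using E0 by simp
    next
      assume "\<exists>r. \<forall>k. [n * k = 1] (mod d) \<longleftrightarrow> [k = r] (mod d)"
      then obtain r where r: "\<And>k. [n * k = 1] (mod d) \<longleftrightarrow> [k = r] (mod d)" by blast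
      have dist: "real (n' - n) \<le> real R" "real (n - n') \<le> real R"
      proof -
        have "n = n div R * R + n mod R" by (rule div_mult_mod_eq[symmetric])
        moreover have "n' = n' div R * R + n' mod R" by (rule div_mult_mod_eq[symmetric])
        hence "n' = n div R * R + n' mod R" by (simp only: n(3))
        moreover have "n mod R < R" "n' mod R < R" using R by auto
        ultimately show "real (n' - n) \<le> real R" "real (n - n') \<le> real R" by linarith+
      qed
      have Ab: "real h * (g * (2 * real N) powr (g - 1)) \<le> \<bar>A\<bar> \<and> \<bar>A\<bar> \<le> real h * (real N powr (g - 1) * real R)"
      proof -
        define \<Delta> where "\<Delta> = \<bar>real n powr g - real n' powr g\<bar>"
        have "g * (2 * real N) powr (g - 1) \<le> \<Delta> \<and> \<Delta> \<le> real N powr (g - 1) * real R"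
        proof (cases "n < n'")
          case True
          have "real n' powr g - real n powr g \<ge> 0" using True g by (simp add: powr_mono2)
          hence "\<Delta> = real n' powr g - real n powr g" by (simp add: \<Delta>_def)
          moreover have "real N powr (g - 1) * real (n' - n) \<le> real N powr (g - 1) * real R" using dist by (intro mult_left_mono) auto
          moreover have "real n' powr g - real n powr g \<le> real N powr (g - 1) * real (n' - n)"
            by (rule powr_diff_bounds) (use g n True in auto)
          moreover have "real n' powr g - real n powr g \<ge> g * (2 * real N) powr (g - 1)"
            by (rule powr_diff_bounds) (use g n True in auto)
          ultimately show ?thesis by linarith
        next
          case False
          hence F: "n' < n" using n by auto
          have "real n powr g - real n' powr g \<ge> 0" using F g by (simp add: powr_mono2)
          hence "\<Delta> = real n powr g - real n' powr g" by (simp add: \<Delta>_def)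
          moreover have "real N powr (g - 1) * real (n - n') \<le> real N powr (g - 1) * real R" using dist by (intro mult_left_mono) auto
          moreover have "real n powr g - real n' powr g \<le> real N powr (g - 1) * real (n - n')"
            by (rule powr_diff_bounds) (use g n F in auto)
          moreover have "real n powr g - real n' powr g \<ge> g * (2 * real N) powr (g - 1)"
            by (rule powr_diff_bounds) (use g n F in auto)
          ultimately show ?thesis by linarith
        qed
        moreover have "\<bar>A\<bar> = real h * \<Delta>" by (simp add: A_def \<Delta>_def abs_mult)
        ultimately show ?thesis by (simp add: mult_left_mono)
      qed
      have NB: "real N powr (g - 1) * B powr (g - 2) = real N * real x powr (g - 2)"
      proof -
        have "real N powr (g - 1) * B powr (g - 2) = real N powr (g - 1) / real N powr (g - 2) * real x powr (g - 2)"
          unfolding B_def using x0 N by (simp add: powr_divide)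
        also have "real N powr (g - 1) / real N powr (g - 2) = real N" using N by (simp add: powr_diff[symmetric])
        finally show ?thesis .
      qed
      have "norm (\<Sum>m\<in>{m\<in>{lo<..hi}. [m = r] (mod d)}. e2 (A * real m powr g))
         \<le> C * (2 * B * sqrt (C0 * real R * real N / real x) + 1 / sqrt (real N * real x powr (g - 2) / 4))"
      proof (rule vdc_progression_bound[OF C])
        have "0 < real h * (g * (2 * real N) powr (g - 1))" using h g N by simp
        thus "A \<noteq> 0" using Ab by auto
        show "d \<ge> 1" "real d \<le> B" using d big by (auto simp: B_def)
        show "B / 64 \<le> real lo"
        proof -
          have "real x / 16 - 1 \<le> real y" unfolding y_def by linarith
          moreover have "real y / real n \<le> real (y div n) + 1"
          proof -
            have "y < n * (y div n + 1)" using n0 by (simp add: dividend_less_times_div)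
            hence "real y < real (n * (y div n + 1))" by (simp only: of_nat_less_iff)
            hence "real y \<le> real n * (real (y div n) + 1)" by (simp add: algebra_simps)
            thus ?thesis using n0 by (simp add: field_simps)
          qed
          moreover have "real y / (2 * real N) \<le> real y / real n" using n n0 by (intro divide_left_mono) auto
          moreover have "real y / (2 * real N) \<ge> (real x / 16 - 1) / (2 * real N)" using calculation(1) by (intro divide_right_mono) auto
          moreover have "(real x / 16 - 1) / (2 * real N) = B / 32 - 1 / (2 * real N)" using N by (simp add: B_def field_simps)
          moreover have "1 / (2 * real N) \<le> 1/2" using N by simp
          moreover have "B \<ge> 96" using big(2) by (simp add: B_def)
          moreover have "real (y div n) \<le> real lo" by (simp add: lo_def)
          ultimately show ?thesis by linarith
        qed
        have "real hi \<le> real M" by (simp add: hi_def)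
        thus "real hi \<le> B" using MB by linarith
        show "0 < real N * real x powr (g - 2) / 4" using N x0 by simp
        \<comment> \<open>One factor \<open>1/2\<close> comes from \<open>g \<ge> 1/2\<close>, the
          other from \<open>2 powr (g - 1) \<ge> 1/2\<close>.\<close>
        have "1 * ((1/2) * ((1/2) * real N powr (g - 1))) \<le> real h * (g * (2 * real N) powr (g - 1))"
        proof (intro mult_mono)
          have "(1/2) * real N powr (g - 1) = 2 powr (-1) * real N powr (g - 1)" by (simp add: powr_minus)
          also have "\<dots> \<le> 2 powr (g - 1) * real N powr (g - 1)" using g by (intro mult_right_mono powr_mono) auto
          also have "\<dots> = (2 * real N) powr (g - 1)" by (simp add: powr_mult)
          finally show "(1/2) * real N powr (g - 1) \<le> (2 * real N) powr (g - 1)" .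
        qed (use h g in auto)
        hence "real N powr (g - 1) / 4 \<le> \<bar>A\<bar>" using Ab by simp
        hence "real N powr (g - 1) / 4 * B powr (g - 2) \<le> \<bar>A\<bar> * B powr (g - 2)" by (intro mult_right_mono) auto
        thus "real N * real x powr (g - 2) / 4 \<le> \<bar>A\<bar> * B powr (g - 2)" using NB by simp
        have "\<bar>A\<bar> * B powr (g - 2) \<le> real h * (real N powr (g - 1) * real R) * B powr (g - 2)" using Ab by (intro mult_right_mono) auto
        also have "\<dots> = real h * real R * (real N powr (g - 1) * B powr (g - 2))" by (simp add: mult_ac)
        also have "\<dots> = real h * (real R * (real N * real x powr (g - 2)))" unfolding NB by (simp add: mult_ac)
        also have "\<dots> \<le> (C0 * real x powr (1 - g)) * (real R * (real N * real x powr (g - 2)))" by (intro mult_right_mono hx) auto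
        also have "\<dots> = C0 * real R * real N * (real x powr (1 - g) * real x powr (g - 2))" by (simp add: mult_ac)
        also have "real x powr (1 - g) * real x powr (g - 2) = 1 / real x" using x0 by (simp add: powr_add[symmetric] powr_minus inverse_eq_divide)
        finally show "\<bar>A\<bar> * B powr (g - 2) \<le> C0 * real R * real N / real x" by simp
      qed
      also have "\<dots> \<le> E0"
        unfolding E0_def
      proof (intro mult_left_mono add_mono)
        have "B * sqrt (C0 * real R * real N / real x) = sqrt (B\<^sup>2 * (C0 * real R * real N / real x))"
        proof -
          have "B \<ge> 0" by (simp add: B_def)
          thus ?thesis unfolding real_sqrt_mult[of "B\<^sup>2"] real_sqrt_abs by simp
        qed
        also have "B\<^sup>2 * (C0 * real R * real N / real x) = C0 * (real R * real x / real N)"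
          using x0 N by (simp add: B_def power2_eq_square field_simps)
        also have "sqrt (C0 * (real R * real x / real N)) = sqrt C0 * sqrt (real R * real x / real N)" by (rule real_sqrt_mult)
        finally show "2 * B * sqrt (C0 * real R * real N / real x) \<le> 2 * sqrt C0 * sqrt (real R * real x / real N)" by simp
        have "1 / sqrt (real N * real x powr (g - 2) / 4) = 2 * (1 / sqrt (real x powr (g - 2))) / sqrt (real N)"
          by (simp add: real_sqrt_mult real_sqrt_divide)
        also have "1 / sqrt (real x powr (g - 2)) = real x powr (- ((g - 2) / 2))"
          using x1 by (simp add: powr_half_sqrt[symmetric] powr_powr powr_minus inverse_eq_divide)
        also have "2 * real x powr (- ((g - 2) / 2)) / sqrt (real N) \<le> 2 * real x powr (51/100) / sqrt (real N)"
        proof (intro divide_right_mono mult_left_mono powr_mono)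
          have "- ((g - 2) / 2) = 1 - g / 2" by (simp add: field_simps)
        thus "- ((g - 2) / 2) \<le> 51 / 100" using g by linarith
        qed (use x1 in auto)
        finally show "1 / sqrt (real N * real x powr (g - 2) / 4) \<le> 2 * real x powr (51/100) / sqrt (real N)" .
      qed (use C1 in auto)
      finally show ?thesis unfolding r .
    qed
    thus ?thesis using True unfolding S by simp
  qed
  have "norm (\<Sum>n\<in>{N<..2*N}. \<Sum>m\<in>{1..M}. of_real (\<alpha> m * \<beta> n) * c m n)
     \<le> sqrt (\<Sum>m\<in>{1..M}. (\<alpha> m)\<^sup>2) * sqrt (\<Sum>n\<in>{N<..2*N}. (\<beta> n)\<^sup>2)
        * sqrt ((real N / real R + 2) * (real x / (real N * real d) + 1 + (real R / real d + 2) * E0))"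
  proof (rule window_bound[OF R])
    fix n assume n: "n \<in> {N<..2*N}"
    have "(\<Sum>n'\<in>{n'\<in>{N<..2*N}. n' div R = n div R}. norm (\<Sum>m\<in>{1..M}. c m n * cnj (c m n')))
       \<le> (real M / real d + 1) + (real R / real d + 2) * E0"
    proof (rule sum_delta_le[where n = n and P = "\<lambda>n'. [n' = n] (mod d)"])
      fix n' assume n': "n' \<in> {n'\<in>{N<..2*N}. n' div R = n div R}"
      show "norm (\<Sum>m\<in>{1..M}. c m n * cnj (c m n')) \<le> (if n' = n then real M / real d + 1 else if [n' = n] (mod d) then E0 else 0)"
        using diag[of n] offc[of n n'] n n' by (cases "n' = n") auto
    next
      show "real (card {n'\<in>{n'\<in>{N<..2*N}. n' div R = n div R}. [n' = n] (mod d)}) \<le> real R / real d + 2"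
        by (rule card_residue_window[OF R d0])
    qed (use E0 card_residue_window[OF R d0, of "{N<..2*N}" "n div R" n] in auto)
    also have "real M / real d \<le> real x / (real N * real d)"
      using MB d0 by (simp add: B_def divide_right_mono flip: divide_divide_eq_left)
    finally show "(\<Sum>n'\<in>{n'\<in>{N<..2*N}. n' div R = n div R}. norm (\<Sum>m\<in>{1..M}. c m n * cnj (c m n')))
       \<le> real x / (real N * real d) + 1 + (real R / real d + 2) * E0" by simp
  qed (use E0 in \<open>auto intro!: add_nonneg_nonneg\<close>)
  thus ?thesis unfolding M_def c_def y_def by (simp only: mult_ac)
qed


lemma nat_floor_bounds:
  assumes "x \<ge> 1" shows "real (nat \<lfloor>x\<rfloor>) \<le> x \<and> real (nat \<lfloor>x\<rfloor>) \<ge> x / 2"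
proof -
  have "\<lfloor>x\<rfloor> \<ge> 1" using assms by (simp add: le_floor_iff)
  hence "real (nat \<lfloor>x\<rfloor>) = of_int \<lfloor>x\<rfloor>" "of_int \<lfloor>x\<rfloor> \<ge> (1::real)" by simp_all
  thus ?thesis by linarith
qed

lemma log2_ceiling_bounds:
  fixes x :: nat
  assumes "x \<ge> 1"
  shows "x \<le> 2 ^ nat \<lceil>log 2 (real x)\<rceil>" "real (nat \<lceil>log 2 (real x)\<rceil>) \<le> 2 * (1 + ln (real x))"
proof -
  have lg: "log 2 (real x) \<ge> 0" using assms by simp
  have "real x = 2 powr log 2 (real x)" using assms by simp
  also have "\<dots> \<le> 2 powr real (nat \<lceil>log 2 (real x)\<rceil>)" by (intro powr_mono) (use lg in linarith)+
  also have "\<dots> = real (2 ^ nat \<lceil>log 2 (real x)\<rceil>)" by (simp add: powr_realpow)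
  finally show "x \<le> 2 ^ nat \<lceil>log 2 (real x)\<rceil>" by (simp only: of_nat_le_iff)
  have c: "real (nat \<lceil>log 2 (real x)\<rceil>) \<le> log 2 (real x) + 1" using lg by simp
  have "log 2 (real x) = ln (real x) * (1 / ln 2)" by (simp add: log_def)
  also have "\<dots> \<le> ln (real x) * 2" using ln2_ge_two_thirds assms by (intro mult_left_mono) (auto simp: field_simps)
  finally show "real (nat \<lceil>log 2 (real x)\<rceil>) \<le> 2 * (1 + ln (real x))" by (intro order_trans[OF c]) (simp add: algebra_simps)
qed

text \<open>With \<open>R\<close> about \<open>d * x powr 0.031\<close> the diagonal contributes
  \<open>x / (R * d)\<close>, at most \<open>x powr 0.969 / d\<^sup>2\<close>. Off the diagonal
  \<open>N * E0 / d\<close> is at most about \<open>x powr 0.827 / d\<close>, hence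
  \<open>x powr 0.95 / d\<^sup>2\<close> by the bound on \<open>d\<close>. Both are below
  \<open>x powr 0.97 / d\<^sup>2\<close>; the division by \<open>d\<^sup>2\<close> under the root is
  what later compensates the weights of the moduli.\<close>

lemma ps_window_estimate:
  fixes x N R d :: nat
  assumes C: "C > 0" "C0 > 0" and d: "d \<ge> 1" "real d \<le> real x powr (123/1000)"
    and x: "real x \<ge> 1" and N: "real N * real N \<le> real x" "N \<ge> 1"
    and R: "real d * real x powr (31/1000) \<le> real R" "real R \<le> 2 * (real d * real x powr (31/1000))" "R \<le> N"
    and dN: "real d \<le> real x / real N"
    and A1: "6 * real x powr (969/1000) + 9 * C * (4 * sqrt C0 * real x powr (95/100) + 2 * real x powr (883/1000)) \<le> real x powr (97/100)"
  shows "sqrt ((real N / real R + 2) * (real x / (real N * real d) + 1 + (real R / real d + 2) *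
       (C * (2 * sqrt C0 * sqrt (real R * real x / real N) + 2 * real x powr (51/100) / sqrt (real N))))) \<le> real x powr (485/1000) / real d"
proof -
  define E0 where "E0 = C * (2 * sqrt C0 * sqrt (real R * real x / real N) + 2 * real x powr (51/100) / sqrt (real N))"
  have E00: "E0 \<ge> 0" unfolding E0_def using C by (intro mult_nonneg_nonneg add_nonneg_nonneg divide_nonneg_nonneg) auto
  have x0: "real x > 0" and d0: "real d > 0" and N0: "real N > 0" using x d N by auto
  have R0: "real R > 0" by (rule less_le_trans[OF _ R(1)]) (use d0 x0 in simp)
  have dR: "real d \<le> real R"
  proof -
    have "real d * 1 \<le> real d * real x powr (31/1000)" using x by (intro mult_left_mono ge_one_powr_ge_zero) auto
    thus ?thesis using R(1) by linarith
  qed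
  have NR: "1 \<le> real N / real R" using R(3) R0 by (simp add: field_simps)
  have xNd: "1 \<le> real x / (real N * real d)" using dN N0 d0 by (simp add: field_simps)
  have Rd: "1 \<le> real R / real d" using dR d0 by simp
  have sN: "sqrt (real N) \<le> real x powr (1/4)"
  proof -
    have "real N \<le> sqrt (real x)" using N by (intro real_le_rsqrt) (simp add: power2_eq_square)
    hence "sqrt (real N) \<le> sqrt (sqrt (real x))" by simp
    also have "\<dots> = (real x powr (1/2)) powr (1/2)" using x0 by (simp add: powr_half_sqrt)
    also have "\<dots> = real x powr (1/4)" by (simp add: powr_powr)
    finally show ?thesis .
  qed
  have sR: "sqrt (real R) \<le> 2 * real x powr (77/1000)"
  proof -
    have "real R \<le> 2 * (real x powr (123/1000) * real x powr (31/1000))"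
      using R(2) d(2) by (smt (verit) mult_right_mono powr_ge_zero)
    also have "\<dots> = 2 * real x powr (154/1000)" by (simp add: powr_add[symmetric])
    also have "\<dots> \<le> 4 * real x powr (154/1000)" by simp
    finally have "sqrt (real R) \<le> sqrt (4 * real x powr (154/1000))" by (rule real_sqrt_le_mono)
    also have "\<dots> = 2 * (real x powr (154/1000)) powr (1/2)" by (simp add: real_sqrt_mult powr_half_sqrt)
    also have "\<dots> = 2 * real x powr (77/1000)" by (simp add: powr_powr)
    finally show ?thesis .
  qed
  have NE: "real N * E0 \<le> C * (4 * sqrt C0 * real x powr (827/1000) + 2 * real x powr (76/100))"
  proof -
    have "real N * sqrt (real R * real x / real N) = sqrt (real R) * sqrt (real x) * sqrt (real N)"
      using N0 by (simp add: real_sqrt_mult real_sqrt_divide real_div_sqrt field_simps)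
    also have "\<dots> \<le> (2 * real x powr (77/1000)) * real x powr (1/2) * real x powr (1/4)"
      using sR sN x0 by (intro mult_mono) (auto simp: powr_half_sqrt)
    also have "\<dots> = 2 * real x powr (827/1000)" by (simp add: powr_add[symmetric])
    finally have 1: "real N * sqrt (real R * real x / real N) \<le> 2 * real x powr (827/1000)" .
    have "real N / sqrt (real N) = sqrt (real N)" using N0 by (simp add: real_div_sqrt)
    hence "real N * (2 * real x powr (51/100) / sqrt (real N)) = 2 * real x powr (51/100) * sqrt (real N)"
      by (metis mult.commute times_divide_eq_right)
    also have "\<dots> \<le> 2 * real x powr (51/100) * real x powr (1/4)" using sN by (intro mult_left_mono) auto
    also have "\<dots> = 2 * real x powr (76/100)" by (simp add: powr_add[symmetric])
    finally have 2: "real N * (2 * real x powr (51/100) / sqrt (real N)) \<le> 2 * real x powr (76/100)" .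
    have "real N * E0 = C * (2 * sqrt C0 * (real N * sqrt (real R * real x / real N)) + real N * (2 * real x powr (51/100) / sqrt (real N)))"
      by (simp add: E0_def algebra_simps)
    also have "\<dots> \<le> C * (2 * sqrt C0 * (2 * real x powr (827/1000)) + 2 * real x powr (76/100))"
      using 1 2 C by (intro mult_left_mono add_mono) auto
    finally show ?thesis by (simp add: mult.assoc)
  qed
  have "(real N / real R + 2) * (real x / (real N * real d) + 1 + (real R / real d + 2) * E0) \<le>
     (3 * (real N / real R)) * (2 * (real x / (real N * real d)) + (3 * (real R / real d)) * E0)"
    using NR xNd Rd E00 by (intro mult_mono add_mono mult_right_mono) auto
  also have "\<dots> = 6 * real x / (real R * real d) + 9 * (real N * E0) / real d"
    using R0 d0 N0 by (simp add: field_simps)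
  also have "\<dots> \<le> 6 * real x powr (969/1000) / (real d)\<^sup>2 + 9 * (C * (4 * sqrt C0 * real x powr (95/100) + 2 * real x powr (883/1000))) / (real d)\<^sup>2"
  proof (rule add_mono)
    have "6 * real x / (real R * real d) \<le> 6 * real x / ((real d * real x powr (31/1000)) * real d)"
      using R(1) R0 d0 x0 by (intro divide_left_mono mult_right_mono mult_pos_pos) auto
    also have "\<dots> = 6 * (real x powr 1 / real x powr (31/1000)) / (real d)\<^sup>2" using x0 by (simp add: power2_eq_square field_simps)
    also have "real x powr 1 / real x powr (31/1000) = real x powr (969/1000)" unfolding powr_diff[symmetric] by simp
    finally show "6 * real x / (real R * real d) \<le> 6 * real x powr (969/1000) / (real d)\<^sup>2" .
    have "9 * (real N * E0) / real d = 9 * (real N * E0 * real d) / (real d)\<^sup>2" using d0 by (simp add: power2_eq_square)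
    also have "\<dots> \<le> 9 * (C * (4 * sqrt C0 * real x powr (827/1000) + 2 * real x powr (76/100)) * real x powr (123/1000)) / (real d)\<^sup>2"
      using C E00 by (intro divide_right_mono mult_left_mono mult_mono[OF NE d(2)]) (auto intro!: mult_nonneg_nonneg add_nonneg_nonneg)
    also have "C * (4 * sqrt C0 * real x powr (827/1000) + 2 * real x powr (76/100)) * real x powr (123/1000) =
        C * (4 * sqrt C0 * (real x powr (827/1000) * real x powr (123/1000)) + 2 * (real x powr (76/100) * real x powr (123/1000)))"
      by (simp add: algebra_simps)
    also have "\<dots> = C * (4 * sqrt C0 * real x powr (95/100) + 2 * real x powr (883/1000))"
      by (simp add: powr_add[symmetric])
    finally show "9 * (real N * E0) / real d \<le> 9 * (C * (4 * sqrt C0 * real x powr (95/100) + 2 * real x powr (883/1000))) / (real d)\<^sup>2" .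
  qed
  also have "\<dots> = (6 * real x powr (969/1000) + 9 * C * (4 * sqrt C0 * real x powr (95/100) + 2 * real x powr (883/1000))) / (real d)\<^sup>2"
    by (simp add: add_divide_distrib mult.assoc)
  also have "\<dots> \<le> real x powr (97/100) / (real d)\<^sup>2" by (intro divide_right_mono A1) auto
  finally have "sqrt ((real N / real R + 2) * (real x / (real N * real d) + 1 + (real R / real d + 2) * E0)) \<le> sqrt (real x powr (97/100) / (real d)\<^sup>2)"
    by (rule real_sqrt_le_mono)
  also have "\<dots> = (real x powr (97/100)) powr (1/2) / real d" using d0 by (simp add: real_sqrt_divide powr_half_sqrt)
  also have "\<dots> = real x powr (485/1000) / real d" by (simp add: powr_powr)
  finally show ?thesis unfolding E0_def .
qed

text \<open>The exponent \<open>0.9855\<close> is chosen below \<open>145/147 = 0.98639...\<close>,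
  so that the error is smaller than the expected main term \<open>x powr g / d\<close>. It comes
  from \<open>0.485 + 1/2\<close> in the type II sums, with \<open>0.0005\<close> to absorb the
  logarithms.\<close>

theorem ps_exponential_sum:
  assumes g: "145/147 < g" "g < 1" and C0: "C0 > 0"
  shows "\<exists>x0. \<forall>x\<ge>x0. \<forall>d h. d \<ge> 1 \<longrightarrow> real d \<le> real x powr (123/1000) \<longrightarrow> h \<ge> 1 \<longrightarrow> real h \<le> C0 * real x powr (1 - g) \<longrightarrow>
     norm (\<Sum>n\<in>{x div 16<..x}. of_real (mangoldt n) * psf g d h n) \<le> real x powr (9855/10000) / real d"
proof -
  obtain C where C: "vdc_const g C"
    using vdc_power_progression[of g] g unfolding vdc_const_def by auto
  have C1: "C > 0" using C by (simp add: vdc_const_def)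
  define c1 where "c1 = sqrt C0"
  have c1: "c1 > 0" using C0 by (simp add: c1_def)
  have ev1: "eventually (\<lambda>x::nat. 6 * real x powr (969/1000) + 9 * C * (4 * c1 * real x powr (95/100) + 2 * real x powr (883/1000)) \<le> real x powr (97/100)) at_top"
    using C1 c1 by real_asymp
  have ev2: "eventually (\<lambda>x::nat. 3 * (1 + ln (real x)) * (C * (2 * c1 + 1)) * real x powr (973/1000) + 4 * sqrt 2 * (1 + ln (real x)) ^ 4 * real x powr (985/1000) \<le> real x powr (9855/10000)) at_top"
    using C1 c1 by real_asymp
  have ev3: "eventually (\<lambda>x::nat. real x powr (17/100) \<ge> 2 \<and> real x powr (17/100) / 2 \<ge> 2 * real x powr (154/1000) \<and> real x \<ge> 10000 \<and> real x powr (66/100) \<ge> 96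
       \<and> real x powr (17/100) \<le> real x / 16 - 1) at_top"
    by (intro eventually_conj; real_asymp)
  obtain x0 where x0: "\<And>x. x \<ge> x0 \<Longrightarrow>
     (6 * real x powr (969/1000) + 9 * C * (4 * c1 * real x powr (95/100) + 2 * real x powr (883/1000)) \<le> real x powr (97/100)) \<and>
     (3 * (1 + ln (real x)) * (C * (2 * c1 + 1)) * real x powr (973/1000) + 4 * sqrt 2 * (1 + ln (real x)) ^ 4 * real x powr (985/1000) \<le> real x powr (9855/10000)) \<and>
     real x powr (17/100) \<ge> 2 \<and> real x powr (17/100) / 2 \<ge> 2 * real x powr (154/1000) \<and> real x \<ge> 10000 \<and> real x powr (66/100) \<ge> 96
       \<and> real x powr (17/100) \<le> real x / 16 - 1"
    using eventually_conj[OF ev1 eventually_conj[OF ev2 ev3]] unfolding eventually_at_top_linorder by metis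
  show ?thesis
  proof (intro exI[of _ x0] allI impI)
    fix x d h :: nat
    assume x: "x \<ge> x0" and d: "d \<ge> 1" "real d \<le> real x powr (123/1000)" and h: "h \<ge> 1" and hx: "real h \<le> C0 * real x powr (1 - g)"
    note X = x0[OF x]
    have x1: "real x \<ge> 1" "x \<ge> 1" using X by auto
    define L where "L = 1 + ln (real x)"
    \<comment> \<open>Large enough that windows of length about \<open>x powr 0.154\<close> fit into
      every block \<open>N \<ge> U\<close>, and small enough that type I costs only
      \<open>U * U * x powr 0.51 = x powr 0.85\<close>, which is below
      \<open>x powr 0.973 / d\<close>.\<close>
    define U where "U = nat \<lfloor>real x powr (17/100)\<rfloor>"
    define R where "R = nat \<lceil>real d * real x powr (31/1000)\<rceil>"
    define Jx where "Jx = nat \<lceil>log 2 (real x)\<rceil>"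
    define E where "E = real x powr (485/1000) / real d"
    define T where "T = C * (2 * sqrt C0 + 1) * real x powr (51/100)"
    have L1: "L \<ge> 1" using x1 by (simp add: L_def)
    have U1: "real U \<le> real x powr (17/100)" "real U \<ge> real x powr (17/100) / 2"
      using nat_floor_bounds[of "real x powr (17/100)"] X unfolding U_def by auto
    have Upos: "U \<ge> 1" using U1(2) X by (simp add: Suc_le_eq)
    have U16: "U \<le> x div 16"
    proof -
      have "real U \<le> real x / 16 - 1" using U1 X by simp
      also have "\<dots> \<le> real (x div 16)" by linarith
      finally show ?thesis by simp
    qed
    have UU: "real (U * U) \<le> real x powr (34/100)"
    proof -
      have "real U * real U \<le> real x powr (17/100) * real x powr (17/100)" using U1 by (intro mult_mono) auto
      also have "\<dots> = real x powr (34/100)" by (simp add: powr_add[symmetric])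
      finally show ?thesis by simp
    qed
    have UUx: "U * U \<le> x"
    proof -
      have "real x powr (34/100) \<le> real x powr 1" using x1 by (intro powr_mono) auto
      hence "real (U * U) \<le> real x" using UU x1 by simp
      thus ?thesis by (simp only: of_nat_le_iff)
    qed
    have Jx: "x \<le> 2 ^ Jx" "real Jx \<le> 2 * L" unfolding Jx_def L_def using log2_ceiling_bounds[OF x1(2)] by auto
    have R1: "real d * real x powr (31/1000) \<le> real R" "real R \<le> 2 * (real d * real x powr (31/1000))"
    proof -
      have "1 * 1 \<le> real d * real x powr (31/1000)" using d x1 by (intro mult_mono ge_one_powr_ge_zero) auto
      thus "real d * real x powr (31/1000) \<le> real R" "real R \<le> 2 * (real d * real x powr (31/1000))" unfolding R_def by linarith+
    qed
    have Rpos: "R > 0"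
    proof -
      have "0 < real d * real x powr (31/1000)" using d x1 by simp
      thus ?thesis using R1(1) by linarith
    qed
    have sq: "real x powr (123/1000) \<le> sqrt (real x)" using x1 by (simp add: powr_half_sqrt[symmetric] powr_mono)
    have E: "E \<ge> 0" by (simp add: E_def)
    \<comment> \<open>A family with a single member: no averaging over \<open>d\<close> is used
      here.\<close>
    have "(\<Sum>i\<in>{()}. norm (\<Sum>n\<in>{x div 16<..x}. of_real (mangoldt n) * psf g d h n))
     \<le> 3 * real (card {()}) * (1 + ln (real x)) * (\<Sum>t\<in>{1..U*U}. T)
        + 2 * real Jx * (E * sqrt (2 * real x) * (1 + ln (real x)) ^ 3)"
    proof (rule vaughan_family_bound[OF _ E Upos U16 _ UUx Jx(1), of _ "\<lambda>_. psf g d h"])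
      fix t H assume t: "1 \<le> t" "t \<le> U * U" "H \<le> x div t"
      have xt: "real x / real t \<ge> real x powr (66/100)"
      proof -
        have "real t \<le> real x powr (34/100)" using t(2) UU by (meson of_nat_mono order_trans)
        hence "real x / real t \<ge> real x / real x powr (34/100)" using t x1 by (intro divide_left_mono mult_pos_pos) auto
        also have "real x / real x powr (34/100) = real x powr 1 / real x powr (34/100)" using x1 by simp
        also have "\<dots> = real x powr (66/100)" unfolding powr_diff[symmetric] by simp
        finally show ?thesis .
      qed
      have "real x powr (123/1000) \<le> real x powr (66/100)" using x1 by (intro powr_mono) auto
      hence "real d \<le> real x / real t" "real x / real t \<ge> 96" using d xt X by linarith+
      thus "norm (\<Sum>k\<in>{x div 16 div t<..H}. psf g d h (t * k)) \<le> T"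
        unfolding T_def using t by (intro ps_type1[OF C g d(1) h hx]) auto
    next
      fix N and \<alpha> \<beta> :: "nat \<Rightarrow> real"
      assume N: "U \<le> N" "N * N \<le> x"
      have N1: "N \<ge> 1" using N Upos by simp
      have NN: "real N * real N \<le> real x" using N(2) by (metis of_nat_le_iff of_nat_mult)
      have Ns: "real N \<le> sqrt (real x)" using NN by (intro real_le_rsqrt) (simp add: power2_eq_square)
      have xN: "sqrt (real x) \<le> real x / real N"
      proof -
        have "real x / sqrt (real x) \<le> real x / real N" using Ns N1 x1 by (intro divide_left_mono mult_pos_pos) auto
        thus ?thesis by (simp add: real_div_sqrt)
      qed
      have s96: "sqrt (real x) \<ge> 96"
        by (rule real_le_rsqrt) (use X in simp)
      have RN: "R \<le> N"
      proof -
        have "real R \<le> 2 * (real x powr (123/1000) * real x powr (31/1000))"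
          using R1(2) d(2) by (smt (verit) mult_right_mono powr_ge_zero)
        also have "\<dots> = 2 * real x powr (154/1000)" by (simp add: powr_add[symmetric])
        also have "\<dots> \<le> real U" using U1 X by linarith
        also have "\<dots> \<le> real N" using N by simp
        finally show ?thesis by simp
      qed
      have big: "real d \<le> real x / real N" "real x / real N \<ge> 96" using d(2) sq xN s96 by linarith+
      have "(\<Sum>i\<in>{()}. norm (\<Sum>n\<in>{N<..2*N}. \<Sum>m\<in>{1..x div N}. of_bool (x div 16 < m * n \<and> m * n \<le> x) * of_real (\<alpha> m * \<beta> n) * psf g d h (m * n)))
         \<le> sqrt (\<Sum>m\<in>{1..x div N}. (\<alpha> m)\<^sup>2) * sqrt (\<Sum>n\<in>{N<..2*N}. (\<beta> n)\<^sup>2)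
          * sqrt ((real N / real R + 2) * (real x / (real N * real d) + 1 + (real R / real d + 2) *
             (C * (2 * sqrt C0 * sqrt (real R * real x / real N) + 2 * real x powr (51/100) / sqrt (real N)))))"
        using ps_type2[OF C g d(1) h hx N1 big Rpos, of \<alpha> \<beta>] by simp
      also have "\<dots> \<le> sqrt (\<Sum>m\<in>{1..x div N}. (\<alpha> m)\<^sup>2) * sqrt (\<Sum>n\<in>{N<..2*N}. (\<beta> n)\<^sup>2) * E"
        unfolding E_def
        by (intro mult_left_mono ps_window_estimate C1 C0 d x1 NN N1 R1 RN big) (use X in \<open>auto simp: c1_def intro!: mult_nonneg_nonneg sum_nonneg\<close>)
      finally show "(\<Sum>i\<in>{()}. norm (\<Sum>n\<in>{N<..2*N}. \<Sum>m\<in>{1..x div N}. of_bool (x div 16 < m * n \<and> m * n \<le> x) * of_real (\<alpha> m * \<beta> n) * psf g d h (m * n)))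
         \<le> E * sqrt (\<Sum>m\<in>{1..x div N}. (\<alpha> m)\<^sup>2) * sqrt (\<Sum>n\<in>{N<..2*N}. (\<beta> n)\<^sup>2)"
        by (simp only: mult_ac)
    qed auto
    hence "norm (\<Sum>n\<in>{x div 16<..x}. of_real (mangoldt n) * psf g d h n)
       \<le> 3 * L * (real (U * U) * T) + 2 * real Jx * (E * sqrt (2 * real x) * L ^ 3)"
      by (simp add: L_def)
    also have "\<dots> \<le> 3 * L * (real x powr (34/100) * T) + 2 * (2 * L) * (E * sqrt (2 * real x) * L ^ 3)"
      using UU Jx(2) L1 E C1 C0 by (intro add_mono mult_left_mono mult_right_mono) (auto simp: T_def intro!: mult_nonneg_nonneg)
    also have "\<dots> \<le> (3 * L * (C * (2 * c1 + 1)) * real x powr (973/1000) + 4 * sqrt 2 * L ^ 4 * real x powr (985/1000)) / real d"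
      unfolding add_divide_distrib
    proof (rule add_mono)
      have "3 * L * (real x powr (34/100) * T) = 3 * L * (C * (2 * c1 + 1)) * (real x powr (34/100) * real x powr (51/100))"
        by (simp add: T_def c1_def)
      also have "real x powr (34/100) * real x powr (51/100) = real x powr (973/1000) / real x powr (123/1000)"
        unfolding powr_add[symmetric] powr_diff[symmetric] by simp
      also have "\<dots> \<le> real x powr (973/1000) / real d" using d x1 by (intro divide_left_mono mult_pos_pos) auto
      finally show "3 * L * (real x powr (34/100) * T) \<le> 3 * L * (C * (2 * c1 + 1)) * real x powr (973/1000) / real d"
        using L1 C1 c1 by (simp add: mult_left_mono)
      have "2 * (2 * L) * (E * sqrt (2 * real x) * L ^ 3) = 4 * sqrt 2 * L ^ 4 * (real x powr (485/1000) * real x powr (1/2)) / real d"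
        using x1 by (simp add: E_def real_sqrt_mult powr_half_sqrt power4_eq_xxxx power3_eq_cube)
      also have "real x powr (485/1000) * real x powr (1/2) = real x powr (985/1000)" unfolding powr_add[symmetric] by simp
      finally show "2 * (2 * L) * (E * sqrt (2 * real x) * L ^ 3) \<le> 4 * sqrt 2 * L ^ 4 * real x powr (985/1000) / real d" by simp
    qed
    also have "\<dots> \<le> real x powr (9855/10000) / real d" using X unfolding L_def by (intro divide_right_mono) auto
    finally show "norm (\<Sum>n\<in>{x div 16<..x}. of_real (mangoldt n) * psf g d h n) \<le> real x powr (9855/10000) / real d" .
  qed
qed

section \<open>Korselt's criterion and common multipliers\<close>

lemma prod_primes_dvd_int:
  assumes "finite S" "\<And>p. p \<in> S \<Longrightarrow> prime (p::nat)" "\<And>p. p \<in> S \<Longrightarrow> int p dvd m"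
  shows "int (\<Prod>S) dvd m"
  using assms
proof (induction S rule: finite_induct)
  case (insert p S)
  have "coprime p (\<Prod>S)"
  proof (rule prod_coprime_right)
    fix q assume "q \<in> S"
    hence "prime p" "prime q" "p \<noteq> q" using insert by auto
    thus "coprime p q" by (rule primes_coprime)
  qed
  hence "coprime (int p) (int (\<Prod>S))" by (simp only: coprime_int_iff)
  hence "int p * int (\<Prod>S) dvd m" using insert by (intro divides_mult) auto
  thus ?case using insert by simp
qed simp

text \<open>A product over a set of primes is squarefree, so divisibility may be checked at one
  prime at a time, where Fermat's theorem applies. At least two primes make the product
  composite.\<close>

lemma korselt:
  assumes S: "finite S" "\<And>p. p \<in> S \<Longrightarrow> prime p" "card S \<ge> 2"
    and dvd: "\<And>p. p \<in> S \<Longrightarrow> (p - 1) dvd (\<Prod>S - 1)"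
  shows "carmichael (\<Prod>S)"
proof -
  have N0: "\<Prod>S > 0" using S by (intro prod_pos) (auto intro: prime_gt_0_nat)
  obtain p where p: "p \<in> S" using S(3) by fastforce
  have "card (S - {p}) \<ge> 1" using S p by simp
  hence "S - {p} \<noteq> {}" by (metis card.empty not_one_le_zero)
  then obtain p' where p': "p' \<in> S" "p' \<noteq> p" by blast
  have Np: "\<Prod>S = p * \<Prod>(S - {p})" using S(1) p by (simp add: prod.remove)
  have "p' dvd \<Prod>(S - {p})" using S(1) p' by (intro dvd_prodI) auto
  moreover have pos: "\<Prod>(S - {p}) > 0" using S by (intro prod_pos) (auto intro: prime_gt_0_nat)
  ultimately have big: "\<Prod>(S - {p}) > 1" using prime_gt_1_nat[OF S(2)[OF p'(1)]] by (meson dvd_imp_le less_le_trans)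
  have p1: "p > 1" using prime_gt_1_nat[OF S(2)[OF p]] .
  have N1: "\<Prod>S > 1" unfolding Np using p1 big by (metis less_1_mult)
  have notprime: "\<not> prime (\<Prod>S)" unfolding Np using p1 big by (metis less_irrefl prime_product)
  have "int (\<Prod>S) dvd a ^ \<Prod>S - a" for a :: int
  proof -
    have "int p dvd a ^ \<Prod>S - a" if p: "p \<in> S" for p
    proof -
      have pp: "prime p" using S(2) p .
      define b where "b = nat (a mod int p)"
      have b: "[int b = a] (mod int p)" unfolding b_def using prime_gt_0_nat[OF pp]
        by (simp add: unique_euclidean_semiring_class.cong_def)
      have "[b ^ \<Prod>S = b] (mod p)"
      proof (cases "p dvd b")
        case True
        hence "p dvd b ^ \<Prod>S" using N0 by (metis dvd_power dvd_trans)
        thus ?thesis using True by (metis cong_0_iff cong_sym cong_trans)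
      next
        case False
        obtain t where t: "\<Prod>S - 1 = (p - 1) * t" using dvd[OF p] by (elim dvdE)
        have "[(b ^ (p - 1)) ^ t = 1 ^ t] (mod p)" using fermat_theorem[OF pp False] by (rule cong_pow)
        hence "[b ^ (\<Prod>S - 1) = 1] (mod p)" by (simp only: t power_mult power_one)
        hence "[b * b ^ (\<Prod>S - 1) = b * 1] (mod p)" by (rule cong_scalar_left)
        moreover have "b * b ^ (\<Prod>S - 1) = b ^ \<Prod>S" using N0 by (simp add: power_eq_if)
        ultimately show ?thesis by simp
      qed
      hence "[int b ^ \<Prod>S = int b] (mod int p)" by (metis cong_int_iff of_nat_power)
      moreover have "[int b ^ \<Prod>S = a ^ \<Prod>S] (mod int p)" using b by (rule cong_pow)
      ultimately have "[a ^ \<Prod>S = a] (mod int p)" using b by (meson cong_sym cong_trans)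
      thus ?thesis by (simp add: cong_iff_dvd_diff)
    qed
    thus ?thesis using S(1,2) by (intro prod_primes_dvd_int) auto
  qed
  thus ?thesis unfolding carmichael_def using N1 notprime by blast
qed

lemma prime_factors_prod_primes:
  assumes "finite S" "\<And>p. p \<in> S \<Longrightarrow> prime (p::nat)"
  shows "prime_factors (\<Prod>S) = S"
proof (rule equalityI; rule subsetI)
  fix q assume q: "q \<in> prime_factors (\<Prod>S)"
  hence "prime q" "q dvd \<Prod>S" by auto
  then obtain p where "p \<in> S" "q dvd p" using prime_dvd_prod_iff[OF assms(1), of q "\<lambda>x. x"] by auto
  thus "q \<in> S" using assms(2) \<open>prime q\<close> primes_dvd_imp_eq by blast
next
  fix p assume p: "p \<in> S"
  have "\<Prod>S \<noteq> 0" using assms by (auto dest: assms(2) simp: prime_gt_0_nat)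
  thus "p \<in> prime_factors (\<Prod>S)" using p assms by (auto simp: in_prime_factors_iff intro: dvd_prodI)
qed

lemma prod_primes_inj:
  assumes "finite Q" "\<And>q. q \<in> Q \<Longrightarrow> prime (q::nat)"
  shows "inj_on (\<lambda>d. \<Prod>d) (Pow Q)"
proof (rule inj_onI)
  fix d e assume de: "d \<in> Pow Q" "e \<in> Pow Q" "\<Prod>d = \<Prod>e"
  have "prime_factors (\<Prod>f) = f" if "f \<in> Pow Q" for f
    using that assms by (intro prime_factors_prod_primes) (auto intro: finite_subset)
  hence "prime_factors (\<Prod>d) = d" "prime_factors (\<Prod>e) = e" using de by blast+
  thus "d = e" using de(3) by metis
qed

text \<open>For \<open>n = k * \<Prod>d + 1\<close> the weight of \<open>d\<close> is at most \<open>x / k\<close>, and these bounds have a sum of order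
  \<open>x * ln x\<close> over \<open>k\<close>; hence some \<open>k\<close> must serve many \<open>d\<close>.\<close>

lemma common_multiplier:
  fixes A :: "nat set"
  assumes Q: "finite Q" "\<And>q. q \<in> Q \<Longrightarrow> prime q" and A: "\<And>p. p \<in> A \<Longrightarrow> prime p" and x: "x \<ge> 1"
    and W: "(\<Sum>d\<in>usets Q u. real (\<Prod>q\<in>d. q - 1) * (\<Sum>n\<in>{y<..x}. of_bool (n \<in> A \<and> [n = 1] (mod \<Prod>d)) * mangoldt n)) \<ge> W"
  shows "\<exists>k\<in>{1..x}. W \<le> real x * (1 + ln (real x))\<^sup>2 * real (card {d\<in>usets Q u. k * \<Prod>d + 1 \<in> A \<and> y < k * \<Prod>d + 1 \<and> k * \<Prod>d + 1 \<le> x})"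
proof (cases "W \<le> 0")
  case True
  have "0 \<le> real x * (1 + ln (real x))\<^sup>2 * real (card {d\<in>usets Q u. 1 * \<Prod>d + 1 \<in> A \<and> y < 1 * \<Prod>d + 1 \<and> 1 * \<Prod>d + 1 \<le> x})" by simp
  thus ?thesis using x True by (intro bexI[of _ 1]) (auto intro: order_trans)
next
  case False
  define L where "L = 1 + ln (real x)"
  define c where "c = (\<lambda>k. real (card {d\<in>usets Q u. k * \<Prod>d + 1 \<in> A \<and> y < k * \<Prod>d + 1 \<and> k * \<Prod>d + 1 \<le> x}))"
  have L1: "L \<ge> 1" using x by (simp add: L_def)
  have finU: "finite (usets Q u)" using Q(1) by (rule finite_usets)
  show ?thesis
  proof (rule ccontr)
    assume neg: "\<not> ?thesis"
    have small: "real x * L\<^sup>2 * c k < W" if "k \<in> {1..x}" for k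
      using neg[unfolded L_def[symmetric]] that unfolding c_def by (auto simp: not_le)
    have one: "real (\<Prod>q\<in>d. q - 1) * (\<Sum>n\<in>{y<..x}. of_bool (n \<in> A \<and> [n = 1] (mod \<Prod>d)) * mangoldt n)
       \<le> (\<Sum>k\<in>{1..x}. of_bool (k * \<Prod>d + 1 \<in> A \<and> y < k * \<Prod>d + 1 \<and> k * \<Prod>d + 1 \<le> x) * (real x / real k * ln (real x)))"
      if d: "d \<in> usets Q u" for d
    proof -
      define m where "m = \<Prod>d"
      have dQ: "d \<subseteq> Q" using d by (simp add: usets_def)
      have m0: "m > 0" unfolding m_def using dQ Q by (intro prod_pos) (meson prime_gt_0_nat subsetD)
      have pm: "real (\<Prod>q\<in>d. q - 1) \<le> real m"
      proof -
        have "(\<Prod>q\<in>d. q - 1) \<le> \<Prod>d" by (rule prod_mono) auto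
        thus ?thesis unfolding m_def by (simp only: of_nat_le_iff)
      qed
      have "(\<Sum>n\<in>{y<..x}. of_bool (n \<in> A \<and> [n = 1] (mod m)) * mangoldt n) = (\<Sum>n\<in>{n\<in>{y<..x}. n \<in> A \<and> [n = 1] (mod m)}. mangoldt n :: real)"
        unfolding sum.inter_filter[OF finite_greaterThanAtMost] by (intro sum.cong) auto
      also have "\<dots> = (\<Sum>k\<in>{k\<in>{1..x}. k * m + 1 \<in> A \<and> y < k * m + 1 \<and> k * m + 1 \<le> x}. mangoldt (k * m + 1))"
      proof (rule sum.reindex_bij_witness[where i = "\<lambda>k. k * m + 1" and j = "\<lambda>n. (n - 1) div m"])
        fix n assume n: "n \<in> {n\<in>{y<..x}. n \<in> A \<and> [n = 1] (mod m)}"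
        hence n1: "n > 1" using A prime_gt_1_nat by auto
        have "m dvd n - 1" using n n1 by (metis (no_types, lifting) CollectD cong_altdef_nat less_imp_le_nat)
        then obtain k where k: "n - 1 = m * k" by (elim dvdE)
        have nk: "n = k * m + 1" using k n1 by (simp add: mult.commute)
        have div: "(n - 1) div m = k" using k m0 by simp
        show "(n - 1) div m * m + 1 = n" using div nk by simp
        have k1: "k \<ge> 1" using nk n1 by (cases k) auto
        have "k \<le> k * m" using m0 by simp
        moreover have "n \<le> x" using n by simp
        ultimately have "k \<le> x" using nk by linarith
        thus "(n - 1) div m \<in> {k\<in>{1..x}. k * m + 1 \<in> A \<and> y < k * m + 1 \<and> k * m + 1 \<le> x}"
          using div nk n k1 by auto
        show "mangoldt ((n - 1) div m * m + 1) = (mangoldt n :: real)" using div nk by simp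
      next
        fix k assume k: "k \<in> {k\<in>{1..x}. k * m + 1 \<in> A \<and> y < k * m + 1 \<and> k * m + 1 \<le> x}"
        show "(k * m + 1 - 1) div m = k" using m0 by simp
        have "[k * m + 1 = 0 + 1] (mod m)" by (intro cong_add cong_refl) (simp add: cong_0_iff)
        thus "k * m + 1 \<in> {n\<in>{y<..x}. n \<in> A \<and> [n = 1] (mod m)}" using k by simp
      qed
      finally have "real (\<Prod>q\<in>d. q - 1) * (\<Sum>n\<in>{y<..x}. of_bool (n \<in> A \<and> [n = 1] (mod m)) * mangoldt n)
         \<le> real m * (\<Sum>k\<in>{k\<in>{1..x}. k * m + 1 \<in> A \<and> y < k * m + 1 \<and> k * m + 1 \<le> x}. mangoldt (k * m + 1))"
        using pm by (simp only:) (intro mult_right_mono sum_nonneg mangoldt_nonneg)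
      also have "\<dots> = (\<Sum>k\<in>{k\<in>{1..x}. k * m + 1 \<in> A \<and> y < k * m + 1 \<and> k * m + 1 \<le> x}. real m * mangoldt (k * m + 1))"
        by (rule sum_distrib_left)
      also have "\<dots> \<le> (\<Sum>k\<in>{k\<in>{1..x}. k * m + 1 \<in> A \<and> y < k * m + 1 \<and> k * m + 1 \<le> x}. real x / real k * ln (real x))"
      proof (intro sum_mono mult_mono)
        fix k assume k: "k \<in> {k\<in>{1..x}. k * m + 1 \<in> A \<and> y < k * m + 1 \<and> k * m + 1 \<le> x}"
        have "k * m \<le> x" using k by auto
        hence "real k * real m \<le> real x" by (metis of_nat_le_iff of_nat_mult)
        thus "real m \<le> real x / real k" using k by (simp add: field_simps)
        have "mangoldt (k * m + 1) \<le> ln (real (k * m + 1))" by (intro mangoldt_le) simp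
        also have "\<dots> \<le> ln (real x)"
        proof (rule ln_mono)
          show "0 < real (k * m + 1)" by (simp only: of_nat_0_less_iff)
          show "real (k * m + 1) \<le> real x" using k by (simp only: of_nat_le_iff) simp
        qed
        finally show "mangoldt (k * m + 1) \<le> ln (real x)" .
      qed (auto simp: mangoldt_nonneg)
      also have "\<dots> = (\<Sum>k\<in>{1..x}. of_bool (k * m + 1 \<in> A \<and> y < k * m + 1 \<and> k * m + 1 \<le> x) * (real x / real k * ln (real x)))"
        unfolding sum.inter_filter[OF finite_atLeastAtMost] by (intro sum.cong) auto
      finally show ?thesis unfolding m_def .
    qed
    have "W \<le> (\<Sum>d\<in>usets Q u. \<Sum>k\<in>{1..x}. of_bool (k * \<Prod>d + 1 \<in> A \<and> y < k * \<Prod>d + 1 \<and> k * \<Prod>d + 1 \<le> x) * (real x / real k * ln (real x)))"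
      by (rule order_trans[OF W]) (intro sum_mono one)
    also have "\<dots> = (\<Sum>k\<in>{1..x}. \<Sum>d\<in>usets Q u. of_bool (k * \<Prod>d + 1 \<in> A \<and> y < k * \<Prod>d + 1 \<and> k * \<Prod>d + 1 \<le> x) * (real x / real k * ln (real x)))"
      by (rule sum.swap)
    also have "\<dots> = (\<Sum>k\<in>{1..x}. c k * (real x / real k * ln (real x)))"
    proof (rule sum.cong[OF refl])
      fix k
      have "(\<Sum>d\<in>usets Q u. of_bool (k * \<Prod>d + 1 \<in> A \<and> y < k * \<Prod>d + 1 \<and> k * \<Prod>d + 1 \<le> x) :: real) = c k"
        unfolding c_def using finU by (simp add: Int_def)
      thus "(\<Sum>d\<in>usets Q u. of_bool (k * \<Prod>d + 1 \<in> A \<and> y < k * \<Prod>d + 1 \<and> k * \<Prod>d + 1 \<le> x) * (real x / real k * ln (real x))) = c k * (real x / real k * ln (real x))"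
        by (simp only: sum_distrib_right[symmetric])
    qed
    also have "\<dots> \<le> (\<Sum>k\<in>{1..x}. (W / L\<^sup>2 * ln (real x)) * (1 / real k))"
    proof (rule sum_mono)
      fix k assume k: "k \<in> {1..x}"
      have "real x * c k \<le> W / L\<^sup>2" using small[OF k] L1 by (simp add: field_simps)
      hence "(real x * c k) * (ln (real x) / real k) \<le> (W / L\<^sup>2) * (ln (real x) / real k)" using x by (intro mult_right_mono) auto
      thus "c k * (real x / real k * ln (real x)) \<le> (W / L\<^sup>2 * ln (real x)) * (1 / real k)" by (simp add: mult_ac)
    qed
    also have "\<dots> = (W / L\<^sup>2 * ln (real x)) * (\<Sum>k\<in>{1..x}. 1 / real k)" by (rule sum_distrib_left[symmetric])
    also have "\<dots> \<le> (W / L\<^sup>2 * ln (real x)) * L"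
      unfolding L_def using False x by (intro mult_left_mono harmonic_le) auto
    also have "\<dots> = W * (ln (real x) / L)" using L1 by (simp add: power2_eq_square)
    \<comment> \<open>The summand \<open>1\<close> in \<open>L\<close> is what makes the inequality
      strict.\<close>
    also have "\<dots> < W * 1" using False L1 by (intro mult_strict_left_mono) (auto simp: L_def)
    finally show False by simp
  qed
qed

section \<open>From a common multiplier to a Carmichael number\<close>

lemma pigeonhole_intersection:
  assumes "finite F" "finite K" "real (card F) > 2 ^ card K * r"
  shows "\<exists>g\<subseteq>K. real (card {d\<in>F. d \<inter> K = g}) > r"
proof (rule ccontr)
  assume neg: "\<not> ?thesis"
  have "F \<subseteq> (\<Union>g\<in>Pow K. {d\<in>F. d \<inter> K = g})"
  proof
    fix d assume "d \<in> F"
    thus "d \<in> (\<Union>g\<in>Pow K. {d\<in>F. d \<inter> K = g})" by (intro UN_I[of "d \<inter> K"]) simp_all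
  qed
  hence "card F \<le> card (\<Union>g\<in>Pow K. {d\<in>F. d \<inter> K = g})"
    using assms(1,2) by (intro card_mono) (auto intro: finite_subset)
  also have "\<dots> \<le> (\<Sum>g\<in>Pow K. card {d\<in>F. d \<inter> K = g})"
    using assms(2) by (intro card_UN_le) simp
  finally have "real (card F) \<le> (\<Sum>g\<in>Pow K. real (card {d\<in>F. d \<inter> K = g}))" by (simp flip: of_nat_sum)
  also have "\<dots> \<le> (\<Sum>g\<in>Pow K. r)" using neg by (intro sum_mono) (auto simp: not_less)
  also have "\<dots> = 2 ^ card K * r" using assms(2) by (simp add: card_Pow)
  finally show False using assms(3) by simp
qed

text \<open>A single subset with product \<open>1\<close> could consist of one prime and give no
  composite number. Splitting \<open>P\<close> into two parts, each beyond the threshold, and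
  uniting the two subsets found ensures at least two elements.\<close>

lemma two_product_one_subsets:
  assumes Q: "finite Q" "\<And>q. q \<in> Q \<Longrightarrow> prime q" and P: "finite P" "\<And>p q. p \<in> P \<Longrightarrow> q \<in> Q \<Longrightarrow> \<not> q dvd p"
    and l: "l > 0" "\<And>q. q \<in> Q \<Longrightarrow> (q - 1) dvd l"
    and big: "real (card P) > 2 * (real l * ln (real (\<Prod>Q))) + 1"
  shows "\<exists>S\<subseteq>P. card S \<ge> 2 \<and> [\<Prod>S = 1] (mod \<Prod>Q)"
proof -
  define T where "T = real l * ln (real (\<Prod>Q))"
  have pos: "\<Prod>Q > 0" using Q by (intro prod_pos) (auto intro: prime_gt_0_nat)
  have T0: "T \<ge> 0" unfolding T_def using pos by (intro mult_nonneg_nonneg ln_ge_zero) (auto simp del: of_nat_prod)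
  define m where "m = nat \<lfloor>T\<rfloor> + 1"
  have m: "real m > T" "real m \<le> T + 1" unfolding m_def using T0 by linarith+
  have "real m \<le> real (card P)" using m big T0 unfolding T_def by linarith
  hence "m \<le> card P" by simp
  then obtain P1 where P1: "P1 \<subseteq> P" "card P1 = m" by (metis obtain_subset_with_card_n)
  have fin1: "finite P1" using P1 P(1) finite_subset by blast
  have "card (P - P1) = card P - m" using P1 fin1 by (simp add: card_Diff_subset)
  hence c2: "real (card (P - P1)) > T" using m big \<open>m \<le> card P\<close> unfolding T_def by (simp add: of_nat_diff)
  obtain S1 where S1: "S1 \<subseteq> P1" "S1 \<noteq> {}" "[\<Prod>S1 = 1] (mod \<Prod>Q)"
    using product_one_subset[of Q P1 l] Q P P1 fin1 l m(1) unfolding T_def by blast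
  obtain S2 where S2: "S2 \<subseteq> P - P1" "S2 \<noteq> {}" "[\<Prod>S2 = 1] (mod \<Prod>Q)"
    using product_one_subset[of Q "P - P1" l] Q P l c2 unfolding T_def by (metis DiffD1 finite_Diff)
  have fin: "finite S1" "finite S2" using S1 S2 fin1 P(1) by (auto intro: finite_subset)
  have disj: "S1 \<inter> S2 = {}" using S1 S2 by blast
  have "card (S1 \<union> S2) = card S1 + card S2" using fin disj by (rule card_Un_disjoint)
  moreover have "card S1 > 0" "card S2 > 0" using fin S1 S2 by (simp_all add: card_gt_0_iff)
  ultimately have "card (S1 \<union> S2) \<ge> 2" by linarith
  moreover have "S1 \<union> S2 \<subseteq> P" using S1(1) S2(1) P1(1) by blast
  moreover have "[\<Prod>S1 * \<Prod>S2 = 1 * 1] (mod \<Prod>Q)" using S1(3) S2(3) by (rule cong_mult)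
  hence "[\<Prod>(S1 \<union> S2) = 1] (mod \<Prod>Q)" using fin disj by (simp add: prod.union_disjoint)
  ultimately show ?thesis by (intro exI[of _ "S1 \<union> S2"] conjI)
qed

text \<open>If \<open>k\<close> shares prime factors with \<open>\<Prod>Q\<close>, pass to the largest class of those \<open>d\<close> that contain the same
  ones, and move their product into \<open>k\<close>: then the modulus splits into coprime parts.\<close>

lemma carmichael_from_progression:
  assumes Q: "finite Q" "\<And>q. q \<in> Q \<Longrightarrow> prime q" and l: "l > 0" "\<And>q. q \<in> Q \<Longrightarrow> (q - 1) dvd l"
    and k: "k > 0" and F: "F \<subseteq> Pow Q" "\<And>d. d \<in> F \<Longrightarrow> prime (k * \<Prod>d + 1)"
    and FQ: "\<And>d q. d \<in> F \<Longrightarrow> q \<in> Q \<Longrightarrow> q < k * \<Prod>d + 1"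
    and big: "real (card F) > 2 ^ card {q\<in>Q. q dvd k} * (2 * (real l * ln (real (\<Prod>Q))) + 1)"
  shows "\<exists>S\<subseteq>(\<lambda>d. k * \<Prod>d + 1) ` F. finite S \<and> card S \<ge> 2 \<and> carmichael (\<Prod>S)"
proof -
  define K where "K = {q\<in>Q. q dvd k}"
  have finF: "finite F" using F(1) Q(1) finite_subset by blast
  have finK: "finite K" unfolding K_def using Q(1) by simp
  obtain g where g: "g \<subseteq> K" "real (card {d\<in>F. d \<inter> K = g}) > 2 * (real l * ln (real (\<Prod>Q))) + 1"
    using pigeonhole_intersection[OF finF finK big[folded K_def]] by blast
  define F' where "F' = {d\<in>F. d \<inter> K = g}"
  define P where "P = (\<lambda>d. k * \<Prod>d + 1) ` F'"
  define k' where "k' = k * \<Prod>g"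
  have posQ: "\<Prod>A > 0" if "A \<subseteq> Q" for A using Q that by (intro prod_pos) (meson prime_gt_0_nat subsetD)
  have inj: "inj_on (\<lambda>d. k * \<Prod>d + 1) F'"
  proof (rule inj_onI)
    fix d e assume de: "d \<in> F'" "e \<in> F'" "k * \<Prod>d + 1 = k * \<Prod>e + 1"
    hence "\<Prod>d = \<Prod>e" using k by simp
    moreover have "d \<in> Pow Q" "e \<in> Pow Q" using de F(1) unfolding F'_def by blast+
    ultimately show "d = e" using inj_onD[OF prod_primes_inj[OF Q]] by blast
  qed
  have cardP: "card P = card F'" unfolding P_def using inj by (rule card_image)
  have finP: "finite P" unfolding P_def F'_def using finF by simp
  have primeP: "prime p" if "p \<in> P" for p using that F(2) unfolding P_def F'_def by blast
  have "real l * ln (real (\<Prod>(Q - K))) \<le> real l * ln (real (\<Prod>Q))"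
  proof (intro mult_left_mono ln_mono)
    have "\<Prod>(Q - K) \<le> \<Prod>Q" using posQ[of Q] Q(1) by (intro dvd_imp_le prod_dvd_prod_subset) auto
    thus "real (\<Prod>(Q - K)) \<le> real (\<Prod>Q)" by (simp only: of_nat_le_iff)
    show "0 < real (\<Prod>(Q - K))" using posQ[of "Q - K"] by (simp only: of_nat_0_less_iff) blast
  qed simp
  hence bigP: "real (card P) > 2 * (real l * ln (real (\<Prod>(Q - K)))) + 1" using g(2) unfolding cardP F'_def by linarith
  have "\<not> q dvd p" if "p \<in> P" "q \<in> Q - K" for p q
  proof -
    have "q < p" using that FQ unfolding P_def F'_def by auto
    moreover have "prime q" using Q(2) that by blast
    ultimately show ?thesis using primeP[OF that(1)] primes_dvd_imp_eq by blast
  qed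
  then obtain S where S: "S \<subseteq> P" "card S \<ge> 2" "[\<Prod>S = 1] (mod \<Prod>(Q - K))"
    using two_product_one_subsets[of "Q - K" P l] Q finP l bigP by blast
  have finS: "finite S" using S finP finite_subset by blast
  have Pk: "\<exists>d\<in>F'. p - 1 = k' * \<Prod>(d - K)" if p: "p \<in> P" for p
  proof -
    obtain d where d: "d \<in> F'" "p = k * \<Prod>d + 1" using p unfolding P_def by blast
    have find: "finite d" using d(1) F(1) Q(1) finite_subset unfolding F'_def by blast
    have "\<Prod>d = \<Prod>(d \<inter> K) * \<Prod>(d - K)" by (rule prod.Int_Diff[OF find])
    also have "d \<inter> K = g" using d(1) unfolding F'_def by blast
    finally have "p - 1 = k' * \<Prod>(d - K)" unfolding d(2) k'_def by simp
    thus ?thesis using d(1) by blast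
  qed
  \<comment> \<open>Every element of \<open>P\<close> is by itself \<open>1\<close> modulo
    \<open>k'\<close>; only the complementary modulus \<open>\<Prod>(Q - K)\<close> depends on the
    choice of \<open>S\<close>.\<close>
  have "[\<Prod>S = 1] (mod k')"
  proof -
    have "[(\<Prod>p\<in>S. p) = (\<Prod>p\<in>S. 1)] (mod k')"
    proof (rule cong_prod)
      fix p assume "p \<in> S"
      hence pP: "p \<in> P" using S by blast
      have "k' dvd p - 1" using Pk[OF pP] by auto
      thus "[p = 1] (mod k')" using prime_ge_1_nat[OF primeP[OF pP]] by (simp add: cong_altdef_nat)
    qed
    thus ?thesis by simp
  qed
  moreover have "coprime k' (\<Prod>(Q - K))"
  proof (rule prod_coprime_right)
    fix q assume q: "q \<in> Q - K"
    have pq: "prime q" using q Q(2) by blast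
    have "\<not> q dvd \<Prod>g"
    proof
      assume "q dvd \<Prod>g"
      moreover have "finite g" using g(1) finK finite_subset by blast
      ultimately obtain r where r: "r \<in> g" "q dvd r" using prime_dvd_prod_iff[OF _ pq, of g "\<lambda>x. x"] by auto
      have "prime r" using r(1) g(1) Q(2) unfolding K_def by blast
      hence "q = r" using r(2) pq primes_dvd_imp_eq by blast
      thus False using r(1) g(1) q by blast
    qed
    moreover have "\<not> q dvd k" using q unfolding K_def by blast
    ultimately have "\<not> q dvd k'" unfolding k'_def using pq by (simp add: prime_dvd_mult_iff)
    thus "coprime k' q" using pq by (metis coprime_commute prime_imp_coprime)
  qed
  ultimately have cong: "[\<Prod>S = 1] (mod (k' * \<Prod>(Q - K)))" using S(3) by (intro coprime_cong_mult_nat)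
  have primeS: "prime p" if "p \<in> S" for p using that S primeP by blast
  have "\<Prod>S > 0" using primeS by (intro prod_pos) (auto intro: prime_gt_0_nat)
  hence dvdN: "k' * \<Prod>(Q - K) dvd \<Prod>S - 1" using cong by (simp add: cong_altdef_nat)
  have "carmichael (\<Prod>S)"
  proof (rule korselt[OF finS primeS S(2)])
    fix p assume "p \<in> S"
    then obtain d where d: "d \<in> F'" "p - 1 = k' * \<Prod>(d - K)" using Pk S by blast
    have "\<Prod>(d - K) dvd \<Prod>(Q - K)" using d(1) F(1) Q(1) unfolding F'_def by (intro prod_dvd_prod_subset) auto
    thus "(p - 1) dvd (\<Prod>S - 1)" using dvdN unfolding d(2) by (meson dvd_trans mult_dvd_mono dvd_refl)
  qed
  moreover have "S \<subseteq> (\<lambda>d. k * \<Prod>d + 1) ` F" using S(1) unfolding P_def F'_def by blast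
  ultimately show ?thesis using finS S(2) by blast
qed

text \<open>Nonprime prime powers are discarded without using the congruence: together they weigh at
  most about \<open>sqrt x * (ln x)\<^sup>2\<close>, and the weight of \<open>d\<close> multiplies
  this by at most \<open>z ^ u\<close>.\<close>

lemma restrict_to_primes:
  assumes Q: "finite Q" "\<And>q. q \<in> Q \<Longrightarrow> q \<le> z" and x: "x \<ge> 1"
  shows "(\<Sum>d\<in>usets Q u. real (\<Prod>q\<in>d. q - 1) * (\<Sum>n\<in>{y<..x}. of_bool (n \<in> B \<and> [n = 1] (mod \<Prod>d)) * mangoldt n))
    \<le> (\<Sum>d\<in>usets Q u. real (\<Prod>q\<in>d. q - 1) * (\<Sum>n\<in>{y<..x}. of_bool (n \<in> {p\<in>B. prime p} \<and> [n = 1] (mod \<Prod>d)) * mangoldt n))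
      + real (card Q choose u) * (real z ^ u * (sqrt (real x) * (2 * ln (real x)) * ln (real x)))"
proof -
  define E where "E = sqrt (real x) * (2 * ln (real x)) * ln (real x)"
  have fin: "finite (usets Q u)" using Q(1) by (rule finite_usets)
  have "(\<Sum>d\<in>usets Q u. real (\<Prod>q\<in>d. q - 1) * (\<Sum>n\<in>{y<..x}. of_bool (n \<in> B \<and> [n = 1] (mod \<Prod>d)) * mangoldt n))
    \<le> (\<Sum>d\<in>usets Q u. real (\<Prod>q\<in>d. q - 1) * (\<Sum>n\<in>{y<..x}. of_bool (n \<in> {p\<in>B. prime p} \<and> [n = 1] (mod \<Prod>d)) * mangoldt n) + real z ^ u * E)"
  proof (rule sum_mono)
    fix d assume d: "d \<in> usets Q u"
    have "(\<Sum>n\<in>{y<..x}. of_bool (n \<in> B \<and> [n = 1] (mod \<Prod>d)) * mangoldt n :: real)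
      \<le> (\<Sum>n\<in>{y<..x}. of_bool (n \<in> {p\<in>B. prime p} \<and> [n = 1] (mod \<Prod>d)) * mangoldt n + of_bool (\<not> prime n) * mangoldt n)"
      by (intro sum_mono) (auto simp: mangoldt_nonneg)
    also have "\<dots> = (\<Sum>n\<in>{y<..x}. of_bool (n \<in> {p\<in>B. prime p} \<and> [n = 1] (mod \<Prod>d)) * mangoldt n) + (\<Sum>n\<in>{y<..x}. of_bool (\<not> prime n) * mangoldt n)"
      by (rule sum.distrib)
    also have "(\<Sum>n\<in>{y<..x}. of_bool (\<not> prime n) * mangoldt n :: real) \<le> (\<Sum>n\<in>{1..x}. of_bool (\<not> prime n) * mangoldt n)"
      by (intro sum_mono2) (auto simp: mangoldt_nonneg)
    also have "\<dots> = (\<Sum>n | n \<in> {1..x} \<and> \<not> prime n. mangoldt n)"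
      by (rule sum.mono_neutral_cong_right) auto
    also have "\<dots> \<le> E" unfolding E_def using x by (rule sum_mangoldt_nonprime)
    finally have le: "(\<Sum>n\<in>{y<..x}. of_bool (n \<in> B \<and> [n = 1] (mod \<Prod>d)) * mangoldt n)
      \<le> (\<Sum>n\<in>{y<..x}. of_bool (n \<in> {p\<in>B. prime p} \<and> [n = 1] (mod \<Prod>d)) * mangoldt n) + E" by simp
    have "(\<Prod>q\<in>d. q - 1) \<le> z ^ u" using prod_pred_le[of d Q z] d Q unfolding usets_def by auto
    hence "real (\<Prod>q\<in>d. q - 1) \<le> real z ^ u" by (metis of_nat_le_iff of_nat_power)
    moreover have "E \<ge> 0" unfolding E_def using x by simp
    ultimately have "real (\<Prod>q\<in>d. q - 1) * E \<le> real z ^ u * E" by (rule mult_right_mono)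
    moreover have "real (\<Prod>q\<in>d. q - 1) * (\<Sum>n\<in>{y<..x}. of_bool (n \<in> B \<and> [n = 1] (mod \<Prod>d)) * mangoldt n)
      \<le> real (\<Prod>q\<in>d. q - 1) * ((\<Sum>n\<in>{y<..x}. of_bool (n \<in> {p\<in>B. prime p} \<and> [n = 1] (mod \<Prod>d)) * mangoldt n) + E)"
      using le by (rule mult_left_mono) (rule of_nat_0_le_iff)
    ultimately show "real (\<Prod>q\<in>d. q - 1) * (\<Sum>n\<in>{y<..x}. of_bool (n \<in> B \<and> [n = 1] (mod \<Prod>d)) * mangoldt n)
      \<le> real (\<Prod>q\<in>d. q - 1) * (\<Sum>n\<in>{y<..x}. of_bool (n \<in> {p\<in>B. prime p} \<and> [n = 1] (mod \<Prod>d)) * mangoldt n) + real z ^ u * E"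
      by (simp only: distrib_left)
  qed
  also have "\<dots> = (\<Sum>d\<in>usets Q u. real (\<Prod>q\<in>d. q - 1) * (\<Sum>n\<in>{y<..x}. of_bool (n \<in> {p\<in>B. prime p} \<and> [n = 1] (mod \<Prod>d)) * mangoldt n))
      + real (card Q choose u) * (real z ^ u * E)"
    using Q(1) by (simp only: sum.distrib sum_constant card_usets)
  finally show ?thesis unfolding E_def .
qed

section \<open>Many primes q with q - 1 dividing a common small number\<close>

text \<open>Chebyshev's bound in a form without logarithms. The exponent \<open>99/100\<close> is
  used for \<open>w\<close> near \<open>t ^ 25\<close>, where it still leaves more than
  \<open>t ^ 24\<close> primes.\<close>

lemma many_primes: "\<exists>w0. \<forall>w\<ge>w0. real (card {p\<in>{1..w}. prime p}) \<ge> real w powr (99/100)"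
proof -
  have "eventually (\<lambda>w::nat. w \<ge> 2 \<and> (real w - 1) * ln 2 - ln (real w) - sqrt (real w) * (2 * ln (real w)) * ln (real w) \<ge> real w powr (99/100) * ln (real w)) at_top"
    by (intro eventually_conj eventually_ge_at_top; real_asymp)
  then obtain w0 where w0: "\<And>w. w \<ge> w0 \<Longrightarrow> w \<ge> (2::nat) \<and> (real w - 1) * ln 2 - ln (real w) - sqrt (real w) * (2 * ln (real w)) * ln (real w) \<ge> real w powr (99/100) * ln (real w)"
    unfolding eventually_at_top_linorder by blast
  show ?thesis
  proof (intro exI[of _ w0] allI impI)
    fix w assume "w \<ge> w0"
    note w = w0[OF this]
    have "psi w = (\<Sum>n\<in>{p\<in>{1..w}. prime p} \<union> {n. n \<in> {1..w} \<and> \<not> prime n}. mangoldt n)"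
      unfolding psi_def by (intro sum.cong) auto
    also have "\<dots> = (\<Sum>n\<in>{p\<in>{1..w}. prime p}. mangoldt n) + (\<Sum>n | n \<in> {1..w} \<and> \<not> prime n. mangoldt n)"
      by (intro sum.union_disjoint) auto
    also have "(\<Sum>n\<in>{p\<in>{1..w}. prime p}. mangoldt n) \<le> (\<Sum>n\<in>{p\<in>{1..w}. prime p}. ln (real w))"
    proof (rule sum_mono)
      fix n assume n: "n \<in> {p\<in>{1..w}. prime p}"
      have "mangoldt n \<le> ln (real n)" using n by (intro mangoldt_le) auto
      also have "\<dots> \<le> ln (real w)" using n by (intro ln_mono) auto
      finally show "mangoldt n \<le> ln (real w)" .
    qed
    finally have "psi w \<le> real (card {p\<in>{1..w}. prime p}) * ln (real w) + sqrt (real w) * (2 * ln (real w)) * ln (real w)"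
      using sum_mangoldt_nonprime[of w] w by simp
    moreover have "psi w \<ge> (real w - 1) * ln 2 - ln (real w)" using w by (intro psi_ge) simp
    ultimately have "real w powr (99/100) * ln (real w) \<le> real (card {p\<in>{1..w}. prime p}) * ln (real w)" using w by linarith
    thus "real w powr (99/100) \<le> real (card {p\<in>{1..w}. prime p})" using w by simp
  qed
qed

lemma ln_prod_le:
  assumes "finite Q" "\<And>q. q \<in> Q \<Longrightarrow> prime q \<and> q \<le> (z::nat)"
  shows "ln (real (\<Prod>Q)) \<le> real (card Q) * ln (real z)"
proof -
  have "ln (real (\<Prod>Q)) = (\<Sum>q\<in>Q. ln (real q))"
    unfolding of_nat_prod using assms by (intro ln_prod) (auto intro: prime_gt_0_nat)
  also have "\<dots> \<le> (\<Sum>q\<in>Q. ln (real z))"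
    using assms by (intro sum_mono ln_mono) (auto intro: prime_gt_0_nat)
  finally show ?thesis by simp
qed

lemma binomial_ge_exp:
  assumes "u \<ge> 1" "u \<le> m" "real m \<ge> exp a * real u" "a \<ge> 0" "real u \<ge> v"
  shows "real (m choose u) \<ge> exp (v * a)"
proof -
  have "exp (v * a) \<le> exp (real u * a)" using assms by (simp add: mult_right_mono)
  also have "\<dots> = exp a ^ u" by (simp add: exp_of_nat_mult)
  also have "\<dots> \<le> (real m / real u) ^ u" using assms by (intro power_mono) (auto simp: field_simps)
  also have "\<dots> \<le> real (m choose u)" using binomial_ge_n_over_k_pow_k[OF assms(2), where 'a = real] by simp
  finally show ?thesis .
qed

lemma shifted_multiples_card:
  assumes Q: "finite Q" "\<And>q. q \<in> Q \<Longrightarrow> prime (q::nat)" and k: "k > 0" and F: "F \<subseteq> Pow Q"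
  shows "card ((\<lambda>d. k * \<Prod>d + 1) ` F) = card F"
proof (rule card_image, rule inj_onI)
  fix d e assume de: "d \<in> F" "e \<in> F" "k * \<Prod>d + 1 = k * \<Prod>e + 1"
  hence "\<Prod>d = \<Prod>e" using k by simp
  thus "d = e" using inj_onD[OF prod_primes_inj[OF Q]] de F by blast
qed

text \<open>Put \<open>t = ln X\<close> and let \<open>Q\<close> be the primes up to
  \<open>t ^ 25\<close>, at least \<open>t ^ 24\<close> of them. Products of \<open>u\<close>, about
  \<open>0.123 * t / (25 * ln t)\<close>, elements stay below \<open>X powr 0.123\<close>, and since
  \<open>u \<le> t\<close> there are at least \<open>(t ^ 23) ^ u\<close> of them, which is about
  \<open>X powr (0.123 * 23/25)\<close>. One multiplier \<open>k\<close> turns at least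
  \<open>X powr 0.112\<close> of these products \<open>d\<close> into primes
  \<open>k * d + 1\<close>. The lower end \<open>X div 16\<close> of the range is recorded because
  later the number of such primes dividing a given integer must be bounded.\<close>

lemma primes_with_smooth_predecessor:
  "\<exists>X0. \<forall>X\<ge>X0. \<exists>Q l. finite Q \<and> (\<forall>q\<in>Q. prime q \<and> X div 16 < q \<and> q \<le> X \<and> (q - 1) dvd l) \<and> l > 0 \<and>
     ln (real l) \<le> ln (real X) ^ 27 \<and> real (card Q) \<ge> real X powr (112/1000)"
proof -
  obtain w0 where w0: "\<And>w. w \<ge> w0 \<Longrightarrow> real (card {p\<in>{1..w}. prime p}) \<ge> real w powr (99/100)"
    using many_primes by blast
  obtain x0 where avg: "\<forall>x\<ge>x0. \<forall>Q z u. finite Q \<longrightarrow> (\<forall>q\<in>Q. prime q \<and> q \<le> z) \<longrightarrow> 1 \<le> u \<longrightarrow> u \<le> card Q \<longrightarrow>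
     real z ^ u \<le> real x powr (123/1000) \<longrightarrow> 2 ^ u \<le> real x powr (1/1000) \<longrightarrow>
     (real u)\<^sup>2 * ln (real x) ^ 6 \<le> real (card Q) \<longrightarrow>
     (\<Sum>d\<in>usets Q u. real (\<Prod>q\<in>d. q - 1) * (\<Sum>n\<in>{x div 16<..x}. of_bool ([n = 1] (mod \<Prod>d)) * mangoldt n))
       \<ge> real (card Q choose u) * (real x / 8)"
    using progression_average by (rule exE)
  \<comment> \<open>Solves \<open>(t ^ 25) powr v = exp (0.123 * t)\<close>, the largest modulus
    allowed.\<close>
  define v where "v = (\<lambda>t::real. 123/1000 * t / (25 * ln t))"
  have ev: "eventually (\<lambda>t::real. t \<ge> 2 \<and> t ^ 25 \<ge> real w0 + 1 \<and> (t ^ 25 - 1) powr (99/100) \<ge> t ^ 24 \<and> v t \<ge> 1 \<and>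
     v t * ln 2 \<le> t / 1000 \<and> v t \<le> t \<and> (v t - 1) * (23 * ln t) \<ge> 1131/10000 * t \<and>
     exp (1131/10000 * t) \<ge> 16 * (1 + t)\<^sup>2 * exp (112/1000 * t) \<and> t + t ^ 25 * (25 * ln t) \<le> t ^ 27 \<and>
     exp (123/1000 * t) * (exp (t/2) * (2 * t) * t) \<le> exp t / 16) at_top"
    unfolding v_def by (intro eventually_conj eventually_ge_at_top; real_asymp)
  have lim: "filterlim (\<lambda>X::nat. ln (real X)) at_top at_top" by real_asymp
  obtain x1 where x1: "\<And>X. X \<ge> x1 \<Longrightarrow> X \<ge> x0 \<and> X \<ge> 3 \<and> (let t = ln (real X) in t \<ge> 2 \<and> t ^ 25 \<ge> real w0 + 1 \<and> (t ^ 25 - 1) powr (99/100) \<ge> t ^ 24 \<and> v t \<ge> 1 \<and>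
     v t * ln 2 \<le> t / 1000 \<and> v t \<le> t \<and> (v t - 1) * (23 * ln t) \<ge> 1131/10000 * t \<and>
     exp (1131/10000 * t) \<ge> 16 * (1 + t)\<^sup>2 * exp (112/1000 * t) \<and> t + t ^ 25 * (25 * ln t) \<le> t ^ 27 \<and>
     exp (123/1000 * t) * (exp (t/2) * (2 * t) * t) \<le> exp t / 16)"
    using eventually_conj[OF eventually_ge_at_top[of x0] eventually_conj[OF eventually_ge_at_top[of 3] eventually_compose_filterlim[OF ev lim]]]
    unfolding eventually_at_top_linorder Let_def by blast
  show ?thesis
  proof (intro exI[of _ x1] allI impI)
    fix X assume X: "X \<ge> x1"
    define t where "t = ln (real X)"
    have t: "t \<ge> 2" "t ^ 25 \<ge> real w0 + 1" "(t ^ 25 - 1) powr (99/100) \<ge> t ^ 24" "v t \<ge> 1"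
      "v t * ln 2 \<le> t / 1000" "v t \<le> t" "(v t - 1) * (23 * ln t) \<ge> 1131/10000 * t"
      "exp (1131/10000 * t) \<ge> 16 * (1 + t)\<^sup>2 * exp (112/1000 * t)" "t + t ^ 25 * (25 * ln t) \<le> t ^ 27"
      "exp (123/1000 * t) * (exp (t/2) * (2 * t) * t) \<le> exp t / 16" and Xx: "X \<ge> x0" "X \<ge> 3"
      using x1[OF X] unfolding t_def Let_def by blast+
    have Xt: "real X = exp t" unfolding t_def using Xx by simp
    have Xp: "real X powr a = exp (a * t)" for a unfolding t_def using Xx by (simp add: powr_def)
    have Xs: "sqrt (real X) = exp (t / 2)"
      unfolding Xt by (rule real_sqrt_unique) (simp_all add: power2_eq_square flip: exp_add)
    define w where "w = nat \<lfloor>t ^ 25\<rfloor>"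
    have t25: "t ^ 25 \<ge> 0" using t(1) by simp
    have w: "real w \<le> t ^ 25" "real w \<ge> t ^ 25 - 1" unfolding w_def using t25 by linarith+
    have ww0: "w \<ge> w0" using w t(2) by linarith
    define u where "u = nat \<lfloor>v t\<rfloor>"
    have u: "real u \<le> v t" "real u \<ge> v t - 1" "u \<ge> 1" unfolding u_def using t(4) by linarith+
    define Q where "Q = {p\<in>{1..w}. prime p}"
    have finQ: "finite Q" unfolding Q_def by simp
    have Qp: "\<And>q. q \<in> Q \<Longrightarrow> prime q \<and> q \<le> w" unfolding Q_def by simp
    have t1: "0 \<le> t ^ 25 - 1" using t(1) one_le_power[of t 25] by simp
    have "t ^ 24 \<le> (t ^ 25 - 1) powr (99/100)" by (rule t)
    also have "\<dots> \<le> real w powr (99/100)" using w t1 by (intro powr_mono2) auto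
    also have "\<dots> \<le> real (card Q)" unfolding Q_def by (rule w0[OF ww0])
    finally have cQ: "t ^ 24 \<le> real (card Q)" .
    have tt: "t ^ 23 * t = t ^ 24" by (simp flip: power_Suc2)
    have t23: "t ^ 23 \<ge> 1" using t(1) by (intro one_le_power) simp
    have "real u \<le> t" using u t by linarith
    hence "t ^ 23 * real u \<le> t ^ 23 * t" using t23 by (intro mult_left_mono) auto
    hence uQ': "t ^ 23 * real u \<le> real (card Q)" using cQ tt by linarith
    have "1 * real u \<le> t ^ 23 * real u" using t23 by (rule mult_right_mono) simp
    hence "real u \<le> real (card Q)" using uQ' by linarith
    hence uQ: "u \<le> card Q" by simp
    define D where "D = real (card Q choose u)"
    have D: "D \<ge> exp ((v t - 1) * (23 * ln t))"
      unfolding D_def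
    proof (rule binomial_ge_exp[OF u(3) uQ])
      have "exp (23 * ln t) = t ^ 23" using exp_of_nat_mult[of 23 "ln t"] t(1) by simp
      thus "exp (23 * ln t) * real u \<le> real (card Q)" using uQ' by simp
      show "0 \<le> 23 * ln t" using t(1) by simp
    qed (rule u)
    have lnt: "ln t > 0" using t(1) by simp
    have lnw: "ln (real w) \<le> 25 * ln t"
    proof (cases "w = 0")
      case False
      hence "ln (real w) \<le> ln (t ^ 25)" using w by (intro ln_mono) auto
      also have "\<dots> = 25 * ln t" using t(1) by (simp add: ln_realpow)
      finally show ?thesis .
    qed (use lnt in simp)
    have zu: "real w ^ u \<le> exp (123/1000 * t)"
    proof (cases "w = 0")
      case False
      have "real w ^ u = exp (real u * ln (real w))" using False by (simp add: exp_of_nat_mult)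
      also have "\<dots> \<le> exp (v t * (25 * ln t))"
        using u lnw lnt False t(4) by (subst exp_le_cancel_iff, intro mult_mono) auto
      also have "v t * (25 * ln t) = 123/1000 * t" unfolding v_def using lnt by simp
      finally show ?thesis .
    qed (use u(3) in \<open>simp add: power_0_left\<close>)
    have u2: "(2::real) ^ u \<le> real X powr (1/1000)"
    proof -
      have "(2::real) ^ u = exp (real u * ln 2)" by (simp add: exp_of_nat_mult)
      also have "\<dots> \<le> exp (v t * ln 2)" using u(1) by simp
      also have "\<dots> \<le> exp (1/1000 * t)" using t(5) by simp
      finally show ?thesis unfolding Xp .
    qed
    have cu: "(real u)\<^sup>2 * ln (real X) ^ 6 \<le> real (card Q)"
    proof -
      have "(real u)\<^sup>2 * t ^ 6 \<le> t\<^sup>2 * t ^ 6" using \<open>real u \<le> t\<close> t(1) by (intro mult_right_mono power_mono) auto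
      also have "\<dots> = t ^ 8" by (simp flip: power_add)
      also have "\<dots> \<le> t ^ 24" using t(1) by (intro power_increasing) auto
      finally show ?thesis using cQ unfolding t_def by linarith
    qed
    have main: "(\<Sum>d\<in>usets Q u. real (\<Prod>q\<in>d. q - 1) * (\<Sum>n\<in>{X div 16<..X}. of_bool ([n = 1] (mod \<Prod>d)) * mangoldt n)) \<ge> D * (real X / 8)"
      unfolding D_def using avg[rule_format, OF Xx(1) finQ Qp u(3) uQ zu[folded Xp] u2 cu] .
    have err: "real w ^ u * (sqrt (real X) * (2 * ln (real X)) * ln (real X)) \<le> real X / 16"
    proof -
      have "real w ^ u * (sqrt (real X) * (2 * ln (real X)) * ln (real X)) \<le> exp (123/1000 * t) * (exp (t/2) * (2 * t) * t)"
        unfolding Xs t_def[symmetric] using zu t(1) by (intro mult_right_mono) auto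
      thus ?thesis using t(10) unfolding Xt by linarith
    qed
    have D0: "D \<ge> 0" unfolding D_def by simp
    have W: "(\<Sum>d\<in>usets Q u. real (\<Prod>q\<in>d. q - 1) * (\<Sum>n\<in>{X div 16<..X}. of_bool (n \<in> {p\<in>UNIV. prime p} \<and> [n = 1] (mod \<Prod>d)) * mangoldt n)) \<ge> D * (real X / 16)"
    proof -
      have "D * (real X / 8) \<le> (\<Sum>d\<in>usets Q u. real (\<Prod>q\<in>d. q - 1) * (\<Sum>n\<in>{X div 16<..X}. of_bool (n \<in> UNIV \<and> [n = 1] (mod \<Prod>d)) * mangoldt n))"
        using main by (simp only: UNIV_I simp_thms)
      also have "\<dots> \<le> (\<Sum>d\<in>usets Q u. real (\<Prod>q\<in>d. q - 1) * (\<Sum>n\<in>{X div 16<..X}. of_bool (n \<in> {p\<in>UNIV. prime p} \<and> [n = 1] (mod \<Prod>d)) * mangoldt n))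
         + D * (real w ^ u * (sqrt (real X) * (2 * ln (real X)) * ln (real X)))"
        unfolding D_def using finQ Qp Xx by (intro restrict_to_primes) auto
      finally have "D * (real X / 8) \<le> (\<Sum>d\<in>usets Q u. real (\<Prod>q\<in>d. q - 1) * (\<Sum>n\<in>{X div 16<..X}. of_bool (n \<in> {p\<in>UNIV. prime p} \<and> [n = 1] (mod \<Prod>d)) * mangoldt n))
         + D * (real w ^ u * (sqrt (real X) * (2 * ln (real X)) * ln (real X)))" .
      moreover have "D * (real w ^ u * (sqrt (real X) * (2 * ln (real X)) * ln (real X))) \<le> D * (real X / 16)"
        using err D0 by (rule mult_left_mono)
      ultimately show ?thesis by linarith
    qed
    have Qpr: "\<And>q. q \<in> Q \<Longrightarrow> prime q" using Qp by blast
    obtain k where k: "k \<in> {1..X}" and kW: "D * (real X / 16) \<le> real X * (1 + ln (real X))\<^sup>2 *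
       real (card {d\<in>usets Q u. k * \<Prod>d + 1 \<in> {p\<in>UNIV. prime p} \<and> X div 16 < k * \<Prod>d + 1 \<and> k * \<Prod>d + 1 \<le> X})"
      using common_multiplier[OF finQ Qpr _ _ W] Xx by auto
    define F where "F = {d\<in>usets Q u. k * \<Prod>d + 1 \<in> {p\<in>UNIV. prime p} \<and> X div 16 < k * \<Prod>d + 1 \<and> k * \<Prod>d + 1 \<le> X}"
    have FQ: "F \<subseteq> Pow Q" unfolding F_def usets_def by blast
    have finF: "finite F" using FQ finQ finite_subset by blast
    have k0: "k > 0" using k by simp
    have "real X * D \<le> real X * (16 * (1 + t)\<^sup>2 * real (card F))" using kW unfolding t_def F_def[symmetric] by (simp add: mult_ac)
    hence "D \<le> 16 * (1 + t)\<^sup>2 * real (card F)" using Xx by (simp only: mult_le_cancel_left_pos of_nat_0_less_iff)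
    moreover have "D \<ge> 16 * (1 + t)\<^sup>2 * exp (112/1000 * t)"
      using D t(7,8) by (meson exp_le_cancel_iff order_trans)
    ultimately have "16 * (1 + t)\<^sup>2 * exp (112/1000 * t) \<le> 16 * (1 + t)\<^sup>2 * real (card F)" by linarith
    moreover have "16 * (1 + t)\<^sup>2 > 0" using t(1) by simp
    ultimately have cF: "real X powr (112/1000) \<le> real (card F)" unfolding Xp by (simp only: mult_le_cancel_left_pos)
    \<comment> \<open>Each new prime \<open>q\<close> has \<open>q - 1 = k * \<Prod>d\<close> with
      \<open>d\<close> a subset of \<open>Q\<close>, so one number serves all of them, and its
      logarithm is governed by the at most \<open>t ^ 25\<close> small primes.\<close>
    define l where "l = k * \<Prod>Q"
    have "\<Prod>Q > 0" using Qpr by (intro prod_pos) (auto intro: prime_gt_0_nat)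
    hence l0: "l > 0" unfolding l_def using k0 by simp
    have "ln (real l) = ln (real k) + ln (real (\<Prod>Q))"
      unfolding l_def of_nat_mult using k0 \<open>\<Prod>Q > 0\<close> by (intro ln_mult_pos) (simp_all only: of_nat_0_less_iff)
    also have "\<dots> \<le> t + t ^ 25 * (25 * ln t)"
    proof (rule add_mono)
      show "ln (real k) \<le> t" unfolding t_def using k by (intro ln_mono) auto
      have "ln (real (\<Prod>Q)) \<le> real (card Q) * ln (real w)" using finQ Qp by (rule ln_prod_le)
      also have "\<dots> \<le> t ^ 25 * (25 * ln t)"
      proof (rule mult_mono)
        have "card Q \<le> card {1..w}" unfolding Q_def by (intro card_mono) auto
        thus "real (card Q) \<le> t ^ 25" using w by simp
        show "0 \<le> ln (real w)" by (cases "w = 0") auto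
      qed (use lnw t25 in auto)
      finally show "ln (real (\<Prod>Q)) \<le> t ^ 25 * (25 * ln t)" .
    qed
    also have "\<dots> \<le> t ^ 27" by (rule t)
    finally have lnl: "ln (real l) \<le> ln (real X) ^ 27" unfolding t_def .
    show "\<exists>Q l. finite Q \<and> (\<forall>q\<in>Q. prime q \<and> X div 16 < q \<and> q \<le> X \<and> (q - 1) dvd l) \<and> l > 0 \<and>
     ln (real l) \<le> ln (real X) ^ 27 \<and> real (card Q) \<ge> real X powr (112/1000)"
    proof (intro exI[of _ "(\<lambda>d. k * \<Prod>d + 1) ` F"] exI[of _ l] conjI ballI)
      show "finite ((\<lambda>d. k * \<Prod>d + 1) ` F)" using finF by simp
      show "real (card ((\<lambda>d. k * \<Prod>d + 1) ` F)) \<ge> real X powr (112/1000)"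
        using cF shifted_multiples_card[OF finQ Qpr k0 FQ] by simp
      fix q assume "q \<in> (\<lambda>d. k * \<Prod>d + 1) ` F"
      then obtain d where d: "d \<in> F" "q = k * \<Prod>d + 1" by blast
      show "prime q" "X div 16 < q" "q \<le> X" using d unfolding F_def by blast+
      have "\<Prod>d dvd \<Prod>Q" using d(1) FQ finQ by (intro prod_dvd_prod_subset) auto
      thus "(q - 1) dvd l" unfolding l_def d(2) by simp
    qed (rule l0 lnl)+
  qed
qed

section \<open>Piatetski-Shapiro primes in progressions\<close>

text \<open>Take \<open>n\<close> to be the ceiling of \<open>p powr g\<close>. Then
  \<open>n powr (1 / g)\<close> lies between \<open>p\<close> and \<open>p + 1\<close> provided that
  \<open>n\<close> is below \<open>(p + 1) powr g\<close>, and the gap between these two powers is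
  at least \<open>x powr (g - 1) / 4\<close>: one half from \<open>g \<ge> 1/2\<close>, another from
  replacing the intermediate point by \<open>2 * x\<close>.\<close>

lemma piatetski_shapiro_primeI:
  assumes g: "1/2 \<le> g" "g < 1" and p: "prime p" "p \<le> x"
    and frac: "frac (- (real p powr g)) < real x powr (g - 1) / 4"
  shows "p \<in> piatetski_shapiro_primes (1 / g)"
proof -
  define y where "y = real p powr g"
  define n where "n = nat \<lceil>y\<rceil>"
  have p1: "real p \<ge> 1" using prime_ge_1_nat[OF p(1)] by simp
  have x1: "real x \<ge> 1" using p1 p(2) by linarith
  have y1: "y \<ge> 1" unfolding y_def using p1 g by (intro ge_one_powr_ge_zero) auto
  have n: "real n = of_int \<lceil>y\<rceil>" unfolding n_def using y1 by simp
  have ny: "real n \<ge> y" unfolding n by simp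
  have "frac (- y) = real n - y" unfolding n frac_def ceiling_def by simp
  hence nlt: "real n < y + real x powr (g - 1) / 4" using frac unfolding y_def by simp
  obtain z where z: "real p < z" "z < real p + 1" "(real p + 1) powr g - real p powr g = (real p + 1 - real p) * (g * z powr (g - 1))"
  proof -
    have "\<exists>z. real p < z \<and> z < real p + 1 \<and> (real p + 1) powr g - real p powr g = (real p + 1 - real p) * (g * z powr (g - 1))"
      using p1 by (intro MVT2) (auto intro!: derivative_eq_intros simp: powr_diff)
    thus ?thesis using that by blast
  qed
  have "real x powr (g - 1) / 4 \<le> g * z powr (g - 1)"
  proof -
    have "(1/2) * real x powr (g - 1) \<le> 2 powr (g - 1) * real x powr (g - 1)"
    proof (rule mult_right_mono)
      have "(2::real) powr (-1) \<le> 2 powr (g - 1)" using g by (intro powr_mono) auto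
      thus "(1/2::real) \<le> 2 powr (g - 1)" by (simp add: powr_minus)
    qed simp
    also have "\<dots> = (2 * real x) powr (g - 1)" using x1 by (simp add: powr_mult)
    also have "\<dots> \<le> z powr (g - 1)" using z p1 x1 p(2) g by (intro powr_mono2') auto
    finally have "(1/2) * ((1/2) * real x powr (g - 1)) \<le> g * z powr (g - 1)" using g by (intro mult_mono) auto
    thus ?thesis by simp
  qed
  hence nlt2: "real n < (real p + 1) powr g" using z(3) nlt unfolding y_def by simp
  have g0: "g > 0" using g by simp
  have "real p = y powr (1 / g)" unfolding y_def using g0 p1 by (simp add: powr_powr)
  also have "\<dots> \<le> real n powr (1 / g)" using ny y1 g0 by (intro powr_mono2) auto
  finally have lo: "real p \<le> real n powr (1 / g)" .
  have "real n powr (1 / g) < ((real p + 1) powr g) powr (1 / g)" using nlt2 g0 by (intro powr_less_mono2) auto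
  also have "\<dots> = real p + 1" using g0 p1 by (simp add: powr_powr)
  finally have "real n powr (1 / g) < real p + 1" .
  hence "int p = \<lfloor>real n powr (1 / g)\<rfloor>" using lo by (intro floor_unique[symmetric]) auto
  thus ?thesis unfolding piatetski_shapiro_primes_def using p(1) by blast
qed

text \<open>The arc has length \<open>\<delta> = x powr (g - 1) / 4\<close>, and the minorant
  involves frequencies up to \<open>3 / \<delta> = 12 * x powr (1 - g)\<close>; this is the range of
  \<open>h\<close> in the hypothesis. The negative sign of the phase only conjugates the exponential
  sums.\<close>

lemma fractional_part_progression:
  assumes g: "0 < g" "g < 1" and x: "x \<ge> 1" and m: "m \<ge> 1"
    and expsum: "\<And>h. 1 \<le> h \<Longrightarrow> real h \<le> 12 * real x powr (1 - g) \<Longrightarrow>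
      norm (\<Sum>n\<in>{x div 16<..x}. of_real (mangoldt n) * psf g m h n) \<le> M / real m"
    and M: "M \<ge> 0"
  shows "50 * (\<Sum>n\<in>{x div 16<..x}. of_bool (frac (- (real n powr g)) < real x powr (g - 1) / 4 \<and> [n = 1] (mod m)) * mangoldt n)
    \<ge> real x powr (g - 1) / 4 * (\<Sum>n\<in>{x div 16<..x}. of_bool ([n = 1] (mod m)) * mangoldt n) - 60 * (M / real m)"
proof -
  define A where "A = {n\<in>{x div 16<..x}. [n = 1] (mod m)}"
  define \<delta> where "\<delta> = real x powr (g - 1) / 4"
  have finA: "finite A" unfolding A_def by simp
  have \<delta>: "0 < \<delta>" "\<delta> \<le> 1/3"
  proof -
    show "0 < \<delta>" unfolding \<delta>_def using x by simp
    have "real x powr (g - 1) \<le> real x powr 0" using x g by (intro powr_mono) auto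
    thus "\<delta> \<le> 1/3" unfolding \<delta>_def using x by simp
  qed
  have "50 * (\<Sum>n | n \<in> A \<and> frac (- (real n powr g)) < \<delta>. mangoldt n) \<ge> \<delta> * (\<Sum>n\<in>A. mangoldt n) - 60 * (M / real m)"
  proof (rule circle_minorant_sum[OF finA _ \<delta>])
    fix k assume k: "1 \<le> k" "real k \<le> 3 / \<delta>"
    have "3 / \<delta> = 12 * real x powr (1 - g)" unfolding \<delta>_def by (simp add: powr_diff field_simps)
    hence k2: "real k \<le> 12 * real x powr (1 - g)" using k by simp
    have "(\<Sum>n\<in>A. of_real (mangoldt n) * e2 (real k * - (real n powr g)))
      = (\<Sum>n\<in>{x div 16<..x}. cnj (of_real (mangoldt n) * psf g m k n))"
      unfolding A_def psf_def by (rule sum.mono_neutral_cong_left) (auto simp: e2_minus simp del: of_real_mangoldt)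
    also have "\<dots> = cnj (\<Sum>n\<in>{x div 16<..x}. of_real (mangoldt n) * psf g m k n)" by (rule cnj_sum[symmetric])
    finally have "norm (\<Sum>n\<in>A. of_real (mangoldt n) * e2 (real k * - (real n powr g)))
      = norm (\<Sum>n\<in>{x div 16<..x}. of_real (mangoldt n) * psf g m k n)" by (simp only: complex_mod_cnj)
    also have "\<dots> \<le> M / real m" using k(1) k2 by (rule expsum)
    finally show "norm (\<Sum>n\<in>A. of_real (mangoldt n) * e2 (real k * - (real n powr g))) \<le> M / real m" .
  qed (use M m in \<open>auto simp: mangoldt_nonneg\<close>)
  moreover have "(\<Sum>n\<in>A. mangoldt n :: real) = (\<Sum>n\<in>{x div 16<..x}. of_bool ([n = 1] (mod m)) * mangoldt n)"
    unfolding A_def by (rule sum.mono_neutral_cong_left) auto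
  moreover have "(\<Sum>n | n \<in> A \<and> frac (- (real n powr g)) < \<delta>. mangoldt n :: real)
     = (\<Sum>n\<in>{x div 16<..x}. of_bool (frac (- (real n powr g)) < \<delta> \<and> [n = 1] (mod m)) * mangoldt n)"
    unfolding A_def by (rule sum.mono_neutral_cong_left) auto
  ultimately show ?thesis unfolding \<delta>_def by simp
qed

text \<open>The average over all primes gives \<open>\<delta> * x / 8 = x powr g / 32\<close> per
  modulus. The exponential sums cost at most \<open>x powr g / 64\<close>, the minorant a factor
  \<open>50\<close>, which leaves \<open>x powr g / 3200\<close>, and half of that is given up for
  the prime powers.\<close>

lemma piatetski_shapiro_progression_average:
  assumes g: "145/147 < g" "g < 1"
  shows "\<exists>x0. \<forall>x\<ge>x0. \<forall>Q z u. finite Q \<longrightarrow> (\<forall>q\<in>Q. prime q \<and> q \<le> z) \<longrightarrow> 1 \<le> u \<longrightarrow> u \<le> card Q \<longrightarrow>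
     real z ^ u \<le> real x powr (123/1000) \<longrightarrow> 2 ^ u \<le> real x powr (1/1000) \<longrightarrow>
     (real u)\<^sup>2 * ln (real x) ^ 6 \<le> real (card Q) \<longrightarrow>
     (\<Sum>d\<in>usets Q u. real (\<Prod>q\<in>d. q - 1) * (\<Sum>n\<in>{x div 16<..x}.
        of_bool (n \<in> {p\<in>{n. frac (- (real n powr g)) < real x powr (g - 1) / 4}. prime p} \<and> [n = 1] (mod \<Prod>d)) * mangoldt n))
       \<ge> real (card Q choose u) * (real x powr g / 6400)"
proof -
  obtain x1 where avg: "\<forall>x\<ge>x1. \<forall>Q z u. finite Q \<longrightarrow> (\<forall>q\<in>Q. prime q \<and> q \<le> z) \<longrightarrow> 1 \<le> u \<longrightarrow> u \<le> card Q \<longrightarrow>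
     real z ^ u \<le> real x powr (123/1000) \<longrightarrow> 2 ^ u \<le> real x powr (1/1000) \<longrightarrow>
     (real u)\<^sup>2 * ln (real x) ^ 6 \<le> real (card Q) \<longrightarrow>
     (\<Sum>d\<in>usets Q u. real (\<Prod>q\<in>d. q - 1) * (\<Sum>n\<in>{x div 16<..x}. of_bool ([n = 1] (mod \<Prod>d)) * mangoldt n))
       \<ge> real (card Q choose u) * (real x / 8)"
    using progression_average by (rule exE)
  obtain x2 where ps: "\<forall>x\<ge>x2. \<forall>d h. d \<ge> 1 \<longrightarrow> real d \<le> real x powr (123/1000) \<longrightarrow> h \<ge> 1 \<longrightarrow> real h \<le> 12 * real x powr (1 - g) \<longrightarrow>
      norm (\<Sum>n\<in>{x div 16<..x}. of_real (mangoldt n) * psf g d h n) \<le> real x powr (9855/10000) / real d"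
    using ps_exponential_sum[OF g zero_less_numeral] by (rule exE)
  have "eventually (\<lambda>x::nat. x \<ge> 1 \<and> real x powr g \<ge> 3840 * real x powr (9855/10000) \<and>
     real x powr (123/1000) * (sqrt (real x) * (2 * ln (real x)) * ln (real x)) \<le> real x powr g / 6400) at_top"
    using g by (intro eventually_conj eventually_ge_at_top; real_asymp)
  then obtain x3 where x3: "\<And>x. x \<ge> x3 \<Longrightarrow> x \<ge> 1 \<and> real x powr g \<ge> 3840 * real x powr (9855/10000) \<and>
     real x powr (123/1000) * (sqrt (real x) * (2 * ln (real x)) * ln (real x)) \<le> real x powr g / 6400"
    unfolding eventually_at_top_linorder by blast
  show ?thesis
  proof (intro exI[of _ "max x1 (max x2 x3)"] allI impI)
    fix x Q z u
    assume xx: "max x1 (max x2 x3) \<le> x" and finQ: "finite Q" and Q: "\<forall>q\<in>Q. prime q \<and> q \<le> z" and u: "1 \<le> u" "u \<le> card Q"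
      and zu: "real z ^ u \<le> real x powr (123/1000)" and u2: "2 ^ u \<le> real x powr (1/1000)"
      and cu: "(real u)\<^sup>2 * ln (real x) ^ 6 \<le> real (card Q)"
    have x: "x \<ge> 1" "real x powr g \<ge> 3840 * real x powr (9855/10000)"
      "real x powr (123/1000) * (sqrt (real x) * (2 * ln (real x)) * ln (real x)) \<le> real x powr g / 6400"
      using x3[of x] xx by auto
    define D where "D = real (card Q choose u)"
    define \<delta> where "\<delta> = real x powr (g - 1) / 4"
    define M where "M = real x powr (9855/10000)"
    define B where "B = {n::nat. frac (- (real n powr g)) < real x powr (g - 1) / 4}"
    define T where "T = (\<lambda>d. \<Sum>n\<in>{x div 16<..x}. of_bool ([n = 1] (mod \<Prod>d)) * mangoldt n :: real)"
    define R where "R = (\<lambda>d. \<Sum>n\<in>{x div 16<..x}. of_bool (n \<in> B \<and> [n = 1] (mod \<Prod>d)) * mangoldt n :: real)"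
    have D0: "D \<ge> 0" unfolding D_def by simp
    have \<delta>0: "\<delta> \<ge> 0" unfolding \<delta>_def by simp
    have \<delta>x: "\<delta> * real x = real x powr g / 4" unfolding \<delta>_def using x(1) by (simp add: powr_diff)
    have "(\<Sum>d\<in>usets Q u. real (\<Prod>q\<in>d. q - 1) * T d) \<ge> D * (real x / 8)"
      unfolding D_def T_def using xx by (intro avg[rule_format, OF _ finQ _ u zu u2 cu]) (use Q in auto)
    hence "\<delta> * (D * (real x / 8)) \<le> \<delta> * (\<Sum>d\<in>usets Q u. real (\<Prod>q\<in>d. q - 1) * T d)"
      using \<delta>0 by (rule mult_left_mono)
    moreover have "\<delta> * (D * (real x / 8)) = D * (real x powr g / 32)" using \<delta>x by (simp add: field_simps)
    ultimately have main: "D * (real x powr g / 32) \<le> \<delta> * (\<Sum>d\<in>usets Q u. real (\<Prod>q\<in>d. q - 1) * T d)" by linarith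
    have "\<delta> * (\<Sum>d\<in>usets Q u. real (\<Prod>q\<in>d. q - 1) * T d) = (\<Sum>d\<in>usets Q u. real (\<Prod>q\<in>d. q - 1) * (\<delta> * T d))"
      by (simp only: sum_distrib_left mult.left_commute)
    also have "\<dots> \<le> (\<Sum>d\<in>usets Q u. 50 * (real (\<Prod>q\<in>d. q - 1) * R d) + 60 * M)"
    proof (rule sum_mono)
      fix d assume d: "d \<in> usets Q u"
      have dQ: "d \<subseteq> Q" "card d = u" using d unfolding usets_def by auto
      have m0: "\<Prod>d > 0" using dQ Q by (intro prod_pos) (meson prime_gt_0_nat subsetD)
      have "\<Prod>d \<le> (\<Prod>q\<in>d. z)" using dQ Q by (intro prod_mono) auto
      hence "\<Prod>d \<le> z ^ u" using dQ by simp
      hence "real (\<Prod>d) \<le> real z ^ u" by (metis of_nat_le_iff of_nat_power)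
      hence mz: "real (\<Prod>d) \<le> real x powr (123/1000)" using zu by linarith
      have "(\<Prod>q\<in>d. q - 1) \<le> \<Prod>d" by (rule prod_mono) auto
      hence pm: "real (\<Prod>q\<in>d. q - 1) \<le> real (\<Prod>d)" by (simp only: of_nat_le_iff)
      have M0: "M \<ge> 0" unfolding M_def by simp
      have "50 * R d \<ge> \<delta> * T d - 60 * (M / real (\<Prod>d))"
        unfolding R_def T_def \<delta>_def B_def mem_Collect_eq
      proof (rule fractional_part_progression)
        fix h :: nat assume "1 \<le> h" "real h \<le> 12 * real x powr (1 - g)"
        thus "norm (\<Sum>n\<in>{x div 16<..x}. of_real (mangoldt n) * psf g (\<Prod>d) h n) \<le> M / real (\<Prod>d)"
          unfolding M_def using ps[rule_format, of x "\<Prod>d" h] m0 mz xx by (simp add: Suc_le_eq del: of_nat_prod)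
      qed (use g x M0 m0 in auto)
      hence "\<delta> * T d \<le> 50 * R d + 60 * (M / real (\<Prod>d))" by linarith
      \<comment> \<open>The weight is at most \<open>\<Prod>d\<close> and cancels the denominator of
        the error term, so the error is \<open>M\<close> for each modulus, whatever its
        size.\<close>
      hence "real (\<Prod>q\<in>d. q - 1) * (\<delta> * T d) \<le> real (\<Prod>q\<in>d. q - 1) * (50 * R d + 60 * (M / real (\<Prod>d)))"
        by (rule mult_left_mono) (rule of_nat_0_le_iff)
      also have "\<dots> = 50 * (real (\<Prod>q\<in>d. q - 1) * R d) + 60 * (real (\<Prod>q\<in>d. q - 1) * (M / real (\<Prod>d)))"
        by (simp only: distrib_left mult.left_commute)
      also have "real (\<Prod>q\<in>d. q - 1) * (M / real (\<Prod>d)) \<le> real (\<Prod>d) * (M / real (\<Prod>d))"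
        using pm M0 by (intro mult_right_mono divide_nonneg_nonneg of_nat_0_le_iff)
      also have "\<dots> = M" using m0 by (metis nonzero_mult_div_cancel_left of_nat_eq_0_iff times_divide_eq_right less_irrefl)
      finally show "real (\<Prod>q\<in>d. q - 1) * (\<delta> * T d) \<le> 50 * (real (\<Prod>q\<in>d. q - 1) * R d) + 60 * M" by linarith
    qed
    also have "\<dots> = 50 * (\<Sum>d\<in>usets Q u. real (\<Prod>q\<in>d. q - 1) * R d) + D * (60 * M)"
      unfolding D_def card_usets[OF finQ, symmetric] by (simp only: sum.distrib sum_distrib_left sum_constant)
    finally have "D * (real x powr g / 32) \<le> 50 * (\<Sum>d\<in>usets Q u. real (\<Prod>q\<in>d. q - 1) * R d) + D * (60 * M)"
      using main by linarith
    moreover have "D * (60 * M) \<le> D * (real x powr g / 64)" using x(2) D0 unfolding M_def by (intro mult_left_mono) auto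
    ultimately have B: "D * (real x powr g / 3200) \<le> (\<Sum>d\<in>usets Q u. real (\<Prod>q\<in>d. q - 1) * R d)" by simp
    have "(\<Sum>d\<in>usets Q u. real (\<Prod>q\<in>d. q - 1) * R d) \<le> (\<Sum>d\<in>usets Q u. real (\<Prod>q\<in>d. q - 1) *
         (\<Sum>n\<in>{x div 16<..x}. of_bool (n \<in> {p\<in>B. prime p} \<and> [n = 1] (mod \<Prod>d)) * mangoldt n))
       + D * (real z ^ u * (sqrt (real x) * (2 * ln (real x)) * ln (real x)))"
      unfolding D_def R_def using finQ Q x(1) by (intro restrict_to_primes) auto
    moreover have "D * (real z ^ u * (sqrt (real x) * (2 * ln (real x)) * ln (real x))) \<le> D * (real x powr g / 6400)"
    proof (rule mult_left_mono[OF _ D0])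
      have "real z ^ u * (sqrt (real x) * (2 * ln (real x)) * ln (real x)) \<le> real x powr (123/1000) * (sqrt (real x) * (2 * ln (real x)) * ln (real x))"
        using zu x(1) by (intro mult_right_mono) auto
      thus "real z ^ u * (sqrt (real x) * (2 * ln (real x)) * ln (real x)) \<le> real x powr g / 6400" using x(3) by linarith
    qed
    ultimately show "real (card Q choose u) * (real x powr g / 6400) \<le> (\<Sum>d\<in>usets Q u. real (\<Prod>q\<in>d. q - 1) * (\<Sum>n\<in>{x div 16<..x}.
        of_bool (n \<in> {p\<in>{n. frac (- (real n powr g)) < real x powr (g - 1) / 4}. prime p} \<and> [n = 1] (mod \<Prod>d)) * mangoldt n))"
      using B unfolding B_def[symmetric] D_def[symmetric] by linarith
  qed
qed

section \<open>Carmichael numbers\<close>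

text \<open>The product of these primes divides \<open>k\<close>, and each has logarithm at least
  \<open>ln X - 4\<close> because \<open>ln 16 \<le> 4\<close>. This controls the factor
  \<open>2 ^ card\<close> lost when the moduli are sorted by their common primes with
  \<open>k\<close>.\<close>

lemma card_prime_divisors_bound:
  assumes Q: "finite Q" "\<And>q. q \<in> Q \<Longrightarrow> prime (q::nat) \<and> X div 16 < q" and k: "k > 0" and X: "ln (real X) > 4"
  shows "real (card {q\<in>Q. q dvd k}) * (ln (real X) - 4) \<le> ln (real k)"
proof -
  define K where "K = {q\<in>Q. q dvd k}"
  have finK: "finite K" unfolding K_def using Q(1) by simp
  have K: "prime q" "q dvd k" "ln (real q) \<ge> ln (real X) - 4" if q: "q \<in> K" for q
  proof -
    have X0: "real X > 0" using X by (cases "X = 0") auto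
    show pq: "prime q" and "q dvd k" using q Q(2) unfolding K_def by auto
    have "X div 16 < q" using q Q(2) unfolding K_def by auto
    hence "real X / 16 \<le> real q" by linarith
    hence "ln (real X / 16) \<le> ln (real q)" using X0 by (intro ln_mono) auto
    moreover have "ln (real X / 16) = ln (real X) - ln 16" using X0 by (simp add: ln_div)
    moreover have "ln (16::real) \<le> 4" using ln_realpow[of 2 4] ln_2_less_1 by simp
    ultimately show "ln (real q) \<ge> ln (real X) - 4" by linarith
  qed
  have dvd: "\<Prod>K dvd k"
  proof -
    have "int (\<Prod>K) dvd int k" using finK K by (intro prod_primes_dvd_int) auto
    thus ?thesis by (simp only: of_nat_dvd_iff)
  qed
  have pos: "\<Prod>K > 0" using K by (intro prod_pos) (auto intro: prime_gt_0_nat)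
  have "real (card K) * (ln (real X) - 4) = (\<Sum>q\<in>K. ln (real X) - 4)" by simp
  also have "\<dots> \<le> (\<Sum>q\<in>K. ln (real q))" using K(3) by (rule sum_mono)
  also have "\<dots> = ln (real (\<Prod>K))"
    unfolding of_nat_prod using finK K by (intro ln_prod[symmetric]) (auto dest: prime_gt_0_nat)
  also have "\<dots> \<le> ln (real k)" using dvd_imp_le[OF dvd k] pos by (intro ln_mono) (simp_all only: of_nat_0_less_iff of_nat_le_iff)
  finally show ?thesis unfolding K_def .
qed

text \<open>With \<open>t = ln X\<close> and \<open>x\<close> about \<open>exp (t ^ 30)\<close>, the
  number of moduli has logarithm about \<open>0.112 * 0.123 * t ^ 30\<close>, and the fractional
  part condition costs less than \<open>2/147 * t ^ 30\<close>. The difference is at least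
  \<open>t ^ 30 / 10000\<close>, while the losses from the primes dividing \<open>k\<close> and from
  \<open>l\<close> have logarithms only of order \<open>t ^ 29\<close> and
  \<open>t ^ 27\<close>.\<close>

lemma carmichael_piatetski_shapiro_large:
  assumes g: "145/147 < g" "g < 1"
  shows "\<exists>N>m. carmichael N \<and> prime_factors N \<subseteq> piatetski_shapiro_primes (1 / g)"
proof -
  obtain X0 where sm: "\<forall>X\<ge>X0. \<exists>Q l. finite Q \<and> (\<forall>q\<in>Q. prime q \<and> X div 16 < q \<and> q \<le> X \<and> (q - 1) dvd l) \<and> l > 0 \<and>
     ln (real l) \<le> ln (real X) ^ 27 \<and> real (card Q) \<ge> real X powr (112/1000)"
    using primes_with_smooth_predecessor by (rule exE)
  obtain x0 where avg: "\<forall>x\<ge>x0. \<forall>Q z u. finite Q \<longrightarrow> (\<forall>q\<in>Q. prime q \<and> q \<le> z) \<longrightarrow> 1 \<le> u \<longrightarrow> u \<le> card Q \<longrightarrow>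
     real z ^ u \<le> real x powr (123/1000) \<longrightarrow> 2 ^ u \<le> real x powr (1/1000) \<longrightarrow>
     (real u)\<^sup>2 * ln (real x) ^ 6 \<le> real (card Q) \<longrightarrow>
     (\<Sum>d\<in>usets Q u. real (\<Prod>q\<in>d. q - 1) * (\<Sum>n\<in>{x div 16<..x}.
        of_bool (n \<in> {p\<in>{n. frac (- (real n powr g)) < real x powr (g - 1) / 4}. prime p} \<and> [n = 1] (mod \<Prod>d)) * mangoldt n))
       \<ge> real (card Q choose u) * (real x powr g / 6400)"
    using piatetski_shapiro_progression_average[OF g] by (rule exE)
  \<comment> \<open>The exact value for \<open>X ^ v = exp (0.123 * (t ^ 30 - 1))\<close>; the
    \<open>- 1\<close> pays for rounding \<open>exp (t ^ 30)\<close> down to an integer.\<close>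
  define v where "v = (\<lambda>t::real. 123/1000 * (t ^ 30 - 1) / t)"
  \<comment> \<open>A lower bound for the logarithm of \<open>card Q / u\<close>, since
    \<open>card Q \<ge> exp (0.112 * t)\<close> and \<open>u \<le> t ^ 30\<close>.\<close>
  define a where "a = (\<lambda>t::real. 112/1000 * t - 30 * ln t)"
  have ev: "eventually (\<lambda>t::real. t \<ge> 5 \<and> exp (t ^ 30) - 1 \<ge> real x0 \<and> (exp (t ^ 30) - 1) / 16 - 1 \<ge> real m \<and> (exp (t ^ 30) - 1) / 16 - 1 \<ge> exp t \<and>
     v t \<ge> 1 \<and> v t * ln 2 \<le> (t ^ 30 - 1) / 1000 \<and> v t \<le> t ^ 30 \<and> t ^ 240 \<le> exp (112/1000 * t) \<and> a t \<ge> 0 \<and>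
     (v t - 1) * a t - 2/147 * t ^ 30 \<ge> t ^ 30 / 10000 \<and>
     exp (t ^ 30 / 10000) > 6400 * (1 + t ^ 30)\<^sup>2 * (exp (t ^ 30 / (t - 4)) * (2 * (exp (t ^ 27) * (exp t * t)) + 1))) at_top"
    unfolding v_def a_def by (intro eventually_conj eventually_ge_at_top; real_asymp)
  have lim: "filterlim (\<lambda>X::nat. ln (real X)) at_top at_top" by real_asymp
  obtain X where X0: "X \<ge> X0" and Xev: "let t = ln (real X) in t \<ge> 5 \<and> exp (t ^ 30) - 1 \<ge> real x0 \<and> (exp (t ^ 30) - 1) / 16 - 1 \<ge> real m \<and> (exp (t ^ 30) - 1) / 16 - 1 \<ge> exp t \<and>
     v t \<ge> 1 \<and> v t * ln 2 \<le> (t ^ 30 - 1) / 1000 \<and> v t \<le> t ^ 30 \<and> t ^ 240 \<le> exp (112/1000 * t) \<and> a t \<ge> 0 \<and>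
     (v t - 1) * a t - 2/147 * t ^ 30 \<ge> t ^ 30 / 10000 \<and>
     exp (t ^ 30 / 10000) > 6400 * (1 + t ^ 30)\<^sup>2 * (exp (t ^ 30 / (t - 4)) * (2 * (exp (t ^ 27) * (exp t * t)) + 1))"
    using eventually_happens'[OF sequentially_bot eventually_conj[OF eventually_ge_at_top[of X0] eventually_compose_filterlim[OF ev lim]]]
    unfolding Let_def by (elim exE conjE) blast
  define t where "t = ln (real X)"
  define s where "s = t ^ 30"
  have t: "t \<ge> 5" "exp s - 1 \<ge> real x0" "(exp s - 1) / 16 - 1 \<ge> real m" "(exp s - 1) / 16 - 1 \<ge> exp t"
    "v t \<ge> 1" "v t * ln 2 \<le> (s - 1) / 1000" "v t \<le> s" "t ^ 240 \<le> exp (112/1000 * t)" "a t \<ge> 0"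
    "(v t - 1) * a t - 2/147 * s \<ge> s / 10000"
    "exp (s / 10000) > 6400 * (1 + s)\<^sup>2 * (exp (s / (t - 4)) * (2 * (exp (t ^ 27) * (exp t * t)) + 1))"
    using Xev unfolding t_def s_def Let_def by blast+
  have X1: "X > 0" using t(1) unfolding t_def by (cases "X = 0") auto
  have Xt: "real X = exp t" unfolding t_def using X1 by simp
  obtain Q l where finQ: "finite Q" and Q: "\<And>q. q \<in> Q \<Longrightarrow> prime q \<and> X div 16 < q \<and> q \<le> X \<and> (q - 1) dvd l" and l: "l > 0"
     "ln (real l) \<le> t ^ 27" and cardQ: "real (card Q) \<ge> exp (112/1000 * t)"
  proof -
    have "real X powr (112/1000) = exp (112/1000 * t)" unfolding t_def using X1 by (simp add: powr_def)
    thus ?thesis using sm[rule_format, OF X0] that unfolding t_def by (elim exE conjE) auto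
  qed
  have Qpr: "\<And>q. q \<in> Q \<Longrightarrow> prime q" using Q by blast
  define x where "x = nat \<lfloor>exp s\<rfloor>"
  have xs: "real x \<le> exp s" "real x \<ge> exp s - 1" unfolding x_def using exp_gt_zero[of s] by linarith+
  have s1: "s \<ge> 1" unfolding s_def using t(1) by (intro one_le_power) simp
  have es: "exp s \<ge> 2" using exp_ge_add_one_self[of s] s1 by linarith
  have x1: "x \<ge> 1" using xs es by linarith
  have lnx: "ln (real x) \<le> s" "ln (real x) \<ge> s - 1"
  proof -
    show "ln (real x) \<le> s" using xs(1) x1 ln_mono[of "real x" "exp s"] by simp
    have "exp (s - 1) * 2 \<le> exp (s - 1) * exp 1" using exp_ge_add_one_self[of 1] by (intro mult_left_mono) auto
    also have "\<dots> = exp s" by (simp flip: exp_add)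
    finally have "exp (s - 1) \<le> exp s - 1" using es by linarith
    hence "exp (s - 1) \<le> real x" using xs by linarith
    thus "ln (real x) \<ge> s - 1" using x1 by (subst ln_ge_iff) auto
  qed
  have xp: "real x powr b = exp (b * ln (real x))" for b using x1 by (simp add: powr_def)
  have yx: "real (x div 16) \<ge> (exp s - 1) / 16 - 1"
  proof -
    have "x \<le> 16 * (x div 16) + 16" by presburger
    hence "real x \<le> 16 * real (x div 16) + 16" by linarith
    moreover have "(exp s - 1) / 16 - 1 \<le> N" if "real x \<le> 16 * N + 16" for N using that xs(2) by argo
    ultimately show ?thesis by blast
  qed
  define u where "u = nat \<lfloor>v t\<rfloor>"
  have u: "real u \<le> v t" "real u \<ge> v t - 1" "u \<ge> 1" unfolding u_def using t(5) by linarith+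
  have us: "real u \<le> s" using u t by linarith
  have Xu: "real X ^ u \<le> real x powr (123/1000)"
  proof -
    have "real X ^ u = exp (real u * t)" unfolding Xt by (simp add: exp_of_nat_mult)
    also have "\<dots> \<le> exp (v t * t)" using u t(1) by (simp add: mult_right_mono)
    also have "v t * t = 123/1000 * (s - 1)" unfolding v_def s_def using t(1) by simp
    also have "exp \<dots> \<le> exp (123/1000 * ln (real x))" using lnx by simp
    finally show ?thesis unfolding xp .
  qed
  have u2: "(2::real) ^ u \<le> real x powr (1/1000)"
  proof -
    have "(2::real) ^ u = exp (real u * ln 2)" by (simp add: exp_of_nat_mult)
    also have "\<dots> \<le> exp (v t * ln 2)" using u(1) by simp
    also have "\<dots> \<le> exp (1/1000 * ln (real x))" using t(6) lnx by simp
    finally show ?thesis unfolding xp .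
  qed
  have cu: "(real u)\<^sup>2 * ln (real x) ^ 6 \<le> real (card Q)"
  proof -
    have "(real u)\<^sup>2 * ln (real x) ^ 6 \<le> s\<^sup>2 * s ^ 6" using us lnx(1) x1 by (intro mult_mono power_mono) auto
    also have "\<dots> = t ^ 240" unfolding s_def by (simp flip: power_mult power_add)
    finally show ?thesis using t(8) cardQ by linarith
  qed
  have bigQ: "exp (a t) * real u \<le> real (card Q)"
  proof -
    have "exp (30 * ln t) = s" unfolding s_def using exp_of_nat_mult[of 30 "ln t"] t(1) by simp
    hence "exp (a t) * s = exp (112/1000 * t)" unfolding a_def exp_diff using s1 by simp
    moreover have "exp (a t) * real u \<le> exp (a t) * s" using us by (intro mult_left_mono) auto
    ultimately show ?thesis using cardQ by linarith
  qed
  have uQ: "u \<le> card Q"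
  proof -
    have "1 * real u \<le> exp (a t) * real u" using t(9) by (intro mult_right_mono) auto
    thus ?thesis using bigQ by linarith
  qed
  define D where "D = real (card Q choose u)"
  have D: "D \<ge> exp ((v t - 1) * a t)"
    unfolding D_def using u(3) uQ bigQ t(9) u(2) by (rule binomial_ge_exp)
  define A where "A = {p\<in>{n::nat. frac (- (real n powr g)) < real x powr (g - 1) / 4}. prime p}"
  have xx0: "x \<ge> x0" using xs t(2) by linarith
  have W: "D * (real x powr g / 6400) \<le> (\<Sum>d\<in>usets Q u. real (\<Prod>q\<in>d. q - 1) * (\<Sum>n\<in>{x div 16<..x}. of_bool (n \<in> A \<and> [n = 1] (mod \<Prod>d)) * mangoldt n))"
    unfolding D_def A_def by (intro avg[rule_format, OF xx0 finQ _ u(3) uQ Xu u2 cu]) (use Q in auto)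
  have Apr: "\<And>p. p \<in> A \<Longrightarrow> prime p" unfolding A_def by blast
  obtain k where k: "k \<in> {1..x}" and kW: "D * (real x powr g / 6400) \<le> real x * (1 + ln (real x))\<^sup>2 *
      real (card {d\<in>usets Q u. k * \<Prod>d + 1 \<in> A \<and> x div 16 < k * \<Prod>d + 1 \<and> k * \<Prod>d + 1 \<le> x})"
    using common_multiplier[OF finQ Qpr Apr x1 W] by (rule bexE)
  define F where "F = {d\<in>usets Q u. k * \<Prod>d + 1 \<in> A \<and> x div 16 < k * \<Prod>d + 1 \<and> k * \<Prod>d + 1 \<le> x}"
  have FQ: "F \<subseteq> Pow Q" unfolding F_def usets_def by blast
  have k0: "k > 0" using k by simp
  have cardF: "exp (s / 10000) \<le> 6400 * (1 + s)\<^sup>2 * real (card F)"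
  proof -
    \<comment> \<open>The loss is \<open>x powr (g - 1)\<close>, and this is where
      \<open>1 - g < 2/147\<close> is compared with the number of moduli.\<close>
    have "exp (s / 10000) \<le> exp ((v t - 1) * a t) * exp ((g - 1) * ln (real x))"
    proof -
      have "(1 - g) * ln (real x) \<le> 2/147 * s" using g lnx(1) x1 s1 by (intro mult_mono) auto
      moreover have "(g - 1) * ln (real x) = - ((1 - g) * ln (real x))" by (simp add: algebra_simps)
      ultimately have "s / 10000 \<le> (v t - 1) * a t + (g - 1) * ln (real x)" using t(10) by linarith
      thus ?thesis by (simp flip: exp_add)
    qed
    also have "\<dots> \<le> D * real x powr (g - 1)" unfolding xp using D by (intro mult_right_mono) auto
    also have "\<dots> \<le> 6400 * (1 + ln (real x))\<^sup>2 * real (card F)"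
    proof -
      have "real x powr g = real x * real x powr (g - 1)" using x1 by (simp add: powr_diff)
      hence "real x * (D * real x powr (g - 1)) \<le> real x * (6400 * (1 + ln (real x))\<^sup>2 * real (card F))"
        using kW unfolding F_def[symmetric] by (simp add: mult_ac)
      thus ?thesis using x1 by (simp only: mult_le_cancel_left_pos of_nat_0_less_iff)
    qed
    also have "\<dots> \<le> 6400 * (1 + s)\<^sup>2 * real (card F)" using lnx(1) x1 by (intro mult_right_mono mult_left_mono power_mono) auto
    finally show ?thesis .
  qed
  \<comment> \<open>The first factor is the pigeonhole loss from primes of \<open>Q\<close> dividing
    \<open>k\<close>, the second the number of primes demanded by the Davenport argument. For the
    latter \<open>\<Prod>Q\<close> is bounded crudely through \<open>card Q \<le> X\<close>.\<close>
  have small: "2 ^ card {q\<in>Q. q dvd k} * (2 * (real l * ln (real (\<Prod>Q))) + 1) \<le> exp (s / (t - 4)) * (2 * (exp (t ^ 27) * (exp t * t)) + 1)"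
  proof (rule mult_mono)
    have "real (card {q\<in>Q. q dvd k}) * (t - 4) \<le> ln (real k)"
      unfolding t_def using finQ Q k0 t(1) by (intro card_prime_divisors_bound) (auto simp: t_def)
    also have "\<dots> \<le> ln (real x)" using k by (intro ln_mono) auto
    also have "\<dots> \<le> s" by (rule lnx)
    finally have c: "real (card {q\<in>Q. q dvd k}) \<le> s / (t - 4)" using t(1) by (simp add: pos_le_divide_eq)
    have "(2::real) ^ card {q\<in>Q. q dvd k} \<le> exp 1 ^ card {q\<in>Q. q dvd k}"
      using exp_ge_add_one_self[of 1] by (intro power_mono) auto
    also have "\<dots> = exp (real (card {q\<in>Q. q dvd k}))" by (simp flip: exp_of_nat_mult)
    finally show "(2::real) ^ card {q\<in>Q. q dvd k} \<le> exp (s / (t - 4))" using c by (meson exp_le_cancel_iff order_trans)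
    have pQ: "\<Prod>Q > 0" using Qpr by (intro prod_pos) (auto intro: prime_gt_0_nat)
    have lQ0: "ln (real (\<Prod>Q)) \<ge> 0" using pQ by (intro ln_ge_zero) (simp del: of_nat_prod)
    have "ln (real (\<Prod>Q)) \<le> real (card Q) * ln (real X)" using finQ Q by (intro ln_prod_le) auto
    also have "\<dots> \<le> exp t * t"
    proof -
      have "card Q \<le> card {1..X}" using Q prime_ge_1_nat by (intro card_mono) fastforce+
      hence "real (card Q) \<le> exp t" unfolding Xt[symmetric] by simp
      thus ?thesis unfolding t_def[symmetric] using t(1) by (intro mult_right_mono) auto
    qed
    finally have lnQ: "ln (real (\<Prod>Q)) \<le> exp t * t" .
    have "real l = exp (ln (real l))" using l(1) by simp
    also have "\<dots> \<le> exp (t ^ 27)" using l(2) by simp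
    finally have "real l \<le> exp (t ^ 27)" .
    hence "real l * ln (real (\<Prod>Q)) \<le> exp (t ^ 27) * (exp t * t)" using lnQ lQ0 by (intro mult_mono) auto
    thus "2 * (real l * ln (real (\<Prod>Q))) + 1 \<le> 2 * (exp (t ^ 27) * (exp t * t)) + 1" by simp
    have "real l * ln (real (\<Prod>Q)) \<ge> 0" using lQ0 by (intro mult_nonneg_nonneg) auto
    thus "0 \<le> 2 * (real l * ln (real (\<Prod>Q))) + 1" by linarith
  qed simp
  have "real (card F) > exp (s / (t - 4)) * (2 * (exp (t ^ 27) * (exp t * t)) + 1)"
  proof -
    have "6400 * (1 + s)\<^sup>2 * (exp (s / (t - 4)) * (2 * (exp (t ^ 27) * (exp t * t)) + 1)) < 6400 * (1 + s)\<^sup>2 * real (card F)"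
      using t(11) cardF by linarith
    moreover have "6400 * (1 + s)\<^sup>2 > 0" using s1 by simp
    ultimately show ?thesis by (simp only: mult_less_cancel_left_pos)
  qed
  hence big: "real (card F) > 2 ^ card {q\<in>Q. q dvd k} * (2 * (real l * ln (real (\<Prod>Q))) + 1)" using small by linarith
  have Qx: "q \<le> x div 16" if "q \<in> Q" for q
  proof -
    have "real q \<le> exp t" using Q[OF that] unfolding Xt[symmetric] by simp
    hence "real q \<le> real (x div 16)" using yx t(4) by linarith
    thus ?thesis by (simp only: of_nat_le_iff)
  qed
  obtain S where S: "S \<subseteq> (\<lambda>d. k * \<Prod>d + 1) ` F" "finite S" "card S \<ge> 2" "carmichael (\<Prod>S)"
  proof -
    have "\<exists>S\<subseteq>(\<lambda>d. k * \<Prod>d + 1) ` F. finite S \<and> card S \<ge> 2 \<and> carmichael (\<Prod>S)"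
    proof (rule carmichael_from_progression[OF finQ Qpr l(1) _ k0 FQ _ _ big])
      show "(q - 1) dvd l" if "q \<in> Q" for q using Q that by blast
      show "prime (k * \<Prod>d + 1)" if "d \<in> F" for d using that Apr unfolding F_def by blast
      show "q < k * \<Prod>d + 1" if "d \<in> F" "q \<in> Q" for d q using that Qx[OF that(2)] unfolding F_def by auto
    qed
    thus ?thesis using that by blast
  qed
  have SA: "p \<in> A" "x div 16 < p" "p \<le> x" if "p \<in> S" for p using that S(1) unfolding F_def by auto
  have pf: "prime_factors (\<Prod>S) = S" using S(2) SA(1) Apr by (intro prime_factors_prod_primes) auto
  have "S \<subseteq> piatetski_shapiro_primes (1 / g)"
  proof
    fix p assume "p \<in> S"
    thus "p \<in> piatetski_shapiro_primes (1 / g)" using g SA[of p] unfolding A_def by (intro piatetski_shapiro_primeI[of g p x]) auto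
  qed
  moreover have "\<Prod>S > m"
  proof -
    obtain p where p: "p \<in> S" using S(3) by fastforce
    have "p \<le> \<Prod>S" using p S(2) SA(1) Apr by (intro dvd_imp_le dvd_prodI prod_pos) (auto intro: prime_gt_0_nat)
    moreover have "x div 16 \<ge> m" using yx t(3) by linarith
    ultimately show ?thesis using SA(2)[OF p] by linarith
  qed
  ultimately show ?thesis using S(4) pf by (intro exI[of _ "\<Prod>S"]) auto
qed

theorem theorem7:
  fixes c :: real
  assumes "1 < c" and "c < 147 / 145"
  shows "infinite {N. carmichael N \<and> prime_factors N \<subseteq> piatetski_shapiro_primes c}"
proof -
  have "145 / 147 < 1 / c" "1 / c < 1" using assms by (simp_all add: field_simps)
  from carmichael_piatetski_shapiro_large[OF this] show ?thesis
    unfolding infinite_nat_iff_unbounded using assms by simp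
qed

end
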